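(* Let $H$ be a hypergroup with left Haar measure $m_H$. Then $\mathcal{L}A(H) = L^1(H)\cap A(H)$ is a dense left ideal of the convolution algebra $L^1(H)$ (dense with respect to $\|\cdot\|_1$).
   Context: A hypergroup (in the sense of Jewett) is a nonempty locally compact Hausdorff space $H$ together with a bilinear associative product (convolution) $*$ on the space $M(H)$ of bounded complex Radon measures such that: $\delta_x*\delta_y$ is a compactly supported probability measure for all $x,y\in H$; the convolution is continuous on nonnegative measures in the weak topology given by bounded-by-support test functions $C_c(H)\cup\{1\}$; $(x,y)\mapsto \mathrm{supp}(\delta_x*\delta_y)$ is continuous into the compact subsets of $H$ with the Michael topology; there is an identity $e\in H$ with $\delta_e*\delta_x=\delta_x*\delta_e=\delta_x$; there is a homeomorphic involution $x\mapsto\check{x}$ with $(\delta_x*\delta_y)\check{\ }=\delta_{\check y}*\delta_{\check x}$, and $e\in\mathrm{supp}(\delta_x*\delta_y)$ if and only if $x=\check y$. All hypergroups are assumed to admit a left Haar measure $m_H$ (a nonzero positive Radon measure with $\int f(xy)\,dm_H(y)=\int f\,dm_H$ for $f\in C_c(H)$, $x\in H$), and $dt$ means $dm_H(t)$. Here $f(xy):=\int_H f\,d(\delta_x*\delta_y)$, and $l_xf(y)=f(xy)$. $L^p(H)=L^p(H,m_H)$. For $f\in L^1(H)$, $g\in L^p(H)$, $(f*g)(x)=\int_H f(y)\,g(\check y x)\,dy$; this makes $L^1(H)$ a Banach algebra. Put $\tilde f(x)=\overline{f(\check x)}$. The left regular representation $\lambda$ on $L^2(H)$ is $\lambda(x)f(y)=f(\check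 x y)$, extended to $L^1(H)$ by integration. $C_\lambda^*(H)$ is the completion of $L^1(H)$ in the norm $\|f\|_{C^*_\lambda(H)}=\|\lambda(f)\|_{\mathcal{B}(L^2(H))}$, and $B_\lambda(H)=C_\lambda^*(H)^*$, whose elements are realized as functions $u$ on $H$ via $\langle u,f\rangle=\int_H u f\,dm_H$, $f\in L^1(H)$. The Fourier space $A(H)$ is the norm-closed subspace of $B_\lambda(H)$ spanned by $\{f*\tilde f: f\in C_c(H)\}$, with the norm $\|\cdot\|_{A(H)}$ of $B_\lambda(H)$; its elements are continuous functions vanishing at infinity. *)

theory Defs
  imports "HOL-Analysis.Analysis"
begin

section \<open>Radon measures\<close>

definition radon_measure :: "'a::t2_space measure \<Rightarrow> bool" where
  "radon_measure M \<longleftrightarrow>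
     sets M = sets borel \<and>
     (\<forall>K. compact K \<longrightarrow> emeasure M K < \<infinity>) \<and>
     (\<forall>A\<in>sets borel. emeasure M A = (INF U\<in>{U. open U \<and> A \<subseteq> U}. emeasure M U)) \<and>
     (\<forall>U. open U \<longrightarrow> emeasure M U = (SUP K\<in>{K. compact K \<and> K \<subseteq> U}. emeasure M K))"

text \<open>A complex Borel measure is a set function that is countably additive on the Borel sets
  and takes the value 0 on all other sets, so that equality of measures is equality of functions.\<close>

type_synonym 'a cmeas = "'a set \<Rightarrow> complex"

definition complex_borel_measure :: "'a::t2_space cmeas \<Rightarrow> bool" where
  "complex_borel_measure \<mu> \<longleftrightarrow>
     (\<forall>A. A \<notin> sets borel \<longrightarrow> \<mu> A = 0) \<and>
     (\<forall>A :: nat \<Rightarrow> 'a set. range A \<subseteq> sets borel \<longrightarrow> disjoint_family A \<longrightarrow>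
        (\<lambda>i. \<mu> (A i)) sums \<mu> (\<Union>i. A i))"

definition total_variation :: "'a::t2_space cmeas \<Rightarrow> 'a set \<Rightarrow> ennreal" where
  "total_variation \<mu> A =
     (SUP P\<in>{P. finite P \<and> disjoint P \<and> P \<subseteq> sets borel \<and> \<Union>P = A}.
        \<Sum>B\<in>P. ennreal (cmod (\<mu> B)))"

definition variation_measure :: "'a::t2_space cmeas \<Rightarrow> 'a measure" where
  "variation_measure \<mu> = measure_of UNIV (sets borel) (total_variation \<mu>)"

text \<open>The space \<open>M(H)\<close> of bounded complex Radon measures.\<close>

definition M_space :: "'a::t2_space cmeas set" where
  "M_space = {\<mu>. complex_borel_measure \<mu> \<and> radon_measure (variation_measure \<mu>)}"

definition M_pos :: "'a::t2_space cmeas set" where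
  "M_pos = {\<mu>\<in>M_space. \<forall>A. \<mu> A \<in> \<real>\<^sub>\<ge>\<^sub>0}"

text \<open>The library measure belonging to an element of \<open>M_pos\<close>.\<close>

definition pos_measure :: "'a::t2_space cmeas \<Rightarrow> 'a measure" where
  "pos_measure \<mu> = measure_of UNIV (sets borel) (\<lambda>A. ennreal (Re (\<mu> A)))"

definition point_mass :: "'a::t2_space \<Rightarrow> 'a cmeas" where
  "point_mass x = (\<lambda>A. if A \<in> sets borel \<and> x \<in> A then 1 else 0)"

definition supp :: "'a::t2_space cmeas \<Rightarrow> 'a set" where
  "supp \<mu> = {x. \<forall>U. open U \<longrightarrow> x \<in> U \<longrightarrow> \<mu> U \<noteq> 0}"  \<comment> \<open>only used on \<open>M_pos\<close>\<close>

definition Cc :: "('a::t2_space \<Rightarrow> complex) set" where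
  "Cc = {f. continuous_on UNIV f \<and> (\<exists>K. compact K \<and> (\<forall>x. x \<notin> K \<longrightarrow> f x = 0))}"

text \<open>The weak topology on \<open>M_pos\<close> induced by \<open>C\<^sub>c(H) \<union> {1}\<close>.\<close>

definition cone_topology :: "'a::t2_space cmeas topology" where
  "cone_topology = topology_generated_by
     {{\<mu>\<in>M_pos. (LINT x|pos_measure \<mu>. f x) \<in> W} | (f :: 'a \<Rightarrow> complex) W.
        f \<in> Cc \<union> {\<lambda>_. 1} \<and> open W}"

text \<open>The Michael topology on the nonempty compact subsets.\<close>

definition michael_topology :: "'a::t2_space set topology" where
  "michael_topology = topology_generated_by
     {{A. compact A \<and> A \<noteq> {} \<and> A \<inter> U \<noteq> {} \<and> A \<subseteq> V} | U V. open U \<and> open V}"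


section \<open>Hypergroups\<close>

record 'a hypergroup_struct =
  mconv :: "'a cmeas \<Rightarrow> 'a cmeas \<Rightarrow> 'a cmeas"
  invol :: "'a \<Rightarrow> 'a"
  unit_elt :: 'a

abbreviation pconv :: "('a::t2_space) hypergroup_struct \<Rightarrow> 'a \<Rightarrow> 'a \<Rightarrow> 'a cmeas" where
  "pconv H x y \<equiv> mconv H (point_mass x) (point_mass y)"

text \<open>The underlying space is the whole type. As in Jewett's axioms, the continuity of the
  convolution on nonnegative measures is that of a map \<open>M_pos \<times> M_pos \<rightarrow> M_pos\<close>, so it
  includes that products of nonnegative measures are nonnegative.\<close>

definition hypergroup :: "('a::t2_space) hypergroup_struct \<Rightarrow> bool" where
  "hypergroup H \<longleftrightarrow>
     locally_compact_space (euclidean :: 'a topology) \<and>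
     \<comment> \<open>bilinear associative product on \<open>M(H)\<close>\<close>
     (\<forall>\<mu>\<in>M_space. \<forall>\<nu>\<in>M_space. mconv H \<mu> \<nu> \<in> M_space) \<and>
     (\<forall>\<mu>\<in>M_space. \<forall>\<nu>\<in>M_space. \<forall>\<rho>\<in>M_space. \<forall>a b.
        mconv H (\<lambda>A. a * \<mu> A + b * \<nu> A) \<rho> = (\<lambda>A. a * mconv H \<mu> \<rho> A + b * mconv H \<nu> \<rho> A) \<and>
        mconv H \<rho> (\<lambda>A. a * \<mu> A + b * \<nu> A) = (\<lambda>A. a * mconv H \<rho> \<mu> A + b * mconv H \<rho> \<nu> A)) \<and>
     (\<forall>\<mu>\<in>M_space. \<forall>\<nu>\<in>M_space. \<forall>\<rho>\<in>M_space.
        mconv H (mconv H \<mu> \<nu>) \<rho> = mconv H \<mu> (mconv H \<nu> \<rho>)) \<and>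
     \<comment> \<open>compactly supported probability measures\<close>
     (\<forall>x y. pconv H x y \<in> M_pos \<and> pconv H x y UNIV = 1 \<and> compact (supp (pconv H x y))) \<and>
     \<comment> \<open>continuity\<close>
     continuous_map (prod_topology cone_topology cone_topology) cone_topology
       (\<lambda>(\<mu>, \<nu>). mconv H \<mu> \<nu>) \<and>
     continuous_map euclidean michael_topology (\<lambda>(x, y). supp (pconv H x y)) \<and>
     \<comment> \<open>identity\<close>
     (\<forall>x. pconv H (unit_elt H) x = point_mass x \<and> pconv H x (unit_elt H) = point_mass x) \<and>
     \<comment> \<open>involution\<close>
     continuous_on UNIV (invol H) \<and>
     (\<forall>x. invol H (invol H x) = x) \<and>
     (\<forall>x y A. pconv H x y (invol H -` A) = pconv H (invol H y) (invol H x) A) \<and>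
     (\<forall>x y. unit_elt H \<in> supp (pconv H x y) \<longleftrightarrow> x = invol H y)"

text \<open>\<open>htrans H f x y\<close> is \<open>f(xy)\<close>.\<close>

definition htrans ::
  "('a::t2_space) hypergroup_struct \<Rightarrow> ('a \<Rightarrow> complex) \<Rightarrow> 'a \<Rightarrow> 'a \<Rightarrow> complex" where
  "htrans H f x y = (LINT z|pos_measure (pconv H x y). f z)"

definition left_haar_measure :: "('a::t2_space) hypergroup_struct \<Rightarrow> 'a measure \<Rightarrow> bool" where
  "left_haar_measure H m \<longleftrightarrow>
     radon_measure m \<and> emeasure m UNIV \<noteq> 0 \<and>
     (\<forall>f\<in>Cc. \<forall>x. (LINT y|m. htrans H f x y) = (LINT y|m. f y))"


section \<open>Function spaces and convolution\<close>

text \<open>\<open>L\<^sup>p\<close> spaces are given by representatives: \<open>L\<^sup>1\<close> and \<open>L\<^sup>2\<close> are sets of functions with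
  seminorms.\<close>

definition L1 :: "'a measure \<Rightarrow> ('a \<Rightarrow> complex) set" where
  "L1 m = {f. integrable m f}"

definition L1_norm :: "'a measure \<Rightarrow> ('a \<Rightarrow> complex) \<Rightarrow> real" where
  "L1_norm m f = (LINT x|m. cmod (f x))"

definition L2 :: "'a measure \<Rightarrow> ('a \<Rightarrow> complex) set" where
  "L2 m = {f\<in>borel_measurable m. integrable m (\<lambda>x. (cmod (f x))\<^sup>2)}"

definition L2_norm :: "'a measure \<Rightarrow> ('a \<Rightarrow> complex) \<Rightarrow> real" where
  "L2_norm m f = sqrt (LINT x|m. (cmod (f x))\<^sup>2)"

definition conv ::
  "('a::t2_space) hypergroup_struct \<Rightarrow> 'a measure \<Rightarrow> ('a \<Rightarrow> complex) \<Rightarrow> ('a \<Rightarrow> complex) \<Rightarrow> 'a \<Rightarrow> complex" where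
  "conv H m f g x = (LINT y|m. f y * htrans H g (invol H y) x)"

definition tilde ::
  "('a::t2_space) hypergroup_struct \<Rightarrow> ('a \<Rightarrow> complex) \<Rightarrow> 'a \<Rightarrow> complex" where
  "tilde H f x = cnj (f (invol H x))"

definition left_regular ::
  "('a::t2_space) hypergroup_struct \<Rightarrow> 'a \<Rightarrow> ('a \<Rightarrow> complex) \<Rightarrow> 'a \<Rightarrow> complex" where
  "left_regular H x g y = htrans H g (invol H x) y"

text \<open>The integrated form \<open>\<lambda>(f) = \<integral> f(y) \<lambda>(y) dy\<close>, so that \<open>\<lambda>(f) g = f * g\<close>.\<close>

definition left_regular_L1 ::
  "('a::t2_space) hypergroup_struct \<Rightarrow> 'a measure \<Rightarrow> ('a \<Rightarrow> complex) \<Rightarrow> ('a \<Rightarrow> complex) \<Rightarrow> 'a \<Rightarrow> complex" where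
  "left_regular_L1 H m f g x = (LINT y|m. f y * left_regular H y g x)"

definition Cstar_norm ::
  "('a::t2_space) hypergroup_struct \<Rightarrow> 'a measure \<Rightarrow> ('a \<Rightarrow> complex) \<Rightarrow> real" where
  "Cstar_norm H m f =
     Sup {L2_norm m (left_regular_L1 H m f g) | g. g \<in> L2 m \<and> L2_norm m g \<le> 1}"


section \<open>The Fourier space\<close>

definition pairing :: "'a measure \<Rightarrow> ('a \<Rightarrow> complex) \<Rightarrow> ('a \<Rightarrow> complex) \<Rightarrow> complex" where
  "pairing m u f = (LINT x|m. u x * f x)"

text \<open>\<open>L\<^sup>1(H)\<close> is dense in \<open>C\<^sup>*\<^sub>\<lambda>(H)\<close>, so elements of the dual space, and their norms, are
  determined on \<open>L\<^sup>1(H)\<close>.\<close>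

definition B_lambda ::
  "('a::t2_space) hypergroup_struct \<Rightarrow> 'a measure \<Rightarrow> ('a \<Rightarrow> complex) set" where
  "B_lambda H m =
     {u\<in>borel_measurable m. bounded (range u) \<and>
        (\<exists>C. \<forall>f\<in>L1 m. cmod (pairing m u f) \<le> C * Cstar_norm H m f)}"

definition B_norm ::
  "('a::t2_space) hypergroup_struct \<Rightarrow> 'a measure \<Rightarrow> ('a \<Rightarrow> complex) \<Rightarrow> real" where
  "B_norm H m u = Sup {cmod (pairing m u f) | f. f \<in> L1 m \<and> Cstar_norm H m f \<le> 1}"

definition fourier_span ::
  "('a::t2_space) hypergroup_struct \<Rightarrow> 'a measure \<Rightarrow> ('a \<Rightarrow> complex) set" where
  "fourier_span H m =
     {\<lambda>x. \<Sum>i<n. c i * conv H m (\<phi> i) (tilde H (\<phi> i)) x |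
        (n :: nat) (c :: nat \<Rightarrow> complex) (\<phi> :: nat \<Rightarrow> 'a \<Rightarrow> complex). \<forall>i<n. \<phi> i \<in> Cc}"

text \<open>Functionals in the closed span are realized by their continuous representatives,
  which are unique because the support of a left Haar measure is the whole space.\<close>

definition fourier_space ::
  "('a::t2_space) hypergroup_struct \<Rightarrow> 'a measure \<Rightarrow> ('a \<Rightarrow> complex) set" where
  "fourier_space H m =
     {u\<in>B_lambda H m. continuous_on UNIV u \<and>
        (\<forall>\<epsilon>>0. \<exists>v\<in>fourier_span H m. B_norm H m (\<lambda>x. u x - v x) < \<epsilon>)}"

definition LA :: "('a::t2_space) hypergroup_struct \<Rightarrow> 'a measure \<Rightarrow> ('a \<Rightarrow> complex) set" where
  "LA H m = L1 m \<inter> fourier_space H m"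

text \<open>For bounded continuous \<open>g\<close> the function \<open>f * g\<close> is defined everywhere and depends only
  on the class of \<open>f\<close>, so for sets \<open>I\<close> of continuous representatives the membership
  \<open>f * g \<in> I\<close> makes sense pointwise.\<close>

definition left_ideal_L1 ::
  "('a::t2_space) hypergroup_struct \<Rightarrow> 'a measure \<Rightarrow> ('a \<Rightarrow> complex) set \<Rightarrow> bool" where
  "left_ideal_L1 H m I \<longleftrightarrow>
     I \<subseteq> L1 m \<and> (\<lambda>_. 0) \<in> I \<and>
     (\<forall>f\<in>I. \<forall>g\<in>I. (\<lambda>x. f x + g x) \<in> I) \<and>
     (\<forall>c. \<forall>f\<in>I. (\<lambda>x. c * f x) \<in> I) \<and>
     (\<forall>f\<in>L1 m. \<forall>g\<in>I. conv H m f g \<in> I)"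

definition dense_L1 :: "'a measure \<Rightarrow> ('a \<Rightarrow> complex) set \<Rightarrow> bool" where
  "dense_L1 m I \<longleftrightarrow>
     (\<forall>f\<in>L1 m. \<forall>\<epsilon>>0. \<exists>g\<in>I. L1_norm m (\<lambda>x. f x - g x) < \<epsilon>)"

end

theory Submission
  imports Defs
begin

text \<open>Write \<open>N f\<close> for the norm of \<open>\<lambda>(f)\<close> on \<open>L\<^sup>2(H)\<close>. A function \<open>u\<close> of the Fourier space is a limit, in the
  dual norm, of linear combinations of functions \<open>\<phi> * \<phi>~\<close> with \<open>\<phi> \<in> C\<^sub>c(H)\<close>, where \<open>\<phi>~\<close> is the
  involuted conjugate. That \<open>f * u\<close> stays in the Fourier space for \<open>f \<in> L\<^sup>1(H)\<close> rests on two estimates.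

  First, convolving from the left by \<open>f\<close> multiplies the dual norm by at most the norm of \<open>f\<close> in
  \<open>L\<^sup>1(H)\<close> (lemma \<open>dual_bound_conv\<close>). Left translations commute with convolution from the right and
  contract \<open>L\<^sup>2(H)\<close>, so they do not increase \<open>N\<close> (lemma \<open>N_htrans\<close>). The adjoint of the translation by a
  point is the translation by the involuted point (lemma \<open>adjoint_Cb\<close>), so pairing a translate of \<open>u\<close>
  with \<open>h\<close> is pairing \<open>u\<close> with a translate of \<open>h\<close>; integrating against \<open>f\<close> gives the estimate. It is
  therefore enough to treat \<open>u = \<phi> * \<phi>~\<close>.

  Second, the dual norm of \<open>\<psi> * \<phi>~\<close> is at most the product of the \<open>L\<^sup>2\<close> norms of \<open>\<psi>\<close> and \<open>\<phi>\<close>, since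
  pairing it with \<open>f\<close> is an inner product of \<open>\<psi>\<close> with a value of \<open>\<lambda>(f)\<close> (lemma \<open>dual_bound_conv_tilde\<close>).
  Now \<open>f * (\<phi> * \<phi>~) = (f * \<phi>) * \<phi>~\<close>, and \<open>f * \<phi>\<close> lies in \<open>L\<^sup>2(H)\<close> and so is a limit of test functions
  \<open>\<psi>\<close>. Each \<open>\<psi> * \<phi>~\<close> is in the span by polarization (lemma \<open>conv_tilde_span\<close>).

  For density, a test function \<open>h\<close> is close to \<open>h * k\<close> when \<open>k\<close> is a symmetric test function of
  integral one supported near the unit; as \<open>k = k~\<close>, polarization puts \<open>h * k\<close> in the span (lemma
  \<open>conv_approximate_unit\<close>).

  The measure theory needs care, as \<open>H\<close> need not be second countable nor the Haar measure sigma-finite,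
  so that neither product measures nor the usual Fubini theorem apply. The substitute is the class of
  lower semicontinuous functions with values in the extended nonnegative reals. For a Radon measure the
  integral commutes with directed suprema of such functions (lemma \<open>nn_integral_SUP_directed\<close>), which
  yields Tonelli's theorem for them (lemma \<open>Tonelli_lsc\<close>) and reduces invariance, associativity and
  the adjoint relation to test functions. Outer regularity dominates every nonnegative Borel
  function by a lower semicontinuous one of almost the same integral (lemma \<open>lsc_dominable_measurable\<close>);
  this gives the boundedness of \<open>\<lambda>(f)\<close> on all of \<open>L\<^sup>2(H)\<close>, for functions whose translates are not
  known to be jointly measurable.

  The axioms speak about measures rather than functions. Since the product is continuous on the cone of
  nonnegative measures and every such measure is a limit of finitely supported ones, the product of a
  point mass with a measure is the integral of the products with point masses (lemma \<open>integral_mconv\<close>).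
  This turns associativity into an identity between iterated translations (lemma \<open>ht_assoc\<close>), from
  which the adjoint relation is derived by smoothing with an approximate unit (lemmas \<open>smooth_adjoint\<close> and
  \<open>smooth_close\<close>).\<close>

section \<open>Lower semicontinuous functions\<close>

text \<open>Lower semicontinuity is stated through open superlevel sets, the form in which the outer and
  inner regularity of Radon measures can be applied.\<close>

definition lsc :: "('a::topological_space \<Rightarrow> ennreal) \<Rightarrow> bool" where
  "lsc F \<longleftrightarrow> (\<forall>c. open {x. c < F x})"

lemma lsc_open: "lsc F \<Longrightarrow> open {x. c < F x}"
  by (simp add: lsc_def)

lemma lscI:
  assumes "\<And>c x. c < F x \<Longrightarrow> eventually (\<lambda>y. c < F y) (nhds x)"
  shows "lsc F"
  unfolding lsc_def
proof
  fix c
  have "\<exists>T. open T \<and> x \<in> T \<and> T \<subseteq> {x. c < F x}" if x: "x \<in> {x. c < F x}" for x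
  proof -
    obtain T where "open T" "x \<in> T" "\<forall>y\<in>T. c < F y"
      using assms[of c x] x by (auto simp: eventually_nhds)
    then show ?thesis by (intro exI[of _ T]) auto
  qed
  then show "open {x. c < F x}" by (subst open_subopen) blast
qed

lemma lscD: "lsc F \<Longrightarrow> c < F x \<Longrightarrow> eventually (\<lambda>y. c < F y) (nhds x)"
  unfolding lsc_def eventually_nhds by blast

lemma lsc_measurable:
  assumes "lsc F" "sets M = sets borel"
  shows "F \<in> borel_measurable M"
proof -
  have "F \<in> borel_measurable borel"
    using assms(1) by (intro borel_measurableI_greater) (auto simp: lsc_def borel_open)
  then show ?thesis
    using assms(2) measurable_cong_sets by blast
qed

lemma lsc_const: "lsc (\<lambda>x. c)"
  by (simp add: lsc_def)

lemma lsc_indicator: "open U \<Longrightarrow> lsc (indicator U)"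
proof (rule lscI)
  fix c x assume U: "open U" and c: "(c::ennreal) < indicator U x"
  then have "x \<in> U" by (cases "x \<in> U") auto
  then have "eventually (\<lambda>y. y \<in> U) (nhds x)" using U by (rule eventually_nhds_in_open[rotated])
  then show "eventually (\<lambda>y. c < indicator U y) (nhds x)"
    by eventually_elim (use c \<open>x \<in> U\<close> in simp)
qed

lemma lsc_continuous: "continuous_on UNIV F \<Longrightarrow> lsc F"
  unfolding lsc_def by (intro allI open_Collect_less continuous_on_const)

lemma lsc_SUP: "(\<And>i. i \<in> I \<Longrightarrow> lsc (F i)) \<Longrightarrow> lsc (\<lambda>x. SUP i\<in>I. F i x)"
proof (rule lscI)
  fix c x assume F: "\<And>i. i \<in> I \<Longrightarrow> lsc (F i)" and "c < (SUP i\<in>I. F i x)"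
  then obtain i where i: "i \<in> I" "c < F i x" unfolding less_SUP_iff by blast
  from lscD[OF F[OF i(1)] i(2)] show "eventually (\<lambda>y. c < (SUP i\<in>I. F i y)) (nhds x)"
    by (rule eventually_mono) (rule less_le_trans[OF _ SUP_upper[OF i(1)]])
qed

lemma lsc_compose:
  assumes "lsc F" "continuous_on UNIV g"
  shows "lsc (\<lambda>x. F (g x))"
proof -
  have "open (g -` {y. c < F y})" for c
    using lsc_open[OF assms(1)] assms(2) by (rule open_vimage)
  then show ?thesis by (simp add: lsc_def vimage_def)
qed

text \<open>Superlevel sets of \<open>f (F x) (G x)\<close> are reached by values of \<open>f\<close> at points strictly below \<open>F x\<close> and
  \<open>G x\<close>. Multiplication on the extended nonnegative reals is not continuous at \<open>(0, \<infinity>)\<close>; the premise on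
  limits therefore only concerns approximating sequences that vanish identically when their limit is zero.\<close>

lemma lsc_binop:
  fixes f :: "ennreal \<Rightarrow> ennreal \<Rightarrow> ennreal"
  assumes mono: "\<And>a b a' b'. a \<le> a' \<Longrightarrow> b \<le> b' \<Longrightarrow> f a b \<le> f a' b'"
    and lim: "\<And>x u v. (u \<longlonglongrightarrow> F x) \<Longrightarrow> (v \<longlonglongrightarrow> G x) \<Longrightarrow>
          (F x = 0 \<Longrightarrow> u = (\<lambda>_. 0)) \<Longrightarrow> (G x = 0 \<Longrightarrow> v = (\<lambda>_. 0)) \<Longrightarrow>
          ((\<lambda>n::nat. f (u n) (v n)) \<longlonglongrightarrow> f (F x) (G x))"
    and F: "lsc F" and G: "lsc G"
  shows "lsc (\<lambda>x. f (F x) (G x))"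
proof (rule lscI)
  fix c x assume c: "c < f (F x) (G x)"
  have ap: "\<exists>u::nat\<Rightarrow>ennreal. (u \<longlonglongrightarrow> t) \<and> (t = 0 \<longrightarrow> u = (\<lambda>_. 0)) \<and> (\<forall>n. u n < t \<or> u n = 0)" for t
  proof (cases "t = 0")
    case False
    then have "0 < t" by (simp add: zero_less_iff_neq_zero)
    then show ?thesis using approx_from_below_dense_linorder[of 0 t] False by auto
  qed auto
  obtain u where u: "u \<longlonglongrightarrow> F x" "F x = 0 \<longrightarrow> u = (\<lambda>_. 0)" "\<And>n. u n < F x \<or> u n = 0"
    using ap[of "F x"] by blast
  obtain v where v: "v \<longlonglongrightarrow> G x" "G x = 0 \<longrightarrow> v = (\<lambda>_. 0)" "\<And>n. v n < G x \<or> v n = 0"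
    using ap[of "G x"] by blast
  have "(\<lambda>n. f (u n) (v n)) \<longlonglongrightarrow> f (F x) (G x)"
    using u v by (intro lim) auto
  from order_tendstoD(1)[OF this c] obtain n where n: "c < f (u n) (v n)"
    unfolding eventually_sequentially by (meson order_refl)
  have "eventually (\<lambda>y. u n \<le> F y) (nhds x)"
    using u(3)[of n] lscD[OF F, of "u n" x] by (auto elim: eventually_mono[OF _ less_imp_le])
  moreover have "eventually (\<lambda>y. v n \<le> G y) (nhds x)"
    using v(3)[of n] lscD[OF G, of "v n" x] by (auto elim: eventually_mono[OF _ less_imp_le])
  ultimately show "eventually (\<lambda>y. c < f (F y) (G y)) (nhds x)"
    by eventually_elim (rule less_le_trans[OF n mono])
qed

lemma lsc_add: "lsc F \<Longrightarrow> lsc G \<Longrightarrow> lsc (\<lambda>x. F x + G x)"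
proof (rule lsc_binop[where f = "(+)" and F = F and G = G])
  fix x :: 'a and u v :: "nat \<Rightarrow> ennreal"
  assume "u \<longlonglongrightarrow> F x" "v \<longlonglongrightarrow> G x"
  then show "(\<lambda>n. u n + v n) \<longlonglongrightarrow> F x + G x" by (rule tendsto_add)
qed (simp_all add: add_mono)

lemma lsc_mult: "lsc F \<Longrightarrow> lsc G \<Longrightarrow> lsc (\<lambda>x. F x * G x)"
proof (rule lsc_binop[where f = "(*)" and F = F and G = G])
  fix x :: 'a and u v :: "nat \<Rightarrow> ennreal"
  assume u: "u \<longlonglongrightarrow> F x" "F x = 0 \<Longrightarrow> u = (\<lambda>_. 0)" and v: "v \<longlonglongrightarrow> G x" "G x = 0 \<Longrightarrow> v = (\<lambda>_. 0)"
  show "(\<lambda>n. u n * v n) \<longlonglongrightarrow> F x * G x"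
  proof (cases "F x = 0 \<or> G x = 0")
    case True then show ?thesis using u v by auto
  next
    case False then show ?thesis using u v by (intro tendsto_mult_ennreal) auto
  qed
qed (simp_all add: mult_mono)

lemma lsc_sum: "(\<And>i. i \<in> I \<Longrightarrow> lsc (F i)) \<Longrightarrow> lsc (\<lambda>x. \<Sum>i\<in>I. F i x)"
  by (induction I rule: infinite_finite_induct) (auto intro: lsc_const lsc_add)

text \<open>A staircase of step \<open>1/2^n\<close> and height \<open>2^n\<close> below the identity. Its steps are at points strictly below
  \<open>t\<close>, so that only open superlevel sets occur when it is applied to a lower semicontinuous function.\<close>

definition layers :: "nat \<Rightarrow> ennreal \<Rightarrow> ennreal" where
  "layers n t = (\<Sum>k\<in>{1..4^n::nat}. ennreal (1/2^n) * indicator {ennreal (k/2^n)<..} t)"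

lemma layers_real:
  assumes "0 \<le> t"
  shows "layers n (ennreal t) = ennreal (min (4^n) (nat (\<lceil>t * 2^n\<rceil> - 1)) / 2^n)"
proof -
  define s where "s = t * 2^n"
  define N where "N = (4::nat)^n"
  have iff: "(real k/2^n < t) = (k \<le> nat (\<lceil>s\<rceil> - 1))" if "1 \<le> k" for k :: nat
  proof -
    have "(real k/2^n < t) = (real k < s)" by (simp add: pos_divide_less_eq s_def)
    also have "\<dots> = (int k < \<lceil>s\<rceil>)" by (simp add: less_ceiling_iff)
    also have "\<dots> = (k \<le> nat (\<lceil>s\<rceil> - 1))" using that by linarith
    finally show ?thesis .
  qed
  have set_eq: "{k\<in>{1..N}. k/2^n < t} = {1..min N (nat (\<lceil>s\<rceil> - 1))}"
    using iff by auto
  have "layers n (ennreal t) = (\<Sum>k\<in>{1..N}. if k/2^n < t then ennreal (1/2^n) else 0)"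
    unfolding layers_def N_def[symmetric] by (intro sum.cong) (auto simp: indicator_def ennreal_less_iff)
  also have "\<dots> = (\<Sum>k\<in>{k\<in>{1..N}. k/2^n < t}. ennreal (1/2^n))"
    by (subst sum.inter_filter) auto
  also have "\<dots> = of_nat (min N (nat (\<lceil>s\<rceil> - 1))) * ennreal (1/2^n)"
    unfolding set_eq by simp
  also have "\<dots> = ennreal (real (min N (nat (\<lceil>s\<rceil> - 1))) * (1/2^n))"
    by (subst ennreal_of_nat_eq_real_of_nat) (simp add: ennreal_mult''[symmetric] del: times_divide_eq_right)
  finally show ?thesis by (simp add: s_def N_def)
qed

lemma layers_top: "layers n top = ennreal (2^n)"
proof -
  have "layers n top = of_nat (4^n) * ennreal (1/2^n)"
    unfolding layers_def by (simp add: indicator_def)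
  also have "\<dots> = ennreal (real (4^n) * (1/2^n))"
    by (subst ennreal_of_nat_eq_real_of_nat) (simp add: ennreal_mult''[symmetric] del: times_divide_eq_right)
  also have "real (4^n) * (1/2^n) = 2^n"
    using power_mult_distrib[of "2::real" 2 n] by simp
  finally show ?thesis .
qed

lemma layers_le: "layers n t \<le> t"
proof (cases t)
  case (real r)
  have "real (nat (\<lceil>r * 2^n\<rceil> - 1)) \<le> r * 2^n"
  proof (cases "\<lceil>r * 2^n\<rceil> - 1 \<ge> 0")
    case True then show ?thesis by simp
  next
    case False then show ?thesis using real by simp
  qed
  then have "real (min (4^n) (nat (\<lceil>r * 2^n\<rceil> - 1))) / 2^n \<le> r"
    by (simp add: pos_divide_le_eq)
  then show ?thesis unfolding real(2) layers_real[OF real(1)] by (intro ennreal_leI)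
qed auto

lemma layers_tendsto: "(\<lambda>n. layers n t) \<longlonglongrightarrow> t"
proof (cases t)
  case (real r)
  have "(\<lambda>n. real (min (4^n) (nat (\<lceil>r * 2^n\<rceil> - 1))) / 2^n) \<longlonglongrightarrow> r"
  proof (rule tendsto_sandwich)
    show "(\<lambda>n. r - 1/2^n) \<longlonglongrightarrow> r"
      using tendsto_diff[OF tendsto_const[of r] LIMSEQ_power_zero[of "1/2::real"]] 
      by (simp add: power_one_over)
    show "eventually (\<lambda>n. real (min (4^n) (nat (\<lceil>r * 2^n\<rceil> - 1))) / 2^n \<le> r) sequentially"
    proof (rule always_eventually, rule allI)
      fix n
      have "layers n (ennreal r) \<le> ennreal r" by (rule layers_le)
      then show "real (min (4^n) (nat (\<lceil>r * 2^n\<rceil> - 1))) / 2^n \<le> r"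
        unfolding layers_real[OF real(1)] using real(1) by (simp add: ennreal_le_iff)
    qed
    have "eventually (\<lambda>n. r < real n) sequentially"
      using filterlim_real_sequentially by (simp add: filterlim_at_top_dense)
    then show "eventually (\<lambda>n. r - 1/2^n \<le> real (min (4^n) (nat (\<lceil>r * 2^n\<rceil> - 1))) / 2^n) sequentially"
    proof eventually_elim
      case (elim n)
      have "r \<le> 2^n" using elim of_nat_less_two_power[of n, where 'a=real] by linarith
      then have "r * 2^n \<le> 2^n * 2^n" by (intro mult_right_mono) auto
      also have "(2::real)^n * 2^n = 4^n" using power_mult_distrib[of "2::real" 2 n] by simp
      finally have "r * 2^n - 1 \<le> 4^n" by linarith
      moreover have "r * 2^n - 1 \<le> real (nat (\<lceil>r * 2^n\<rceil> - 1))" by linarith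
      ultimately have "r * 2^n - 1 \<le> real (min (4^n) (nat (\<lceil>r * 2^n\<rceil> - 1)))"
        by (simp add: min_def)
      then show ?case by (simp add: pos_le_divide_eq left_diff_distrib)
    qed
  qed auto
  then show ?thesis unfolding real(2) layers_real[OF real(1)] by (intro tendsto_ennrealI)
next
  case top
  have "(\<lambda>n. ennreal (2^n)) \<longlonglongrightarrow> top"
    unfolding ennreal_tendsto_top_eq_at_top
    by (rule filterlim_at_top_mono[OF filterlim_real_sequentially])
      (simp add: of_nat_less_two_power less_imp_le)
  then show ?thesis using top by (simp add: layers_top)
qed

lemma nn_integral_layers:
  assumes F: "F \<in> borel_measurable M"
  shows "(\<integral>\<^sup>+x. layers n (F x) \<partial>M) = (\<Sum>k\<in>{1..4^n::nat}. ennreal (1/2^n) * emeasure M {x\<in>space M. ennreal (k/2^n) < F x})"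
proof -
  have [measurable]: "F \<in> borel_measurable M" by fact
  have "(\<integral>\<^sup>+x. layers n (F x) \<partial>M) =
    (\<integral>\<^sup>+x. (\<Sum>k\<in>{1..4^n::nat}. ennreal (1/2^n) * indicator {x\<in>space M. ennreal (k/2^n) < F x} x) \<partial>M)"
    unfolding layers_def by (intro nn_integral_cong sum.cong) (auto simp: indicator_def)
  also have "\<dots> = (\<Sum>k\<in>{1..4^n::nat}. ennreal (1/2^n) * emeasure M {x\<in>space M. ennreal (k/2^n) < F x})"
    by (subst nn_integral_sum) (auto simp: nn_integral_cmult_indicator)
  finally show ?thesis .
qed

text \<open>Writes the integral through measures of superlevel sets with weights independent of \<open>F\<close>, so that
  statements on open sets pass to lower semicontinuous functions.\<close>

lemma nn_integral_eq_SUP_layers: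
  assumes F: "F \<in> borel_measurable M"
  shows "(\<integral>\<^sup>+x. F x \<partial>M) =
    (SUP n. \<Sum>k\<in>{1..4^n::nat}. ennreal (1/2^n) * emeasure M {x\<in>space M. ennreal (k/2^n) < F x})"
proof -
  have [measurable]: "F \<in> borel_measurable M" by fact
  have lm: "layers n \<in> borel_measurable borel" for n
    unfolding layers_def by measurable
  \<comment> \<open>Fatou's lemma suffices because the layer sums lie below \<open>F\<close>.\<close>
  have "(\<integral>\<^sup>+x. F x \<partial>M) = (\<integral>\<^sup>+x. liminf (\<lambda>n. layers n (F x)) \<partial>M)"
    by (intro nn_integral_cong) (simp add: lim_imp_Liminf[OF sequentially_bot layers_tendsto])
  also have "\<dots> \<le> liminf (\<lambda>n. \<integral>\<^sup>+x. layers n (F x) \<partial>M)"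
    by (intro nn_integral_liminf) (use lm F in measurable)
  also have "\<dots> \<le> (SUP n. \<integral>\<^sup>+x. layers n (F x) \<partial>M)"
    unfolding liminf_SUP_INF by (rule SUP_mono, rule bexI, rule INF_lower) auto
  finally have "(\<integral>\<^sup>+x. F x \<partial>M) \<le> (SUP n. \<integral>\<^sup>+x. layers n (F x) \<partial>M)" .
  moreover have "(SUP n. \<integral>\<^sup>+x. layers n (F x) \<partial>M) \<le> (\<integral>\<^sup>+x. F x \<partial>M)"
    by (intro SUP_least nn_integral_mono layers_le)
  ultimately show ?thesis by (simp add: nn_integral_layers[OF F])
qed

section \<open>Radon measures and directed suprema\<close>

text \<open>The nonnegative test functions, kept real-valued so that they embed both into the complex test
  functions and into the lower semicontinuous functions.\<close>

definition Ccp :: "('a::t2_space \<Rightarrow> real) set" where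
  "Ccp = {\<phi>. continuous_on UNIV \<phi> \<and> (\<forall>x. 0 \<le> \<phi> x) \<and> (\<exists>K. compact K \<and> (\<forall>x. x \<notin> K \<longrightarrow> \<phi> x = 0))}"

lemma CcpD:
  assumes "\<phi> \<in> Ccp"
  shows "continuous_on UNIV \<phi>" "0 \<le> \<phi> x"
  using assms by (auto simp: Ccp_def)

lemma Ccp_lsc: "\<phi> \<in> Ccp \<Longrightarrow> lsc (\<lambda>x. ennreal (\<phi> x))"
  by (intro lsc_continuous continuous_on_ennreal CcpD)

lemma Ccp_max: "\<phi> \<in> Ccp \<Longrightarrow> \<psi> \<in> Ccp \<Longrightarrow> (\<lambda>x. max (\<phi> x) (\<psi> x)) \<in> Ccp"
  unfolding Ccp_def
proof safe
  fix K L assume "compact K" "\<forall>x. x \<notin> K \<longrightarrow> \<phi> x = 0" "compact L" "\<forall>x. x \<notin> L \<longrightarrow> \<psi> x = 0"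
  then show "\<exists>K. compact K \<and> (\<forall>x. x \<notin> K \<longrightarrow> max (\<phi> x) (\<psi> x) = 0)"
    by (intro exI[of _ "K \<union> L"]) (auto simp: compact_Un)
qed (auto intro!: continuous_on_max simp: le_max_iff_disj)

lemma Ccp_add: "\<phi> \<in> Ccp \<Longrightarrow> \<psi> \<in> Ccp \<Longrightarrow> (\<lambda>x. \<phi> x + \<psi> x) \<in> Ccp"
  unfolding Ccp_def
proof safe
  fix K L assume "compact K" "\<forall>x. x \<notin> K \<longrightarrow> \<phi> x = 0" "compact L" "\<forall>x. x \<notin> L \<longrightarrow> \<psi> x = 0"
  then show "\<exists>K. compact K \<and> (\<forall>x. x \<notin> K \<longrightarrow> \<phi> x + \<psi> x = 0)"
    by (intro exI[of _ "K \<union> L"]) (auto simp: compact_Un)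
qed (auto intro!: continuous_on_add)

lemma Ccp_cmult: "\<phi> \<in> Ccp \<Longrightarrow> 0 \<le> c \<Longrightarrow> (\<lambda>x. c * \<phi> x) \<in> Ccp"
  unfolding Ccp_def by (auto intro!: continuous_on_mult_left)

lemma Ccp_zero: "(\<lambda>x. 0) \<in> Ccp"
  unfolding Ccp_def by (auto intro!: exI[of _ "{}"])

lemma Ccp_bounded: 
  assumes "\<phi> \<in> Ccp" obtains B where "0 < B" "\<And>x. \<phi> x \<le> B"
proof -
  obtain K where K: "compact K" "\<And>x. x \<notin> K \<Longrightarrow> \<phi> x = 0" "continuous_on UNIV \<phi>"
    using assms by (auto simp: Ccp_def)
  have "compact (\<phi> ` K)"
    using K by (intro compact_continuous_image) (auto intro: continuous_on_subset)
  then have "bounded (\<phi> ` K)" by (rule compact_imp_bounded)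
  then obtain B where B: "0 < B" "\<And>y. y \<in> \<phi> ` K \<Longrightarrow> norm y \<le> B" unfolding bounded_pos by blast
  have "\<phi> x \<le> B" for x
  proof (cases "x \<in> K")
    case True then show ?thesis using B(2)[of "\<phi> x"] by auto
  next
    case False then show ?thesis using K(2)[of x] B(1) by simp
  qed
  then show thesis using B(1) that by blast
qed

text \<open>Local compactness is a property of the whole type; the type argument allows it as a premise.\<close>

abbreviation lch :: "'a::t2_space itself \<Rightarrow> bool" where
  "lch (_::'a itself) \<equiv> locally_compact_space (euclidean :: 'a topology)"

lemma Hausdorff_euclidean_t2: "Hausdorff_space (euclidean :: 'a::t2_space topology)"
  unfolding Hausdorff_space_def by (auto simp: disjnt_def dest!: hausdorff)

lemma lch_compact_nbhd:
  assumes lc: "lch TYPE('a::t2_space)" and K: "compact (K::'a set)" 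
  obtains V L where "open V" "compact L" "K \<subseteq> V" "V \<subseteq> L"
proof -
  have "\<forall>K. compactin (euclidean :: 'a topology) K \<longrightarrow>
      (\<exists>U L. open U \<and> compact L \<and> closed L \<and> K \<subseteq> U \<and> U \<subseteq> L)"
    using lc locally_compact_space_compact_closed_compact[of "euclidean :: 'a topology"]
      Hausdorff_euclidean_t2[where 'a = 'a] by simp
  then obtain V L where "open V" "compact L" "K \<subseteq> V" "V \<subseteq> L"
    using K by (auto simp: compactin_euclidean_iff)
  then show thesis by (rule that)
qed

lemma Urysohn_Ccp:
  assumes lc: "lch TYPE('a::t2_space)" and K: "compact (K::'a set)" and U: "open U" "K \<subseteq> U"
  obtains \<phi> where "\<phi> \<in> Ccp" "\<And>x. \<phi> x \<le> 1" "\<And>x. x \<in> K \<Longrightarrow> \<phi> x = 1" "\<And>x. x \<notin> U \<Longrightarrow> \<phi> x = 0"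
proof -
  obtain V L where V: "open V" "compact L" "K \<subseteq> V" "V \<subseteq> L" using lch_compact_nbhd[OF lc K] .
  have cr: "completely_regular_space (euclidean :: 'a topology)"
    using lc Hausdorff_euclidean_t2 by (intro locally_compact_regular_imp_completely_regular_space) auto
  have "closedin euclidean (- (U \<inter> V))" "disjnt K (- (U \<inter> V))"
    using U V by (auto simp: disjnt_def closed_Compl)
  then obtain f where f: "continuous_map euclidean (top_of_set {0..1::real}) f"
      "f ` (- (U \<inter> V)) \<subseteq> {0}" "f ` K \<subseteq> {1}"
    using Urysohn_completely_regular_compact_closed[of 0 1 euclidean K "- (U \<inter> V)"] cr K by auto
  have c: "continuous_on UNIV f" and r: "\<And>x. 0 \<le> f x \<and> f x \<le> 1"
    using f(1) by (auto simp: continuous_map_in_subtopology)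
  have z: "f x = 0" if "x \<notin> U \<or> x \<notin> V" for x using f(2) that by auto
  show thesis
  proof
    show "f \<in> Ccp" unfolding Ccp_def using c r z V by (auto intro!: exI[of _ L])
  qed (use r z f(3) in auto)
qed

lemma open_rect_compact:
  assumes "compact K" "open U" "\<And>y. y \<in> K \<Longrightarrow> (x, y) \<in> U"
  obtains N V where "open N" "open V" "x \<in> N" "K \<subseteq> V" "N \<times> V \<subseteq> U"
proof -
  have "\<exists>A B. open A \<and> open B \<and> x \<in> A \<and> y \<in> B \<and> A \<times> B \<subseteq> U" if y: "y \<in> K" for y
    using open_prod_elim[OF assms(2) assms(3)[OF y]] by (metis mem_Sigma_iff)
  then obtain A B where AB: "\<And>y. y \<in> K \<Longrightarrow> open (A y) \<and> open (B y) \<and> x \<in> A y \<and> y \<in> B y \<and> A y \<times> B y \<subseteq> U"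
    by metis
  then obtain C where C: "C \<subseteq> K" "finite C" "K \<subseteq> (\<Union>y\<in>C. B y)"
    using compactE_image[OF assms(1), of K B] by (metis UN_I subsetI)
  show thesis
  proof (rule that[of "\<Inter>y\<in>C. A y" "\<Union>y\<in>C. B y"])
    show "open (\<Inter>y\<in>C. A y)" "open (\<Union>y\<in>C. B y)" using AB C by (auto intro!: open_INT)
    show "(\<Inter>y\<in>C. A y) \<times> (\<Union>y\<in>C. B y) \<subseteq> U" using AB C by fast
  qed (use AB C in auto)
qed

lemma radon_sets: "radon_measure M \<Longrightarrow> sets M = sets borel"
  and radon_space: "radon_measure M \<Longrightarrow> space M = UNIV"
  and radon_compact: "radon_measure M \<Longrightarrow> compact K \<Longrightarrow> emeasure M K < \<infinity>"
  and radon_outer: "radon_measure M \<Longrightarrow> A \<in> sets borel \<Longrightarrow> emeasure M A = (INF U\<in>{U. open U \<and> A \<subseteq> U}. emeasure M U)"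
  and radon_inner: "radon_measure M \<Longrightarrow> open U \<Longrightarrow> emeasure M U = (SUP K\<in>{K. compact K \<and> K \<subseteq> U}. emeasure M K)"
  by (auto simp: radon_measure_def dest: sets_eq_imp_space_eq)

definition directed_fam :: "'i set \<Rightarrow> ('i \<Rightarrow> 'c::order) \<Rightarrow> bool" where
  "directed_fam I h \<longleftrightarrow> I \<noteq> {} \<and> (\<forall>i\<in>I. \<forall>j\<in>I. \<exists>k\<in>I. h i \<le> h k \<and> h j \<le> h k)"

lemma directed_fam_finite:
  assumes "directed_fam I h" "finite J" "J \<subseteq> I"
  shows "\<exists>k\<in>I. \<forall>j\<in>J. h j \<le> h k"
  using assms(2,3)
proof (induction J)
  case empty then show ?case using assms(1) by (auto simp: directed_fam_def)
next
  case (insert j J)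
  then obtain k where k: "k \<in> I" "\<forall>j\<in>J. h j \<le> h k" by auto
  obtain l where "l \<in> I" "h j \<le> h l" "h k \<le> h l"
    using assms(1) insert k unfolding directed_fam_def by blast
  then show ?case using k by (auto intro!: bexI[of _ l] intro: order_trans)
qed

text \<open>A compact subset of the union is already contained in one member of the family, by directedness.\<close>

lemma emeasure_directed_open:
  assumes M: "radon_measure M" and V: "\<And>i. i \<in> I \<Longrightarrow> open (V i)" and dir: "directed_fam I V"
  shows "emeasure M (\<Union>i\<in>I. V i) = (SUP i\<in>I. emeasure M (V i))"
proof (rule antisym)
  have "emeasure M K \<le> (SUP i\<in>I. emeasure M (V i))" if K: "compact K" "K \<subseteq> (\<Union>i\<in>I. V i)" for K
  proof -
    obtain J where J: "J \<subseteq> I" "finite J" "K \<subseteq> (\<Union>i\<in>J. V i)"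
      using compactE_image[OF K(1), of I V] K(2) V by metis
    obtain k where k: "k \<in> I" "\<forall>j\<in>J. V j \<subseteq> V k"
      using directed_fam_finite[OF dir J(2,1)] by auto
    have "K \<subseteq> V k" using J(3) k(2) by blast
    then have "emeasure M K \<le> emeasure M (V k)"
      using k(1) V by (intro emeasure_mono) (auto simp: radon_sets[OF M])
    then show ?thesis using k(1) by (meson SUP_upper2)
  qed
  moreover have "open (\<Union>i\<in>I. V i)" using V by auto
  ultimately show "emeasure M (\<Union>i\<in>I. V i) \<le> (SUP i\<in>I. emeasure M (V i))"
    unfolding radon_inner[OF M \<open>open (\<Union>i\<in>I. V i)\<close>] by (auto intro!: SUP_least)
  show "(SUP i\<in>I. emeasure M (V i)) \<le> emeasure M (\<Union>i\<in>I. V i)"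
    using V by (intro SUP_least emeasure_mono) (auto simp: radon_sets[OF M] intro!: borel_open)
qed

text \<open>Each summand gets its own index; for a directed family a common one is found afterwards.\<close>

lemma less_sum_SUP:
  fixes g :: "'k \<Rightarrow> 'i \<Rightarrow> ennreal"
  assumes "finite A" and c: "c < (\<Sum>k\<in>A. a * (SUP i\<in>I. g k i))" and I: "I \<noteq> {}"
  shows "\<exists>s. (\<forall>k\<in>A. s k \<in> I) \<and> c < (\<Sum>k\<in>A. a * g k (s k))"
proof -
  have "\<exists>u::nat\<Rightarrow>'i. (\<forall>n. u n \<in> I) \<and> (\<lambda>n. a * g k (u n)) \<longlonglongrightarrow> a * (SUP i\<in>I. g k i)" for k
  proof -
    have "(\<lambda>i. a * g k i) ` I \<noteq> {}" using I by auto
    from ennreal_Sup_countable_SUP[OF this] obtain f where f: "incseq f" 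
      "range f \<subseteq> (\<lambda>i. a * g k i) ` I" "(SUP i\<in>I. a * g k i) = (SUP i. f i)" by auto
    have "\<forall>n. \<exists>i\<in>I. f n = a * g k i" using f(2) by auto
    then obtain u where u: "\<And>n. u n \<in> I" "\<And>n. f n = a * g k (u n)" by metis
    have "f \<longlonglongrightarrow> (SUP i. f i)" by (rule LIMSEQ_SUP[OF f(1)])
    moreover have "(SUP i. f i) = a * (SUP i\<in>I. g k i)"
      unfolding f(3)[symmetric] by (rule SUP_mult_left_ennreal[symmetric])
    moreover have "f = (\<lambda>n. a * g k (u n))" using u(2) by auto
    ultimately show ?thesis using u(1) by (intro exI[of _ u]) simp
  qed
  then obtain u where u: "\<And>k n. u k n \<in> I" "\<And>k. (\<lambda>n. a * g k (u k n)) \<longlonglongrightarrow> a * (SUP i\<in>I. g k i)"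
    by metis
  have "(\<lambda>n::nat. \<Sum>k\<in>A. a * g k (u k n)) \<longlonglongrightarrow> (\<Sum>k\<in>A. a * (SUP i\<in>I. g k i))"
    by (intro tendsto_sum u(2))
  from order_tendstoD(1)[OF this c] obtain n where "c < (\<Sum>k\<in>A. a * g k (u k n))"
    unfolding eventually_sequentially by (meson order_refl)
  then show ?thesis using u(1) by (intro exI[of _ "\<lambda>k. u k n"]) auto
qed

text \<open>The monotone convergence theorem for directed families of arbitrary cardinality. On superlevel sets
  it is \<open>emeasure_directed_open\<close>, and finitely many layers only involve finitely many indices.\<close>

lemma nn_integral_SUP_directed:
  assumes M: "radon_measure M" and h: "\<And>i. i \<in> I \<Longrightarrow> lsc (h i)" and dir: "directed_fam I h"
  shows "(\<integral>\<^sup>+x. (SUP i\<in>I. h i x) \<partial>M) = (SUP i\<in>I. \<integral>\<^sup>+x. h i x \<partial>M)"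
proof (rule antisym)
  note sp = radon_space[OF M]
  have I: "I \<noteq> {}" using dir by (simp add: directed_fam_def)
  have lS: "lsc (\<lambda>x. SUP i\<in>I. h i x)" by (intro lsc_SUP h)
  show "(SUP i\<in>I. \<integral>\<^sup>+x. h i x \<partial>M) \<le> (\<integral>\<^sup>+x. (SUP i\<in>I. h i x) \<partial>M)"
    by (intro SUP_least nn_integral_mono) (auto intro: SUP_upper)
  show "(\<integral>\<^sup>+x. (SUP i\<in>I. h i x) \<partial>M) \<le> (SUP i\<in>I. \<integral>\<^sup>+x. h i x \<partial>M)"
  proof (rule dense_le)
    fix c assume "c < (\<integral>\<^sup>+x. (SUP i\<in>I. h i x) \<partial>M)"
    then obtain n where n: "c < (\<Sum>k\<in>{1..4^n::nat}. ennreal (1/2^n) * emeasure M {x\<in>space M. ennreal (k/2^n) < (SUP i\<in>I. h i x)})"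
      unfolding nn_integral_eq_SUP_layers[OF lsc_measurable[OF lS radon_sets[OF M]]]
      by (auto simp: less_SUP_iff)
    have "emeasure M {x\<in>space M. q < (SUP i\<in>I. h i x)} = (SUP i\<in>I. emeasure M {x. q < h i x})" for q
    proof -
      have "{x\<in>space M. q < (SUP i\<in>I. h i x)} = (\<Union>i\<in>I. {x. q < h i x})"
        unfolding sp by (auto simp: less_SUP_iff)
      moreover have "directed_fam I (\<lambda>i. {x. q < h i x})"
        unfolding directed_fam_def
      proof (intro conjI ballI)
        fix i j assume "i \<in> I" "j \<in> I"
        then obtain k where k: "k \<in> I" "h i \<le> h k" "h j \<le> h k"
          using dir unfolding directed_fam_def by blast
        have "{x. q < h i x} \<subseteq> {x. q < h k x}" "{x. q < h j x} \<subseteq> {x. q < h k x}"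
          using le_funD[OF k(2)] le_funD[OF k(3)] by (auto intro: less_le_trans)
        then show "\<exists>k\<in>I. {x. q < h i x} \<subseteq> {x. q < h k x} \<and> {x. q < h j x} \<subseteq> {x. q < h k x}"
          using k(1) by blast
      qed (rule I)
      ultimately show ?thesis
        using emeasure_directed_open[OF M lsc_open[OF h], of I "\<lambda>i. i"] by simp
    qed
    with n have "c < (\<Sum>k\<in>{1..4^n::nat}. ennreal (1/2^n) * (SUP i\<in>I. emeasure M {x. ennreal (k/2^n) < h i x}))"
      by simp
    from less_sum_SUP[OF _ this I] obtain s where s: "\<And>k. k \<in> {1..4^n::nat} \<Longrightarrow> s k \<in> I"
      "c < (\<Sum>k\<in>{1..4^n::nat}. ennreal (1/2^n) * emeasure M {x. ennreal (k/2^n) < h (s k) x})"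
      by blast
    obtain j where j: "j \<in> I" "\<And>k. k \<in> {1..4^n::nat} \<Longrightarrow> h (s k) \<le> h j"
    proof -
      have "s ` {1..4^n} \<subseteq> I" using s(1) by blast
      from directed_fam_finite[OF dir _ this] show ?thesis using that by auto
    qed
    have "c \<le> (\<Sum>k\<in>{1..4^n::nat}. ennreal (1/2^n) * emeasure M {x. ennreal (k/2^n) < h (s k) x})"
      using s(2) by simp
    also have "\<dots> \<le> (\<Sum>k\<in>{1..4^n::nat}. ennreal (1/2^n) * emeasure M {x\<in>space M. ennreal (k/2^n) < h j x})"
    proof (intro sum_mono mult_left_mono emeasure_mono)
      fix k :: nat assume k: "k \<in> {1..4^n}"
      show "{x. ennreal (k/2^n) < h (s k) x} \<subseteq> {x\<in>space M. ennreal (k/2^n) < h j x}"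
        using j(2)[OF k] unfolding sp le_fun_def by (auto intro: less_le_trans)
      show "{x\<in>space M. ennreal (k/2^n) < h j x} \<in> sets M"
        unfolding sp radon_sets[OF M] using lsc_open[OF h[OF j(1)]] by simp
    qed auto
    also have "\<dots> \<le> (\<integral>\<^sup>+x. h j x \<partial>M)"
      unfolding nn_integral_eq_SUP_layers[OF lsc_measurable[OF h[OF j(1)] radon_sets[OF M]]]
      by (rule SUP_upper) simp
    also have "\<dots> \<le> (SUP i\<in>I. \<integral>\<^sup>+x. h i x \<partial>M)" by (rule SUP_upper[OF j(1)])
    finally show "c \<le> (SUP i\<in>I. \<integral>\<^sup>+x. h i x \<partial>M)" .
  qed
qed

text \<open>The test functions below \<open>F\<close> form a directed family, and in a locally compact space their
  supremum is \<open>F\<close> whenever \<open>F\<close> is lower semicontinuous.\<close>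

definition below :: "('a::t2_space \<Rightarrow> ennreal) \<Rightarrow> ('a \<Rightarrow> real) set" where
  "below F = {\<phi>\<in>Ccp. \<forall>x. ennreal (\<phi> x) \<le> F x}"

lemma directed_below:
  fixes F :: "'a::t2_space \<Rightarrow> ennreal"
  shows "directed_fam (below F) (\<lambda>\<phi> x. ennreal (\<phi> x))"
  unfolding directed_fam_def
proof (intro conjI ballI)
  show "below F \<noteq> {}" using Ccp_zero by (auto simp: below_def)
  fix \<phi> \<psi> assume "\<phi> \<in> below F" "\<psi> \<in> below F"
  then have "(\<lambda>x. max (\<phi> x) (\<psi> x)) \<in> below F"
    by (auto simp: below_def Ccp_max) (simp add: max_def)
  then show "\<exists>k\<in>below F. (\<lambda>x. ennreal (\<phi> x)) \<le> (\<lambda>x. ennreal (k x)) \<and> (\<lambda>x. ennreal (\<psi> x)) \<le> (\<lambda>x. ennreal (k x))"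
    by (rule rev_bexI) (auto simp: le_fun_def intro!: ennreal_leI)
qed

lemma SUP_below:
  assumes lc: "lch TYPE('a::t2_space)" and F: "lsc (F::'a\<Rightarrow>ennreal)"
  shows "(SUP \<phi>\<in>below F. ennreal (\<phi> x)) = F x"
proof (rule antisym)
  show "(SUP \<phi>\<in>below F. ennreal (\<phi> x)) \<le> F x" by (auto intro!: SUP_least simp: below_def)
  show "F x \<le> (SUP \<phi>\<in>below F. ennreal (\<phi> x))"
  proof (rule dense_le)
    fix c assume c: "c < F x"
    then obtain r where r: "c = ennreal r" "0 \<le> r" by (cases c) auto
    obtain \<phi> where \<phi>: "\<phi> \<in> Ccp" "\<And>y. \<phi> y \<le> 1" "\<phi> x = 1" "\<And>y. y \<notin> {y. c < F y} \<Longrightarrow> \<phi> y = 0"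
      using Urysohn_Ccp[OF lc, of "{x}" "{y. c < F y}"] lsc_open[OF F] c by auto
    have "(\<lambda>y. r * \<phi> y) \<in> below F"
      unfolding below_def
    proof safe
      show "(\<lambda>y. r * \<phi> y) \<in> Ccp" using \<phi>(1) r(2) by (rule Ccp_cmult)
      fix y show "ennreal (r * \<phi> y) \<le> F y"
      proof (cases "c < F y")
        case True
        have "ennreal (r * \<phi> y) \<le> ennreal r"
          using \<phi>(2)[of y] r(2) by (intro ennreal_leI) (simp add: mult_left_le)
        then show ?thesis using True r(1) by simp
      qed (simp add: \<phi>(4))
    qed
    then have "ennreal (r * \<phi> x) \<le> (SUP \<phi>\<in>below F. ennreal (\<phi> x))" by (rule SUP_upper2) simp
    then show "c \<le> (SUP \<phi>\<in>below F. ennreal (\<phi> x))" using r \<phi>(3) by simp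
  qed
qed

lemma nn_integral_SUP_below:
  assumes lc: "lch TYPE('a::t2_space)" and M: "radon_measure (M::'a measure)" and F: "lsc F"
  shows "(\<integral>\<^sup>+x. F x \<partial>M) = (SUP \<phi>\<in>below F. \<integral>\<^sup>+x. ennreal (\<phi> x) \<partial>M)"
proof -
  have "(\<integral>\<^sup>+x. (SUP \<phi>\<in>below F. ennreal (\<phi> x)) \<partial>M) = (SUP \<phi>\<in>below F. \<integral>\<^sup>+x. ennreal (\<phi> x) \<partial>M)"
  proof (rule nn_integral_SUP_directed[OF M _ directed_below])
    fix \<phi> assume "\<phi> \<in> below F"
    then show "lsc (\<lambda>x. ennreal (\<phi> x))" unfolding below_def by (blast intro: Ccp_lsc)
  qed
  moreover have "(\<integral>\<^sup>+x. (SUP \<phi>\<in>below F. ennreal (\<phi> x)) \<partial>M) = (\<integral>\<^sup>+x. F x \<partial>M)"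
    by (rule nn_integral_cong) (rule SUP_below[OF lc F])
  ultimately show ?thesis by (rule trans[OF sym, rotated])
qed

text \<open>Inner regularity gives a compact set in the section at \<open>x\<close>, the tube lemma a product neighbourhood
  of it inside \<open>U\<close>, and Urysohn's lemma a test function in between, on which the kernel is controlled.\<close>

lemma lsc_emeasure_kernel:
  fixes \<kappa> :: "'x::topological_space \<Rightarrow> 'b::t2_space measure"
  assumes lc: "lch TYPE('b)" and \<kappa>: "\<And>x. radon_measure (\<kappa> x)"
    and cont: "\<And>\<phi>. \<phi> \<in> Ccp \<Longrightarrow> lsc (\<lambda>x. \<integral>\<^sup>+y. ennreal (\<phi> y) \<partial>\<kappa> x)"
    and U: "open U"
  shows "lsc (\<lambda>x. emeasure (\<kappa> x) {y. (x, y) \<in> U})"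
proof (rule lscI)
  fix c x assume c: "c < emeasure (\<kappa> x) {y. (x, y) \<in> U}"
  have sec: "open {y. (z, y) \<in> U}" for z
  proof -
    have "continuous_on UNIV (\<lambda>y. (z, y))" by (intro continuous_intros)
    from open_vimage[OF U this] show ?thesis by (simp add: vimage_def)
  qed
  obtain K where K: "compact K" "K \<subseteq> {y. (x, y) \<in> U}" "c < emeasure (\<kappa> x) K"
    using c unfolding radon_inner[OF \<kappa> sec] by (auto simp: less_SUP_iff)
  obtain N V where N: "open N" "open V" "x \<in> N" "K \<subseteq> V" "N \<times> V \<subseteq> U"
    using open_rect_compact[OF K(1) U, of x] K(2) by auto
  obtain \<phi> where \<phi>: "\<phi> \<in> Ccp" "\<And>y. \<phi> y \<le> 1" "\<And>y. y \<in> K \<Longrightarrow> \<phi> y = 1" "\<And>y. y \<notin> V \<Longrightarrow> \<phi> y = 0"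
    using Urysohn_Ccp[OF lc K(1) N(2,4)] by metis
  have Ks: "K \<in> sets (\<kappa> x)" using K(1) by (simp add: radon_sets[OF \<kappa>] borel_compact)
  have "emeasure (\<kappa> x) K = (\<integral>\<^sup>+y. indicator K y \<partial>\<kappa> x)" using Ks by simp
  also have "\<dots> \<le> (\<integral>\<^sup>+y. ennreal (\<phi> y) \<partial>\<kappa> x)"
    using \<phi>(3) by (intro nn_integral_mono) (auto simp: indicator_def)
  finally have "c < (\<integral>\<^sup>+y. ennreal (\<phi> y) \<partial>\<kappa> x)" using K(3) by simp
  from lscD[OF cont[OF \<phi>(1)] this] eventually_nhds_in_open[OF N(1,3)]
  show "eventually (\<lambda>z. c < emeasure (\<kappa> z) {y. (z, y) \<in> U}) (nhds x)"
  proof eventually_elim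
    case (elim z)
    note elim(1)
    also have "(\<integral>\<^sup>+y. ennreal (\<phi> y) \<partial>\<kappa> z) \<le> (\<integral>\<^sup>+y. indicator {y. (z, y) \<in> U} y \<partial>\<kappa> z)"
    proof (intro nn_integral_mono)
      fix y show "ennreal (\<phi> y) \<le> indicator {y. (z, y) \<in> U} y"
      proof (cases "y \<in> V")
        case True
        then have "(z, y) \<in> U" using elim(2) N(5) by auto
        then show ?thesis using \<phi>(2)[of y] ennreal_leI[of "\<phi> y" 1] by simp
      qed (simp add: \<phi>(4))
    qed
    also have "\<dots> = emeasure (\<kappa> z) {y. (z, y) \<in> U}"
      using sec[of z] by (simp add: radon_sets[OF \<kappa>])
    finally show ?case .
  qed
qed

lemma lsc_section: "lsc F \<Longrightarrow> lsc (\<lambda>y. F (x, y))"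
  by (rule lsc_compose[of F "\<lambda>y. (x, y)"]) (auto intro!: continuous_intros)

lemma lsc_section': "lsc F \<Longrightarrow> lsc (\<lambda>x. F (x, y))"
  by (rule lsc_compose[of F "\<lambda>x. (x, y)"]) (auto intro!: continuous_intros)

text \<open>Integrating against a weakly lower semicontinuous family of measures preserves lower
  semicontinuity, even if the integrand also depends on the parameter.\<close>

lemma lsc_nn_integral_kernel:
  fixes \<kappa> :: "'x::topological_space \<Rightarrow> 'b::t2_space measure"
  assumes lc: "lch TYPE('b)" and \<kappa>: "\<And>x. radon_measure (\<kappa> x)"
    and cont: "\<And>\<phi>. \<phi> \<in> Ccp \<Longrightarrow> lsc (\<lambda>x. \<integral>\<^sup>+y. ennreal (\<phi> y) \<partial>\<kappa> x)"
    and F: "lsc F"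
  shows "lsc (\<lambda>x. \<integral>\<^sup>+y. F (x, y) \<partial>\<kappa> x)"
proof -
  have "(\<integral>\<^sup>+y. F (x, y) \<partial>\<kappa> x) = (SUP n. \<Sum>k\<in>{1..4^n::nat}. ennreal (1/2^n) * emeasure (\<kappa> x) {y. ennreal (k/2^n) < F (x, y)})" for x
    using nn_integral_eq_SUP_layers[OF lsc_measurable[OF lsc_section[OF F, of x] radon_sets[OF \<kappa>[of x]]]]
    by (simp add: radon_space[OF \<kappa>])
  moreover have "lsc (\<lambda>x. emeasure (\<kappa> x) {y. q < F (x, y)})" for q
    using lsc_emeasure_kernel[OF lc \<kappa> cont lsc_open[OF F, of q]] by simp
  ultimately show ?thesis
    by (simp only:) (intro lsc_SUP lsc_sum lsc_mult lsc_const)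
qed

lemma lsc_nn_integral:
  fixes M :: "'b::t2_space measure"
  assumes "lch TYPE('b)" and "radon_measure M" and "lsc F"
  shows "lsc (\<lambda>x. \<integral>\<^sup>+y. F (x, y) \<partial>M)"
  by (rule lsc_nn_integral_kernel[of "\<lambda>_. M" F, OF assms(1,2) lsc_const assms(3)])

section \<open>Iterated integrals of lower semicontinuous functions\<close>

lemma directed_fam_mono:
  assumes dir: "directed_fam I h" and mono: "\<And>i k. i \<in> I \<Longrightarrow> k \<in> I \<Longrightarrow> h i \<le> h k \<Longrightarrow> g i \<le> g k"
  shows "directed_fam I g"
  unfolding directed_fam_def
proof (intro conjI ballI)
  show "I \<noteq> {}" using dir by (simp add: directed_fam_def)
  fix i j assume i: "i \<in> I" and j: "j \<in> I"
  then obtain k where k: "k \<in> I" "h i \<le> h k" "h j \<le> h k"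
    using dir unfolding directed_fam_def by blast
  show "\<exists>k\<in>I. g i \<le> g k \<and> g j \<le> g k"
    using mono[OF i k(1,2)] mono[OF j k(1,3)] k(1) by blast
qed

text \<open>The inner integrals are again lower semicontinuous and directed, so the supremum passes both integrals.\<close>

lemma iterated_integral_SUP_directed:
  fixes M :: "'a::t2_space measure" and N :: "'b::t2_space measure"
  assumes lc: "lch TYPE('b)" and M: "radon_measure M" and N: "radon_measure N"
    and h: "\<And>i. i \<in> I \<Longrightarrow> lsc (h i)" and dir: "directed_fam I h"
  shows "(\<integral>\<^sup>+x. \<integral>\<^sup>+y. (SUP i\<in>I. h i (x, y)) \<partial>N \<partial>M) = (SUP i\<in>I. \<integral>\<^sup>+x. \<integral>\<^sup>+y. h i (x, y) \<partial>N \<partial>M)"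
proof -
  have "(\<integral>\<^sup>+x. \<integral>\<^sup>+y. (SUP i\<in>I. h i (x, y)) \<partial>N \<partial>M) = (\<integral>\<^sup>+x. (SUP i\<in>I. \<integral>\<^sup>+y. h i (x, y) \<partial>N) \<partial>M)"
  proof (rule nn_integral_cong)
    fix x
    show "(\<integral>\<^sup>+y. (SUP i\<in>I. h i (x, y)) \<partial>N) = (SUP i\<in>I. \<integral>\<^sup>+y. h i (x, y) \<partial>N)"
    proof (rule nn_integral_SUP_directed[OF N])
      show "directed_fam I (\<lambda>i y. h i (x, y))"
        by (rule directed_fam_mono[OF dir]) (rule le_funI, erule le_funD)
      show "lsc (\<lambda>y. h i (x, y))" if "i \<in> I" for i by (rule lsc_section[OF h[OF that]])
    qed
  qed
  also have "\<dots> = (SUP i\<in>I. \<integral>\<^sup>+x. \<integral>\<^sup>+y. h i (x, y) \<partial>N \<partial>M)"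
  proof (rule nn_integral_SUP_directed[OF M])
    show "lsc (\<lambda>x. \<integral>\<^sup>+y. h i (x, y) \<partial>N)" if "i \<in> I" for i
      by (rule lsc_nn_integral[OF lc N h[OF that]])
    show "directed_fam I (\<lambda>i x. \<integral>\<^sup>+y. h i (x, y) \<partial>N)"
      by (rule directed_fam_mono[OF dir]) (rule le_funI, rule nn_integral_mono, erule le_funD)
  qed
  finally show ?thesis .
qed

text \<open>Cutting both measures down to the finite rectangle makes them finite without changing the integrals.\<close>

lemma Tonelli_finite_rectangle:
  fixes M :: "'a measure" and N :: "'b measure"
  assumes h[measurable]: "h \<in> borel_measurable (M \<Otimes>\<^sub>M N)"
    and A[measurable]: "A \<in> sets M" "emeasure M A < \<infinity>" and B[measurable]: "B \<in> sets N" "emeasure N B < \<infinity>"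
    and supp: "\<And>x y. x \<notin> A \<or> y \<notin> B \<Longrightarrow> h (x, y) = 0"
  shows "(\<integral>\<^sup>+x. \<integral>\<^sup>+y. h (x, y) \<partial>N \<partial>M) = (\<integral>\<^sup>+y. \<integral>\<^sup>+x. h (x, y) \<partial>M \<partial>N)"
proof -
  define M' where "M' = density M (indicator A)"
  define N' where "N' = density N (indicator B)"
  have sets[measurable_cong]: "sets M' = sets M" "sets N' = sets N" by (auto simp: M'_def N'_def)
  have "emeasure M' (space M') = emeasure M A"
    unfolding M'_def by (subst emeasure_density) (auto intro!: nn_integral_cong simp flip: nn_integral_indicator)
  then interpret M': finite_measure M'
    using A by (intro finite_measureI) simp
  have "emeasure N' (space N') = emeasure N B"
    unfolding N'_def by (subst emeasure_density) (auto intro!: nn_integral_cong simp flip: nn_integral_indicator)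
  then interpret N': finite_measure N'
    using B by (intro finite_measureI) simp
  interpret MN: pair_sigma_finite M' N' ..
  have 1: "(\<integral>\<^sup>+y. h (x, y) \<partial>N') = (\<integral>\<^sup>+y. h (x, y) \<partial>N)" if "x \<in> space M" for x
    unfolding N'_def using that by (subst nn_integral_density) (auto intro!: nn_integral_cong simp: supp indicator_def)
  have 2: "(\<integral>\<^sup>+x. h (x, y) \<partial>M') = (\<integral>\<^sup>+x. h (x, y) \<partial>M)" if "y \<in> space N" for y
    unfolding M'_def using that by (subst nn_integral_density) (auto intro!: nn_integral_cong simp: supp indicator_def)
  have "(\<integral>\<^sup>+x. \<integral>\<^sup>+y. h (x, y) \<partial>N' \<partial>M') = (\<integral>\<^sup>+x. indicator A x * (\<integral>\<^sup>+y. h (x, y) \<partial>N') \<partial>M)"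
    unfolding M'_def by (subst nn_integral_density) auto
  also have "\<dots> = (\<integral>\<^sup>+x. \<integral>\<^sup>+y. h (x, y) \<partial>N \<partial>M)"
    by (intro nn_integral_cong) (auto simp: 1 indicator_def supp)
  finally have a: "(\<integral>\<^sup>+x. \<integral>\<^sup>+y. h (x, y) \<partial>N' \<partial>M') = (\<integral>\<^sup>+x. \<integral>\<^sup>+y. h (x, y) \<partial>N \<partial>M)" .
  have "(\<integral>\<^sup>+y. \<integral>\<^sup>+x. h (x, y) \<partial>M' \<partial>N') = (\<integral>\<^sup>+y. indicator B y * (\<integral>\<^sup>+x. h (x, y) \<partial>M') \<partial>N)"
    unfolding N'_def by (subst nn_integral_density) auto
  also have "\<dots> = (\<integral>\<^sup>+y. \<integral>\<^sup>+x. h (x, y) \<partial>M \<partial>N)"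
    by (intro nn_integral_cong) (auto simp: 2 indicator_def supp)
  finally have b: "(\<integral>\<^sup>+y. \<integral>\<^sup>+x. h (x, y) \<partial>M' \<partial>N') = (\<integral>\<^sup>+y. \<integral>\<^sup>+x. h (x, y) \<partial>M \<partial>N)" .
  have "(\<integral>\<^sup>+y. \<integral>\<^sup>+x. h (x, y) \<partial>M' \<partial>N') = (\<integral>\<^sup>+x. \<integral>\<^sup>+y. h (x, y) \<partial>N' \<partial>M')"
    by (rule MN.Fubini') simp
  then show ?thesis unfolding a b by simp
qed

text \<open>Tonelli's theorem without sigma-finiteness. A lower semicontinuous function on the product is the
  directed supremum of finite maxima of constants on open rectangles of finite measure; for such
  maxima the theorem for finite measures applies, and both iterated integrals commute with the supremum.\<close>

lemma Tonelli_lsc: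
  fixes M :: "'a::t2_space measure" and N :: "'b::t2_space measure"
  assumes lca: "lch TYPE('a)" and lcb: "lch TYPE('b)" and M: "radon_measure M" and N: "radon_measure N"
    and F: "lsc F"
  shows "(\<integral>\<^sup>+x. \<integral>\<^sup>+y. F (x, y) \<partial>N \<partial>M) = (\<integral>\<^sup>+y. \<integral>\<^sup>+x. F (x, y) \<partial>M \<partial>N)"
proof -
  define I where "I = {J :: (ennreal \<times> 'a set \<times> 'b set) set. finite J \<and> (\<forall>(c, A, B)\<in>J.
      open A \<and> open B \<and> emeasure M A < \<infinity> \<and> emeasure N B < \<infinity> \<and> (\<forall>x\<in>A. \<forall>y\<in>B. c \<le> F (x, y)))}"
  define g :: "ennreal \<times> 'a set \<times> 'b set \<Rightarrow> 'a \<times> 'b \<Rightarrow> ennreal"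
    where "g = (\<lambda>(c, A, B) (x, y). c * indicator A x * indicator B y)"
  define h where "h = (\<lambda>J p. SUP t\<in>J. g t p)"
  have fin_nbhd: "\<exists>A. open A \<and> x \<in> A \<and> emeasure P A < \<infinity>" if lc: "lch TYPE('c)" and P: "radon_measure (P::'c::t2_space measure)" for x P
  proof -
    obtain V L where "open V" "compact L" "{x} \<subseteq> V" "V \<subseteq> L" using lch_compact_nbhd[OF lc, of "{x}"] by auto
    moreover have "emeasure P V \<le> emeasure P L"
      using \<open>V \<subseteq> L\<close> \<open>compact L\<close> by (intro emeasure_mono) (auto simp: radon_sets[OF P] borel_compact)
    ultimately show ?thesis using radon_compact[OF P, of L] by (intro exI[of _ V]) auto
  qed
  have lg: "lsc (g (c, A, B))" if "open A" "open B" for c A B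
  proof -
    have "lsc (\<lambda>p. c * indicator A (fst p) * indicator B (snd p))"
      by (intro lsc_mult lsc_const lsc_compose[OF lsc_indicator] that continuous_intros)
    then show ?thesis by (simp add: g_def case_prod_beta')
  qed
  have lh: "lsc (h J)" if "J \<in> I" for J
    unfolding h_def using that lg by (intro lsc_SUP) (auto simp: I_def)
  have dir: "directed_fam I h"
    unfolding directed_fam_def
  proof (intro conjI ballI)
    show "I \<noteq> {}" by (auto simp: I_def intro!: exI[of _ "{}"])
    fix J K assume "J \<in> I" "K \<in> I"
    then have "J \<union> K \<in> I" by (auto simp: I_def)
    then show "\<exists>L\<in>I. h J \<le> h L \<and> h K \<le> h L"
      by (rule rev_bexI) (auto simp: h_def le_fun_def intro!: SUP_subset_mono)
  qed
  have sup: "(SUP J\<in>I. h J p) = F p" for p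
  proof (rule antisym)
    have "h J p \<le> F p" if "J \<in> I" for J
      unfolding h_def
    proof (rule SUP_least)
      fix t assume "t \<in> J"
      then show "g t p \<le> F p"
        using that by (cases t; cases p) (auto simp: I_def g_def indicator_def)
    qed
    then show "(SUP J\<in>I. h J p) \<le> F p" by (rule SUP_least)
    show "F p \<le> (SUP J\<in>I. h J p)"
    proof (rule dense_le)
      fix c assume c: "c < F p"
      obtain x y where p: "p = (x, y)" by (cases p)
      obtain A B where AB: "open A" "open B" "x \<in> A" "y \<in> B" "A \<times> B \<subseteq> {q. c < F q}"
      proof -
        have "p \<in> {q. c < F q}" using c by simp
        from open_prod_elim[OF lsc_open[OF F] this] obtain A B
          where "open A" "open B" "p \<in> A \<times> B" "A \<times> B \<subseteq> {q. c < F q}" by blast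
        then show thesis using that[of A B] unfolding p by blast
      qed
      obtain A' B' where AB': "open A'" "x \<in> A'" "emeasure M A' < \<infinity>" "open B'" "y \<in> B'" "emeasure N B' < \<infinity>"
        using fin_nbhd[OF lca M, of x] fin_nbhd[OF lcb N, of y] by blast
      have "{(c, A \<inter> A', B \<inter> B')} \<in> I"
      proof -
        have "emeasure M (A \<inter> A') \<le> emeasure M A'" "emeasure N (B \<inter> B') \<le> emeasure N B'"
          using AB' by (auto intro!: emeasure_mono simp: radon_sets[OF M] radon_sets[OF N])
        moreover have "c \<le> F (x, y)" if "x \<in> A" "y \<in> B" for x y
        proof -
          have "(x, y) \<in> {q. c < F q}" using AB(5) that by blast
          then show ?thesis by simp
        qed
        ultimately show ?thesis using AB AB' by (simp add: I_def open_Int le_less_trans)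
      qed
      moreover have "c \<le> h {(c, A \<inter> A', B \<inter> B')} p"
        using AB AB' by (simp add: h_def g_def p)
      ultimately show "c \<le> (SUP J\<in>I. h J p)" by (rule SUP_upper2)
    qed
  qed
  have ton: "(\<integral>\<^sup>+x. \<integral>\<^sup>+y. h J (x, y) \<partial>N \<partial>M) = (\<integral>\<^sup>+y. \<integral>\<^sup>+x. h J (x, y) \<partial>M \<partial>N)" if J: "J \<in> I" for J
  proof (rule Tonelli_finite_rectangle)
    let ?A = "\<Union>t\<in>J. fst (snd t)" and ?B = "\<Union>t\<in>J. snd (snd t)"
    have fin: "finite J" using J by (simp add: I_def)
    have o: "open (fst (snd t)) \<and> open (snd (snd t)) \<and> emeasure M (fst (snd t)) < \<infinity> \<and> emeasure N (snd (snd t)) < \<infinity>" if "t \<in> J" for t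
      using J that by (cases t) (auto simp: I_def)
    show "?A \<in> sets M" "?B \<in> sets N" using o by (auto simp: radon_sets[OF M] radon_sets[OF N] intro!: borel_open)
    show "emeasure M ?A < \<infinity>" "emeasure N ?B < \<infinity>"
    proof -
      have "emeasure M ?A \<le> (\<Sum>t\<in>J. emeasure M (fst (snd t)))" "emeasure N ?B \<le> (\<Sum>t\<in>J. emeasure N (snd (snd t)))"
        using o fin by (auto simp: radon_sets[OF M] radon_sets[OF N] intro!: emeasure_subadditive_finite borel_open)
      moreover have "(\<Sum>t\<in>J. emeasure M (fst (snd t))) < \<infinity>" "(\<Sum>t\<in>J. emeasure N (snd (snd t))) < \<infinity>"
        using o fin by (simp_all add: ennreal_sum_less_top)
      ultimately show "emeasure M ?A < \<infinity>" "emeasure N ?B < \<infinity>" by (auto intro: le_less_trans)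
    qed
    show "h J (x, y) = 0" if "x \<notin> ?A \<or> y \<notin> ?B" for x y
    proof -
      have "g t (x, y) = 0" if t: "t \<in> J" for t
      proof -
        have "x \<notin> fst (snd t) \<or> y \<notin> snd (snd t)" using t \<open>x \<notin> ?A \<or> y \<notin> ?B\<close> by blast
        then show ?thesis by (cases t) (auto simp: g_def indicator_def)
      qed
      then have "h J (x, y) \<le> 0" unfolding h_def by (intro SUP_least) simp
      then show ?thesis by simp
    qed
    show "h J \<in> borel_measurable (M \<Otimes>\<^sub>M N)"
      unfolding h_def
    proof (rule borel_measurable_SUP)
      fix t assume t: "t \<in> J"
      obtain c A B where [simp]: "t = (c, A, B)" by (cases t)
      have [measurable]: "A \<in> sets M" "B \<in> sets N"
        using o[OF t] by (auto simp: radon_sets[OF M] radon_sets[OF N])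
      show "g t \<in> borel_measurable (M \<Otimes>\<^sub>M N)"
        unfolding g_def by simp
    qed (use fin in \<open>simp add: countable_finite\<close>)
  qed
  define sw where "sw = (\<lambda>J (p::'b\<times>'a). h J (snd p, fst p))"
  have lsw: "lsc (sw J)" if "J \<in> I" for J
    unfolding sw_def by (rule lsc_compose[OF lh[OF that]]) (intro continuous_intros)
  have dsw: "directed_fam I sw"
    by (rule directed_fam_mono[OF dir]) (simp add: sw_def le_fun_def)
  have "(\<integral>\<^sup>+x. \<integral>\<^sup>+y. F (x, y) \<partial>N \<partial>M) = (SUP J\<in>I. \<integral>\<^sup>+x. \<integral>\<^sup>+y. h J (x, y) \<partial>N \<partial>M)"
    using iterated_integral_SUP_directed[OF lcb M N lh dir] by (simp add: sup)
  also have "\<dots> = (SUP J\<in>I. \<integral>\<^sup>+y. \<integral>\<^sup>+x. h J (x, y) \<partial>M \<partial>N)"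
    by (rule SUP_cong) (auto simp: ton)
  also have "\<dots> = (\<integral>\<^sup>+y. \<integral>\<^sup>+x. F (x, y) \<partial>M \<partial>N)"
    using iterated_integral_SUP_directed[OF lca N M lsw dsw] by (simp add: sup sw_def)
  finally show ?thesis .
qed

section \<open>Domination by lower semicontinuous functions\<close>

text \<open>\<open>F\<close> has lower semicontinuous majorants of almost the same integral, which is one half of the
  Vitali--Caratheodory theorem.\<close>

definition lsc_dominable :: "'a::t2_space measure \<Rightarrow> ('a \<Rightarrow> ennreal) \<Rightarrow> bool" where
  "lsc_dominable M F \<longleftrightarrow> (\<forall>e>0. \<exists>G. lsc G \<and> F \<le> G \<and> (\<integral>\<^sup>+x. G x \<partial>M) \<le> (\<integral>\<^sup>+x. F x \<partial>M) + ennreal e)"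

lemma lsc_dominable_suminf:
  fixes u :: "nat \<Rightarrow> 'a::t2_space \<Rightarrow> ennreal"
  assumes M: "sets M = sets borel" and u: "\<And>n. lsc_dominable M (u n)" and [measurable]: "\<And>n. u n \<in> borel_measurable M"
  shows "lsc_dominable M (\<lambda>x. \<Sum>n. u n x)"
  unfolding lsc_dominable_def
proof (intro allI impI)
  fix e :: real assume e: "0 < e"
  have "\<forall>n. \<exists>G. lsc G \<and> u n \<le> G \<and> (\<integral>\<^sup>+x. G x \<partial>M) \<le> (\<integral>\<^sup>+x. u n x \<partial>M) + ennreal (e * (1/2)^Suc n)"
    using u e unfolding lsc_dominable_def by simp
  then obtain G where G: "\<And>n. lsc (G n)" "\<And>n. u n \<le> G n"
    "\<And>n. (\<integral>\<^sup>+x. G n x \<partial>M) \<le> (\<integral>\<^sup>+x. u n x \<partial>M) + ennreal (e * (1/2)^Suc n)" by metis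
  have [measurable]: "G n \<in> borel_measurable M" for n by (rule lsc_measurable[OF G(1) M])
  show "\<exists>G. lsc G \<and> (\<lambda>x. \<Sum>n. u n x) \<le> G \<and> (\<integral>\<^sup>+x. G x \<partial>M) \<le> (\<integral>\<^sup>+x. (\<Sum>n. u n x) \<partial>M) + ennreal e"
  proof (intro exI conjI)
    show "lsc (\<lambda>x. \<Sum>n. G n x)"
      unfolding suminf_eq_SUP by (intro lsc_SUP lsc_sum G)
    show "(\<lambda>x. \<Sum>n. u n x) \<le> (\<lambda>x. \<Sum>n. G n x)"
      using G(2) by (auto simp: le_fun_def intro!: suminf_le)
    have geo: "(\<lambda>n. e * (1/2)^Suc n) sums e"
      using sums_mult[OF power_half_series, of e] by simp
    have "(\<integral>\<^sup>+x. (\<Sum>n. G n x) \<partial>M) = (\<Sum>n. \<integral>\<^sup>+x. G n x \<partial>M)" by (rule nn_integral_suminf) simp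
    also have "\<dots> \<le> (\<Sum>n. (\<integral>\<^sup>+x. u n x \<partial>M) + ennreal (e * (1/2)^Suc n))"
      by (intro suminf_le G) auto
    also have "\<dots> = (\<Sum>n. \<integral>\<^sup>+x. u n x \<partial>M) + (\<Sum>n. ennreal (e * (1/2)^Suc n))"
      by (rule suminf_add[symmetric]) auto
    also have "(\<Sum>n. ennreal (e * (1/2)^Suc n)) = ennreal e"
      using geo e by (subst suminf_ennreal2) (auto simp: sums_iff)
    also have "(\<Sum>n. \<integral>\<^sup>+x. u n x \<partial>M) = (\<integral>\<^sup>+x. (\<Sum>n. u n x) \<partial>M)" by (rule nn_integral_suminf[symmetric]) simp
    finally show "(\<integral>\<^sup>+x. (\<Sum>n. G n x) \<partial>M) \<le> (\<integral>\<^sup>+x. (\<Sum>n. u n x) \<partial>M) + ennreal e" .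
  qed
qed

lemma lsc_dominable_infinite: "(\<integral>\<^sup>+x. F x \<partial>M) = \<infinity> \<Longrightarrow> lsc_dominable M F"
  unfolding lsc_dominable_def by (auto intro!: exI[of _ "\<lambda>_. top"] lsc_const simp: le_fun_def)

lemma lsc_dominable_indicator:
  assumes M: "radon_measure M" and A: "A \<in> sets M"
  shows "lsc_dominable M (indicator A)"
proof (cases "emeasure M A = \<infinity>")
  case True then show ?thesis using A by (intro lsc_dominable_infinite) simp
next
  case False
  have A': "A \<in> sets borel" using A radon_sets[OF M] by simp
  show ?thesis
    unfolding lsc_dominable_def
  proof (intro allI impI)
    fix e :: real assume "0 < e"
    then have "emeasure M A < emeasure M A + ennreal e"
      using False by (cases "emeasure M A") (auto simp: ennreal_plus[symmetric] ennreal_less_iff simp del: ennreal_plus)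
    then obtain U where U: "open U" "A \<subseteq> U" "emeasure M U < emeasure M A + ennreal e"
      using radon_outer[OF M A'] by (auto simp: INF_less_iff)
    show "\<exists>G. lsc G \<and> indicator A \<le> G \<and> integral\<^sup>N M G \<le> integral\<^sup>N M (indicator A) + ennreal e"
    proof (intro exI conjI)
      show "lsc (indicator U)" using U(1) by (rule lsc_indicator)
      show "(indicator A :: 'a \<Rightarrow> ennreal) \<le> indicator U" using U(2) by (auto simp: le_fun_def indicator_def)
      have "U \<in> sets M" using U(1) by (simp add: radon_sets[OF M])
      then show "integral\<^sup>N M (indicator U) \<le> integral\<^sup>N M (indicator A) + ennreal e"
        using U(3) A by simp
    qed
  qed
qed

text \<open>The infinite constant is the sum of countably many copies of \<open>u\<close>.\<close>

lemma lsc_dominable_cmult: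
  assumes M: "sets M = sets borel" and u: "lsc_dominable M u" and [measurable]: "u \<in> borel_measurable M"
  shows "lsc_dominable M (\<lambda>x. c * u x)"
proof (cases c)
  case top
  have "(\<Sum>n::nat. u x) = c * u x" for x
  proof -
    have "(\<Sum>n::nat. (1::ennreal)) = top"
      unfolding suminf_eq_SUP by (simp add: ennreal_SUP_of_nat_eq_top)
    then show ?thesis using ennreal_suminf_cmult[of "u x" "\<lambda>_. 1"] top by (simp add: mult.commute)
  qed
  then show ?thesis
    using lsc_dominable_suminf[OF M, of "\<lambda>_. u"] u by simp
next
  case (real r)
  show ?thesis
  proof (cases "r = 0")
    case True
    then show ?thesis
      using real unfolding lsc_dominable_def by (auto intro!: exI[of _ "\<lambda>_. 0"] lsc_const)
  next
    case False
    then have r: "0 < r" using real by simp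
    show ?thesis
      unfolding lsc_dominable_def
    proof (intro allI impI)
      fix e :: real assume "0 < e"
      then have "0 < e / r" using r by simp
      then obtain G where G: "lsc G" "u \<le> G" "(\<integral>\<^sup>+x. G x \<partial>M) \<le> (\<integral>\<^sup>+x. u x \<partial>M) + ennreal (e/r)"
        using u unfolding lsc_dominable_def by blast
      have [measurable]: "G \<in> borel_measurable M" by (rule lsc_measurable[OF G(1) M])
      show "\<exists>G. lsc G \<and> (\<lambda>x. c * u x) \<le> G \<and> (\<integral>\<^sup>+x. G x \<partial>M) \<le> (\<integral>\<^sup>+x. c * u x \<partial>M) + ennreal e"
      proof (intro exI conjI)
        show "lsc (\<lambda>x. c * G x)" by (intro lsc_mult lsc_const G)
        show "(\<lambda>x. c * u x) \<le> (\<lambda>x. c * G x)" using G(2) by (auto simp: le_fun_def intro!: mult_left_mono)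
        have "(\<integral>\<^sup>+x. c * G x \<partial>M) = c * (\<integral>\<^sup>+x. G x \<partial>M)" by (rule nn_integral_cmult) simp
        also have "\<dots> \<le> c * ((\<integral>\<^sup>+x. u x \<partial>M) + ennreal (e/r))" by (intro mult_left_mono G) simp
        also have "\<dots> = (\<integral>\<^sup>+x. c * u x \<partial>M) + ennreal e"
          using r \<open>0 < e\<close> real by (simp add: distrib_left nn_integral_cmult ennreal_mult[symmetric])
        finally show "(\<integral>\<^sup>+x. c * G x \<partial>M) \<le> (\<integral>\<^sup>+x. c * u x \<partial>M) + ennreal e" .
      qed
    qed
  qed
qed

lemma lsc_dominable_add:
  assumes M: "sets M = sets borel" and u: "lsc_dominable M u" "u \<in> borel_measurable M" and v: "lsc_dominable M v" "v \<in> borel_measurable M"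
  shows "lsc_dominable M (\<lambda>x. u x + v x)"
  unfolding lsc_dominable_def
proof (intro allI impI)
  note [measurable] = u(2) v(2)
  fix e :: real assume e: "0 < e"
  then have "0 < e / 2" by simp
  then obtain F G where F: "lsc F" "u \<le> F" "(\<integral>\<^sup>+x. F x \<partial>M) \<le> (\<integral>\<^sup>+x. u x \<partial>M) + ennreal (e/2)"
    and G: "lsc G" "v \<le> G" "(\<integral>\<^sup>+x. G x \<partial>M) \<le> (\<integral>\<^sup>+x. v x \<partial>M) + ennreal (e/2)"
    using u(1) v(1) unfolding lsc_dominable_def by meson
  have [measurable]: "F \<in> borel_measurable M" "G \<in> borel_measurable M"
    by (rule lsc_measurable[OF F(1) M], rule lsc_measurable[OF G(1) M])
  show "\<exists>G. lsc G \<and> (\<lambda>x. u x + v x) \<le> G \<and> (\<integral>\<^sup>+x. G x \<partial>M) \<le> (\<integral>\<^sup>+x. u x + v x \<partial>M) + ennreal e"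
  proof (intro exI conjI)
    show "lsc (\<lambda>x. F x + G x)" by (intro lsc_add F G)
    show "(\<lambda>x. u x + v x) \<le> (\<lambda>x. F x + G x)" using F(2) G(2) by (auto simp: le_fun_def intro!: add_mono)
    have "(\<integral>\<^sup>+x. F x + G x \<partial>M) = (\<integral>\<^sup>+x. F x \<partial>M) + (\<integral>\<^sup>+x. G x \<partial>M)" by (rule nn_integral_add) simp_all
    also have "\<dots> \<le> ((\<integral>\<^sup>+x. u x \<partial>M) + ennreal (e/2)) + ((\<integral>\<^sup>+x. v x \<partial>M) + ennreal (e/2))"
      by (intro add_mono F G)
    also have "\<dots> = (\<integral>\<^sup>+x. u x \<partial>M) + (\<integral>\<^sup>+x. v x \<partial>M) + (ennreal (e/2) + ennreal (e/2))"
      by (simp add: ac_simps)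
    also have "ennreal (e/2) + ennreal (e/2) = ennreal e" using e by (subst ennreal_plus[symmetric]) auto
    also have "(\<integral>\<^sup>+x. u x \<partial>M) + (\<integral>\<^sup>+x. v x \<partial>M) = (\<integral>\<^sup>+x. u x + v x \<partial>M)" by (rule nn_integral_add[symmetric]) simp_all
    finally show "(\<integral>\<^sup>+x. F x + G x \<partial>M) \<le> (\<integral>\<^sup>+x. u x + v x \<partial>M) + ennreal e" .
  qed
qed

lemma lsc_dominable_simple:
  assumes M: "radon_measure M" and u: "simple_function M u"
  shows "lsc_dominable M u"
proof -
  have *: "(\<lambda>x. \<Sum>y\<in>S. y * indicator (u -` {y} \<inter> space M) x) \<in> borel_measurable M \<and>
     lsc_dominable M (\<lambda>x. \<Sum>y\<in>S. y * indicator (u -` {y} \<inter> space M) x)" if "finite S" for S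
    using that
  proof (induction S)
    case empty
    then show ?case by (auto simp: lsc_dominable_def intro!: exI[of _ "\<lambda>_. 0"] lsc_const)
  next
    case (insert y S)
    have A: "u -` {y} \<inter> space M \<in> sets M" using u by (rule simple_functionD(2))
    then have "(\<lambda>x. y * indicator (u -` {y} \<inter> space M) x) \<in> borel_measurable M" by simp
    moreover have "lsc_dominable M (\<lambda>x. y * indicator (u -` {y} \<inter> space M) x)"
      using A by (intro lsc_dominable_cmult[OF radon_sets[OF M] lsc_dominable_indicator[OF M]]) auto
    ultimately show ?case
      using insert.IH unfolding sum.insert[OF insert.hyps]
      by (intro conjI borel_measurable_add lsc_dominable_add[OF radon_sets[OF M]]) simp_all
  qed
  have eq: "u = (\<lambda>x. \<Sum>y\<in>u ` space M. y * indicator (u -` {y} \<inter> space M) x)"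
    by (rule ext) (rule simple_function_indicator_representation[OF u], simp add: radon_space[OF M])
  show ?thesis by (subst eq) (rule conjunct2[OF *[OF simple_functionD(1)[OF u]]])
qed

text \<open>Outer regularity is the case of indicator functions. A nonnegative measurable function is a countable
  sum of nonnegative simple functions, whose majorants may be summed with errors \<open>e/2, e/4, ...\<close>.\<close>

lemma lsc_dominable_measurable:
  assumes M: "radon_measure M" and F: "F \<in> borel_measurable M"
  shows "lsc_dominable M F"
proof -
  obtain f where f': "incseq f" "\<forall>i. (\<forall>x. f i x < top) \<and> simple_function M (f i)" "F = (SUP i. f i)"
    using borel_measurable_implies_simple_function_sequence[OF F] by blast
  then have f: "\<And>i. simple_function M (f i)" "incseq f" "\<And>x. (SUP i. f i x) = F x"
    by (simp_all add: image_comp)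
  define d where "d = (\<lambda>n x. case n of 0 \<Rightarrow> f 0 x | Suc k \<Rightarrow> f (Suc k) x - f k x)"
  have mono: "f k x \<le> f (Suc k) x" for k x using incseq_SucD[OF f(2)] by (auto simp: le_fun_def)
  have part: "(\<Sum>i<Suc n. d i x) = f n x" for n x
  proof (induction n)
    case (Suc n)
    have "(\<Sum>i<Suc (Suc n). d i x) = f n x + (f (Suc n) x - f n x)" using Suc by (simp add: d_def)
    also have "\<dots> = f (Suc n) x" using mono by (rule add_diff_inverse_ennreal)
    finally show ?case .
  qed (simp add: d_def)
  have "(\<Sum>n. d n x) = F x" for x
  proof -
    have "(\<lambda>n. \<Sum>i<Suc n. d i x) \<longlonglongrightarrow> (\<Sum>n. d n x)"
      using summable_LIMSEQ[of "\<lambda>n. d n x"] by (intro LIMSEQ_Suc) simp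
    moreover have "(\<lambda>n. f n x) \<longlonglongrightarrow> F x"
      using LIMSEQ_SUP[of "\<lambda>n. f n x"] f(2,3) by (simp add: incseq_def le_fun_def)
    ultimately show ?thesis unfolding part by (rule LIMSEQ_unique)
  qed
  moreover have sd: "simple_function M (d n)" for n
    unfolding d_def using f(1) by (cases n) auto
  ultimately show ?thesis
    using lsc_dominable_suminf[OF radon_sets[OF M], of d] lsc_dominable_simple[OF M sd]
    by (simp add: borel_measurable_simple_function)
qed

section \<open>Test functions and bounded continuous functions\<close>

text \<open>Reduces linear identities between integrals of complex functions to nonnegative ones. The positive
  and negative parts of real and imaginary part appear as \<open>h \<circ> f\<close> with \<open>h\<close> continuous and bounded by the
  modulus, so continuity, boundedness and compact support of \<open>f\<close> are inherited.\<close>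

lemma complex_parts_induct:
  fixes f :: "'a \<Rightarrow> complex"
  assumes pos: "\<And>h. continuous_on UNIV h \<Longrightarrow> (\<And>z. 0 \<le> h z \<and> h z \<le> cmod z) \<Longrightarrow> P (\<lambda>x. complex_of_real (h (f x)))"
    and add: "\<And>f g. P f \<Longrightarrow> P g \<Longrightarrow> P (\<lambda>x. f x + g x)"
    and scale: "\<And>c f. P f \<Longrightarrow> P (\<lambda>x. c * f x)"
  shows "P f"
proof -
  have re: "\<bar>Re z\<bar> \<le> cmod z" and im: "\<bar>Im z\<bar> \<le> cmod z" for z by (rule abs_Re_le_cmod, rule abs_Im_le_cmod)
  have P1: "P (\<lambda>x. complex_of_real (max 0 (Re (f x))))"
    by (rule pos[of "\<lambda>z. max 0 (Re z)"]) (use re in \<open>auto intro!: continuous_intros simp: abs_le_iff\<close>)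
  have P2: "P (\<lambda>x. complex_of_real (max 0 (- Re (f x))))"
    by (rule pos[of "\<lambda>z. max 0 (- Re z)"]) (use re in \<open>auto intro!: continuous_intros simp: abs_le_iff\<close>)
  have P3: "P (\<lambda>x. complex_of_real (max 0 (Im (f x))))"
    by (rule pos[of "\<lambda>z. max 0 (Im z)"]) (use im in \<open>auto intro!: continuous_intros simp: abs_le_iff\<close>)
  have P4: "P (\<lambda>x. complex_of_real (max 0 (- Im (f x))))"
    by (rule pos[of "\<lambda>z. max 0 (- Im z)"]) (use im in \<open>auto intro!: continuous_intros simp: abs_le_iff\<close>)
  have "P (\<lambda>x. (complex_of_real (max 0 (Re (f x))) + (-1) * complex_of_real (max 0 (- Re (f x)))) +
     \<i> * (complex_of_real (max 0 (Im (f x))) + (-1) * complex_of_real (max 0 (- Im (f x)))))"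
    by (intro add scale P1 P2 P3 P4)
  also have "(\<lambda>x. (complex_of_real (max 0 (Re (f x))) + (-1) * complex_of_real (max 0 (- Re (f x)))) +
     \<i> * (complex_of_real (max 0 (Im (f x))) + (-1) * complex_of_real (max 0 (- Im (f x))))) = f"
    by (rule ext, rule complex_eqI) (simp_all add: max_def)
  finally show ?thesis .
qed

definition Cb :: "('a::topological_space \<Rightarrow> complex) set" where
  "Cb = {f. continuous_on UNIV f \<and> bounded (range f)}"

lemma CbI: "continuous_on UNIV f \<Longrightarrow> (\<And>x. cmod (f x) \<le> B) \<Longrightarrow> f \<in> Cb"
  unfolding Cb_def bounded_iff by auto

lemma Cb_cont: "f \<in> Cb \<Longrightarrow> continuous_on UNIV f" by (simp add: Cb_def)

lemma Cb_bound: "f \<in> Cb \<Longrightarrow> \<exists>B>0. \<forall>x. cmod (f x) \<le> B"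
  by (auto simp: Cb_def bounded_pos)

lemma Cb_measurable: "f \<in> Cb \<Longrightarrow> sets M = sets borel \<Longrightarrow> f \<in> borel_measurable M"
  using borel_measurable_continuous_onI[of f] measurable_cong_sets[of M borel borel borel] by (auto simp: Cb_def)

lemma Cb_add: assumes "f \<in> Cb" "g \<in> Cb" shows "(\<lambda>x. f x + g x) \<in> Cb"
proof -
  obtain A where A: "\<And>x. cmod (f x) \<le> A" using Cb_bound[OF assms(1)] by blast
  obtain B where B: "\<And>x. cmod (g x) \<le> B" using Cb_bound[OF assms(2)] by blast
  show ?thesis
    by (rule CbI[where B = "A + B"]) (auto intro!: continuous_intros Cb_cont[OF assms(1)] Cb_cont[OF assms(2)] norm_triangle_mono A B)
qed

lemma Cb_mult: assumes "f \<in> Cb" "g \<in> Cb" shows "(\<lambda>x. f x * g x) \<in> Cb"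
proof -
  obtain A where A: "0 < A" "\<And>x. cmod (f x) \<le> A" using Cb_bound[OF assms(1)] by blast
  obtain B where B: "0 < B" "\<And>x. cmod (g x) \<le> B" using Cb_bound[OF assms(2)] by blast
  show ?thesis
    using A B by (intro CbI[where B = "A * B"]) (auto intro!: continuous_intros Cb_cont[OF assms(1)] Cb_cont[OF assms(2)] mult_mono simp: norm_mult)
qed

lemma Cb_const: "(\<lambda>x. c) \<in> Cb"
  by (rule CbI[where B = "cmod c"]) auto

lemma Cb_cmult: "f \<in> Cb \<Longrightarrow> (\<lambda>x. c * f x) \<in> Cb"
  by (rule Cb_mult[OF Cb_const])

lemma Cb_diff: "f \<in> Cb \<Longrightarrow> g \<in> Cb \<Longrightarrow> (\<lambda>x. f x - g x) \<in> Cb"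
  using Cb_add[of f "\<lambda>x. -1 * g x"] Cb_cmult[of g "-1"] by simp

lemma Cb_compose: "f \<in> Cb \<Longrightarrow> continuous_on UNIV g \<Longrightarrow> (\<lambda>x. f (g x)) \<in> Cb"
proof -
  assume f: "f \<in> Cb" and g: "continuous_on UNIV g"
  obtain B where B: "\<And>x. cmod (f x) \<le> B" using Cb_bound[OF f] by blast
  show ?thesis
    by (rule CbI[where B = B]) (auto intro!: B continuous_on_compose2[OF Cb_cont[OF f] g])
qed

lemma Cb_section: "K \<in> Cb \<Longrightarrow> (\<lambda>y. K (x, y)) \<in> Cb" and Cb_section': "K \<in> Cb \<Longrightarrow> (\<lambda>x. K (x, y)) \<in> Cb"
  by (erule Cb_compose, intro continuous_intros)+

lemma Cb_swap: "K \<in> Cb \<Longrightarrow> (\<lambda>(y, x). K (x, y)) \<in> Cb"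
  using Cb_compose[of K "\<lambda>p. (snd p, fst p)"] by (simp add: case_prod_beta' continuous_on_Pair continuous_on_fst continuous_on_snd continuous_on_id)

lemma Ccp_Cc: "\<phi> \<in> Ccp \<Longrightarrow> (\<lambda>x. complex_of_real (\<phi> x)) \<in> Cc"
  by (auto simp: Ccp_def Cc_def intro!: continuous_intros)

lemma Cc_Ccp:
  assumes "f \<in> Cc" and h: "continuous_on UNIV h" "\<And>z. 0 \<le> h z \<and> h z \<le> cmod z"
  shows "(\<lambda>x. h (f x)) \<in> Ccp"
proof -
  obtain K where K: "compact K" "\<And>x. x \<notin> K \<Longrightarrow> f x = 0" and c: "continuous_on UNIV f"
    using assms(1) by (auto simp: Cc_def)
  have "h 0 = 0" using h(2)[of 0] by simp
  then show ?thesis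
    using K h continuous_on_compose2[OF h(1) c] by (auto simp: Ccp_def intro!: exI[of _ K])
qed

lemma Cc_cont: "f \<in> Cc \<Longrightarrow> continuous_on UNIV f" by (simp add: Cc_def)

lemma Cc_Cb: assumes "f \<in> Cc" shows "f \<in> Cb"
proof -
  have "(\<lambda>x. cmod (f x)) \<in> Ccp" using assms by (rule Cc_Ccp) (auto intro!: continuous_intros)
  then obtain B where "\<And>x. cmod (f x) \<le> B" using Ccp_bounded by metis 
  then show ?thesis using Cc_cont[OF assms] by (intro CbI)
qed

lemma Cc_add: "f \<in> Cc \<Longrightarrow> g \<in> Cc \<Longrightarrow> (\<lambda>x. f x + g x) \<in> Cc"
  unfolding Cc_def
proof safe
  fix K L assume "compact K" "\<forall>x. x \<notin> K \<longrightarrow> f x = 0" "compact L" "\<forall>x. x \<notin> L \<longrightarrow> g x = 0"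
  then show "\<exists>K. compact K \<and> (\<forall>x. x \<notin> K \<longrightarrow> f x + g x = 0)"
    by (intro exI[of _ "K \<union> L"]) (auto simp: compact_Un)
qed (auto intro!: continuous_on_add)

lemma Cc_cmult: "f \<in> Cc \<Longrightarrow> (\<lambda>x. c * f x) \<in> Cc"
  unfolding Cc_def by (auto intro!: continuous_on_mult_left)

lemma Cc_cnj: "f \<in> Cc \<Longrightarrow> (\<lambda>x. cnj (f x)) \<in> Cc"
  unfolding Cc_def by (auto intro!: continuous_intros)

lemma Cc_integrable:
  assumes M: "radon_measure M" and f: "f \<in> Cc"
  shows "integrable M f"
proof -
  obtain K where K: "compact K" "\<And>x. x \<notin> K \<Longrightarrow> f x = 0" using f by (auto simp: Cc_def)
  obtain B where B: "\<And>x. cmod (f x) \<le> B" using Cb_bound[OF Cc_Cb[OF f]] by blast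
  show ?thesis
    using K B radon_compact[OF M K(1)] Cb_measurable[OF Cc_Cb[OF f] radon_sets[OF M]]
    by (intro integrableI_bounded_set[where A = K and B = B]) (auto simp: radon_sets[OF M] borel_compact)
qed

lemma Ccp_integrable: "radon_measure M \<Longrightarrow> \<phi> \<in> Ccp \<Longrightarrow> integrable M \<phi>"
  using Cc_integrable[OF _ Ccp_Cc, of M \<phi>] by (simp add: complex_of_real_integrable_eq)

lemma integrable_mult_Cb:
  assumes M: "radon_measure M" and b: "integrable M b" and u: "u \<in> Cb"
  shows "integrable M (\<lambda>x. b x * u x)"
proof -
  obtain B where B: "0 < B" "\<And>x. cmod (u x) \<le> B" using Cb_bound[OF u] by blast
  have [measurable]: "u \<in> borel_measurable M" "b \<in> borel_measurable M"
    using Cb_measurable[OF u radon_sets[OF M]] b by auto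
  show ?thesis
  proof (rule Bochner_Integration.integrable_bound[where f = "\<lambda>x. B * cmod (b x)"])
    show "AE x in M. norm (b x * u x) \<le> norm (B * cmod (b x))"
    proof (rule AE_I2)
      fix x show "norm (b x * u x) \<le> norm (B * cmod (b x))"
        using mult_right_mono[OF B(2)[of x] norm_ge_zero[of "b x"]] B(1) by (simp add: norm_mult mult.commute)
    qed
  qed (use b in auto)
qed

text \<open>If the product is not integrable, its Bochner integral is zero.\<close>

lemma integral_mult_bound:
  assumes M: "radon_measure M" and b: "integrable M b" and B: "\<And>x. cmod (u x) \<le> B"
  shows "cmod (LINT x|M. b x * u x) \<le> B * (LINT x|M. cmod (b x))"
proof -
  have "0 \<le> B" using B[of undefined] norm_ge_zero order_trans by blast
  show ?thesis
  proof (cases "integrable M (\<lambda>x. b x * u x)")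
    case True
    have "cmod (LINT x|M. b x * u x) \<le> (LINT x|M. cmod (b x * u x))" by simp
    also have "\<dots> \<le> (LINT x|M. B * cmod (b x))"
    proof (rule integral_mono)
      show "integrable M (\<lambda>x. cmod (b x * u x))" by (rule integrable_norm[OF True])
      show "integrable M (\<lambda>x. B * cmod (b x))" using b by simp
      show "cmod (b x * u x) \<le> B * cmod (b x)" for x
        using mult_right_mono[OF B[of x] norm_ge_zero[of "b x"]] by (simp add: norm_mult mult.commute)
    qed
    finally show ?thesis by simp
  next
    case False
    then show ?thesis using \<open>0 \<le> B\<close> by (simp add: not_integrable_integral_eq)
  qed
qed

text \<open>Between a compact and an open set that approximate \<open>A\<close> in measure from either side, Urysohn's lemma
  provides \<open>\<phi>\<close>; the difference is supported in the two small remainders.\<close>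

lemma Ccp_approx_indicator:
  assumes lc: "lch TYPE('a::t2_space)" and M: "radon_measure (M::'a measure)" 
    and A: "A \<in> sets M" "emeasure M A < \<infinity>" and e: "0 < e"
  obtains \<phi> where "\<phi> \<in> Ccp" "(LINT x|M. \<bar>indicator A x - \<phi> x\<bar>) < e"
proof -
  have A': "A \<in> sets borel" using A radon_sets[OF M] by simp
  have lt: "t < t + ennreal (e/2)" if "t < \<infinity>" for t
    using that e by (cases t) (auto simp: ennreal_plus[symmetric] ennreal_less_iff simp del: ennreal_plus)
  obtain U where U: "open U" "A \<subseteq> U" "emeasure M U < emeasure M A + ennreal (e/2)"
    using radon_outer[OF M A'] lt[OF A(2)] by (auto simp: INF_less_iff)
  have Us: "U \<in> sets M" using U by (simp add: radon_sets[OF M])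
  have Ufin: "emeasure M U < \<infinity>" using U(3) A(2) by (auto intro: less_trans)
  have "\<exists>K. compact K \<and> K \<subseteq> U \<and> emeasure M U < emeasure M K + ennreal (e/2)"
  proof (cases "emeasure M U = 0")
    case True then show ?thesis using e by (intro exI[of _ "{}"]) auto
  next
    case False
    have "emeasure M U - ennreal (e/2) < emeasure M U"
      using False Ufin e by (intro ennreal_between) (auto simp: zero_less_iff_neq_zero)
    then have "emeasure M U - ennreal (e/2) < (SUP K\<in>{K. compact K \<and> K \<subseteq> U}. emeasure M K)"
      by (subst (asm) (2) radon_inner[OF M U(1)])
    then obtain K where K: "compact K" "K \<subseteq> U" "emeasure M U - ennreal (e/2) < emeasure M K"
      unfolding less_SUP_iff by blast
    have "emeasure M U < emeasure M K + ennreal (e/2)"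
    proof (cases "ennreal (e/2) \<le> emeasure M U")
      case True
      then show ?thesis using K(3) by (simp add: minus_less_iff_ennreal)
    next
      case False
      then have "emeasure M U < ennreal (e/2)" by simp
      also have "\<dots> \<le> emeasure M K + ennreal (e/2)" by simp
      finally show ?thesis .
    qed
    then show ?thesis using K by blast
  qed
  then obtain K where K: "compact K" "K \<subseteq> U" "emeasure M U < emeasure M K + ennreal (e/2)" by blast
  have Ks: "K \<in> sets M" using K by (simp add: radon_sets[OF M] borel_compact)
  obtain \<phi> where \<phi>: "\<phi> \<in> Ccp" "\<And>x. \<phi> x \<le> 1" "\<And>x. x \<in> K \<Longrightarrow> \<phi> x = 1" "\<And>x. x \<notin> U \<Longrightarrow> \<phi> x = 0"
    using Urysohn_Ccp[OF lc K(1) U(1) K(2)] by metis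
  have Kfin: "emeasure M K < \<infinity>" by (rule radon_compact[OF M K(1)])
  have mA: "measure M (U - A) < e/2"
  proof -
    have "measure M (U - A) = measure M U - measure M A" using U A Us Ufin by (intro measure_Diff) auto
    moreover have "measure M U < measure M A + e/2"
      using U(3) A(2) Ufin e by (simp add: emeasure_eq_ennreal_measure ennreal_plus[symmetric] ennreal_less_iff del: ennreal_plus)
    ultimately show ?thesis by simp
  qed
  have mK: "measure M (U - K) < e/2"
  proof -
    have "measure M (U - K) = measure M U - measure M K" using K Ks Us Ufin by (intro measure_Diff) auto
    moreover have "measure M U < measure M K + e/2"
      using K(3) Kfin Ufin e by (simp add: emeasure_eq_ennreal_measure ennreal_plus[symmetric] ennreal_less_iff del: ennreal_plus)
    ultimately show ?thesis by simp
  qed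
  have fin: "emeasure M (U - A) < \<infinity>" "emeasure M (U - K) < \<infinity>"
    using Ufin Us by (auto intro: le_less_trans[OF emeasure_mono])
  have "(LINT x|M. \<bar>indicator A x - \<phi> x\<bar>) \<le> (LINT x|M. indicator (U - A) x + indicator (U - K) x)"
  proof (rule integral_mono)
    show "integrable M (\<lambda>x. \<bar>indicator A x - \<phi> x\<bar>)"
      using A Ccp_integrable[OF M \<phi>(1)] by (intro integrable_abs Bochner_Integration.integrable_diff) (auto simp: integrable_indicator_iff)
    show "integrable M (\<lambda>x. indicator (U - A) x + indicator (U - K) x :: real)"
      using fin A Us Ks by (intro Bochner_Integration.integrable_add) (auto simp: integrable_indicator_iff)
    fix x show "\<bar>indicator A x - \<phi> x\<bar> \<le> (indicator (U - A) x + indicator (U - K) x :: real)"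
      using U(2) \<phi>(2)[of x] \<phi>(3)[of x] \<phi>(4)[of x] CcpD(2)[OF \<phi>(1), of x] by (auto simp: indicator_def)
  qed
  also have "\<dots> = measure M (U - A) + measure M (U - K)"
    using fin A Us Ks by (subst Bochner_Integration.integral_add) (auto simp: integrable_indicator_iff)
  finally have "(LINT x|M. \<bar>indicator A x - \<phi> x\<bar>) < e" using mA mK by simp
  with \<phi>(1) show thesis by (rule that)
qed

lemma Cc_dense_L1:
  fixes f :: "'a::t2_space \<Rightarrow> complex"
  assumes lc: "lch TYPE('a)" and M: "radon_measure M" and f: "integrable M f" and e: "0 < e"
  obtains g where "g \<in> Cc" "(LINT x|M. cmod (f x - g x)) < e"
proof -
  have "\<forall>e>0. \<exists>g\<in>Cc. (LINT x|M. cmod (f x - g x)) < e"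
    using f
  proof (induction f rule: integrable_induct)
    case (base A c)
    show ?case
    proof (intro allI impI)
      fix e :: real assume e: "0 < e"
      define d where "d = e / (cmod c + 1)"
      have d: "0 < d" "cmod c * d < e" using e by (auto simp: d_def field_simps add_pos_nonneg)
      obtain \<phi> where \<phi>: "\<phi> \<in> Ccp" "(LINT x|M. \<bar>indicator A x - \<phi> x\<bar>) < d"
        using Ccp_approx_indicator[OF lc M base d(1)] .
      have "cmod (indicator A x *\<^sub>R c - c * complex_of_real (\<phi> x)) = cmod c * \<bar>indicator A x - \<phi> x\<bar>" for x
        by (metis (no_types, opaque_lifting) abs_of_nonneg mult.commute norm_ge_zero norm_mult norm_of_real of_real_diff right_diff_distrib scaleR_conv_of_real)
      then have "(LINT x|M. cmod (indicator A x *\<^sub>R c - c * complex_of_real (\<phi> x))) = cmod c * (LINT x|M. \<bar>indicator A x - \<phi> x\<bar>)"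
        by simp
      also have "\<dots> \<le> cmod c * d" using \<phi>(2) by (intro mult_left_mono) auto
      finally show "\<exists>g\<in>Cc. (LINT x|M. cmod (indicator A x *\<^sub>R c - g x)) < e"
        using d(2) Cc_cmult[OF Ccp_Cc[OF \<phi>(1)], of c] by force
    qed
  next
    case (add f g)
    show ?case
    proof (intro allI impI)
      fix e :: real assume "0 < e"
      then have "0 < e/2" by simp
      then obtain u v where u: "u \<in> Cc" "(LINT x|M. cmod (f x - u x)) < e/2" and v: "v \<in> Cc" "(LINT x|M. cmod (g x - v x)) < e/2"
        using add.IH by meson
      note [simp] = add.hyps Cc_integrable[OF M u(1)] Cc_integrable[OF M v(1)]
      have "(LINT x|M. cmod (f x + g x - (u x + v x))) \<le> (LINT x|M. cmod (f x - u x) + cmod (g x - v x))"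
        by (intro integral_mono) (auto simp: add_diff_add intro: norm_triangle_ineq)
      also have "\<dots> = (LINT x|M. cmod (f x - u x)) + (LINT x|M. cmod (g x - v x))"
        by (rule Bochner_Integration.integral_add) auto
      finally show "\<exists>w\<in>Cc. (LINT x|M. cmod (f x + g x - w x)) < e"
        using u v by (intro bexI[OF _ Cc_add[OF u(1) v(1)]]) auto
    qed
  next
    case (lim f s)
    show ?case
    proof (intro allI impI)
      fix e :: real assume "0 < e"
      then have e2: "0 < e/2" by simp
      note [simp] = lim.hyps(1,4)
      have [measurable]: "f \<in> borel_measurable M" "s i \<in> borel_measurable M" for i
        by (rule borel_measurable_integrable[OF lim.hyps(4)], rule borel_measurable_integrable[OF lim.hyps(1)])
      have "(\<lambda>i. LINT x|M. cmod (f x - s i x)) \<longlonglongrightarrow> (LINT x|M. 0)"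
      proof (rule integral_dominated_convergence[where w = "\<lambda>x. 3 * cmod (f x)"])
        show "AE x in M. (\<lambda>i. cmod (f x - s i x)) \<longlonglongrightarrow> 0"
        proof (rule AE_I2)
          fix x assume "x \<in> space M"
          from tendsto_norm[OF tendsto_diff[OF tendsto_const[of "f x"] lim.hyps(2)[OF this]]]
          show "(\<lambda>i. cmod (f x - s i x)) \<longlonglongrightarrow> 0" by simp
        qed
        fix i show "AE x in M. norm (cmod (f x - s i x)) \<le> 3 * cmod (f x)"
        proof (rule AE_I2)
          fix x assume "x \<in> space M"
          then show "norm (cmod (f x - s i x)) \<le> 3 * cmod (f x)"
            using lim.hyps(3)[of x i] norm_triangle_ineq4[of "f x" "s i x"] by simp
        qed
      qed auto
      from order_tendstoD(2)[OF this[simplified] e2] obtain i where i: "(LINT x|M. cmod (f x - s i x)) < e/2"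
        unfolding eventually_sequentially by (meson order_refl)
      obtain u where u: "u \<in> Cc" "(LINT x|M. cmod (s i x - u x)) < e/2" using lim.IH[of i] e2 by blast
      note [simp] = Cc_integrable[OF M u(1)]
      have "(LINT x|M. cmod (f x - u x)) \<le> (LINT x|M. cmod (f x - s i x) + cmod (s i x - u x))"
      proof (rule integral_mono)
        show "cmod (f x - u x) \<le> cmod (f x - s i x) + cmod (s i x - u x)" for x
          using norm_triangle_ineq[of "f x - s i x" "s i x - u x"] by simp
      qed auto
      also have "\<dots> = (LINT x|M. cmod (f x - s i x)) + (LINT x|M. cmod (s i x - u x))"
        by (rule Bochner_Integration.integral_add) auto
      finally show "\<exists>w\<in>Cc. (LINT x|M. cmod (f x - w x)) < e" using i u by (intro bexI[OF _ u(1)]) auto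
    qed
  qed
  then show thesis using e that by blast
qed

text \<open>A bounded linear functional on the integrable functions is determined by the nonnegative test functions.\<close>

lemma L1_functional_zero:
  fixes T :: "('a::t2_space \<Rightarrow> complex) \<Rightarrow> complex"
  assumes lc: "lch TYPE('a)" and M: "radon_measure M"
    and add: "\<And>f g. integrable M f \<Longrightarrow> integrable M g \<Longrightarrow> T (\<lambda>x. f x + g x) = T f + T g"
    and scale: "\<And>c f. integrable M f \<Longrightarrow> T (\<lambda>x. c * f x) = c * T f"
    and bd: "\<And>f. integrable M f \<Longrightarrow> cmod (T f) \<le> C * (LINT x|M. cmod (f x))"
    and zero: "\<And>\<phi>. \<phi> \<in> Ccp \<Longrightarrow> T (\<lambda>x. complex_of_real (\<phi> x)) = 0"
    and f: "integrable M f"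
  shows "T f = 0"
proof -
  have Z: "T g = 0" if g: "g \<in> Cc" for g
  proof -
    have "integrable M g \<and> T g = 0"
    proof (rule complex_parts_induct[of "\<lambda>g. integrable M g \<and> T g = 0" g])
      fix h :: "complex \<Rightarrow> real" assume "continuous_on UNIV h" "\<And>z. 0 \<le> h z \<and> h z \<le> cmod z"
      then have "(\<lambda>x. h (g x)) \<in> Ccp" by (rule Cc_Ccp[OF g])
      then show "integrable M (\<lambda>x. complex_of_real (h (g x))) \<and> T (\<lambda>x. complex_of_real (h (g x))) = 0"
        using zero Cc_integrable[OF M Ccp_Cc] by blast
    qed (auto simp: add scale)
    then show ?thesis by simp
  qed
  have "cmod (T f) \<le> e" if e: "0 < e" for e
  proof -
    define d where "d = e / (\<bar>C\<bar> + 1)"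
    have d: "0 < d" "\<bar>C\<bar> * d \<le> e" using e by (auto simp: d_def field_simps add_pos_nonneg)
    obtain g where g: "g \<in> Cc" "(LINT x|M. cmod (f x - g x)) < d" using Cc_dense_L1[OF lc M f d(1)] .
    note [simp] = f Cc_integrable[OF M g(1)]
    have "T f = T (\<lambda>x. (f x + -1 * g x) + g x)" by simp
    also have "\<dots> = T (\<lambda>x. f x + -1 * g x) + T g" by (rule add) auto
    finally have "cmod (T f) = cmod (T (\<lambda>x. f x + -1 * g x))" using Z[OF g(1)] by simp
    also have "\<dots> \<le> C * (LINT x|M. cmod (f x + -1 * g x))" by (rule bd) auto
    also have "\<dots> \<le> \<bar>C\<bar> * d" using g(2) by (intro mult_mono) auto
    finally show ?thesis using d(2) by simp
  qed
  then show ?thesis by (metis dense_ge norm_le_zero_iff)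
qed

section \<open>Integrals with a bounded continuous kernel\<close>

lemma continuous_on_UNIV_I:
  fixes f :: "'a::topological_space \<Rightarrow> 'b::real_normed_vector"
  assumes "\<And>x e. 0 < e \<Longrightarrow> eventually (\<lambda>y. norm (f y - f x) < e) (nhds x)"
  shows "continuous_on UNIV f"
  unfolding continuous_on_def
proof (intro ballI tendstoI)
  fix x :: 'a and e :: real assume "0 < e"
  from assms[OF this, of x] show "eventually (\<lambda>y. dist (f y) (f x) < e) (at x within UNIV)"
    unfolding eventually_at_filter by (rule eventually_mono) (simp add: dist_norm)
qed

text \<open>Replacing \<open>b\<close> by a test function makes the integral one over a compact set, near which \<open>K\<close> is
  uniformly close to its value at the given parameter.\<close>

lemma Cb_integral:
  fixes K :: "'x::topological_space \<times> 'b::t2_space \<Rightarrow> complex"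
  assumes lc: "lch TYPE('b)" and N: "radon_measure N" and b: "integrable N b" and K: "K \<in> Cb"
  shows "(\<lambda>x. LINT y|N. b y * K (x, y)) \<in> Cb"
proof -
  obtain B where B: "0 < B" "\<And>p. cmod (K p) \<le> B" using Cb_bound[OF K] by blast
  define L where "L = (LINT y|N. cmod (b y))"
  have L: "0 \<le> L" unfolding L_def by simp
  show ?thesis
  proof (rule CbI)
    show "cmod (LINT y|N. b y * K (x, y)) \<le> B * L" for x
      unfolding L_def by (rule integral_mult_bound[OF N b B(2)])
    show "continuous_on UNIV (\<lambda>x. LINT y|N. b y * K (x, y))"
    proof (rule continuous_on_UNIV_I)
      fix x0 :: 'x and e :: real assume e: "0 < e"
      \<comment> \<open>\<open>2 * B * d\<close> bounds the effect of replacing \<open>b\<close>, and \<open>d * (L + 1)\<close> the variation of \<open>K\<close> on the support.\<close>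
      define d where "d = min 1 (e / (2 * B + L + 2))"
      have d: "0 < d" "d \<le> 1" "(2 * B + (L + 1)) * d < e"
      proof -
        show d0: "0 < d" "d \<le> 1" using e B(1) L by (auto simp: d_def)
        have "(2 * B + L + 2) * d \<le> e"
          using B(1) L e mult_left_mono[of d "e / (2 * B + L + 2)" "2 * B + L + 2"] by (simp add: d_def)
        then show "(2 * B + (L + 1)) * d < e" using d0 by (simp add: algebra_simps)
      qed
      obtain b' where b': "b' \<in> Cc" "(LINT y|N. cmod (b y - b' y)) < d" using Cc_dense_L1[OF lc N b d(1)] .
      obtain S where S: "compact S" "\<And>y. y \<notin> S \<Longrightarrow> b' y = 0" using b'(1) by (auto simp: Cc_def)
      note ib' = Cc_integrable[OF N b'(1)]
      have ibb: "integrable N (\<lambda>y. b y - b' y)" using b ib' by simp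
      have L': "(LINT y|N. cmod (b' y)) \<le> L + 1"
      proof -
        have "(LINT y|N. cmod (b' y)) \<le> (LINT y|N. cmod (b y) + cmod (b y - b' y))"
        proof (rule integral_mono)
          show "cmod (b' y) \<le> cmod (b y) + cmod (b y - b' y)" for y
            using norm_triangle_ineq4[of "b y" "b y - b' y"] by simp
        qed (use b ib' in auto)
        also have "\<dots> = L + (LINT y|N. cmod (b y - b' y))"
          unfolding L_def using b ibb by (intro Bochner_Integration.integral_add) auto
        finally show ?thesis using b'(2) d(2) by simp
      qed
      define U where "U = {p. cmod (K p - K (x0, snd p)) < d}"
      have "open U" unfolding U_def
      proof (rule open_Collect_less)
        have "continuous_on UNIV (\<lambda>p::'x\<times>'b. K (x0, snd p))"
          by (rule continuous_on_compose2[OF Cb_cont[OF K]]) (auto intro!: continuous_intros)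
        then show "continuous_on UNIV (\<lambda>p. cmod (K p - K (x0, snd p)))"
          by (intro continuous_intros Cb_cont[OF K])
      qed simp
      then obtain V W where VW: "open V" "open W" "x0 \<in> V" "S \<subseteq> W" "V \<times> W \<subseteq> U"
        using open_rect_compact[OF S(1), of U x0] d(1) by (auto simp: U_def)
      from eventually_nhds_in_open[OF VW(1,3)]
      show "eventually (\<lambda>x. cmod ((LINT y|N. b y * K (x, y)) - (LINT y|N. b y * K (x0, y))) < e) (nhds x0)"
      proof eventually_elim
        case (elim x)
        define D where "D = (\<lambda>y. K (x, y) - K (x0, y))"
        have D: "D \<in> Cb" unfolding D_def by (intro Cb_diff Cb_section K)
        have D2: "cmod (D y) \<le> 2 * B" for y
          unfolding D_def using norm_triangle_ineq4[of "K (x, y)" "K (x0, y)"] B(2)[of "(x, y)"] B(2)[of "(x0, y)"] by simp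
        have Dd: "cmod (D y) \<le> d" if "y \<in> S" for y
          using VW elim that by (fastforce simp: U_def D_def)
        have "(LINT y|N. b y * K (x, y)) - (LINT y|N. b y * K (x0, y)) = (LINT y|N. b y * D y)"
          unfolding D_def right_diff_distrib
          by (rule Bochner_Integration.integral_diff[symmetric]) (intro integrable_mult_Cb[OF N b] Cb_section K)+
        also have "\<dots> = (LINT y|N. (b y - b' y) * D y + b' y * D y)"
          by (simp add: left_diff_distrib)
        also have "\<dots> = (LINT y|N. (b y - b' y) * D y) + (LINT y|N. b' y * D y)"
          by (rule Bochner_Integration.integral_add) (intro integrable_mult_Cb[OF N] ibb ib' D)+
        also have "(LINT y|N. b' y * D y) = (LINT y|N. b' y * (if y \<in> S then D y else 0))"
          by (rule Bochner_Integration.integral_cong) (auto simp: S(2))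
        finally have "cmod ((LINT y|N. b y * K (x, y)) - (LINT y|N. b y * K (x0, y))) \<le>
          cmod (LINT y|N. (b y - b' y) * D y) + cmod (LINT y|N. b' y * (if y \<in> S then D y else 0))"
          by (simp only: norm_triangle_ineq)
        also have "\<dots> \<le> 2 * B * (LINT y|N. cmod (b y - b' y)) + d * (LINT y|N. cmod (b' y))"
          by (intro add_mono integral_mult_bound[OF N] ibb ib' D2) (use Dd d in auto)
        also have "\<dots> \<le> 2 * B * d + d * (L + 1)"
          using b'(2) L' B(1) d(1) by (intro add_mono mult_left_mono) auto
        also have "\<dots> < e" using d(3) by (simp add: algebra_simps)
        finally show ?case .
      qed
    qed
  qed
qed

lemma nn_integral_real:
  "integrable M f \<Longrightarrow> (\<And>x. 0 \<le> f x) \<Longrightarrow> (\<integral>\<^sup>+x. ennreal (f x) \<partial>M) = ennreal (LINT x|M. f x)"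
  by (intro nn_integral_eq_integral) auto

lemma Cb_real_integrable:
  assumes M: "radon_measure M" and b: "integrable M (b :: 'a::t2_space \<Rightarrow> real)" and u: "continuous_on UNIV u" "\<And>x. \<bar>u x\<bar> \<le> B"
  shows "integrable M (\<lambda>x. b x * u x)"
proof -
  have "(\<lambda>x. complex_of_real (u x)) \<in> Cb"
    by (rule CbI[where B = B]) (use u in \<open>auto intro!: continuous_intros\<close>)
  from integrable_mult_Cb[OF M _ this, of "\<lambda>x. complex_of_real (b x)"] show ?thesis
    using b by (simp add: complex_of_real_integrable_eq flip: of_real_mult)
qed

text \<open>The integrands are continuous and nonnegative, so this is Tonelli's theorem in real form.\<close>

lemma Fubini_Ccp:
  fixes M :: "'a::t2_space measure" and N :: "'b::t2_space measure"
  assumes lca: "lch TYPE('a)" and lcb: "lch TYPE('b)" and M: "radon_measure M" and N: "radon_measure N"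
    and \<alpha>: "\<alpha> \<in> Ccp" and \<beta>: "\<beta> \<in> Ccp" and k: "continuous_on UNIV k" "\<And>p. 0 \<le> k p" "\<And>p. k p \<le> B"
  shows "(LINT x|M. \<alpha> x * (LINT y|N. \<beta> y * k (x, y))) = (LINT y|N. \<beta> y * (LINT x|M. \<alpha> x * k (x, y)))"
proof -
  define F where "F = (\<lambda>p. ennreal (\<alpha> (fst p) * \<beta> (snd p) * k p))"
  have lF: "lsc F"
    unfolding F_def
  proof (intro lsc_continuous continuous_on_ennreal continuous_on_mult)
    show "continuous_on UNIV (\<lambda>p::'a \<times> 'b. \<alpha> (fst p))"
      by (rule continuous_on_compose2[OF CcpD(1)[OF \<alpha>] continuous_on_fst[OF continuous_on_id]]) simp
    show "continuous_on UNIV (\<lambda>p::'a \<times> 'b. \<beta> (snd p))"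
      by (rule continuous_on_compose2[OF CcpD(1)[OF \<beta>] continuous_on_snd[OF continuous_on_id]]) simp
  qed (rule k(1))
  have kc: "continuous_on UNIV (\<lambda>y. k (x, y))" "continuous_on UNIV (\<lambda>x. k (x, y))" for x y
    by (rule continuous_on_compose2[OF k(1)]; auto intro!: continuous_intros)+
  note [simp] = CcpD(2)[OF \<alpha>] CcpD(2)[OF \<beta>] k(2)
  have k': "\<bar>k p\<bar> \<le> B" for p using k(2,3)[of p] by simp
  have i1: "integrable N (\<lambda>y. \<beta> y * k (x, y))" for x
    by (rule Cb_real_integrable[OF N Ccp_integrable[OF N \<beta>] kc(1) k'])
  have i2: "integrable M (\<lambda>x. \<alpha> x * k (x, y))" for y
    by (rule Cb_real_integrable[OF M Ccp_integrable[OF M \<alpha>] kc(2) k'])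
  have kCb: "(\<lambda>p. complex_of_real (k p)) \<in> Cb" "(\<lambda>p. complex_of_real (k (snd p, fst p))) \<in> Cb"
  proof -
    show *: "(\<lambda>p. complex_of_real (k p)) \<in> Cb"
      by (rule CbI[where B = B]) (use k k' in \<open>auto intro!: continuous_intros\<close>)
    show "(\<lambda>p. complex_of_real (k (snd p, fst p))) \<in> Cb"
      by (rule Cb_compose[OF *, of "\<lambda>p. (snd p, fst p)"]) (intro continuous_intros)
  qed
  have j1: "integrable M (\<lambda>x. \<alpha> x * (LINT y|N. \<beta> y * k (x, y)))"
  proof -
    have "(\<lambda>x. LINT y|N. complex_of_real (\<beta> y) * complex_of_real (k (x, y))) \<in> Cb"
      by (rule Cb_integral[OF lcb N _ kCb(1)]) (simp add: complex_of_real_integrable_eq Ccp_integrable[OF N \<beta>])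
    from integrable_mult_Cb[OF M _ this, of "\<lambda>x. complex_of_real (\<alpha> x)"] show ?thesis
      by (simp add: complex_of_real_integrable_eq Ccp_integrable[OF M \<alpha>] flip: of_real_mult)
  qed
  have j2: "integrable N (\<lambda>y. \<beta> y * (LINT x|M. \<alpha> x * k (x, y)))"
  proof -
    have "(\<lambda>y. LINT x|M. complex_of_real (\<alpha> x) * complex_of_real (k (snd (y, x), fst (y, x)))) \<in> Cb"
      by (rule Cb_integral[OF lca M _ kCb(2)]) (simp add: complex_of_real_integrable_eq Ccp_integrable[OF M \<alpha>])
    from integrable_mult_Cb[OF N _ this, of "\<lambda>x. complex_of_real (\<beta> x)"] show ?thesis
      by (simp add: complex_of_real_integrable_eq Ccp_integrable[OF N \<beta>] flip: of_real_mult)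
  qed
  have "ennreal (LINT x|M. \<alpha> x * (LINT y|N. \<beta> y * k (x, y))) = (\<integral>\<^sup>+x. \<integral>\<^sup>+y. F (x, y) \<partial>N \<partial>M)"
  proof -
    have "(\<integral>\<^sup>+y. F (x, y) \<partial>N) = ennreal (\<alpha> x * (LINT y|N. \<beta> y * k (x, y)))" for x
      unfolding F_def using nn_integral_real[of N "\<lambda>y. \<alpha> x * (\<beta> y * k (x, y))"] i1[of x] by (simp add: mult.assoc)
    then show ?thesis using nn_integral_real[OF j1] by (simp add: integral_nonneg_AE)
  qed
  also have "\<dots> = (\<integral>\<^sup>+y. \<integral>\<^sup>+x. F (x, y) \<partial>M \<partial>N)" by (rule Tonelli_lsc[OF lca lcb M N lF])
  also have "\<dots> = ennreal (LINT y|N. \<beta> y * (LINT x|M. \<alpha> x * k (x, y)))"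
  proof -
    have "(\<integral>\<^sup>+x. F (x, y) \<partial>M) = ennreal (\<beta> y * (LINT x|M. \<alpha> x * k (x, y)))" for y
    proof -
      have "F (x, y) = ennreal (\<beta> y * (\<alpha> x * k (x, y)))" for x
        by (simp add: F_def mult.assoc mult.left_commute[of "\<beta> y"])
      then show ?thesis using nn_integral_real[of M "\<lambda>x. \<beta> y * (\<alpha> x * k (x, y))"] i2[of y] by simp
    qed
    then show ?thesis using nn_integral_real[OF j2] by (simp add: integral_nonneg_AE)
  qed
  finally show ?thesis by (subst (asm) ennreal_inj) (auto intro!: integral_nonneg_AE)
qed

text \<open>Fubini's theorem without sigma-finiteness, for integrands that factor into two integrable functions
  and a bounded continuous kernel. Both sides are bounded and linear in \<open>a\<close> and in \<open>b\<close> separately, so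
  it suffices to compare them on test functions.\<close>

lemma Fubini_Cb:
  fixes M :: "'a::t2_space measure" and N :: "'b::t2_space measure"
  assumes lca: "lch TYPE('a)" and lcb: "lch TYPE('b)" and M: "radon_measure M" and N: "radon_measure N"
    and a: "integrable M a" and b: "integrable N b" and K: "K \<in> Cb"
  shows "(LINT x|M. a x * (LINT y|N. b y * K (x, y))) = (LINT y|N. b y * (LINT x|M. a x * K (x, y)))"
proof -
  obtain B where B: "0 < B" "\<And>p. cmod (K p) \<le> B" using Cb_bound[OF K] by blast
  have I1: "(\<lambda>x. LINT y|N. b y * K (x, y)) \<in> Cb" if "integrable N b" "K \<in> Cb" for b K
    by (rule Cb_integral[OF lcb N that])
  have I2: "(\<lambda>y. LINT x|M. a x * K (x, y)) \<in> Cb" if "integrable M a" "K \<in> Cb" for a K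
    using Cb_integral[OF lca M that(1) Cb_swap[OF that(2)]] by simp
  note ib = integrable_mult_Cb[OF N _ Cb_section] and ia = integrable_mult_Cb[OF M _ Cb_section']
  have s1: "(LINT x|M. complex_of_real (\<alpha> x) * (LINT y|N. complex_of_real (\<beta> y) * K (x, y))) =
     (LINT y|N. complex_of_real (\<beta> y) * (LINT x|M. complex_of_real (\<alpha> x) * K (x, y)))"
    if \<alpha>: "\<alpha> \<in> Ccp" and \<beta>: "\<beta> \<in> Ccp" for \<alpha> \<beta>
  proof -
    define P where "P = (\<lambda>K. K \<in> Cb \<and> (LINT x|M. complex_of_real (\<alpha> x) * (LINT y|N. complex_of_real (\<beta> y) * K (x, y))) =
     (LINT y|N. complex_of_real (\<beta> y) * (LINT x|M. complex_of_real (\<alpha> x) * K (x, y))))"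
    note ca = Cc_integrable[OF M Ccp_Cc[OF \<alpha>]] and cb = Cc_integrable[OF N Ccp_Cc[OF \<beta>]]
    have "P K"
    proof (rule complex_parts_induct[of P K])
      fix h :: "complex \<Rightarrow> real" assume h: "continuous_on UNIV h" "\<And>z. 0 \<le> h z \<and> h z \<le> cmod z"
      have c: "continuous_on UNIV (\<lambda>p. h (K p))" by (rule continuous_on_compose2[OF h(1) Cb_cont[OF K]]) auto
      have le: "h (K p) \<le> B" for p using h(2)[of "K p"] B(2)[of p] by simp
      have "(\<lambda>p. complex_of_real (h (K p))) \<in> Cb"
        by (rule CbI[where B = B]) (use c le h in \<open>auto intro!: continuous_intros\<close>)
      moreover have "(LINT x|M. \<alpha> x * (LINT y|N. \<beta> y * h (K (x, y)))) = (LINT y|N. \<beta> y * (LINT x|M. \<alpha> x * h (K (x, y))))"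
        using Fubini_Ccp[OF lca lcb M N \<alpha> \<beta> c _ le] h by simp
      ultimately show "P (\<lambda>p. complex_of_real (h (K p)))"
        unfolding P_def by (simp flip: of_real_mult)
    next
      fix K L assume "P K" "P L"
      then have K: "K \<in> Cb" and L: "L \<in> Cb"
        and eq: "(LINT x|M. complex_of_real (\<alpha> x) * (LINT y|N. complex_of_real (\<beta> y) * K (x, y))) =
     (LINT y|N. complex_of_real (\<beta> y) * (LINT x|M. complex_of_real (\<alpha> x) * K (x, y)))"
         "(LINT x|M. complex_of_real (\<alpha> x) * (LINT y|N. complex_of_real (\<beta> y) * L (x, y))) =
     (LINT y|N. complex_of_real (\<beta> y) * (LINT x|M. complex_of_real (\<alpha> x) * L (x, y)))"
        by (auto simp: P_def)
      show "P (\<lambda>p. K p + L p)"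
        unfolding P_def using Cb_add[OF K L] eq
        by (simp add: distrib_left ib[OF cb K] ib[OF cb L] ia[OF ca K] ia[OF ca L]
            integrable_mult_Cb[OF M ca I1[OF cb K]] integrable_mult_Cb[OF M ca I1[OF cb L]]
            integrable_mult_Cb[OF N cb I2[OF ca K]] integrable_mult_Cb[OF N cb I2[OF ca L]])
    next
      fix c K assume "P K"
      then show "P (\<lambda>p. c * K p)"
        unfolding P_def by (simp add: Cb_cmult mult.left_commute[of _ c])
    qed
    then show ?thesis by (simp add: P_def)
  qed
  define T where "T = (\<lambda>a b. (LINT x|M. a x * (LINT y|N. b y * K (x, y))) - (LINT y|N. b y * (LINT x|M. a x * K (x, y))))"
  have bd1: "cmod (LINT y|N. b y * K (x, y)) \<le> B * (LINT y|N. cmod (b y))" if "integrable N b" for b x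
    by (rule integral_mult_bound[OF N that B(2)])
  have bd2: "cmod (LINT x|M. a x * K (x, y)) \<le> B * (LINT x|M. cmod (a x))" if "integrable M a" for a y
    by (rule integral_mult_bound[OF M that B(2)])
  have bd: "cmod (T a b) \<le> 2 * B * (LINT x|M. cmod (a x)) * (LINT y|N. cmod (b y))"
    if a: "integrable M a" and b: "integrable N b" for a b
  proof -
    have "cmod (LINT x|M. a x * (LINT y|N. b y * K (x, y))) \<le> B * (LINT y|N. cmod (b y)) * (LINT x|M. cmod (a x))"
      by (rule integral_mult_bound[OF M a bd1[OF b]])
    moreover have "cmod (LINT y|N. b y * (LINT x|M. a x * K (x, y))) \<le> B * (LINT x|M. cmod (a x)) * (LINT y|N. cmod (b y))"
      by (rule integral_mult_bound[OF N b bd2[OF a]])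
    moreover have "cmod (T a b) \<le> cmod (LINT x|M. a x * (LINT y|N. b y * K (x, y))) + cmod (LINT y|N. b y * (LINT x|M. a x * K (x, y)))"
      unfolding T_def by (rule norm_triangle_ineq4)
    moreover have "B * (LINT y|N. cmod (b y)) * (LINT x|M. cmod (a x)) = B * (LINT x|M. cmod (a x)) * (LINT y|N. cmod (b y))"
      by (simp only: mult_ac)
    ultimately show ?thesis by linarith
  qed
  have add1: "T (\<lambda>x. f x + g x) b = T f b + T g b" if "integrable M f" "integrable M g" "integrable N b" for f g b
    unfolding T_def using that
    by (simp add: distrib_left distrib_right ia K integrable_mult_Cb[OF M _ I1] integrable_mult_Cb[OF N _ I2])
  have add2: "T a (\<lambda>x. f x + g x) = T a f + T a g" if "integrable N f" "integrable N g" "integrable M a" for f g a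
    unfolding T_def using that
    by (simp add: distrib_left distrib_right ib K integrable_mult_Cb[OF M _ I1] integrable_mult_Cb[OF N _ I2])
  have sc1: "T (\<lambda>x. c * f x) b = c * T f b" for c f b
    unfolding T_def by (simp add: mult.assoc mult.left_commute[of _ c] right_diff_distrib)
  have sc2: "T a (\<lambda>x. c * f x) = c * T a f" for c f a
    unfolding T_def by (simp add: mult.assoc mult.left_commute[of _ c] right_diff_distrib)
  have z1: "T (\<lambda>x. complex_of_real (\<alpha> x)) b = 0" if "\<alpha> \<in> Ccp" for \<alpha>
  proof (rule L1_functional_zero[OF lcb N _ _ _ _ b, where T = "T (\<lambda>x. complex_of_real (\<alpha> x))" and C = "2 * B * (LINT x|M. cmod (complex_of_real (\<alpha> x)))"])
    note ca = Cc_integrable[OF M Ccp_Cc[OF that]]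
    show "T (\<lambda>x. complex_of_real (\<alpha> x)) (\<lambda>x. complex_of_real (\<beta> x)) = 0" if "\<beta> \<in> Ccp" for \<beta>
      using s1[OF \<open>\<alpha> \<in> Ccp\<close> that] by (simp add: T_def)
    show "cmod (T (\<lambda>x. complex_of_real (\<alpha> x)) f) \<le> 2 * B * (LINT x|M. cmod (complex_of_real (\<alpha> x))) * (LINT x|N. cmod (f x))" if "integrable N f" for f
      by (rule bd[OF ca that])
    show "T (\<lambda>x. complex_of_real (\<alpha> x)) (\<lambda>x. f x + g x) = T (\<lambda>x. complex_of_real (\<alpha> x)) f + T (\<lambda>x. complex_of_real (\<alpha> x)) g"
      if "integrable N f" "integrable N g" for f g by (rule add2[OF that ca])
  qed (rule sc2)
  have "T a b = 0"
  proof (rule L1_functional_zero[OF lca M _ _ _ _ a, where T = "\<lambda>a. T a b" and C = "2 * B * (LINT x|N. cmod (b x))"])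
    show "cmod (T f b) \<le> 2 * B * (LINT x|N. cmod (b x)) * (LINT x|M. cmod (f x))" if "integrable M f" for f
      using bd[OF that b] by (simp add: mult_ac)
    show "T (\<lambda>x. f x + g x) b = T f b + T g b" if "integrable M f" "integrable M g" for f g by (rule add1[OF that b])
    show "T (\<lambda>x. c * f x) b = c * T f b" for c f by (rule sc1)
  qed (rule z1)
  then show ?thesis by (simp add: T_def)
qed

section \<open>Square integrable functions\<close>

lemma L2D: "f \<in> L2 m \<Longrightarrow> f \<in> borel_measurable m" "f \<in> L2 m \<Longrightarrow> integrable m (\<lambda>x. (cmod (f x))\<^sup>2)"
  by (auto simp: L2_def)

lemma L2_norm_nonneg: "0 \<le> L2_norm m f"
  by (simp add: L2_norm_def)

lemma L2_norm_power2: "(L2_norm m f)\<^sup>2 = (LINT x|m. (cmod (f x))\<^sup>2)"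
  by (simp add: L2_norm_def)

lemma nn_integral_L2: "f \<in> L2 m \<Longrightarrow> (\<integral>\<^sup>+x. ennreal ((cmod (f x))\<^sup>2) \<partial>m) = ennreal ((L2_norm m f)\<^sup>2)"
  unfolding L2_norm_power2 by (rule nn_integral_real) (auto dest: L2D)

lemma L2I:
  assumes "f \<in> borel_measurable m" "(\<integral>\<^sup>+x. ennreal ((cmod (f x))\<^sup>2) \<partial>m) \<le> ennreal (c\<^sup>2)" "0 \<le> c"
  shows "f \<in> L2 m" "L2_norm m f \<le> c"
proof -
  have fin: "(\<integral>\<^sup>+x. ennreal ((cmod (f x))\<^sup>2) \<partial>m) < \<infinity>"
    using assms(2) by (rule le_less_trans) simp
  show "f \<in> L2 m" unfolding L2_def
    using assms(1) fin by (auto intro!: integrableI_bounded)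
  from nn_integral_L2[OF this] assms(2) have "ennreal ((L2_norm m f)\<^sup>2) \<le> ennreal (c\<^sup>2)"
    by (simp only:)
  then have "(L2_norm m f)\<^sup>2 \<le> c\<^sup>2" by (simp add: ennreal_le_iff)
  then show "L2_norm m f \<le> c" using assms(3) by (rule power2_le_imp_le)
qed

text \<open>If the square of the modulus is not integrable, the norm, as a Bochner integral, is zero; this covers
  the functions whose measurability is unknown.\<close>

lemma L2_norm_le:
  assumes "(\<integral>\<^sup>+x. ennreal ((cmod (f x))\<^sup>2) \<partial>m) \<le> ennreal (c\<^sup>2)" "0 \<le> c"
  shows "L2_norm m f \<le> c"
proof (cases "integrable m (\<lambda>x. (cmod (f x))\<^sup>2)")
  case True
  have "ennreal ((L2_norm m f)\<^sup>2) = (\<integral>\<^sup>+x. ennreal ((cmod (f x))\<^sup>2) \<partial>m)"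
    unfolding L2_norm_power2 using nn_integral_real[OF True] by simp
  then have "ennreal ((L2_norm m f)\<^sup>2) \<le> ennreal (c\<^sup>2)" using assms(1) by (simp only:)
  then have "(L2_norm m f)\<^sup>2 \<le> c\<^sup>2" by (simp add: ennreal_le_iff)
  then show ?thesis using assms(2) by (rule power2_le_imp_le)
next
  case False
  then show ?thesis using assms(2) by (simp add: L2_norm_def not_integrable_integral_eq)
qed

lemma ennreal_power2_le:
  assumes "x\<^sup>2 \<le> (ennreal c)\<^sup>2" "0 \<le> c"
  shows "x \<le> ennreal c"
proof (cases x)
  case (real r)
  have "ennreal (r\<^sup>2) \<le> ennreal (c\<^sup>2)" using assms real by (simp add: ennreal_power)
  then have "r\<^sup>2 \<le> c\<^sup>2" by (simp add: ennreal_le_iff)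
  then have "r \<le> c" using assms(2) by (rule power2_le_imp_le)
  then show ?thesis using real by (simp add: ennreal_leI)
next
  case top
  then show ?thesis using assms by (simp add: ennreal_power power2_eq_square ennreal_mult[symmetric] top_unique)
qed

lemma L2_mult_integrable:
  assumes f: "f \<in> L2 m" and g: "g \<in> L2 m"
  shows "integrable m (\<lambda>x. cmod (f x) * cmod (g x))" "(LINT x|m. cmod (f x) * cmod (g x)) \<le> L2_norm m f * L2_norm m g"
proof -
  note [measurable] = L2D(1)[OF f] L2D(1)[OF g]
  have "(\<integral>\<^sup>+x. ennreal (cmod (f x)) * ennreal (cmod (g x)) \<partial>m)\<^sup>2 \<le>
     (\<integral>\<^sup>+x. (ennreal (cmod (f x)))\<^sup>2 \<partial>m) * (\<integral>\<^sup>+x. (ennreal (cmod (g x)))\<^sup>2 \<partial>m)"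
    by (rule Cauchy_Schwarz_nn_integral) simp_all
  also have "\<dots> = ennreal ((L2_norm m f)\<^sup>2) * ennreal ((L2_norm m g)\<^sup>2)"
    by (simp add: ennreal_power nn_integral_L2 f g)
  also have "\<dots> = (ennreal (L2_norm m f * L2_norm m g))\<^sup>2"
    by (simp add: ennreal_mult[symmetric] ennreal_power L2_norm_nonneg power_mult_distrib)
  finally have le: "(\<integral>\<^sup>+x. ennreal (cmod (f x)) * ennreal (cmod (g x)) \<partial>m) \<le> ennreal (L2_norm m f * L2_norm m g)"
    by (rule ennreal_power2_le) (simp add: L2_norm_nonneg)
  then have le': "(\<integral>\<^sup>+x. ennreal (cmod (f x) * cmod (g x)) \<partial>m) \<le> ennreal (L2_norm m f * L2_norm m g)"
    by (simp add: ennreal_mult)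
  show i: "integrable m (\<lambda>x. cmod (f x) * cmod (g x))"
    using le_less_trans[OF le' ennreal_less_top] by (intro integrableI_bounded) auto
  from nn_integral_real[OF i] le' show "(LINT x|m. cmod (f x) * cmod (g x)) \<le> L2_norm m f * L2_norm m g"
    by (simp add: L2_norm_nonneg)
qed

lemma L2_Cauchy_Schwarz:
  assumes f: "f \<in> L2 m" and g: "g \<in> L2 m"
  shows "cmod (LINT x|m. f x * g x) \<le> L2_norm m f * L2_norm m g"
proof -
  have "cmod (LINT x|m. f x * g x) \<le> (LINT x|m. cmod (f x * g x))" by simp
  also have "\<dots> \<le> L2_norm m f * L2_norm m g"
    using L2_mult_integrable(2)[OF f g] by (simp add: norm_mult)
  finally show ?thesis .
qed

lemma L2_add:
  assumes f: "f \<in> L2 m" and g: "g \<in> L2 m"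
  shows "(\<lambda>x. f x + g x) \<in> L2 m" "L2_norm m (\<lambda>x. f x + g x) \<le> L2_norm m f + L2_norm m g"
proof -
  note [simp] = L2D(2)[OF f] L2D(2)[OF g] L2_mult_integrable(1)[OF f g]
  note [measurable] = L2D(1)[OF f] L2D(1)[OF g]
  define h where "h = (\<lambda>x. (cmod (f x))\<^sup>2 + (cmod (g x))\<^sup>2 + 2 * (cmod (f x) * cmod (g x)))"
  have h: "integrable m h" unfolding h_def by (intro Bochner_Integration.integrable_add) simp_all
  have le: "(cmod (f x + g x))\<^sup>2 \<le> h x" for x
  proof -
    have "(cmod (f x + g x))\<^sup>2 \<le> (cmod (f x) + cmod (g x))\<^sup>2" by (intro power_mono norm_triangle_ineq) simp
    then show ?thesis by (simp add: h_def power2_sum mult.assoc)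
  qed
  have i: "integrable m (\<lambda>x. (cmod (f x + g x))\<^sup>2)"
    by (rule Bochner_Integration.integrable_bound[OF h]) (auto intro!: AE_I2 order_trans[OF le])
  then show "(\<lambda>x. f x + g x) \<in> L2 m" by (simp add: L2_def)
  have "(L2_norm m (\<lambda>x. f x + g x))\<^sup>2 \<le> (LINT x|m. h x)"
    unfolding L2_norm_power2 by (rule integral_mono[OF i h le])
  also have "\<dots> = (L2_norm m f)\<^sup>2 + (L2_norm m g)\<^sup>2 + 2 * (LINT x|m. cmod (f x) * cmod (g x))"
    unfolding h_def L2_norm_power2 by simp
  also have "\<dots> \<le> (L2_norm m f + L2_norm m g)\<^sup>2"
    using L2_mult_integrable(2)[OF f g] by (simp add: power2_sum mult.assoc)
  finally show "L2_norm m (\<lambda>x. f x + g x) \<le> L2_norm m f + L2_norm m g"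
    by (rule power2_le_imp_le) (simp add: L2_norm_nonneg)
qed

lemma L2_cmult:
  assumes "f \<in> L2 m"
  shows "(\<lambda>x. c * f x) \<in> L2 m"
  using L2D[OF assms] by (simp add: L2_def norm_mult power_mult_distrib)

lemma L2_norm_cmult: "L2_norm m (\<lambda>x. c * f x) = cmod c * L2_norm m f"
  unfolding L2_norm_def by (simp add: norm_mult power_mult_distrib real_sqrt_mult)

lemma L2_norm_cnj: "L2_norm m (\<lambda>x. cnj (f x)) = L2_norm m f"
  unfolding L2_norm_def by simp

lemma L2_diff:
  assumes f: "f \<in> L2 m" and g: "g \<in> L2 m"
  shows "(\<lambda>x. f x - g x) \<in> L2 m"
  using L2_add(1)[OF f L2_cmult[OF g, of "-1"]] by simp

lemma L1_Cb_L2: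
  assumes M: "radon_measure m" and f: "integrable m f" and fb: "f \<in> Cb"
  shows "f \<in> L2 m"
proof -
  have "(\<lambda>x. complex_of_real (cmod (f x))) \<in> Cb"
  proof -
    obtain B where B: "\<And>x. cmod (f x) \<le> B" using Cb_bound[OF fb] by blast
    show ?thesis by (rule CbI[where B = B]) (use B Cb_cont[OF fb] in \<open>auto intro!: continuous_intros\<close>)
  qed
  from integrable_mult_Cb[OF M _ this, of "\<lambda>x. complex_of_real (cmod (f x))"]
  have "integrable m (\<lambda>x. (cmod (f x))\<^sup>2)"
    using f by (simp add: complex_of_real_integrable_eq power2_eq_square flip: of_real_mult)
  then show ?thesis using f by (auto simp: L2_def)
qed

lemma Cc_L2: "radon_measure m \<Longrightarrow> f \<in> Cc \<Longrightarrow> f \<in> L2 m"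
  by (rule L1_Cb_L2) (auto intro: Cc_integrable Cc_Cb)

text \<open>\<open>f\<close> is first truncated to values of moderate size, which makes it bounded and integrable. Projection
  to a disc is a contraction, so an approximation in the first mean may be assumed to have the same
  bound, and then it is also an approximation in the second mean.\<close>

lemma Cc_dense_L2:
  fixes f :: "'a::t2_space \<Rightarrow> complex"
  assumes lc: "lch TYPE('a)" and M: "radon_measure m" and f: "f \<in> L2 m" and e: "0 < e"
  obtains g where "g \<in> Cc" "L2_norm m (\<lambda>x. f x - g x) < e"
proof -
  note [measurable] = L2D(1)[OF f]
  define t where "t = (\<lambda>(n::nat) x. if 1 / real (Suc n) < cmod (f x) \<and> cmod (f x) \<le> real n then f x else 0)"
  have tm[measurable]: "t n \<in> borel_measurable m" for n unfolding t_def by measurable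
  have t_le: "cmod (t n x) \<le> cmod (f x)" "cmod (f x - t n x) \<le> cmod (f x)" "cmod (t n x) \<le> real n" for n x
    by (auto simp: t_def)
  have lim: "(\<lambda>n. LINT x|m. (cmod (f x - t n x))\<^sup>2) \<longlonglongrightarrow> (LINT x|m. 0)"
  proof (rule integral_dominated_convergence[where w = "\<lambda>x. (cmod (f x))\<^sup>2"])
    show "AE x in m. (\<lambda>n. (cmod (f x - t n x))\<^sup>2) \<longlonglongrightarrow> 0"
    proof (rule AE_I2)
      fix x
      have "eventually (\<lambda>n. (cmod (f x - t n x))\<^sup>2 = 0) sequentially"
      proof (cases "f x = 0")
        case True then show ?thesis by (simp add: t_def)
      next
        case False
        have "(\<lambda>n. 1 / real (Suc n)) \<longlonglongrightarrow> 0" using LIMSEQ_inverse_real_of_nat by (simp add: inverse_eq_divide)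
        from order_tendstoD(2)[OF this, of "cmod (f x)"] False
        have "eventually (\<lambda>n. 1 / real (Suc n) < cmod (f x)) sequentially" by simp
        moreover have "eventually (\<lambda>n. cmod (f x) \<le> real n) sequentially"
          using filterlim_real_sequentially by (simp add: filterlim_at_top)
        ultimately show ?thesis by eventually_elim (simp add: t_def)
      qed
      then show "(\<lambda>n. (cmod (f x - t n x))\<^sup>2) \<longlonglongrightarrow> 0" by (rule tendsto_eventually)
    qed
    show "AE x in m. norm ((cmod (f x - t n x))\<^sup>2) \<le> (cmod (f x))\<^sup>2" for n
      using t_le(2) by (auto intro!: AE_I2 power_mono)
  qed (use L2D[OF f] in auto)
  have "0 < (e/2)\<^sup>2" using e by simp
  from order_tendstoD(2)[OF lim[simplified] this] obtain n where n: "(LINT x|m. (cmod (f x - t n x))\<^sup>2) < (e/2)\<^sup>2"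
    unfolding eventually_sequentially by (meson order_refl)
  have ti: "integrable m (t n)"
  proof (rule Bochner_Integration.integrable_bound[where f = "\<lambda>x. real (Suc n) * (cmod (f x))\<^sup>2"])
    show "AE x in m. norm (t n x) \<le> norm (real (Suc n) * (cmod (f x))\<^sup>2)"
    proof (rule AE_I2)
      fix x
      show "norm (t n x) \<le> norm (real (Suc n) * (cmod (f x))\<^sup>2)"
      proof (cases "1 / real (Suc n) < cmod (f x)")
        case True
        then have "1 \<le> real (Suc n) * cmod (f x)" by (simp add: field_simps)
        from mult_right_mono[OF this, of "cmod (f x)"] show ?thesis
          using t_le(1)[of n x] by (simp add: power2_eq_square mult.assoc)
      qed (simp add: t_def)
    qed
  qed (use L2D[OF f] in auto)
  have tL2: "t n \<in> L2 m"
    unfolding L2_def using L2D(2)[OF f] 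
    by (auto intro!: Bochner_Integration.integrable_bound[where f = "\<lambda>x. (cmod (f x))\<^sup>2"] AE_I2 power_mono t_le)
  define d where "d = (e/2)\<^sup>2 / (2 * (real n + 1))"
  have d: "0 < d" "2 * real n * d < (e/2)\<^sup>2"
    using e by (auto simp: d_def field_simps)
  obtain g where g: "g \<in> Cc" "(LINT x|m. cmod (t n x - g x)) < d" using Cc_dense_L1[OF lc M ti d(1)] .
  define B where "B = cball (0::complex) (real n)"
  have B: "closed B" "convex B" "B \<noteq> {}" "0 \<in> B" by (auto simp: B_def)
  \<comment> \<open>The projection to the disc of radius \<open>n\<close>, which fixes \<open>t n x\<close> and zero.\<close>
  define p where "p = closest_point B"
  have p: "\<And>z. p z \<in> B" "\<And>z. z \<in> B \<Longrightarrow> p z = z" "\<And>z w. dist (p z) (p w) \<le> dist z w"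
    unfolding p_def using B by (auto intro: closest_point_in_set closest_point_self closest_point_lipschitz)
  have pc: "continuous_on UNIV p" unfolding p_def by (rule continuous_on_closest_point[OF B(2,1,3)])
  have gC: "(\<lambda>x. p (g x)) \<in> Cc"
  proof -
    obtain K where K: "compact K" "\<And>x. x \<notin> K \<Longrightarrow> g x = 0" using g(1) by (auto simp: Cc_def)
    show ?thesis unfolding Cc_def
      using K p(2)[OF B(4)] continuous_on_compose2[OF pc Cc_cont[OF g(1)]] by (auto intro!: exI[of _ K])
  qed
  have gL2: "(\<lambda>x. p (g x)) \<in> L2 m" by (rule Cc_L2[OF M gC])
  have "(L2_norm m (\<lambda>x. t n x - p (g x)))\<^sup>2 \<le> (LINT x|m. 2 * real n * cmod (t n x - g x))"
    unfolding L2_norm_power2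
  proof (rule integral_mono)
    show "integrable m (\<lambda>x. (cmod (t n x - p (g x)))\<^sup>2)" by (rule L2D(2)[OF L2_diff[OF tL2 gL2]])
    show "integrable m (\<lambda>x. 2 * real n * cmod (t n x - g x))"
      using ti Cc_integrable[OF M g(1)] by simp
    fix x
    have tB: "t n x \<in> B" using t_le(3)[of n x] by (simp add: B_def)
    have 1: "cmod (t n x - p (g x)) \<le> cmod (t n x - g x)"
      using p(3)[of "t n x" "g x"] p(2)[OF tB] by (simp add: dist_norm)
    have "cmod (p (g x)) \<le> real n" using p(1)[of "g x"] by (simp add: B_def)
    then have 2: "cmod (t n x - p (g x)) \<le> 2 * real n"
      using t_le(3)[of n x] norm_triangle_ineq4[of "t n x" "p (g x)"] by linarith
    show "(cmod (t n x - p (g x)))\<^sup>2 \<le> 2 * real n * cmod (t n x - g x)"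
      using mult_mono[OF 2 1] by (simp add: power2_eq_square)
  qed
  also have "\<dots> \<le> 2 * real n * d" using g(2) by (simp add: mult_left_mono)
  also have "\<dots> < (e/2)\<^sup>2" by (rule d(2))
  finally have 1: "L2_norm m (\<lambda>x. t n x - p (g x)) < e/2"
    by (rule power2_less_imp_less) (use e in simp)
  have 2: "L2_norm m (\<lambda>x. f x - t n x) < e/2"
    by (rule power2_less_imp_less) (use n e in \<open>simp_all add: L2_norm_power2\<close>)
  have "L2_norm m (\<lambda>x. f x - p (g x)) = L2_norm m (\<lambda>x. (f x - t n x) + (t n x - p (g x)))" by simp
  also have "\<dots> \<le> L2_norm m (\<lambda>x. f x - t n x) + L2_norm m (\<lambda>x. t n x - p (g x))"
    by (rule L2_add(2)[OF L2_diff[OF f tL2] L2_diff[OF tL2 gL2]])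
  finally have "L2_norm m (\<lambda>x. f x - p (g x)) < e" using 1 2 by simp
  with gC show thesis by (rule that)
qed

section \<open>Nonnegative measures and finitely supported measures\<close>

lemma complex_borel_measure_empty:
  assumes "complex_borel_measure \<mu>" shows "\<mu> {} = 0"
proof -
  have "(\<lambda>i::nat. \<mu> {}) sums \<mu> (\<Union>i::nat. {})"
    using assms unfolding complex_borel_measure_def
    by (elim conjE allE[of _ "\<lambda>i::nat. {}"]) (auto simp: disjoint_family_on_def)
  then have "summable (\<lambda>i::nat. \<mu> {})" by (rule sums_summable)
  then show ?thesis by (simp add: summable_const_iff)
qed

definition nonneg_cmeas :: "'a::t2_space cmeas \<Rightarrow> bool" where
  "nonneg_cmeas \<mu> \<longleftrightarrow> complex_borel_measure \<mu> \<and> (\<forall>A. \<mu> A \<in> \<real>\<^sub>\<ge>\<^sub>0)"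

lemma nonneg_cmeas_re:
  assumes "nonneg_cmeas \<mu>"
  shows "\<mu> A = complex_of_real (Re (\<mu> A))" "0 \<le> Re (\<mu> A)"
  using assms by (auto simp: nonneg_cmeas_def complex_nonneg_Reals_iff complex_eq_iff)

lemma sigma_algebra_borel: "sigma_algebra UNIV (sets (borel :: 'a::topological_space measure))"
  using sets.sigma_algebra_axioms[of "borel :: 'a measure"] by simp

lemma sets_pos_measure [simp, measurable_cong]: "sets (pos_measure \<mu>) = sets borel"
  unfolding pos_measure_def by (rule sigma_algebra.sets_measure_of_eq[OF sigma_algebra_borel])

lemma space_pos_measure [simp]: "space (pos_measure \<mu>) = UNIV"
  unfolding pos_measure_def by (rule space_measure_of_conv)

lemma emeasure_pos_measure:
  fixes \<mu> :: "'a::t2_space cmeas"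
  assumes \<mu>: "nonneg_cmeas \<mu>" and A: "A \<in> sets borel"
  shows "emeasure (pos_measure \<mu>) A = ennreal (Re (\<mu> A))"
  unfolding pos_measure_def
proof (rule emeasure_measure_of_sigma[OF sigma_algebra_borel _ _ A])
  have cb: "complex_borel_measure \<mu>" using \<mu> by (simp add: nonneg_cmeas_def)
  show "positive (sets borel) (\<lambda>A. ennreal (Re (\<mu> A)))"
    by (simp add: positive_def complex_borel_measure_empty[OF cb])
  show "countably_additive (sets borel) (\<lambda>A. ennreal (Re (\<mu> A)))"
    unfolding countably_additive_def
  proof (intro allI impI)
    fix A :: "nat \<Rightarrow> 'a set" assume "range A \<subseteq> sets borel" "disjoint_family A"
    then have "(\<lambda>i. \<mu> (A i)) sums \<mu> (\<Union>i. A i)" using cb by (simp add: complex_borel_measure_def)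
    then have "(\<lambda>i. Re (\<mu> (A i))) sums Re (\<mu> (\<Union>i. A i))" by (rule sums_Re)
    then show "(\<Sum>i. ennreal (Re (\<mu> (A i)))) = ennreal (Re (\<mu> (\<Union> (range A))))"
      using nonneg_cmeas_re(2)[OF \<mu>] by (intro suminf_ennreal_eq) auto
  qed
qed

lemma finite_measure_pos_measure: "nonneg_cmeas \<mu> \<Longrightarrow> finite_measure (pos_measure \<mu>)"
  by (intro finite_measureI) (simp add: emeasure_pos_measure)

text \<open>A nonnegative measure is its own variation, so that membership in the cone means that the associated
  library measure is a Radon measure.\<close>

lemma variation_measure_nonneg:
  assumes \<mu>: "nonneg_cmeas \<mu>"
  shows "variation_measure \<mu> = pos_measure \<mu>"
proof -
  have cm: "ennreal (cmod (\<mu> A)) = ennreal (Re (\<mu> A))" for A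
    by (subst nonneg_cmeas_re(1)[OF \<mu>]) (simp add: nonneg_cmeas_re(2)[OF \<mu>])
  have tv: "total_variation \<mu> A = ennreal (Re (\<mu> A))" if A: "A \<in> sets borel" for A
  proof -
    have "(\<Sum>B\<in>P. ennreal (cmod (\<mu> B))) = ennreal (Re (\<mu> A))"
      if P: "finite P" "disjoint P" "P \<subseteq> sets borel" "\<Union>P = A" for P
    proof -
      have "(\<Sum>B\<in>P. ennreal (cmod (\<mu> B))) = (\<Sum>B\<in>P. emeasure (pos_measure \<mu>) B)"
        using P(3) by (intro sum.cong) (auto simp: cm emeasure_pos_measure[OF \<mu>])
      also have "\<dots> = emeasure (pos_measure \<mu>) (\<Union>B\<in>P. B)"
        using P by (intro sum_emeasure) (auto simp: disjoint_family_on_def disjoint_def)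
      finally show ?thesis using P A by (simp add: emeasure_pos_measure[OF \<mu>])
    qed
    moreover have "{A} \<in> {P. finite P \<and> disjoint P \<and> P \<subseteq> sets borel \<and> \<Union>P = A}" using A by (simp add: disjoint_def)
    ultimately show ?thesis unfolding total_variation_def
      by (intro antisym SUP_least SUP_upper2[of "{A}"]) (auto simp: cm)
  qed
  show ?thesis unfolding variation_measure_def pos_measure_def
    by (rule measure_of_eq) (auto simp: tv sigma_algebra.sigma_sets_eq[OF sigma_algebra_borel])
qed

lemma M_pos_iff: "\<mu> \<in> M_pos \<longleftrightarrow> nonneg_cmeas \<mu> \<and> radon_measure (pos_measure \<mu>)"
  using variation_measure_nonneg[of \<mu>] by (auto simp: M_pos_def M_space_def nonneg_cmeas_def)

lemma M_posD:
  assumes "\<mu> \<in> M_pos"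
  shows "nonneg_cmeas \<mu>" "radon_measure (pos_measure \<mu>)" "finite_measure (pos_measure \<mu>)" "\<mu> \<in> M_space"
proof -
  show nn: "nonneg_cmeas \<mu>" and "radon_measure (pos_measure \<mu>)" using assms by (auto simp: M_pos_iff)
  show "finite_measure (pos_measure \<mu>)" by (rule finite_measure_pos_measure[OF nn])
  show "\<mu> \<in> M_space" using assms by (simp add: M_pos_def)
qed

definition discrete :: "'a::t2_space set \<Rightarrow> ('a \<Rightarrow> real) \<Rightarrow> 'a cmeas" where
  "discrete W c = (\<lambda>A. \<Sum>w\<in>W. complex_of_real (c w) * point_mass w A)"

lemma discrete_eq:
  "A \<in> sets borel \<Longrightarrow> finite W \<Longrightarrow> discrete W c A = complex_of_real (\<Sum>w\<in>W \<inter> A. c w)"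
proof -
  assume A: "A \<in> sets borel" and W: "finite W"
  have "discrete W c A = (\<Sum>w\<in>W. complex_of_real (if w \<in> A then c w else 0))"
    unfolding discrete_def by (rule sum.cong) (use A in \<open>auto simp: point_mass_def\<close>)
  then show ?thesis using W by (simp add: sum.inter_restrict flip: of_real_sum)
qed

lemma point_mass_complex: "complex_borel_measure (point_mass x)"
  unfolding complex_borel_measure_def
proof (intro conjI allI impI)
  fix A :: "nat \<Rightarrow> 'a set" assume A: "range A \<subseteq> sets borel" and dj: "disjoint_family A"
  have U: "(\<Union>i. A i) \<in> sets borel" using A by auto
  show "(\<lambda>i. point_mass x (A i)) sums point_mass x (\<Union>i. A i)"
  proof (cases "\<exists>i. x \<in> A i")
    case True
    then obtain i where i: "x \<in> A i" by blast
    have "(\<lambda>j. point_mass x (A j)) = (\<lambda>j. if j = i then 1 else 0)"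
    proof
      fix j show "point_mass x (A j) = (if j = i then 1 else 0)"
        using i A disjoint_family_onD[OF dj, of i j] by (auto simp: point_mass_def)
    qed
    moreover have "point_mass x (\<Union>i. A i) = 1" using i U by (auto simp: point_mass_def)
    ultimately show ?thesis using sums_single[of i "\<lambda>_. 1::complex"] by simp
  qed (simp add: point_mass_def)
qed (simp add: point_mass_def)

lemma discrete_M_pos:
  assumes W: "finite W" and c: "\<And>w. 0 \<le> c w"
  shows "discrete W c \<in> M_pos"
proof -
  have "complex_borel_measure (discrete W c)"
    unfolding complex_borel_measure_def
  proof (intro conjI allI impI)
    fix A :: "nat \<Rightarrow> 'a set" assume "range A \<subseteq> sets borel" "disjoint_family A"
    then have "(\<lambda>i. point_mass w (A i)) sums point_mass w (\<Union>i. A i)" for w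
      using point_mass_complex[of w] by (simp add: complex_borel_measure_def)
    then show "(\<lambda>i. discrete W c (A i)) sums discrete W c (\<Union>i. A i)"
      unfolding discrete_def by (intro sums_sum sums_mult)
  qed (simp add: discrete_def point_mass_def)
  moreover have "discrete W c A \<in> \<real>\<^sub>\<ge>\<^sub>0" for A
  proof (cases "A \<in> sets borel")
    case True then show ?thesis using c by (simp add: discrete_eq[OF _ W] sum_nonneg del: of_real_sum)
  next
    case False then show ?thesis by (simp add: discrete_def point_mass_def)
  qed
  ultimately have nn: "nonneg_cmeas (discrete W c)" by (simp add: nonneg_cmeas_def)
  have em: "emeasure (pos_measure (discrete W c)) A = ennreal (\<Sum>w\<in>W \<inter> A. c w)" if "A \<in> sets borel" for A
    using that by (simp add: emeasure_pos_measure[OF nn] discrete_eq[OF _ W])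
  have "radon_measure (pos_measure (discrete W c))"
    unfolding radon_measure_def
  proof (intro conjI allI ballI impI)
    show "emeasure (pos_measure (discrete W c)) K < \<infinity>" if "compact K" for K
      using that by (simp add: em borel_compact)
    show "emeasure (pos_measure (discrete W c)) A = (INF U\<in>{U. open U \<and> A \<subseteq> U}. emeasure (pos_measure (discrete W c)) U)"
      if A: "A \<in> sets borel" for A
    proof (rule antisym)
      show "emeasure (pos_measure (discrete W c)) A \<le> (INF U\<in>{U. open U \<and> A \<subseteq> U}. emeasure (pos_measure (discrete W c)) U)"
        by (intro INF_greatest emeasure_mono) auto
      have "open (- (W - A))" using W by (intro open_Compl finite_imp_closed) simp
      moreover have "W \<inter> - (W - A) = W \<inter> A" by auto
      ultimately show "(INF U\<in>{U. open U \<and> A \<subseteq> U}. emeasure (pos_measure (discrete W c)) U) \<le> emeasure (pos_measure (discrete W c)) A"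
        using A by (intro INF_lower2[of "- (W - A)"]) (auto simp: em)
    qed
    show "emeasure (pos_measure (discrete W c)) U = (SUP K\<in>{K. compact K \<and> K \<subseteq> U}. emeasure (pos_measure (discrete W c)) K)"
      if U: "open U" for U
    proof (rule antisym)
      have "compact (W \<inter> U)" using W by (intro finite_imp_compact) simp
      then show "emeasure (pos_measure (discrete W c)) U \<le> (SUP K\<in>{K. compact K \<and> K \<subseteq> U}. emeasure (pos_measure (discrete W c)) K)"
        using U by (intro SUP_upper2[of "W \<inter> U"]) (auto simp: em borel_compact)
      show "(SUP K\<in>{K. compact K \<and> K \<subseteq> U}. emeasure (pos_measure (discrete W c)) K) \<le> emeasure (pos_measure (discrete W c)) U"
        using U by (intro SUP_least emeasure_mono) auto
    qed
  qed simp
  then show ?thesis using nn by (simp add: M_pos_iff)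
qed

lemma point_mass_discrete: "point_mass x = discrete {x} (\<lambda>_. 1)"
  by (simp add: discrete_def)

lemma point_mass_M_pos: "point_mass x \<in> M_pos"
  unfolding point_mass_discrete by (rule discrete_M_pos) auto

lemma integral_point_mass:
  fixes f :: "'a::t2_space \<Rightarrow> 'b::{banach, second_countable_topology}"
  assumes f: "f \<in> borel_measurable borel"
  shows "(LINT y|pos_measure (point_mass x). f y) = f x"
proof -
  let ?N = "pos_measure (point_mass x)"
  note nn = M_posD(1)[OF point_mass_M_pos[of x]]
  have [measurable]: "f \<in> borel_measurable ?N" using f by simp
  have "emeasure ?N (- {x}) = 0" by (subst emeasure_pos_measure[OF nn]) (simp_all add: point_mass_def)
  then have "AE y in ?N. y = x" by (intro AE_I[of _ _ "- {x}"]) auto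
  then have "(LINT y|?N. f y) = (LINT y|?N. f x)" by (intro integral_cong_AE) auto
  also have "\<dots> = measure ?N UNIV *\<^sub>R f x" by simp
  also have "measure ?N UNIV = 1" 
    unfolding measure_def by (subst emeasure_pos_measure[OF nn]) (simp_all add: point_mass_def)
  finally show ?thesis by simp
qed

lemma nn_integral_pos_measure_sum:
  assumes W: "finite W" and c: "\<And>w. w \<in> W \<Longrightarrow> 0 \<le> c w" and \<mu>: "\<And>w. w \<in> W \<Longrightarrow> nonneg_cmeas (\<mu> w)"
    and S: "nonneg_cmeas S" "\<And>A. S A = (\<Sum>w\<in>W. complex_of_real (c w) * \<mu> w A)"
    and f: "f \<in> borel_measurable borel"
  shows "(\<integral>\<^sup>+x. f x \<partial>pos_measure S) = (\<Sum>w\<in>W. ennreal (c w) * (\<integral>\<^sup>+x. f x \<partial>pos_measure (\<mu> w)))"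
  using f
proof (induction rule: borel_measurable_induct)
  case (cong f g)
  then have "f = g" by auto
  then show ?case using cong by simp
next
  case (set A)
  have "ennreal (Re (S A)) = (\<Sum>w\<in>W. ennreal (c w) * ennreal (Re (\<mu> w A)))"
    using c nonneg_cmeas_re(2)[OF \<mu>] by (simp add: S(2) ennreal_mult[symmetric] sum_ennreal)
  then show ?case using set by (simp add: emeasure_pos_measure[OF S(1)] emeasure_pos_measure[OF \<mu>])
next
  case (mult u d)
  then show ?case by (simp add: nn_integral_cmult sum_distrib_left mult.left_commute)
next
  case (add u v)
  then show ?case by (simp add: nn_integral_add distrib_left sum.distrib)
next
  case (seq U)
  have lim: "(\<lambda>i. \<integral>\<^sup>+x. U i x \<partial>N) \<longlonglongrightarrow> (\<integral>\<^sup>+x. (SUP i. U i) x \<partial>N)" if N: "sets N = sets borel" for N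
  proof -
    have m: "U i \<in> borel_measurable N" for i using seq(1) N measurable_cong_sets by blast
    have "(\<integral>\<^sup>+x. (SUP i. U i) x \<partial>N) = (SUP i. \<integral>\<^sup>+x. U i x \<partial>N)"
      using nn_integral_monotone_convergence_SUP[OF seq(3) m] by (simp add: image_comp)
    moreover have "incseq (\<lambda>i. \<integral>\<^sup>+x. U i x \<partial>N)"
      using seq(3) by (auto simp: incseq_def le_fun_def intro!: nn_integral_mono)
    ultimately show ?thesis using LIMSEQ_SUP by metis
  qed
  have "(\<lambda>i. \<Sum>w\<in>W. ennreal (c w) * (\<integral>\<^sup>+x. U i x \<partial>pos_measure (\<mu> w))) \<longlonglongrightarrow>
     (\<Sum>w\<in>W. ennreal (c w) * (\<integral>\<^sup>+x. (SUP i. U i) x \<partial>pos_measure (\<mu> w)))"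
    by (intro tendsto_sum ennreal_tendsto_cmult lim) auto
  moreover have "(\<lambda>i. \<Sum>w\<in>W. ennreal (c w) * (\<integral>\<^sup>+x. U i x \<partial>pos_measure (\<mu> w))) \<longlonglongrightarrow> (\<integral>\<^sup>+x. (SUP i. U i) x \<partial>pos_measure S)"
    using lim[of "pos_measure S"] unfolding seq.IH by simp
  ultimately show ?case by (rule LIMSEQ_unique[THEN sym])
qed

lemma integrable_pos_measure:
  fixes f :: "'a::t2_space \<Rightarrow> 'b::{banach, second_countable_topology}"
  assumes "nonneg_cmeas \<mu>" "f \<in> borel_measurable borel" "\<And>x. norm (f x) \<le> B"
  shows "integrable (pos_measure \<mu>) f"
  using assms by (intro finite_measure.integrable_const_bound[OF finite_measure_pos_measure[OF assms(1)], of _ B]) auto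

lemma integral_pos_measure_sum:
  fixes f :: "'a::t2_space \<Rightarrow> complex"
  assumes W: "finite W" and c: "\<And>w. w \<in> W \<Longrightarrow> 0 \<le> c w" and \<mu>: "\<And>w. w \<in> W \<Longrightarrow> nonneg_cmeas (\<mu> w)"
    and S: "nonneg_cmeas S" "\<And>A. S A = (\<Sum>w\<in>W. complex_of_real (c w) * \<mu> w A)"
    and f: "f \<in> borel_measurable borel" "bounded (range f)"
  shows "(LINT x|pos_measure S. f x) = (\<Sum>w\<in>W. complex_of_real (c w) * (LINT x|pos_measure (\<mu> w). f x))"
proof -
  obtain B where B: "\<And>x. cmod (f x) \<le> B" using f(2) by (auto simp: bounded_iff)
  define P where "P = (\<lambda>f. f \<in> borel_measurable borel \<and> (\<exists>B. \<forall>x. cmod (f x) \<le> B) \<and>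
     (LINT x|pos_measure S. f x) = (\<Sum>w\<in>W. complex_of_real (c w) * (LINT x|pos_measure (\<mu> w). f x)))"
  have "P f"
  proof (rule complex_parts_induct[of P f])
    fix h :: "complex \<Rightarrow> real" assume h: "continuous_on UNIV h" "\<And>z. 0 \<le> h z \<and> h z \<le> cmod z"
    have hm: "(\<lambda>x. h (f x)) \<in> borel_measurable borel"
      using f(1) borel_measurable_continuous_onI[OF h(1)] by (rule measurable_compose)
    have le: "norm (h (f x)) \<le> B" for x using h(2)[of "f x"] B[of x] by simp
    have e: "(\<integral>\<^sup>+x. ennreal (h (f x)) \<partial>pos_measure \<nu>) = ennreal (LINT x|pos_measure \<nu>. h (f x))" if "nonneg_cmeas \<nu>" for \<nu>
      by (rule nn_integral_real[OF integrable_pos_measure[OF that hm le]]) (simp add: h)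
    have "ennreal (LINT x|pos_measure S. h (f x)) = (\<Sum>w\<in>W. ennreal (c w) * ennreal (LINT x|pos_measure (\<mu> w). h (f x)))"
      using nn_integral_pos_measure_sum[OF W c \<mu> S, of "\<lambda>x. ennreal (h (f x))"] hm by (simp add: e S(1) \<mu>)
    also have "\<dots> = ennreal (\<Sum>w\<in>W. c w * (LINT x|pos_measure (\<mu> w). h (f x)))"
      using c h by (simp add: ennreal_mult[symmetric] integral_nonneg_AE sum_ennreal)
    finally have "(LINT x|pos_measure S. h (f x)) = (\<Sum>w\<in>W. c w * (LINT x|pos_measure (\<mu> w). h (f x)))"
      using c h by (subst (asm) ennreal_inj) (auto intro!: sum_nonneg integral_nonneg_AE mult_nonneg_nonneg)
    then show "P (\<lambda>x. complex_of_real (h (f x)))"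
      unfolding P_def using hm le h(2) by (auto intro!: exI[of _ B])
  next
    fix f g assume fg: "P f" "P g"
    then obtain A B where AB: "\<And>x. cmod (f x) \<le> A" "\<And>x. cmod (g x) \<le> B" and m: "f \<in> borel_measurable borel" "g \<in> borel_measurable borel"
      unfolding P_def by blast
    have i: "integrable (pos_measure \<nu>) f" "integrable (pos_measure \<nu>) g" if "nonneg_cmeas \<nu>" for \<nu>
      by (rule integrable_pos_measure[OF that m(1) AB(1)], rule integrable_pos_measure[OF that m(2) AB(2)])
    have "\<exists>C. \<forall>x. cmod (f x + g x) \<le> C" using norm_triangle_mono[OF AB] by blast
    then show "P (\<lambda>x. f x + g x)"
      using fg m by (simp add: P_def i S(1) \<mu> distrib_left sum.distrib)
  next
    fix d f assume f: "P f"
    then obtain A where A: "\<And>x. cmod (f x) \<le> A" unfolding P_def by blast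
    have "\<exists>C. \<forall>x. cmod (d * f x) \<le> C"
      using A by (auto simp: norm_mult intro!: exI[of _ "cmod d * A"] mult_left_mono)
    then show "P (\<lambda>x. d * f x)"
      using f borel_measurable_times[OF borel_measurable_const, of f borel d]
      by (simp add: P_def sum_distrib_left mult.left_commute)
  qed
  then show ?thesis by (simp add: P_def)
qed

lemma integral_discrete:
  fixes f :: "'a::t2_space \<Rightarrow> complex"
  assumes W: "finite W" and c: "\<And>w. 0 \<le> c w" and f: "f \<in> borel_measurable borel" "bounded (range f)"
  shows "(LINT x|pos_measure (discrete W c). f x) = (\<Sum>w\<in>W. complex_of_real (c w) * f w)"
  using integral_pos_measure_sum[OF W c _ M_posD(1)[OF discrete_M_pos[OF W c]] _ f, of point_mass]
  by (simp add: M_posD(1)[OF point_mass_M_pos] discrete_def integral_point_mass[OF f(1)])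

text \<open>Finitely supported measures are dense in the cone. Finitely many bounded Borel functions are almost
  constant on the pieces of a finite Borel partition; each piece contributes its mass at one of its points.\<close>

lemma discrete_approx:
  fixes \<mu> :: "'a::t2_space cmeas"
  assumes \<mu>: "nonneg_cmeas \<mu>" and T: "finite T" "\<And>f. f \<in> T \<Longrightarrow> f \<in> borel_measurable borel \<and> bounded (range f)" and e: "0 < e"
  obtains W c where "finite W" "\<And>w. 0 \<le> c w"
    "\<And>f. f \<in> T \<Longrightarrow> cmod ((\<Sum>w\<in>W. complex_of_real (c w) * f w) - (LINT x|pos_measure \<mu>. f x)) < e"
proof -
  let ?N = "pos_measure \<mu>"
  interpret N: finite_measure ?N by (rule finite_measure_pos_measure[OF \<mu>])
  define d where "d = e / (2 * (measure ?N UNIV + 1))"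
  have d: "0 < d" "2 * d * measure ?N UNIV < e"
    using e measure_nonneg[of ?N UNIV] by (auto simp: d_def field_simps add_pos_nonneg)
  \<comment> \<open>The square of side \<open>d\<close> that contains \<open>f x\<close>; \<open>q\<close> collects these squares for all \<open>f \<in> T\<close>, and \<open>r x\<close> is a
    representative of the piece on which \<open>q\<close> is constant.\<close>
  define q1 where "q1 = (\<lambda>f (x::'a). (\<lfloor>Re (f x) / d\<rfloor>, \<lfloor>Im (f x) / d\<rfloor>))"
  define q where "q = (\<lambda>x. restrict (\<lambda>f. q1 f x) T)"
  define r where "r = (\<lambda>x. SOME y. q y = q x)"
  have qr: "q (r x) = q x" for x unfolding r_def by (rule someI[of _ x]) simp
  have rq: "r x = r y" if "q x = q y" for x y using that by (simp add: r_def)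
  have fin1: "finite (range (q1 f))" if f: "f \<in> T" for f
  proof -
    obtain B where B: "\<And>x. cmod (f x) \<le> B" using T(2)[OF f] by (auto simp: bounded_iff)
    have "\<lfloor>t / d\<rfloor> \<in> {\<lfloor>- B / d\<rfloor>..\<lfloor>B / d\<rfloor>}" if "\<bar>t\<bar> \<le> B" for t
    proof -
      have "- B \<le> t" "t \<le> B" using that by auto
      then show ?thesis using d(1) floor_mono[OF divide_right_mono[of "- B" t d]] floor_mono[OF divide_right_mono[of t B d]] by simp
    qed
    then have "range (q1 f) \<subseteq> {\<lfloor>- B / d\<rfloor>..\<lfloor>B / d\<rfloor>} \<times> {\<lfloor>- B / d\<rfloor>..\<lfloor>B / d\<rfloor>}"
      unfolding q1_def using B abs_Re_le_cmod abs_Im_le_cmod order_trans by blast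
    then show ?thesis by (rule finite_subset) simp
  qed
  have "range q \<subseteq> PiE T (\<lambda>f. range (q1 f))" by (auto simp: q_def)
  then have "finite (range q)" by (rule finite_subset) (rule finite_PiE[OF T(1) fin1])
  moreover have "range r \<subseteq> (\<lambda>v. SOME y. q y = v) ` range q" by (auto simp: r_def)
  ultimately have finr: "finite (range r)" by (auto intro: finite_subset)
  have close: "cmod (f (r x) - f x) \<le> 2 * d" if f: "f \<in> T" for f x
  proof -
    have "q1 f (r x) = q1 f x" using fun_cong[OF qr[of x], of f] f by (simp add: q_def)
    then have fl: "\<lfloor>Re (f (r x)) / d\<rfloor> = \<lfloor>Re (f x) / d\<rfloor>" "\<lfloor>Im (f (r x)) / d\<rfloor> = \<lfloor>Im (f x) / d\<rfloor>" by (auto simp: q1_def)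
    have "\<bar>s - t\<bar> \<le> d" if "\<lfloor>s / d\<rfloor> = \<lfloor>t / d\<rfloor>" for s t
    proof -
      have "\<bar>s / d - t / d\<bar> \<le> 1" using that by linarith
      then show ?thesis using d(1) by (simp add: diff_divide_distrib[symmetric] abs_divide pos_divide_le_eq)
    qed
    from this[OF fl(1)] this[OF fl(2)] show ?thesis
      using cmod_le[of "f (r x) - f x"] by simp
  qed
  have rm: "r -` {w} \<in> sets borel" for w
  proof (cases "w \<in> range r")
    case True
    then obtain z where z: "w = r z" by blast
    have "r -` {w} = {x. q x = q z}"
    proof (intro set_eqI iffI)
      fix x assume "x \<in> r -` {w}"
      then have "r x = r z" using z by simp
      then have "q (r x) = q (r z)" by simp
      then show "x \<in> {x. q x = q z}" unfolding qr by simp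
    next
      fix x assume "x \<in> {x. q x = q z}"
      then have "r x = r z" by (intro rq) simp
      then show "x \<in> r -` {w}" using z by simp
    qed
    also have "\<dots> = {x \<in> space borel. \<forall>f\<in>T. q1 f x = q1 f z}"
    proof (intro set_eqI iffI)
      fix x assume "x \<in> {x. q x = q z}"
      then have "q x f = q z f" for f by simp
      then have "restrict (\<lambda>f. q1 f x) T f = restrict (\<lambda>f. q1 f z) T f" for f unfolding q_def .
      then have "q1 f x = q1 f z" if "f \<in> T" for f using restrict_apply' that by metis
      then show "x \<in> {x \<in> space borel. \<forall>f\<in>T. q1 f x = q1 f z}" by simp
    next
      fix x assume "x \<in> {x \<in> space borel. \<forall>f\<in>T. q1 f x = q1 f z}"
      then have "restrict (\<lambda>f. q1 f x) T = restrict (\<lambda>f. q1 f z) T" by (intro restrict_ext) blast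
      then show "x \<in> {x. q x = q z}" by (simp add: q_def)
    qed
    also have "\<dots> \<in> sets borel"
    proof (rule sets.sets_Collect_finite_All[OF _ T(1)])
      fix f assume "f \<in> T"
      then have [measurable]: "f \<in> borel_measurable borel" using T(2) by blast
      have "{x \<in> space borel. \<lfloor>Re (f x) / d\<rfloor> = fst (q1 f z) \<and> \<lfloor>Im (f x) / d\<rfloor> = snd (q1 f z)} \<in> sets borel"
        by measurable
      then show "{x \<in> space borel. q1 f x = q1 f z} \<in> sets borel" by (simp add: q1_def prod_eq_iff)
    qed
    finally show ?thesis .
  next
    case False
    then have "r -` {w} = {}" by auto
    then show ?thesis by simp
  qed
  show thesis
  proof (rule that[of "range r" "\<lambda>w. measure ?N (r -` {w})"])
    fix f assume f: "f \<in> T"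
    obtain B where B: "\<And>x. cmod (f x) \<le> B" using T(2)[OF f] by (auto simp: bounded_iff)
    have fm[measurable]: "f \<in> borel_measurable borel" using T(2)[OF f] by blast
    have rep: "f (r x) = (\<Sum>w\<in>range r. indicator (r -` {w}) x * f w)" for x
    proof -
      have "(\<Sum>w\<in>range r. indicator (r -` {w}) x * f w) = (\<Sum>w\<in>range r. if w = r x then f w else 0)"
        by (rule sum.cong) (auto simp: indicator_def)
      then show ?thesis using finr by simp
    qed
    have frm: "(\<lambda>x. f (r x)) \<in> borel_measurable borel"
      unfolding rep using rm by (intro borel_measurable_sum borel_measurable_times) auto
    have ii: "integrable ?N (\<lambda>x. indicator (r -` {w}) x * f w)" for w
    proof (rule integrable_pos_measure[OF \<mu>, where B = "cmod (f w)"])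
      show "(\<lambda>x. indicator (r -` {w}) x * f w) \<in> borel_measurable borel"
        by (intro borel_measurable_times borel_measurable_indicator rm borel_measurable_const)
      show "norm (indicator (r -` {w}) x * f w) \<le> cmod (f w)" for x by (auto simp: indicator_def)
    qed
    have "(LINT x|?N. f (r x)) = (\<Sum>w\<in>range r. LINT x|?N. indicator (r -` {w}) x * f w)"
      unfolding rep by (rule Bochner_Integration.integral_sum) (rule ii)
    also have "\<dots> = (\<Sum>w\<in>range r. complex_of_real (measure ?N (r -` {w})) * f w)"
    proof (rule sum.cong)
      fix w
      have "(LINT x|?N. indicator (r -` {w}) x * f w) = (LINT x|?N. indicator (r -` {w}) x *\<^sub>R f w)"
        by (rule Bochner_Integration.integral_cong) (auto simp: indicator_def)
      then show "(LINT x|?N. indicator (r -` {w}) x * f w) = complex_of_real (measure ?N (r -` {w})) * f w"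
        using rm[of w] by (simp add: scaleR_conv_of_real)
    qed simp
    finally have "(\<Sum>w\<in>range r. complex_of_real (measure ?N (r -` {w})) * f w) - (LINT x|?N. f x) = (LINT x|?N. f (r x)) - (LINT x|?N. f x)" by simp
    also have "\<dots> = (LINT x|?N. f (r x) - f x)"
      by (rule Bochner_Integration.integral_diff[symmetric]) (rule integrable_pos_measure[OF \<mu> _ B], simp add: frm fm)+
    finally have "cmod ((\<Sum>w\<in>range r. complex_of_real (measure ?N (r -` {w})) * f w) - (LINT x|?N. f x)) = cmod (LINT x|?N. f (r x) - f x)" by simp
    also have "\<dots> \<le> (LINT x|?N. cmod (f (r x) - f x))" by simp
    also have "\<dots> \<le> (LINT x|?N. 2 * d)"
    proof (rule integral_mono)
      show "integrable ?N (\<lambda>x. cmod (f (r x) - f x))"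
        by (rule integrable_pos_measure[OF \<mu>, where B = "2 * d"]) (use frm fm close[OF f] in auto)
    qed (auto simp: close[OF f])
    also have "\<dots> = 2 * d * measure ?N UNIV" by simp
    also have "\<dots> < e" by (rule d(2))
    finally show "cmod ((\<Sum>w\<in>range r. complex_of_real (measure ?N (r -` {w})) * f w) - (LINT x|?N. f x)) < e" .
  qed (use finr in auto)
qed

section \<open>Translations on a hypergroup\<close>

text \<open>The sets that generate the topology of the cone, named so that neighbourhoods can be found by
  induction on the generated topology.\<close>

definition cone_subbase :: "'a::t2_space cmeas set set" where
  "cone_subbase = {{\<mu>\<in>M_pos. (LINT x|pos_measure \<mu>. f x) \<in> W} | (f :: 'a \<Rightarrow> complex) W.
        f \<in> Cc \<union> {\<lambda>_. 1} \<and> open W}"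

lemma cone_topology_subbase: "cone_topology = topology_generated_by cone_subbase"
  by (simp add: cone_topology_def cone_subbase_def)

lemma Union_cone_subbase: "\<Union>cone_subbase = (M_pos :: ('a::t2_space) cmeas set)"
proof
  show "\<Union>cone_subbase \<subseteq> (M_pos :: 'a cmeas set)" by (auto simp: cone_subbase_def)
  have "(M_pos :: 'a cmeas set) = {\<mu>\<in>M_pos. (LINT x|pos_measure \<mu>. (\<lambda>_. 1) x) \<in> (UNIV :: complex set)}" by simp
  then have "(M_pos :: 'a cmeas set) \<in> cone_subbase" unfolding cone_subbase_def by blast
  then show "(M_pos :: 'a cmeas set) \<subseteq> \<Union>cone_subbase" by blast
qed

lemma topspace_cone: "topspace (cone_topology :: ('a::t2_space) cmeas topology) = M_pos"
  unfolding cone_topology_subbase topology_generated_by_topspace by (rule Union_cone_subbase)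

lemma openin_cone:
  assumes "f \<in> Cc \<union> {\<lambda>_. 1}" "open W"
  shows "openin cone_topology {\<mu>\<in>M_pos. (LINT x|pos_measure \<mu>. f x) \<in> W}"
  unfolding cone_topology_def using assms by (intro topology_generated_by_Basis) blast

lemma continuous_map_cone_integral:
  assumes "f \<in> Cc"
  shows "continuous_map cone_topology euclidean (\<lambda>\<mu>. LINT x|pos_measure \<mu>. f x)"
  unfolding continuous_map_def using openin_cone[of f] assms by (auto simp: topspace_cone)

lemma test_function_bounded:
  assumes "f \<in> Cc \<union> {\<lambda>_. 1}"
  shows "f \<in> borel_measurable borel" "bounded (range f)"
proof -
  have "f \<in> Cb" using assms Cc_Cb Cb_const[of 1] by auto
  then show "f \<in> borel_measurable borel" "bounded (range f)"
    using Cb_measurable[of f borel] by (auto simp: Cb_def)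
qed

lemma continuous_map_point_mass: "continuous_map euclidean cone_topology (point_mass :: 'a::t2_space \<Rightarrow> _)"
  unfolding cone_topology_subbase
proof (rule continuous_on_generated_topo)
  fix U :: "'a cmeas set"
  assume "U \<in> cone_subbase"
  then obtain f W where U: "U = {\<mu>\<in>M_pos. (LINT x|pos_measure \<mu>. f x) \<in> W}" and f: "f \<in> Cc \<union> {\<lambda>_. 1}" and W: "open (W :: complex set)"
    unfolding cone_subbase_def by blast
  have "continuous_on UNIV f" using f by (auto simp: Cc_def)
  then have "open (f -` W)" using W by (intro open_vimage)
  moreover have "point_mass -` U = f -` W"
    unfolding U vimage_def mem_Collect_eq integral_point_mass[OF test_function_bounded(1)[OF f]]
    by (simp add: point_mass_M_pos)
  ultimately show "openin euclidean (point_mass -` U \<inter> topspace euclidean)" by simp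
next
  show "point_mass ` topspace euclidean \<subseteq> \<Union>(cone_subbase :: 'a cmeas set set)"
    unfolding Union_cone_subbase using point_mass_M_pos by auto
qed

lemma cone_nbhd:
  assumes "openin cone_topology V" "\<mu> \<in> V"
  shows "\<exists>T e. finite T \<and> T \<subseteq> Cc \<union> {\<lambda>_. 1} \<and> 0 < e \<and>
    (\<forall>\<rho>\<in>M_pos. (\<forall>f\<in>T. cmod ((LINT x|pos_measure \<rho>. f x) - (LINT x|pos_measure \<mu>. f x)) < e) \<longrightarrow> \<rho> \<in> V)"
proof -
  have "generate_topology_on cone_subbase V"
    using assms(1) by (simp add: cone_topology_subbase openin_topology_generated_by_iff)
  then show ?thesis using assms(2)
  proof (induction V)
    case (Int A B)
    then obtain T e S d where T: "finite T" "T \<subseteq> Cc \<union> {\<lambda>_. 1}" "0 < e"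
        "\<And>\<rho>. \<rho>\<in>M_pos \<Longrightarrow> (\<forall>f\<in>T. cmod ((LINT x|pos_measure \<rho>. f x) - (LINT x|pos_measure \<mu>. f x)) < e) \<Longrightarrow> \<rho> \<in> A"
      and S: "finite S" "S \<subseteq> Cc \<union> {\<lambda>_. 1}" "0 < d"
        "\<And>\<rho>. \<rho>\<in>M_pos \<Longrightarrow> (\<forall>f\<in>S. cmod ((LINT x|pos_measure \<rho>. f x) - (LINT x|pos_measure \<mu>. f x)) < d) \<Longrightarrow> \<rho> \<in> B"
      by (auto; blast)
    show ?case
    proof (intro exI[of _ "T \<union> S"] exI[of _ "min e d"] conjI ballI impI)
      fix \<rho> assume "\<rho> \<in> M_pos" "\<forall>f\<in>T \<union> S. cmod ((LINT x|pos_measure \<rho>. f x) - (LINT x|pos_measure \<mu>. f x)) < min e d"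
      then show "\<rho> \<in> A \<inter> B" using T(4) S(4) by simp
    qed (use T S in auto)
  next
    case (UN K)
    then obtain k where k: "k \<in> K" "\<mu> \<in> k" by blast
    from UN.IH[OF k] k(1) show ?case by (elim exE conjE) (intro exI conjI; blast)
  next
    case (Basis s)
    then obtain f W where s: "s = {\<mu>\<in>M_pos. (LINT x|pos_measure \<mu>. f x) \<in> W}" and f: "f \<in> Cc \<union> {\<lambda>_. 1}" and W: "open (W :: complex set)"
      unfolding cone_subbase_def by blast
    have "(LINT x|pos_measure \<mu>. f x) \<in> W" using Basis.prems s by blast
    from openE[OF W this] obtain e where e: "0 < e" "ball (LINT x|pos_measure \<mu>. f x) e \<subseteq> W" by blast
    show ?case
    proof (intro exI[of _ "{f}"] exI[of _ e] conjI ballI impI)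
      fix \<rho> assume "\<rho> \<in> M_pos" "\<forall>f\<in>{f}. cmod ((LINT x|pos_measure \<rho>. f x) - (LINT x|pos_measure \<mu>. f x)) < e"
      then show "\<rho> \<in> s" using e(2) unfolding s by (auto simp: dist_norm norm_minus_commute subset_iff)
    qed (use f e in auto)
  qed simp
qed

text \<open>A continuous operator on the cone that is additive on finitely supported measures is the integral
  of its values at the point masses, since both sides are continuous in the measure and agree on the
  dense set of finitely supported measures.\<close>

lemma cone_operator_integral:
  assumes Tc: "continuous_map cone_topology cone_topology Tm"
    and lin: "\<And>W c A. finite W \<Longrightarrow> (\<And>w. 0 \<le> c w) \<Longrightarrow> Tm (discrete W c) A = (\<Sum>w\<in>W. complex_of_real (c w) * Tm (point_mass w) A)"
    and bdd: "bounded (range (\<lambda>w. LINT x|pos_measure (Tm (point_mass w)). f x))"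
    and f: "f \<in> Cc" and \<mu>: "\<mu> \<in> M_pos"
  shows "(LINT x|pos_measure (Tm \<mu>). f x) = (LINT w|pos_measure \<mu>. LINT x|pos_measure (Tm (point_mass w)). f x)"
    (is "?L = ?R")
proof -
  define G where "G = (\<lambda>w. LINT x|pos_measure (Tm (point_mass w)). f x)"
  have TM: "Tm \<nu> \<in> M_pos" if "\<nu> \<in> M_pos" for \<nu>
    using Tc that unfolding continuous_map_def topspace_cone by auto
  have Gc: "continuous_on UNIV G"
  proof -
    have "continuous_map euclidean euclidean ((\<lambda>\<mu>. LINT x|pos_measure \<mu>. f x) \<circ> (Tm \<circ> point_mass))"
      by (intro continuous_map_compose[of _ cone_topology] continuous_map_point_mass Tc continuous_map_cone_integral f)
    then show ?thesis by (simp add: G_def comp_def)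
  qed
  have lin_int: "(LINT x|pos_measure (Tm (discrete W c)). f x) = (\<Sum>w\<in>W. complex_of_real (c w) * G w)"
    if "finite W" "\<And>w. 0 \<le> c w" for W c
    unfolding G_def
    by (rule integral_pos_measure_sum[OF that M_posD(1)[OF TM[OF point_mass_M_pos]]
        M_posD(1)[OF TM[OF discrete_M_pos[OF that]]] lin[OF that]]) (use test_function_bounded[of f] f in auto)
  obtain B where B: "\<And>x. cmod (f x) \<le> B" using Cb_bound[OF Cc_Cb[OF f]] by blast
  have small: "cmod (?L - ?R) \<le> e" if e: "0 < e" for e
  proof -
    let ?V = "{\<nu>\<in>M_pos. (LINT x|pos_measure \<nu>. f x) \<in> ball ?L (e/2)}"
    have oV: "openin cone_topology {\<nu> \<in> topspace cone_topology. Tm \<nu> \<in> ?V}"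
      using Tc openin_cone[of f "ball ?L (e/2)"] f unfolding continuous_map_def by auto
    have mV: "\<mu> \<in> {\<nu> \<in> topspace cone_topology. Tm \<nu> \<in> ?V}" using \<mu> TM e by (simp add: topspace_cone)
    from cone_nbhd[OF oV mV] obtain T d where T: "finite T" "T \<subseteq> Cc \<union> {\<lambda>_. 1}" "0 < d"
      and T4: "\<forall>\<rho>\<in>M_pos. (\<forall>f\<in>T. cmod ((LINT x|pos_measure \<rho>. f x) - (LINT x|pos_measure \<mu>. f x)) < d) \<longrightarrow>
         \<rho> \<in> {\<nu> \<in> topspace cone_topology. Tm \<nu> \<in> ?V}"
      by (elim exE conjE) (rule that)
    have G: "G \<in> borel_measurable borel \<and> bounded (range G)"
      using borel_measurable_continuous_onI[OF Gc] bdd by (simp add: G_def)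
    \<comment> \<open>Including \<open>G\<close> among the functions to be approximated makes the right hand side converge as well.\<close>
    obtain W c where W: "finite W" "\<And>w. 0 \<le> c w" and
      app: "\<And>g. g \<in> insert G T \<Longrightarrow> cmod ((\<Sum>w\<in>W. complex_of_real (c w) * g w) - (LINT x|pos_measure \<mu>. g x)) < min d (e/2)"
    proof (rule discrete_approx[OF M_posD(1)[OF \<mu>], of "insert G T" "min d (e/2)"])
      show "g \<in> borel_measurable borel \<and> bounded (range g)" if "g \<in> insert G T" for g
      proof (cases "g = G")
        case True then show ?thesis using G by simp
      next
        case False
        then have "g \<in> Cc \<union> {\<lambda>_. 1}" using that T(2) by blast
        then show ?thesis using test_function_bounded by blast
      qed
    qed (use T e in auto)
    have "discrete W c \<in> {\<nu> \<in> topspace cone_topology. Tm \<nu> \<in> ?V}"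
    proof (rule T4[THEN bspec, THEN mp, OF discrete_M_pos[OF W]], rule ballI)
      fix g assume g: "g \<in> T"
      then have "g \<in> Cc \<union> {\<lambda>_. 1}" using T(2) by blast
      then show "cmod ((LINT x|pos_measure (discrete W c). g x) - (LINT x|pos_measure \<mu>. g x)) < d"
        using app[of g] g by (simp add: integral_discrete[OF W test_function_bounded])
    qed
    then have "cmod (?L - (\<Sum>w\<in>W. complex_of_real (c w) * G w)) < e/2"
      by (simp add: lin_int[OF W] dist_norm)
    moreover have "cmod ((\<Sum>w\<in>W. complex_of_real (c w) * G w) - ?R) < e/2"
      using app[of G] by (simp add: G_def)
    ultimately show ?thesis using norm_triangle_ineq[of "?L - (\<Sum>w\<in>W. complex_of_real (c w) * G w)" "(\<Sum>w\<in>W. complex_of_real (c w) * G w) - ?R"] by simp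
  qed
  have "cmod (?L - ?R) \<le> 0" by (rule dense_ge) (rule small)
  then show ?thesis by simp
qed

text \<open>Meant for integrals \<open>v\<close> of bounded functions against probability measures that depend on a parameter,
  where \<open>B - v\<close> is an integral of the same kind.\<close>

lemma lsc_sandwich_continuous:
  fixes v :: "'a::topological_space \<Rightarrow> real"
  assumes v: "\<And>x. 0 \<le> v x" "\<And>x. v x \<le> B" and l: "lsc (\<lambda>x. ennreal (v x))" "lsc (\<lambda>x. ennreal (B - v x))"
  shows "continuous_on UNIV v"
proof (rule continuous_on_UNIV_I)
  fix x :: 'a and e :: real assume e: "0 < e"
  have low: "eventually (\<lambda>y. u x - e < u y) (nhds x)" if u: "\<And>x. 0 \<le> u x" and lu: "lsc (\<lambda>x. ennreal (u x))" for u
  proof (cases "0 \<le> u x - e")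
    case True
    then have "ennreal (u x - e) < ennreal (u x)" using e u by (simp add: ennreal_less_iff)
    from lscD[OF lu this] show ?thesis by (rule eventually_mono) (use True in \<open>simp add: ennreal_less_iff\<close>)
  next
    case False
    have "u x - e < u y" for y using False u[of y] by linarith
    then show ?thesis by simp
  qed
  have "eventually (\<lambda>y. v x - e < v y) (nhds x)" by (rule low[OF v(1) l(1)])
  moreover have "eventually (\<lambda>y. (B - v x) - e < B - v y) (nhds x)" by (rule low[OF _ l(2)]) (simp add: v)
  ultimately show "eventually (\<lambda>y. norm (v y - v x) < e) (nhds x)"
    by eventually_elim simp
qed

locale hyper =
  fixes H :: "('a::t2_space) hypergroup_struct"
  assumes hyper: "hypergroup H"
begin

abbreviation inv :: "'a \<Rightarrow> 'a" where "inv \<equiv> invol H"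

text \<open>The product \<open>\<delta>\<^sub>x * \<delta>\<^sub>y\<close> as a library measure.\<close>

definition kap :: "'a \<Rightarrow> 'a \<Rightarrow> 'a measure" where "kap x y = pos_measure (pconv H x y)"

text \<open>The translation \<open>F(xy)\<close> for functions with values in the extended nonnegative reals, where no
  integrability is needed.\<close>

definition ht :: "('a \<Rightarrow> ennreal) \<Rightarrow> 'a \<Rightarrow> 'a \<Rightarrow> ennreal" where "ht F x y = (\<integral>\<^sup>+z. F z \<partial>kap x y)"

lemma lc: "lch TYPE('a)"
  and pconv_M_pos: "pconv H x y \<in> M_pos"
  and pconv_UNIV: "pconv H x y UNIV = 1"
  and inv_cont: "continuous_on UNIV inv"
  and inv_inv [simp]: "inv (inv x) = x"
  and pconv_inv: "pconv H x y (inv -` A) = pconv H (inv y) (inv x) A"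
  and unit_supp: "unit_elt H \<in> supp (pconv H x y) \<longleftrightarrow> x = inv y"
  and supp_cont: "continuous_map euclidean michael_topology (\<lambda>(x, y). supp (pconv H x y))"
  and mconv_cont: "continuous_map (prod_topology cone_topology cone_topology) cone_topology (\<lambda>(\<mu>, \<nu>). mconv H \<mu> \<nu>)"
  and mconv_assoc: "\<mu> \<in> M_space \<Longrightarrow> \<nu> \<in> M_space \<Longrightarrow> \<rho> \<in> M_space \<Longrightarrow> mconv H (mconv H \<mu> \<nu>) \<rho> = mconv H \<mu> (mconv H \<nu> \<rho>)"
  and mconv_linear1: "\<mu> \<in> M_space \<Longrightarrow> \<nu> \<in> M_space \<Longrightarrow> \<rho> \<in> M_space \<Longrightarrow>
     mconv H (\<lambda>A. a * \<mu> A + b * \<nu> A) \<rho> = (\<lambda>A. a * mconv H \<mu> \<rho> A + b * mconv H \<nu> \<rho> A)"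
  and mconv_linear2: "\<mu> \<in> M_space \<Longrightarrow> \<nu> \<in> M_space \<Longrightarrow> \<rho> \<in> M_space \<Longrightarrow>
     mconv H \<rho> (\<lambda>A. a * \<mu> A + b * \<nu> A) = (\<lambda>A. a * mconv H \<rho> \<mu> A + b * mconv H \<rho> \<nu> A)"
  using hyper unfolding hypergroup_def by blast+

lemma kap_sets [simp, measurable_cong]: "sets (kap x y) = sets borel" and kap_space [simp]: "space (kap x y) = UNIV"
  by (simp_all add: kap_def)

lemma kap_radon: "radon_measure (kap x y)"
  unfolding kap_def by (rule M_posD(2)[OF pconv_M_pos])

lemma kap_UNIV: "emeasure (kap x y) UNIV = 1"
  unfolding kap_def by (simp add: emeasure_pos_measure[OF M_posD(1)[OF pconv_M_pos]] pconv_UNIV)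

lemma kap_finite: "finite_measure (kap x y)"
  by (rule finite_measureI) (simp add: kap_UNIV)

lemma kap_measure_UNIV [simp]: "measure (kap x y) UNIV = 1"
  by (simp add: measure_def kap_UNIV)

lemma htrans_kap: "htrans H f x y = (LINT z|kap x y. f z)"
  by (simp add: htrans_def kap_def)

lemma integrable_kap_const [simp]: "integrable (kap x y) (\<lambda>z. c :: complex)"
  by (rule finite_measure.integrable_const[OF kap_finite])

lemma htrans_bound: "(\<And>x. cmod (f x) \<le> B) \<Longrightarrow> cmod (htrans H f x y) \<le> B"
  using integral_mult_bound[OF kap_radon, of x y "\<lambda>_. 1" f B] by (simp add: htrans_kap)

lemma integrable_kap_Cb: "f \<in> Cb \<Longrightarrow> integrable (kap x y) f"
  using integrable_mult_Cb[OF kap_radon, of x y "\<lambda>_. 1" f] by simp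

lemma htrans_add: "f \<in> Cb \<Longrightarrow> g \<in> Cb \<Longrightarrow> htrans H (\<lambda>x. f x + g x) a b = htrans H f a b + htrans H g a b"
  unfolding htrans_kap by (intro Bochner_Integration.integral_add integrable_kap_Cb)

lemma htrans_cmult: "htrans H (\<lambda>x. c * f x) a b = c * htrans H f a b"
  unfolding htrans_kap by simp

lemma continuous_map_mconv:
  assumes "continuous_map X cone_topology p" "continuous_map X cone_topology q"
  shows "continuous_map X cone_topology (\<lambda>x. mconv H (p x) (q x))"
proof -
  have "continuous_map X (prod_topology cone_topology cone_topology) (\<lambda>x. (p x, q x))"
    using assms by (simp add: continuous_map_pairedI)
  from continuous_map_compose[OF this mconv_cont] show ?thesis by (simp add: comp_def)
qed

lemma htrans_Cc_continuous:
  assumes "f \<in> Cc"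
  shows "continuous_on UNIV (\<lambda>p. htrans H f (fst p) (snd p))"
proof -
  have "continuous_map (euclidean :: ('a \<times> 'a) topology) cone_topology (\<lambda>p. point_mass (fst p))"
    "continuous_map (euclidean :: ('a \<times> 'a) topology) cone_topology (\<lambda>p. point_mass (snd p))"
    using continuous_map_compose[OF _ continuous_map_point_mass, of euclidean "\<lambda>p. fst p :: 'a"]
      continuous_map_compose[OF _ continuous_map_point_mass, of euclidean "\<lambda>p. snd p :: 'a"]
    by (simp_all add: comp_def continuous_on_fst continuous_on_snd continuous_on_id)
  from continuous_map_compose[OF continuous_map_mconv[OF this] continuous_map_cone_integral[OF assms]]
  show ?thesis by (simp add: comp_def htrans_def)
qed

text \<open>For test functions the translate is continuous in both arguments, by continuity of the product on the cone.\<close>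

lemma kernel_lsc:
  assumes "\<phi> \<in> Ccp"
  shows "lsc (\<lambda>p. \<integral>\<^sup>+z. ennreal (\<phi> z) \<partial>kap (fst p) (snd p))"
proof -
  have "(\<integral>\<^sup>+z. ennreal (\<phi> z) \<partial>kap (fst p) (snd p)) = ennreal (Re (htrans H (\<lambda>z. complex_of_real (\<phi> z)) (fst p) (snd p)))" for p
    using nn_integral_real[OF Ccp_integrable[OF kap_radon assms] CcpD(2)[OF assms]] by (simp add: htrans_kap)
  then show ?thesis
    using htrans_Cc_continuous[OF Ccp_Cc[OF assms]]
    by (simp only:) (intro lsc_continuous continuous_on_ennreal continuous_on_Re)
qed

lemma ht_lsc: "lsc F \<Longrightarrow> lsc (\<lambda>p. ht F (fst p) (snd p))"
  using lsc_nn_integral_kernel[OF lc kap_radon kernel_lsc, of "\<lambda>q. F (snd q)"]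
    lsc_compose[of F "snd :: ('a \<times> 'a) \<times> 'a \<Rightarrow> 'a"]
  by (simp add: ht_def continuous_on_snd continuous_on_id)

lemma ht_lsc_compose:
  assumes "lsc F" "continuous_on UNIV p" "continuous_on UNIV q"
  shows "lsc (\<lambda>x. ht F (p x) (q x))"
  using lsc_compose[OF ht_lsc[OF assms(1)] continuous_on_Pair[OF assms(2,3)]] by simp

lemma ht_mono: "F \<le> G \<Longrightarrow> ht F x y \<le> ht G x y"
  unfolding ht_def by (rule nn_integral_mono) (rule le_funD)

lemma ht_SUP_below: "lsc F \<Longrightarrow> ht F x y = (SUP \<phi>\<in>below F. ht (\<lambda>z. ennreal (\<phi> z)) x y)"
  unfolding ht_def by (rule nn_integral_SUP_below[OF lc kap_radon])

text \<open>Iterated integrals of a lower semicontinuous function are determined by test functions.\<close>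

lemma ht_integral_SUP_below:
  fixes M :: "'b::t2_space measure"
  assumes M: "radon_measure M" and F: "lsc F" and pq: "continuous_on UNIV p" "continuous_on UNIV q" and g: "lsc g"
  shows "(\<integral>\<^sup>+w. ht F (p w) (q w) * g w \<partial>M) = (SUP \<phi>\<in>below F. \<integral>\<^sup>+w. ht (\<lambda>z. ennreal (\<phi> z)) (p w) (q w) * g w \<partial>M)"
proof -
  have "(\<integral>\<^sup>+w. ht F (p w) (q w) * g w \<partial>M) = (\<integral>\<^sup>+w. (SUP \<phi>\<in>below F. ht (\<lambda>z. ennreal (\<phi> z)) (p w) (q w) * g w) \<partial>M)"
    by (intro nn_integral_cong) (simp add: ht_SUP_below[OF F] SUP_mult_right_ennreal)
  also have "\<dots> = (SUP \<phi>\<in>below F. \<integral>\<^sup>+w. ht (\<lambda>z. ennreal (\<phi> z)) (p w) (q w) * g w \<partial>M)"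
  proof (rule nn_integral_SUP_directed[OF M])
    show "lsc (\<lambda>w. ht (\<lambda>z. ennreal (\<phi> z)) (p w) (q w) * g w)" if "\<phi> \<in> below F" for \<phi>
      using that by (intro lsc_mult ht_lsc_compose pq g Ccp_lsc) (simp add: below_def)
    show "directed_fam (below F) (\<lambda>\<phi> w. ht (\<lambda>z. ennreal (\<phi> z)) (p w) (q w) * g w)"
      by (rule directed_fam_mono[OF directed_below]) (rule le_funI, rule mult_right_mono, erule ht_mono, simp)
  qed
  finally show ?thesis .
qed

text \<open>The axioms only give this for test functions. A bounded continuous \<open>u \<ge> 0\<close> and \<open>B - u\<close> are both lower
  semicontinuous, hence so are their translates, and these add up to the constant \<open>B\<close>.\<close>

lemma htrans_Cb:
  assumes u: "u \<in> Cb"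
  shows "(\<lambda>p. htrans H u (fst p) (snd p)) \<in> Cb"
proof -
  define P where "P = (\<lambda>u. u \<in> Cb \<and> continuous_on UNIV (\<lambda>p. htrans H u (fst p) (snd p)))"
  obtain B where B: "0 < B" "\<And>x. cmod (u x) \<le> B" using Cb_bound[OF u] by blast
  have "P u"
  proof (rule complex_parts_induct[of P u])
    fix h :: "complex \<Rightarrow> real" assume h: "continuous_on UNIV h" "\<And>z. 0 \<le> h z \<and> h z \<le> cmod z"
    have c: "continuous_on UNIV (\<lambda>x. h (u x))" by (rule continuous_on_compose2[OF h(1) Cb_cont[OF u]]) simp
    have b: "0 \<le> h (u x)" "h (u x) \<le> B" for x using h(2)[of "u x"] B(2)[of x] by auto
    have hC: "(\<lambda>x. complex_of_real (h (u x))) \<in> Cb"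
      by (rule CbI[where B = B]) (use c b in \<open>auto intro!: continuous_intros\<close>)
    have ih: "integrable (kap x y) (\<lambda>z. h (u z))" for x y
      using integrable_kap_Cb[OF hC] by (simp add: complex_of_real_integrable_eq)
    define v where "v = (\<lambda>p. LINT z|kap (fst p) (snd p). h (u z))"
    have "continuous_on UNIV v"
    proof (rule lsc_sandwich_continuous[of v B])
      show "0 \<le> v p" for p unfolding v_def by (rule integral_nonneg_AE) (simp add: b)
      show "v p \<le> B" for p
      proof -
        have "v p \<le> (LINT z|kap (fst p) (snd p). B)"
          unfolding v_def by (rule integral_mono[OF ih _ b(2)]) (rule finite_measure.integrable_const[OF kap_finite])
        then show ?thesis by simp
      qed
      have "ht (\<lambda>z. ennreal (h (u z))) (fst p) (snd p) = ennreal (v p)" for p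
        unfolding ht_def v_def by (rule nn_integral_real[OF ih b(1)])
      then show "lsc (\<lambda>p. ennreal (v p))"
        using ht_lsc[of "\<lambda>z. ennreal (h (u z))"] c by (simp add: lsc_continuous continuous_on_ennreal)
      have "ht (\<lambda>z. ennreal (B - h (u z))) (fst p) (snd p) = ennreal (B - v p)" for p
      proof -
        have "integrable (kap (fst p) (snd p)) (\<lambda>z. B - h (u z))"
          by (rule Bochner_Integration.integrable_diff[OF finite_measure.integrable_const[OF kap_finite] ih])
        then have "ht (\<lambda>z. ennreal (B - h (u z))) (fst p) (snd p) = ennreal (LINT z|kap (fst p) (snd p). B - h (u z))"
          unfolding ht_def by (rule nn_integral_real) (simp add: b)
        also have "(LINT z|kap (fst p) (snd p). B - h (u z)) = B - v p"
          unfolding v_def by (subst Bochner_Integration.integral_diff[OF finite_measure.integrable_const[OF kap_finite] ih]) simp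
        finally show ?thesis .
      qed
      then show "lsc (\<lambda>p. ennreal (B - v p))"
        using ht_lsc[of "\<lambda>z. ennreal (B - h (u z))"] c by (simp add: lsc_continuous continuous_on_ennreal continuous_on_diff continuous_on_const)
    qed
    then show "P (\<lambda>x. complex_of_real (h (u x)))"
      unfolding P_def htrans_kap using hC by (simp add: v_def continuous_on_of_real)
  next
    fix f g assume "P f" "P g"
    then show "P (\<lambda>x. f x + g x)"
      unfolding P_def htrans_kap by (simp add: Cb_add integrable_kap_Cb continuous_on_add)
  next
    fix c f assume "P f"
    then show "P (\<lambda>x. c * f x)"
      unfolding P_def htrans_kap by (simp add: Cb_cmult continuous_on_mult_left)
  qed
  then show ?thesis by (intro CbI[where B = B] htrans_bound B) (simp add: P_def)
qed

lemma htrans_Cb_compose: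
  assumes "u \<in> Cb" "continuous_on UNIV p" "continuous_on UNIV q"
  shows "(\<lambda>x. htrans H u (p x) (q x)) \<in> Cb"
  using Cb_compose[OF htrans_Cb[OF assms(1)] continuous_on_Pair[OF assms(2,3)]] by simp

lemma kap_inv: "kap (inv y) (inv x) = distr (kap x y) borel inv"
proof (rule measure_eqI)
  have im: "inv \<in> measurable (kap x y) borel"
    using borel_measurable_continuous_onI[OF inv_cont] by simp
  fix A assume "A \<in> sets (kap (inv y) (inv x))"
  then have A: "A \<in> sets borel" by simp
  have "inv -` A \<in> sets borel" using measurable_sets[OF borel_measurable_continuous_onI[OF inv_cont] A] by simp
  then show "emeasure (kap (inv y) (inv x)) A = emeasure (distr (kap x y) borel inv) A"
    using A im unfolding kap_def
    by (simp add: emeasure_distr emeasure_pos_measure[OF M_posD(1)[OF pconv_M_pos]] pconv_inv)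
qed simp

lemma ht_inv: "F \<in> borel_measurable borel \<Longrightarrow> ht F (inv y) (inv x) = ht (\<lambda>z. F (inv z)) x y"
  unfolding ht_def kap_inv using borel_measurable_continuous_onI[OF inv_cont]
  by (subst nn_integral_distr) auto

lemma htrans_inv: "f \<in> borel_measurable borel \<Longrightarrow> htrans H f (inv y) (inv x) = htrans H (\<lambda>z. f (inv z)) x y"
  unfolding htrans_kap kap_inv using borel_measurable_continuous_onI[OF inv_cont]
  by (subst integral_distr) auto

text \<open>Linearity of the product in each argument, iterated over the support.\<close>

lemma mconv_discrete:
  assumes \<rho>: "\<rho> \<in> M_pos" and W: "finite W" and c: "\<And>w. 0 \<le> c w"
  shows "mconv H \<rho> (discrete W c) = (\<lambda>A. \<Sum>w\<in>W. complex_of_real (c w) * mconv H \<rho> (point_mass w) A)"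
    and "mconv H (discrete W c) \<rho> = (\<lambda>A. \<Sum>w\<in>W. complex_of_real (c w) * mconv H (point_mass w) \<rho> A)"
proof -
  note MS = M_posD(4)[OF point_mass_M_pos] M_posD(4)[OF \<rho>] M_posD(4)[OF discrete_M_pos[OF _ c]]
  have "mconv H \<rho> (discrete W c) = (\<lambda>A. \<Sum>w\<in>W. complex_of_real (c w) * mconv H \<rho> (point_mass w) A) \<and>
    mconv H (discrete W c) \<rho> = (\<lambda>A. \<Sum>w\<in>W. complex_of_real (c w) * mconv H (point_mass w) \<rho> A)"
    using W
  proof (induction W)
    case empty
    have "discrete {} c = (\<lambda>A. 0 * \<rho> A + 0 * \<rho> A)" by (simp add: discrete_def)
    then show ?case using mconv_linear1[OF MS(2) MS(2) MS(2), of 0 0] mconv_linear2[OF MS(2) MS(2) MS(2), of 0 0] by simp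
  next
    case (insert w W)
    have "discrete (insert w W) c = (\<lambda>A. complex_of_real (c w) * point_mass w A + 1 * discrete W c A)"
      using insert.hyps by (simp add: discrete_def)
    then show ?case
      using insert.hyps insert.IH mconv_linear1[OF MS(1) MS(3)[OF insert.hyps(1)] MS(2), of "complex_of_real (c w)" w 1]
        mconv_linear2[OF MS(1) MS(3)[OF insert.hyps(1)] MS(2), of "complex_of_real (c w)" w 1] by simp
  qed
  then show "mconv H \<rho> (discrete W c) = (\<lambda>A. \<Sum>w\<in>W. complex_of_real (c w) * mconv H \<rho> (point_mass w) A)"
    "mconv H (discrete W c) \<rho> = (\<lambda>A. \<Sum>w\<in>W. complex_of_real (c w) * mconv H (point_mass w) \<rho> A)" by auto
qed

text \<open>Multiplication by a point mass is an operator of the kind treated in \<open>cone_operator_integral\<close>.\<close>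

lemma integral_mconv:
  assumes f: "f \<in> Cc" and \<mu>: "\<mu> \<in> M_pos"
  shows "(LINT x|pos_measure (mconv H (point_mass a) \<mu>). f x) = (LINT w|pos_measure \<mu>. htrans H f a w)"
    and "(LINT x|pos_measure (mconv H \<mu> (point_mass a)). f x) = (LINT w|pos_measure \<mu>. htrans H f w a)"
proof -
  obtain B where B: "\<And>x. cmod (f x) \<le> B" using Cb_bound[OF Cc_Cb[OF f]] by blast
  have bd: "bounded (range (\<lambda>w. htrans H f a w))" "bounded (range (\<lambda>w. htrans H f w a))"
    using htrans_bound[of f B, OF B] by (auto simp: bounded_iff)
  have cm: "continuous_map cone_topology cone_topology (\<lambda>\<mu>. mconv H (point_mass a) \<mu>)"
    "continuous_map cone_topology cone_topology (\<lambda>\<mu>. mconv H \<mu> (point_mass a))"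
    by (intro continuous_map_mconv; simp add: topspace_cone point_mass_M_pos)+
  show "(LINT x|pos_measure (mconv H (point_mass a) \<mu>). f x) = (LINT w|pos_measure \<mu>. htrans H f a w)"
    unfolding htrans_def
    by (rule cone_operator_integral[OF cm(1) _ _ f \<mu>]) (use bd mconv_discrete(1)[OF point_mass_M_pos] in \<open>simp_all add: htrans_def\<close>)
  show "(LINT x|pos_measure (mconv H \<mu> (point_mass a)). f x) = (LINT w|pos_measure \<mu>. htrans H f w a)"
    unfolding htrans_def
    by (rule cone_operator_integral[OF cm(2) _ _ f \<mu>]) (use bd mconv_discrete(2)[OF point_mass_M_pos] in \<open>simp_all add: htrans_def\<close>)
qed

text \<open>Associativity of the product for three point masses, written as iterated translations of a function.\<close>

lemma htrans_assoc:
  assumes f: "f \<in> Cc"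
  shows "(LINT w|kap b c. htrans H f a w) = (LINT w|kap a b. htrans H f w c)"
  unfolding kap_def integral_mconv(1)[OF f pconv_M_pos, symmetric] integral_mconv(2)[OF f pconv_M_pos, symmetric]
  by (simp add: mconv_assoc M_posD(4)[OF point_mass_M_pos])

lemma ht_assoc:
  assumes F: "lsc F"
  shows "(\<integral>\<^sup>+w. ht F a w \<partial>kap b c) = (\<integral>\<^sup>+w. ht F w c \<partial>kap a b)"
proof -
  have eq: "(\<integral>\<^sup>+w. ht (\<lambda>z. ennreal (\<phi> z)) a w \<partial>kap b c) = (\<integral>\<^sup>+w. ht (\<lambda>z. ennreal (\<phi> z)) w c \<partial>kap a b)"
    if \<phi>: "\<phi> \<in> below F" for \<phi>
  proof -
    have C: "\<phi> \<in> Ccp" using \<phi> by (simp add: below_def)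
    define v where "v = (\<lambda>x y. LINT z|kap x y. \<phi> z)"
    have v0: "0 \<le> v x y" for x y unfolding v_def by (rule integral_nonneg_AE) (simp add: CcpD(2)[OF C])
    have hv: "ht (\<lambda>z. ennreal (\<phi> z)) x y = ennreal (v x y)" for x y
      unfolding ht_def v_def by (rule nn_integral_real[OF Ccp_integrable[OF kap_radon C] CcpD(2)[OF C]])
    have cv: "htrans H (\<lambda>z. complex_of_real (\<phi> z)) x y = complex_of_real (v x y)" for x y
      by (simp add: htrans_kap v_def)
    note Cb = htrans_Cb_compose[OF Cc_Cb[OF Ccp_Cc[OF C]], unfolded cv]
    have i: "integrable (kap b c) (\<lambda>w. v a w)" "integrable (kap a b) (\<lambda>w. v w c)"
      using integrable_kap_Cb[OF Cb, of "\<lambda>_. a" "\<lambda>w. w" b c] integrable_kap_Cb[OF Cb, of "\<lambda>w. w" "\<lambda>_. c" a b]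
      by (simp_all add: complex_of_real_integrable_eq continuous_on_const continuous_on_id)
    have "(LINT w|kap b c. v a w) = (LINT w|kap a b. v w c)"
      using htrans_assoc[OF Ccp_Cc[OF C], of b c a] by (simp add: cv)
    then show ?thesis unfolding hv using nn_integral_real[OF i(1)] nn_integral_real[OF i(2)] v0 by simp
  qed
  have "(\<integral>\<^sup>+w. ht F a w \<partial>kap b c) = (SUP \<phi>\<in>below F. \<integral>\<^sup>+w. ht (\<lambda>z. ennreal (\<phi> z)) a w \<partial>kap b c)"
    using ht_integral_SUP_below[OF kap_radon F continuous_on_const continuous_on_id lsc_const, of b c a 1] by simp
  also have "\<dots> = (SUP \<phi>\<in>below F. \<integral>\<^sup>+w. ht (\<lambda>z. ennreal (\<phi> z)) w c \<partial>kap a b)"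
    by (rule SUP_cong) (simp_all add: eq)
  also have "\<dots> = (\<integral>\<^sup>+w. ht F w c \<partial>kap a b)"
    using ht_integral_SUP_below[OF kap_radon F continuous_on_id continuous_on_const lsc_const, of a b c 1] by simp
  finally show ?thesis .
qed

end

section \<open>Supports and small translates\<close>

context hyper begin

abbreviation sp :: "'a \<Rightarrow> 'a \<Rightarrow> 'a set" where "sp x y \<equiv> supp (pconv H x y)"

lemma sp_iff: "t \<in> sp x y \<longleftrightarrow> (\<forall>U. open U \<longrightarrow> t \<in> U \<longrightarrow> emeasure (kap x y) U \<noteq> 0)"
proof -
  note nn = M_posD(1)[OF pconv_M_pos[of x y]]
  have "pconv H x y U \<noteq> 0 \<longleftrightarrow> emeasure (kap x y) U \<noteq> 0" if "open U" for U
    using nonneg_cmeas_re[OF nn, of U] that by (auto simp: kap_def emeasure_pos_measure[OF nn] complex_eq_iff)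
  then show ?thesis by (auto simp: supp_def)
qed

lemma sp_closed: "closed (sp x y)"
proof -
  have "- sp x y = \<Union>{U. open U \<and> emeasure (kap x y) U = 0}" by (auto simp: sp_iff)
  then have "open (- sp x y)" by (simp only:) auto
  then show ?thesis by (simp add: closed_def)
qed

text \<open>A compact set in the complement is covered by finitely many open null sets, and the complement is
  open, hence inner regular.\<close>

lemma sp_null: "emeasure (kap x y) (- sp x y) = 0"
proof -
  have o: "open (- sp x y)" using sp_closed by auto
  have "emeasure (kap x y) K = 0" if K: "compact K" "K \<subseteq> - sp x y" for K
  proof -
    have "\<forall>t\<in>K. \<exists>U. open U \<and> t \<in> U \<and> emeasure (kap x y) U = 0" using K(2) by (auto simp: sp_iff)
    then obtain U where U: "\<And>t. t \<in> K \<Longrightarrow> open (U t) \<and> t \<in> U t \<and> emeasure (kap x y) (U t) = 0" by metis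
    then obtain C where C: "C \<subseteq> K" "finite C" "K \<subseteq> (\<Union>t\<in>C. U t)"
      using compactE_image[OF K(1), of K U] by (metis UN_I subsetI)
    have "(\<Union>t\<in>C. U t) \<in> null_sets (kap x y)"
      using C U by (intro null_sets_UN' countable_finite) (auto simp: null_sets_def)
    then show ?thesis using C(3) borel_compact[OF K(1)] by (metis emeasure_eq_0 kap_sets null_setsD1 null_setsD2)
  qed
  then show ?thesis unfolding radon_inner[OF kap_radon o] by (simp add: SUP_eq_const bot_ennreal cong: SUP_cong) (auto intro!: antisym SUP_least)
qed

lemma AE_sp: "AE t in kap x y. t \<in> sp x y"
  using sp_null sp_closed by (intro AE_I[of _ _ "- sp x y"]) auto

lemma sp_compact: "compact (sp x y)"
  using hyper unfolding hypergroup_def by blast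

lemma sp_nonempty: "sp x y \<noteq> {}"
  using sp_null[of x y] kap_UNIV[of x y] by auto

text \<open>Upper semicontinuity of the supports, which is half of the continuity for the Michael topology.\<close>

lemma sp_subset_open:
  assumes V: "open V"
  shows "open {p. sp (fst p) (snd p) \<subseteq> V}"
proof -
  have "openin michael_topology {A. compact A \<and> A \<noteq> {} \<and> A \<inter> UNIV \<noteq> {} \<and> A \<subseteq> V}"
    unfolding michael_topology_def by (intro topology_generated_by_Basis) (use V in blast)
  then have "openin euclidean {p \<in> topspace euclidean. (\<lambda>(x, y). sp x y) p \<in> {A. compact A \<and> A \<noteq> {} \<and> A \<inter> UNIV \<noteq> {} \<and> A \<subseteq> V}}"
    using supp_cont unfolding continuous_map_def by blast
  then show ?thesis by (simp add: sp_compact sp_nonempty case_prod_beta')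
qed

lemma sp_unit: "sp y (unit_elt H) = {y}"
proof -
  have eq: "pconv H y (unit_elt H) = point_mass y" using hyper unfolding hypergroup_def by blast
  have "x \<in> supp (point_mass y) \<longleftrightarrow> x = y" for x
  proof
    assume x: "x \<in> supp (point_mass y)"
    show "x = y"
    proof (rule ccontr)
      assume "x \<noteq> y"
      then have "x \<in> - {y}" "open (- {y})" by auto
      then have "point_mass y (- {y}) \<noteq> 0" using x by (auto simp: supp_def)
      then show False by (simp add: point_mass_def)
    qed
  qed (auto simp: supp_def point_mass_def)
  then show ?thesis unfolding eq by auto
qed

lemma inv_unit: "inv (unit_elt H) = unit_elt H"
  using unit_supp[of "inv (unit_elt H)" "unit_elt H"] sp_unit[of "inv (unit_elt H)"] by simp

lemma ht_pos:
  assumes F: "lsc F" and t: "t \<in> sp x y" "0 < F t"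
  shows "0 < ht F x y"
proof -
  have "F \<in> borel_measurable (kap x y)" by (rule lsc_measurable[OF F]) simp
  moreover have "emeasure (kap x y) {z. 0 < F z} \<noteq> 0" using t lsc_open[OF F, of 0] by (auto simp: sp_iff)
  ultimately have "ht F x y \<noteq> 0"
    unfolding ht_def by (subst nn_integral_0_iff) (simp_all add: zero_less_iff_neq_zero)
  then show ?thesis by (simp add: zero_less_iff_neq_zero)
qed

lemma ht_posD:
  assumes "ht F x y \<noteq> 0"
  obtains t where "t \<in> sp x y" "F t \<noteq> 0"
proof -
  have "ht F x y = (\<integral>\<^sup>+z. 0 \<partial>kap x y)" if "\<forall>t\<in>sp x y. F t = 0"
    unfolding ht_def by (rule nn_integral_cong_AE) (use AE_sp[of x y] that in auto)
  then show thesis using assms that by force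
qed

lemma sp_inv: "t \<in> sp x y \<Longrightarrow> inv t \<in> sp (inv y) (inv x)"
  unfolding sp_iff
proof (intro allI impI)
  fix U assume t: "\<forall>U. open U \<longrightarrow> t \<in> U \<longrightarrow> emeasure (kap x y) U \<noteq> 0" and U: "open U" "inv t \<in> U"
  have "open (inv -` U)" using open_vimage[OF U(1) inv_cont] .
  then have "emeasure (kap x y) (inv -` U) \<noteq> 0" using t U(2) by simp
  then show "emeasure (kap (inv y) (inv x)) U \<noteq> 0"
    using U(1) borel_measurable_continuous_onI[OF inv_cont] by (simp add: kap_inv emeasure_distr)
qed

text \<open>Both \<open>t \<in> supp (\<delta>\<^sub>y' * \<delta>\<^sub>z)\<close> and \<open>z \<in> supp (\<delta>\<^sub>y * \<delta>\<^sub>t)\<close>, with \<open>y'\<close> the involuted \<open>y\<close>, say that the unit lies in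
  the support of the product of \<open>z'\<close>, \<open>y\<close> and \<open>t\<close>, for \<open>z'\<close> the involuted \<open>z\<close>. If the second fails, the
  supports of \<open>z'\<close> times a point of the compact set \<open>supp (\<delta>\<^sub>y * \<delta>\<^sub>t)\<close> all miss one neighbourhood of the unit,
  while associativity and the first give that neighbourhood positive mass.\<close>

lemma sp_cancel:
  assumes t: "t \<in> sp (inv y) z"
  shows "z \<in> sp y t"
proof (rule ccontr)
  let ?e = "unit_elt H"
  assume z: "z \<notin> sp y t"
  have "\<exists>U N. open U \<and> ?e \<in> U \<and> open N \<and> w \<in> N \<and> (\<forall>w'\<in>N. sp (inv z) w' \<inter> U = {})" if w: "w \<in> sp y t" for w
  proof -
    have "?e \<notin> sp (inv z) w"
    proof
      assume "?e \<in> sp (inv z) w"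
      then have "inv z = inv w" by (simp add: unit_supp)
      then have "inv (inv z) = inv (inv w)" by simp
      then show False using w z by simp
    qed
    then obtain U V where UV: "open U" "open V" "?e \<in> U" "sp (inv z) w \<subseteq> V" "U \<inter> V = {}"
    proof -
      assume *: "\<And>U V. open U \<Longrightarrow> open V \<Longrightarrow> ?e \<in> U \<Longrightarrow> sp (inv z) w \<subseteq> V \<Longrightarrow> U \<inter> V = {} \<Longrightarrow> thesis"
      assume "?e \<notin> sp (inv z) w"
      then have "disjnt {?e} (sp (inv z) w)" by simp
      then obtain U V where "openin euclidean U" "openin euclidean V" "{?e} \<subseteq> U" "sp (inv z) w \<subseteq> V" "disjnt U V"
        using Hausdorff_space_compact_sets[of "euclidean :: 'a topology"] Hausdorff_euclidean_t2[where 'a = 'a] sp_compact[of "inv z" w]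
        by (metis compactin_euclidean_iff finite.emptyI finite.insertI finite_imp_compact)
      then show thesis using *[of U V] by (auto simp: disjnt_def)
    qed
    let ?N = "(\<lambda>w'. (inv z, w')) -` {p. sp (fst p) (snd p) \<subseteq> V}"
    have "open ?N" by (rule open_vimage[OF sp_subset_open[OF UV(2)]]) (intro continuous_intros)
    moreover have "w \<in> ?N" using UV(4) by simp
    moreover have "\<forall>w'\<in>?N. sp (inv z) w' \<inter> U = {}" using UV(5) by auto
    ultimately show ?thesis using UV(1,3) by (intro exI[of _ U] exI[of _ ?N] conjI)
  qed
  then obtain U N where UN: "\<And>w. w \<in> sp y t \<Longrightarrow> open (U w) \<and> ?e \<in> U w \<and> open (N w) \<and> w \<in> N w \<and> (\<forall>w'\<in>N w. sp (inv z) w' \<inter> U w = {})"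
    by metis
  then obtain C where C: "C \<subseteq> sp y t" "finite C" "sp y t \<subseteq> (\<Union>w\<in>C. N w)"
    using compactE_image[OF sp_compact[of y t], of "sp y t" N] by (metis UN_I subsetI)
  define U0 where "U0 = (\<Inter>w\<in>C. U w)"
  have U0: "open U0" "?e \<in> U0" unfolding U0_def using C UN by (auto intro!: open_INT)
  have disj: "sp (inv z) w \<inter> U0 = {}" if w: "w \<in> sp y t" for w
  proof -
    obtain v where v: "v \<in> C" "w \<in> N v" using C(3) w by blast
    then have "v \<in> sp y t" using C(1) by blast
    with v(2) have "sp (inv z) w \<inter> U v = {}" using UN[of v] by blast
    moreover have "U0 \<subseteq> U v" using v(1) by (auto simp: U0_def)
    ultimately show ?thesis by blast
  qed
  have l: "lsc (indicator U0 :: 'a \<Rightarrow> ennreal)" by (rule lsc_indicator[OF U0(1)])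
  have "(\<integral>\<^sup>+w. ht (indicator U0) (inv z) w \<partial>kap y t) = (\<integral>\<^sup>+w. 0 \<partial>kap y t)"
  proof (rule nn_integral_cong_AE)
    show "AE w in kap y t. ht (indicator U0) (inv z) w = 0"
      using AE_sp[of y t]
    proof (rule AE_mp, intro AE_I2 impI)
      fix w assume w: "w \<in> sp y t"
      show "ht (indicator U0) (inv z) w = 0"
      proof (rule ccontr)
        assume "ht (indicator U0) (inv z) w \<noteq> 0"
        then obtain s where "s \<in> sp (inv z) w" "(indicator U0 s :: ennreal) \<noteq> 0" by (rule ht_posD)
        then show False using disj[OF w] by (auto simp: indicator_def split: if_splits)
      qed
    qed
  qed
  then have zero: "(\<integral>\<^sup>+w. ht (indicator U0) w t \<partial>kap (inv z) y) = 0"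
    by (simp add: ht_assoc[OF l])
  have "inv t \<in> sp (inv z) y" using sp_inv[OF t] by simp
  moreover have "0 < ht (indicator U0) (inv t) t"
    by (rule ht_pos[OF l, of ?e]) (use U0 in \<open>simp_all add: unit_supp\<close>)
  moreover have "lsc (\<lambda>w. ht (indicator U0) w t)"
    by (intro ht_lsc_compose[OF l] continuous_intros)
  ultimately have "0 < ht (\<lambda>w. ht (indicator U0) w t) (inv z) y" using ht_pos by blast
  then show False using zero by (simp add: ht_def)
qed

text \<open>The support of \<open>\<delta>\<^sub>y * \<delta>\<^sub>e\<close> is \<open>{y}\<close>; upper semicontinuity of supports at \<open>(y, e)\<close> and compactness of \<open>S\<close> give
  one neighbourhood of the unit that works for all \<open>y\<close>.\<close>

lemma small_translates:
  assumes S: "compact S" and N: "\<And>y. y \<in> S \<Longrightarrow> open (N y) \<and> y \<in> N y"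
  obtains V where "open V" "unit_elt H \<in> V" "\<And>y t. y \<in> S \<Longrightarrow> t \<in> V \<Longrightarrow> \<exists>y0\<in>S. y \<in> N y0 \<and> sp y t \<subseteq> N y0"
proof -
  define E where "E = (\<lambda>y. {p. sp (fst p) (snd p) \<subseteq> N y})"
  have oE: "open (E y)" if "y \<in> S" for y unfolding E_def using N[OF that] by (intro sp_subset_open) blast
  have "\<exists>A B. open A \<and> open B \<and> y \<in> A \<and> unit_elt H \<in> B \<and> A \<times> B \<subseteq> E y" if y: "y \<in> S" for y
  proof -
    have "(y, unit_elt H) \<in> {p. sp (fst p) (snd p) \<subseteq> N y}" using N[OF y] by (simp add: sp_unit)
    then have "(y, unit_elt H) \<in> E y" by (simp add: E_def)
    then obtain A B where "open A" "open B" "(y, unit_elt H) \<in> A \<times> B" "A \<times> B \<subseteq> E y"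
      using open_prod_elim[OF oE[OF y]] by blast
    then show ?thesis by (intro exI[of _ A] exI[of _ B]) simp
  qed
  then obtain A B where AB: "\<And>y. y \<in> S \<Longrightarrow> open (A y) \<and> open (B y) \<and> y \<in> A y \<and> unit_elt H \<in> B y \<and>
     A y \<times> B y \<subseteq> E y" by metis
  have "\<And>y. y \<in> S \<Longrightarrow> open (A y \<inter> N y)" "S \<subseteq> (\<Union>y\<in>S. A y \<inter> N y)" using AB N by auto
  from compactE_image[OF S this] obtain C where C: "C \<subseteq> S" "finite C" "S \<subseteq> (\<Union>y\<in>C. A y \<inter> N y)" by blast
  show thesis
  proof (rule that[of "\<Inter>y\<in>C. B y"])
    show "open (\<Inter>y\<in>C. B y)" "unit_elt H \<in> (\<Inter>y\<in>C. B y)" using AB C by (auto intro!: open_INT)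
    fix y t assume y: "y \<in> S" and t: "t \<in> (\<Inter>y\<in>C. B y)"
    obtain y0 where y0: "y0 \<in> C" "y \<in> A y0" "y \<in> N y0" using C(3) y by blast
    have "(y, t) \<in> A y0 \<times> B y0" using y0 t by blast
    then have "(y, t) \<in> E y0" using AB[of y0] y0(1) C(1) by blast
    then show "\<exists>y0\<in>S. y \<in> N y0 \<and> sp y t \<subseteq> N y0" using y0 C(1) unfolding E_def by auto
  qed
qed

text \<open>Uniform continuity of a test function with respect to small translations. If neither \<open>y\<close> nor \<open>z\<close> lies in
  the support, both values vanish; otherwise the smallness of the translates of points of \<open>S\<close> applies
  to \<open>y\<close>, or after an involution to \<open>z\<close>.\<close>

lemma uniform_translates:
  fixes g :: "'a \<Rightarrow> complex"
  assumes g: "continuous_on UNIV g" and S: "compact S" "\<And>x. x \<notin> S \<Longrightarrow> g x = 0" and O: "open Q" "S \<subseteq> Q" and e: "0 < e"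
  obtains V where "open V" "unit_elt H \<in> V"
    "\<And>y z t. t \<in> V \<Longrightarrow> t \<in> sp (inv y) z \<Longrightarrow> cmod (g z - g y) < e"
    "\<And>y z t. t \<in> V \<Longrightarrow> t \<in> sp (inv y) z \<Longrightarrow> z \<in> S \<Longrightarrow> y \<in> Q"
proof -
  define N where "N = (\<lambda>y. Q \<inter> {z. cmod (g z - g y) < e/2})"
  have N: "open (N y) \<and> y \<in> N y" if "y \<in> S" for y
  proof -
    have "open {z. cmod (g z - g y) < e/2}"
      by (intro open_Collect_less continuous_intros g)
    then show ?thesis using that O e by (auto simp: N_def)
  qed
  obtain V where V: "open V" "unit_elt H \<in> V" "\<And>y t. y \<in> S \<Longrightarrow> t \<in> V \<Longrightarrow> \<exists>y0\<in>S. y \<in> N y0 \<and> sp y t \<subseteq> N y0"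
    using small_translates[OF S(1) N] by blast
  have close: "cmod (g z - g y) < e \<and> z \<in> Q" if yt: "y \<in> S" "t \<in> V" "z \<in> sp y t" for y z t
  proof -
    obtain y0 where "y \<in> N y0" "z \<in> N y0" using V(3)[OF yt(1,2)] yt(3) by blast
    then have "cmod (g y - g y0) < e/2" "cmod (g z - g y0) < e/2" "z \<in> Q" by (auto simp: N_def)
    then show ?thesis using norm_triangle_ineq4[of "g z - g y0" "g y - g y0"] by simp
  qed
  \<comment> \<open>Invariance under the involution allows the roles of \<open>y\<close> and \<open>z\<close> to be exchanged.\<close>
  let ?V = "V \<inter> inv -` V"
  have bwd: "cmod (g z - g y) < e \<and> y \<in> Q" if "t \<in> ?V" "t \<in> sp (inv y) z" "z \<in> S" for y z t
  proof -
    have "inv t \<in> sp (inv z) y" using sp_inv[OF that(2)] by simp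
    then have "y \<in> sp z (inv t)" by (rule sp_cancel)
    then show ?thesis using close[of z "inv t" y] that by (simp add: norm_minus_commute)
  qed
  show thesis
  proof (rule that[of ?V])
    show "open ?V" using V(1) open_vimage[OF V(1) inv_cont] by blast
    show "unit_elt H \<in> ?V" using V(2) inv_unit by simp
    show "cmod (g z - g y) < e" if t: "t \<in> ?V" "t \<in> sp (inv y) z" for y z t
    proof (cases "y \<in> S")
      case True
      then show ?thesis using close[of y t z] sp_cancel[OF t(2)] t(1) by blast
    next
      case False
      show ?thesis
      proof (cases "z \<in> S")
        case True then show ?thesis using bwd[OF t] by blast
      qed (use False S(2) e in simp)
    qed
    show "y \<in> Q" if "t \<in> ?V" "t \<in> sp (inv y) z" "z \<in> S" for y z t using bwd[OF that] by blast
  qed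
qed

lemma Ccp_inv:
  assumes "\<phi> \<in> Ccp" shows "(\<lambda>z. \<phi> (inv z)) \<in> Ccp"
proof -
  obtain K where K: "compact K" "\<And>x. x \<notin> K \<Longrightarrow> \<phi> x = 0" using assms by (auto simp: Ccp_def)
  have "compact (inv ` K)" using K(1) inv_cont by (auto intro: compact_continuous_image continuous_on_subset)
  moreover have "\<phi> (inv x) = 0" if "x \<notin> inv ` K" for x
    using K(2)[of "inv x"] that image_eqI[of x inv "inv x" K] by auto
  ultimately show ?thesis
    using assms continuous_on_compose2[OF CcpD(1)[OF assms] inv_cont] by (auto simp: Ccp_def)
qed

lemma Cc_inv:
  assumes "f \<in> Cc" shows "(\<lambda>z. f (inv z)) \<in> Cc"
proof -
  obtain K where K: "compact K" "\<And>x. x \<notin> K \<Longrightarrow> f x = 0" using assms by (auto simp: Cc_def)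
  have "compact (inv ` K)" using K(1) inv_cont by (auto intro: compact_continuous_image continuous_on_subset)
  moreover have "f (inv x) = 0" if "x \<notin> inv ` K" for x
    using K(2)[of "inv x"] that image_eqI[of x inv "inv x" K] by auto
  ultimately show ?thesis
    using continuous_on_compose2[OF Cc_cont[OF assms] inv_cont] by (auto simp: Cc_def)
qed

end

section \<open>The left Haar measure\<close>

locale haar = hyper +
  fixes m :: "'a measure"
  assumes haar: "left_haar_measure H m"
begin

lemma m_radon: "radon_measure m" and m_UNIV: "emeasure m UNIV \<noteq> 0"
  and m_inv: "f \<in> Cc \<Longrightarrow> (LINT y|m. htrans H f x y) = (LINT y|m. f y)"
  using haar unfolding left_haar_measure_def by auto

lemma m_sets [simp, measurable_cong]: "sets m = sets borel" and m_space [simp]: "space m = UNIV"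
  by (rule radon_sets[OF m_radon], rule radon_space[OF m_radon])

lemma ht_Ccp: "\<phi> \<in> Ccp \<Longrightarrow> ht (\<lambda>z. ennreal (\<phi> z)) x y = ennreal (LINT z|kap x y. \<phi> z)"
  unfolding ht_def by (rule nn_integral_real) (auto intro: Ccp_integrable[OF kap_radon] CcpD)

lemma nn_integral_Ccp: "\<phi> \<in> Ccp \<Longrightarrow> (\<integral>\<^sup>+z. ennreal (\<phi> z) \<partial>m) = ennreal (LINT z|m. \<phi> z)"
  by (rule nn_integral_real) (auto intro: Ccp_integrable[OF m_radon] CcpD)

text \<open>The Bochner integral of a function that is not integrable is zero, so left invariance proves
  integrability of a translate only if the integral of \<open>\<phi>\<close> is not zero. In general \<open>\<phi>\<close> is compared with
  \<open>\<phi> + \<psi>\<close> for some \<open>\<psi>\<close> of positive integral.\<close>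

lemma ht_integral_Ccp:
  assumes \<phi>: "\<phi> \<in> Ccp"
  shows "(\<integral>\<^sup>+y. ht (\<lambda>z. ennreal (\<phi> z)) x y \<partial>m) = (\<integral>\<^sup>+y. ennreal (\<phi> y) \<partial>m)"
proof -
  have pos: "(\<integral>\<^sup>+y. ht (\<lambda>z. ennreal (\<phi> z)) x y \<partial>m) = (\<integral>\<^sup>+y. ennreal (\<phi> y) \<partial>m)"
    if \<phi>: "\<phi> \<in> Ccp" and ne: "(LINT z|m. \<phi> z) \<noteq> 0" for \<phi>
  proof -
    have eq: "(LINT y|m. complex_of_real (LINT z|kap x y. \<phi> z)) = complex_of_real (LINT z|m. \<phi> z)"
      using m_inv[OF Ccp_Cc[OF \<phi>], of x] by (simp add: htrans_kap)
    then have "integrable m (\<lambda>y. complex_of_real (LINT z|kap x y. \<phi> z))"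
      using ne not_integrable_integral_eq by fastforce
    then have i: "integrable m (\<lambda>y. LINT z|kap x y. \<phi> z)" by (simp add: complex_of_real_integrable_eq)
    have "(\<integral>\<^sup>+y. ht (\<lambda>z. ennreal (\<phi> z)) x y \<partial>m) = ennreal (LINT y|m. LINT z|kap x y. \<phi> z)"
      unfolding ht_Ccp[OF \<phi>] by (rule nn_integral_real[OF i]) (auto intro!: integral_nonneg_AE simp: CcpD(2)[OF \<phi>])
    also have "(LINT y|m. LINT z|kap x y. \<phi> z) = (LINT z|m. \<phi> z)" using eq by simp
    finally show ?thesis by (simp add: nn_integral_Ccp[OF \<phi>])
  qed
  have "\<exists>K. compact K \<and> emeasure m K \<noteq> 0"
  proof (rule ccontr)
    assume "\<nexists>K. compact K \<and> emeasure m K \<noteq> 0"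
    then have "emeasure m K = 0" if "compact K" for K using that by blast
    then have "emeasure m UNIV \<le> 0" unfolding radon_inner[OF m_radon open_UNIV] by (intro SUP_least) simp
    then show False using m_UNIV by simp
  qed
  then obtain K where K: "compact K" "emeasure m K \<noteq> 0" by blast
  obtain \<psi> where \<psi>: "\<psi> \<in> Ccp" "\<And>x. \<psi> x \<le> 1" "\<And>x. x \<in> K \<Longrightarrow> \<psi> x = 1"
    using Urysohn_Ccp[OF lc K(1) open_UNIV] by auto
  have "emeasure m K = (\<integral>\<^sup>+y. indicator K y \<partial>m)" using borel_compact[OF K(1)] by simp
  also have "\<dots> \<le> (\<integral>\<^sup>+y. ennreal (\<psi> y) \<partial>m)" using \<psi>(3) by (intro nn_integral_mono) (auto simp: indicator_def)
  finally have p\<psi>: "(LINT z|m. \<psi> z) \<noteq> 0" using K(2) by (auto simp: nn_integral_Ccp[OF \<psi>(1)])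
  have n: "0 \<le> (LINT z|m. \<phi> z)" "0 \<le> (LINT z|m. \<psi> z)"
    by (auto intro!: integral_nonneg_AE simp: CcpD(2)[OF \<phi>] CcpD(2)[OF \<psi>(1)])
  note s = Ccp_add[OF \<phi> \<psi>(1)]
  have "(LINT z|m. \<phi> z + \<psi> z) = (LINT z|m. \<phi> z) + (LINT z|m. \<psi> z)"
    by (intro Bochner_Integration.integral_add Ccp_integrable[OF m_radon] \<phi> \<psi>)
  then have ps: "(LINT z|m. \<phi> z + \<psi> z) \<noteq> 0" using n p\<psi> by linarith
  have ml: "(\<lambda>y. ht (\<lambda>z. ennreal (\<omega> z)) x y) \<in> borel_measurable m" if "\<omega> \<in> Ccp" for \<omega>
    by (rule lsc_measurable[OF ht_lsc_compose[OF Ccp_lsc[OF that]]]) (auto intro!: continuous_intros)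
  have "ht (\<lambda>z. ennreal (\<phi> z + \<psi> z)) x y = ht (\<lambda>z. ennreal (\<phi> z)) x y + ht (\<lambda>z. ennreal (\<psi> z)) x y" for y
    unfolding ht_def ennreal_plus[OF CcpD(2)[OF \<phi>] CcpD(2)[OF \<psi>(1)]]
    by (rule nn_integral_add) (rule lsc_measurable[OF Ccp_lsc], fact, simp)+
  then have "(\<integral>\<^sup>+y. ht (\<lambda>z. ennreal (\<phi> z)) x y \<partial>m) + (\<integral>\<^sup>+y. ht (\<lambda>z. ennreal (\<psi> z)) x y \<partial>m) = (\<integral>\<^sup>+y. ennreal (\<phi> y + \<psi> y) \<partial>m)"
    using pos[OF s ps] by (simp add: nn_integral_add[OF ml[OF \<phi>] ml[OF \<psi>(1)]])
  also have "\<dots> = (\<integral>\<^sup>+y. ennreal (\<phi> y) \<partial>m) + (\<integral>\<^sup>+y. ennreal (\<psi> y) \<partial>m)"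
    unfolding ennreal_plus[OF CcpD(2)[OF \<phi>] CcpD(2)[OF \<psi>(1)]]
    by (rule nn_integral_add) (rule lsc_measurable[OF Ccp_lsc], fact, simp)+
  finally have "(\<integral>\<^sup>+y. ht (\<lambda>z. ennreal (\<phi> z)) x y \<partial>m) + (\<integral>\<^sup>+y. ennreal (\<psi> y) \<partial>m) = (\<integral>\<^sup>+y. ennreal (\<phi> y) \<partial>m) + (\<integral>\<^sup>+y. ennreal (\<psi> y) \<partial>m)"
    unfolding pos[OF \<psi>(1) p\<psi>] .
  moreover have "(\<integral>\<^sup>+y. ennreal (\<psi> y) \<partial>m) \<noteq> top" by (simp add: nn_integral_Ccp[OF \<psi>(1)])
  ultimately show ?thesis by (metis add.commute ennreal_add_left_cancel infinity_ennreal_def)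
qed

lemma ht_integral:
  assumes F: "lsc F"
  shows "(\<integral>\<^sup>+y. ht F x y \<partial>m) = (\<integral>\<^sup>+y. F y \<partial>m)"
proof -
  have "(\<integral>\<^sup>+y. ht F x y \<partial>m) = (SUP \<phi>\<in>below F. \<integral>\<^sup>+y. ht (\<lambda>z. ennreal (\<phi> z)) x y \<partial>m)"
    using ht_integral_SUP_below[OF m_radon F continuous_on_const continuous_on_id lsc_const, of x 1] by simp
  also have "\<dots> = (SUP \<phi>\<in>below F. \<integral>\<^sup>+y. ennreal (\<phi> y) \<partial>m)"
    by (rule SUP_cong) (auto simp: below_def ht_integral_Ccp)
  also have "\<dots> = (\<integral>\<^sup>+y. F y \<partial>m)" by (rule nn_integral_SUP_below[OF lc m_radon F, symmetric])
  finally show ?thesis .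
qed

text \<open>If \<open>k\<close> had integral zero, so would all its translates by left invariance. The translate at the
  involuted \<open>y\<close> is positive near \<open>y\<close>, so every point would have a null neighbourhood.\<close>

lemma integral_pos_at_unit:
  assumes k: "lsc k" "0 < k (unit_elt H)"
  shows "(\<integral>\<^sup>+y. k y \<partial>m) \<noteq> 0"
proof
  assume z: "(\<integral>\<^sup>+y. k y \<partial>m) = 0"
  have "\<exists>U. open U \<and> y \<in> U \<and> emeasure m U = 0" for y
  proof -
    have l: "lsc (\<lambda>z. ht k (inv y) z)" by (intro ht_lsc_compose k continuous_intros)
    have "(\<integral>\<^sup>+z. ht k (inv y) z \<partial>m) = 0" using ht_integral[OF k(1)] z by simp
    then have "emeasure m {z. ht k (inv y) z \<noteq> 0} = 0"
      by (subst (asm) nn_integral_0_iff) (use lsc_measurable[OF l] in auto)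
    moreover have "{z. ht k (inv y) z \<noteq> 0} = {z. 0 < ht k (inv y) z}" by (simp add: zero_less_iff_neq_zero)
    moreover have "0 < ht k (inv y) y" by (rule ht_pos[OF k(1) _ k(2)]) (simp add: unit_supp)
    ultimately show ?thesis using lsc_open[OF l, of 0] by (intro exI[of _ "{z. 0 < ht k (inv y) z}"]) auto
  qed
  then obtain U where U: "\<And>y. open (U y) \<and> y \<in> U y \<and> emeasure m (U y) = 0" by metis
  have "emeasure m K = 0" if K: "compact K" for K
  proof -
    obtain C where C: "C \<subseteq> K" "finite C" "K \<subseteq> (\<Union>t\<in>C. U t)"
      using compactE_image[OF K, of K U] U by (metis UN_I subsetI)
    have "(\<Union>t\<in>C. U t) \<in> null_sets m"
      using C U by (intro null_sets_UN' countable_finite) (auto simp: null_sets_def)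
    then show ?thesis using C(3) borel_compact[OF K] by (metis emeasure_eq_0 m_sets null_setsD1 null_setsD2)
  qed
  then have "emeasure m UNIV \<le> 0" unfolding radon_inner[OF m_radon open_UNIV] by (intro SUP_least) simp
  then show False using m_UNIV by simp
qed

lemma approximate_unit:
  assumes V: "open V" "unit_elt H \<in> V"
  obtains k where "k \<in> Ccp" "\<And>z. k (inv z) = k z" "\<And>z. z \<notin> V \<Longrightarrow> k z = 0" "(\<integral>\<^sup>+z. ennreal (k z) \<partial>m) = 1"
proof -
  have "open (V \<inter> inv -` V)" "{unit_elt H} \<subseteq> V \<inter> inv -` V"
    using V open_vimage[OF V(1) inv_cont] inv_unit by auto
  then obtain \<phi> where \<phi>: "\<phi> \<in> Ccp" "\<phi> (unit_elt H) = 1" "\<And>z. z \<notin> V \<inter> inv -` V \<Longrightarrow> \<phi> z = 0"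
    using Urysohn_Ccp[OF lc, of "{unit_elt H}" "V \<inter> inv -` V"] by (metis finite.emptyI finite.insertI finite_imp_compact singletonI)
  define k0 where "k0 = (\<lambda>z. \<phi> z + \<phi> (inv z))"
  have k0: "k0 \<in> Ccp" unfolding k0_def by (intro Ccp_add Ccp_inv \<phi>)
  define c where "c = (LINT z|m. k0 z)"
  have c: "(\<integral>\<^sup>+z. ennreal (k0 z) \<partial>m) = ennreal c" "0 \<le> c"
    unfolding c_def by (rule nn_integral_Ccp[OF k0]) (auto intro!: integral_nonneg_AE simp: CcpD(2)[OF k0])
  have "(\<integral>\<^sup>+z. ennreal (k0 z) \<partial>m) \<noteq> 0"
    by (rule integral_pos_at_unit[OF Ccp_lsc[OF k0]]) (simp add: k0_def inv_unit \<phi>(2))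
  then have c0: "0 < c" using c by (cases "c = 0") auto
  show thesis
  proof (rule that[of "\<lambda>z. (1/c) * k0 z"])
    show "(\<lambda>z. (1/c) * k0 z) \<in> Ccp" using k0 c0 by (intro Ccp_cmult) auto
    show "(1/c) * k0 (inv z) = (1/c) * k0 z" for z by (simp add: k0_def add.commute)
    show "(1/c) * k0 z = 0" if "z \<notin> V" for z using that \<phi>(3)[of z] \<phi>(3)[of "inv z"] by (simp add: k0_def)
    have "(\<integral>\<^sup>+z. ennreal ((1/c) * k0 z) \<partial>m) = (\<integral>\<^sup>+z. ennreal (1/c) * ennreal (k0 z) \<partial>m)"
      by (intro nn_integral_cong ennreal_mult) (use c0 CcpD(2)[OF k0] in auto)
    also have "\<dots> = ennreal (1/c) * ennreal c"
      unfolding c(1)[symmetric] by (rule nn_integral_cmult) (rule lsc_measurable[OF Ccp_lsc[OF k0]], simp)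
    also have "\<dots> = 1" using c0 by (simp add: ennreal_mult[symmetric])
    finally show "(\<integral>\<^sup>+z. ennreal ((1/c) * k0 z) \<partial>m) = 1" .
  qed
qed

text \<open>The convolution \<open>f * k\<close> for functions with values in the extended nonnegative reals.\<close>

definition smooth :: "('a \<Rightarrow> ennreal) \<Rightarrow> ('a \<Rightarrow> ennreal) \<Rightarrow> 'a \<Rightarrow> ennreal" where
  "smooth k f y = (\<integral>\<^sup>+z. f z * ht k (inv z) y \<partial>m)"

lemma ht_symmetric:
  assumes k: "lsc k" "\<And>z. k (inv z) = k z"
  shows "ht k (inv y) (inv x) = ht k x y"
  using ht_inv[OF lsc_measurable[OF k(1) refl]] by (simp add: k(2))

lemma lsc_smooth:
  assumes "lsc k" "lsc f" shows "lsc (smooth k f)"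
proof -
  have "lsc (\<lambda>p. f (snd p) * ht k (inv (snd p)) (fst p))"
    by (intro lsc_mult lsc_compose[OF assms(2)] ht_lsc_compose assms) (auto intro!: continuous_intros continuous_on_compose2[OF inv_cont])
  from lsc_nn_integral[OF lc m_radon this] show ?thesis unfolding smooth_def[abs_def] by simp
qed

text \<open>For smoothed functions the adjoint relation is exact: associativity moves the translation of
  \<open>k (z' y)\<close> from \<open>y\<close> to \<open>z\<close> (with \<open>z'\<close> the involuted \<open>z\<close>), and Tonelli's theorem interchanges the integrals.\<close>

lemma smooth_adjoint:
  assumes k: "lsc k" "\<And>z. k (inv z) = k z" and f: "lsc f" and g: "lsc g"
  shows "(\<integral>\<^sup>+y. ht (smooth k f) x y * g y \<partial>m) = (\<integral>\<^sup>+z. f z * ht (smooth k g) (inv x) z \<partial>m)"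
proof -
  note ic = continuous_on_compose2[OF inv_cont _ subset_UNIV]
  note hl = ht_lsc_compose[OF k(1)]
  \<comment> \<open>\<open>A z y\<close> is \<open>k\<close> evaluated at the triple product of the involuted \<open>z\<close>, \<open>x\<close> and \<open>y\<close>.\<close>
  define A where "A = (\<lambda>z y. \<integral>\<^sup>+w. ht k w y \<partial>kap (inv z) x)"
  have lA: "lsc (\<lambda>p. A (fst p) (snd p))"
  proof -
    have "lsc (\<lambda>p. \<integral>\<^sup>+w. ht k w (snd p) \<partial>kap (inv (fst p)) x)"
    proof (rule lsc_nn_integral_kernel[OF lc kap_radon, where F = "\<lambda>q. ht k (snd q) (snd (fst q))", simplified])
      show "lsc (\<lambda>p. \<integral>\<^sup>+y. ennreal (\<phi> y) \<partial>kap (inv (fst p)) x)" if "\<phi> \<in> Ccp" for \<phi>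
        using ht_lsc_compose[OF Ccp_lsc[OF that], of "\<lambda>p. inv (fst p)" "\<lambda>_. x"]
        by (simp add: ht_def ic continuous_on_fst continuous_on_id continuous_on_const)
      show "lsc (\<lambda>q. ht k (snd q) (snd (fst q)))" by (intro hl continuous_intros)
    qed
    then show ?thesis by (simp add: A_def)
  qed
  have mA: "(\<lambda>z. A z y) \<in> borel_measurable m" "(\<lambda>y. A z y) \<in> borel_measurable m" for y z
    using lsc_measurable[OF lsc_section'[OF lA, of y]] lsc_measurable[OF lsc_section[OF lA, of z]] by auto
  have mh: "(\<lambda>w. ht k (p w) (q w)) \<in> borel_measurable M" if "continuous_on UNIV p" "continuous_on UNIV q" "sets M = sets borel" for p q and M :: "'a measure"
    by (rule lsc_measurable[OF hl[OF that(1,2)] that(3)])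
  have mf: "f \<in> borel_measurable m" and mg: "g \<in> borel_measurable m" by (auto intro!: lsc_measurable f g)
  have 1: "ht (smooth k f) x y = (\<integral>\<^sup>+z. f z * A z y \<partial>m)" for y
  proof -
    have "ht (smooth k f) x y = (\<integral>\<^sup>+w. \<integral>\<^sup>+z. f z * ht k (inv z) w \<partial>m \<partial>kap x y)"
      by (simp add: ht_def smooth_def)
    also have "\<dots> = (\<integral>\<^sup>+z. \<integral>\<^sup>+w. f z * ht k (inv z) w \<partial>kap x y \<partial>m)"
    proof -
      have "lsc (\<lambda>p. f (snd p) * ht k (inv (snd p)) (fst p))"
        by (intro lsc_mult lsc_compose[OF f] hl ic continuous_intros)
      from Tonelli_lsc[OF lc lc kap_radon m_radon this, of x y] show ?thesis by simp
    qed
    also have "\<dots> = (\<integral>\<^sup>+z. f z * A z y \<partial>m)"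
      unfolding A_def ht_assoc[OF k(1), symmetric]
      by (intro nn_integral_cong nn_integral_cmult mh continuous_intros) simp
    finally show ?thesis .
  qed
  have 2: "(\<integral>\<^sup>+y. g y * A z y \<partial>m) = ht (smooth k g) (inv x) z" for z
  proof -
    have "(\<integral>\<^sup>+y. g y * A z y \<partial>m) = (\<integral>\<^sup>+y. \<integral>\<^sup>+w. g y * ht k w y \<partial>kap (inv z) x \<partial>m)"
      unfolding A_def by (intro nn_integral_cong nn_integral_cmult[symmetric] mh continuous_intros) simp
    also have "\<dots> = (\<integral>\<^sup>+w. \<integral>\<^sup>+y. g y * ht k w y \<partial>m \<partial>kap (inv z) x)"
    proof -
      have "lsc (\<lambda>p. g (fst p) * ht k (snd p) (fst p))"
        by (intro lsc_mult lsc_compose[OF g] hl continuous_intros)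
      from Tonelli_lsc[OF lc lc m_radon kap_radon this, of "inv z" x] show ?thesis by simp
    qed
    also have "\<dots> = ht (\<lambda>w. smooth k g (inv w)) (inv z) x"
      unfolding ht_def[of "\<lambda>w. smooth k g (inv w)"] by (simp add: smooth_def ht_symmetric[OF k])
    also have "\<dots> = ht (smooth k g) (inv x) z"
      using ht_inv[OF lsc_measurable[OF lsc_smooth[OF k(1) g] refl], of x "inv z"] by simp
    finally show ?thesis .
  qed
  have "(\<integral>\<^sup>+y. ht (smooth k f) x y * g y \<partial>m) = (\<integral>\<^sup>+y. \<integral>\<^sup>+z. f z * A z y * g y \<partial>m \<partial>m)"
    unfolding 1 by (intro nn_integral_cong nn_integral_multc[symmetric] borel_measurable_times_ennreal mf mA)
  also have "\<dots> = (\<integral>\<^sup>+z. \<integral>\<^sup>+y. f z * A z y * g y \<partial>m \<partial>m)"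
  proof -
    have "lsc (\<lambda>p. f (snd p) * A (snd p) (fst p) * g (fst p))"
      using lsc_compose[OF lA, of "\<lambda>p. (snd p, fst p)"]
      by (intro lsc_mult lsc_compose[OF f] lsc_compose[OF g] continuous_intros) (simp add: continuous_on_Pair continuous_on_fst continuous_on_snd continuous_on_id)
    from Tonelli_lsc[OF lc lc m_radon m_radon this] show ?thesis by simp
  qed
  also have "\<dots> = (\<integral>\<^sup>+z. f z * (\<integral>\<^sup>+y. g y * A z y \<partial>m) \<partial>m)"
  proof (rule nn_integral_cong)
    fix z
    have "(\<integral>\<^sup>+y. f z * A z y * g y \<partial>m) = (\<integral>\<^sup>+y. f z * (g y * A z y) \<partial>m)"
      by (simp only: mult.assoc mult.commute[of "A z _"])
    also have "\<dots> = f z * (\<integral>\<^sup>+y. g y * A z y \<partial>m)"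
      by (rule nn_integral_cmult) (intro borel_measurable_times_ennreal mg mA)
    finally show "(\<integral>\<^sup>+y. f z * A z y * g y \<partial>m) = f z * (\<integral>\<^sup>+y. g y * A z y \<partial>m)" .
  qed
  finally show ?thesis by (simp add: 2)
qed

end

section \<open>The adjoint of a left translation\<close>

context haar begin

text \<open>Smoothing with a symmetric kernel \<open>k\<close> of integral one supported in a small set averages \<open>f\<close> over
  points \<open>z\<close> for which some element of that set lies in the product of the involuted \<open>y\<close> with \<open>z\<close>; at
  such points \<open>f\<close> differs from \<open>f y\<close> by less than \<open>e\<close>.\<close>

lemma smooth_close:
  assumes f: "f \<in> Ccp" and k: "k \<in> Ccp" "\<And>z. k (inv z) = k z" "\<And>z. z \<notin> V \<Longrightarrow> k z = 0" "(\<integral>\<^sup>+z. ennreal (k z) \<partial>m) = 1"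
    and V: "\<And>y z t. t \<in> V \<Longrightarrow> t \<in> sp (inv y) z \<Longrightarrow> \<bar>f z - f y\<bar> < e" and e: "0 < e"
  shows "ennreal (f y) \<le> smooth (\<lambda>z. ennreal (k z)) (\<lambda>z. ennreal (f z)) y + ennreal e"
    and "smooth (\<lambda>z. ennreal (k z)) (\<lambda>z. ennreal (f z)) y \<le> ennreal (f y) + ennreal e"
proof -
  let ?k = "\<lambda>z. ennreal (k z)"
  note lk = Ccp_lsc[OF k(1)] and lf = Ccp_lsc[OF f]
  have sym: "ht ?k (inv z) y = ht ?k (inv y) z" for z
    using ht_symmetric[OF lk, of y "inv z"] k(2) by simp
  have one: "(\<integral>\<^sup>+z. ht ?k (inv y) z \<partial>m) = 1" using ht_integral[OF lk] k(4) by simp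
  have mh[measurable]: "(\<lambda>z. ht ?k (inv y) z) \<in> borel_measurable m"
    by (rule lsc_measurable[OF ht_lsc_compose[OF lk]]) (auto intro!: continuous_intros)
  have mf[measurable]: "(\<lambda>z. ennreal (f z)) \<in> borel_measurable m" by (rule lsc_measurable[OF lf]) simp
  have sm: "smooth ?k (\<lambda>z. ennreal (f z)) y = (\<integral>\<^sup>+z. ennreal (f z) * ht ?k (inv y) z \<partial>m)"
    unfolding smooth_def sym ..
  have close: "\<bar>f z - f y\<bar> < e" if "ht ?k (inv y) z \<noteq> 0" for z
  proof -
    obtain t where "t \<in> sp (inv y) z" "?k t \<noteq> 0" using ht_posD[OF \<open>ht ?k (inv y) z \<noteq> 0\<close>] by blast
    then show ?thesis using V[of t y z] k(3)[of t] by fastforce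
  qed
  have const: "(\<integral>\<^sup>+z. c * ht ?k (inv y) z \<partial>m) = c" for c
    by (subst nn_integral_cmult) (auto simp: one)
  have "ennreal (f y) = (\<integral>\<^sup>+z. ennreal (f y) * ht ?k (inv y) z \<partial>m)" by (simp add: const)
  also have "\<dots> \<le> (\<integral>\<^sup>+z. ennreal (f z) * ht ?k (inv y) z + ennreal e * ht ?k (inv y) z \<partial>m)"
  proof (rule nn_integral_mono)
    fix z
    show "ennreal (f y) * ht ?k (inv y) z \<le> ennreal (f z) * ht ?k (inv y) z + ennreal e * ht ?k (inv y) z"
    proof (cases "ht ?k (inv y) z = 0")
      case False
      then have "f y \<le> f z + e" using close[of z] by linarith
      then have "ennreal (f y) \<le> ennreal (f z) + ennreal e"
        using CcpD(2)[OF f, of z] e by (simp add: ennreal_plus[symmetric] del: ennreal_plus)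
      from mult_right_mono[OF this, of "ht ?k (inv y) z"] show ?thesis by (simp add: distrib_right)
    qed simp
  qed
  also have "\<dots> = smooth ?k (\<lambda>z. ennreal (f z)) y + ennreal e"
    unfolding sm by (subst nn_integral_add) (auto simp: const)
  finally show "ennreal (f y) \<le> smooth ?k (\<lambda>z. ennreal (f z)) y + ennreal e" .
  have "smooth ?k (\<lambda>z. ennreal (f z)) y \<le> (\<integral>\<^sup>+z. (ennreal (f y) + ennreal e) * ht ?k (inv y) z \<partial>m)"
    unfolding sm
  proof (rule nn_integral_mono)
    fix z
    show "ennreal (f z) * ht ?k (inv y) z \<le> (ennreal (f y) + ennreal e) * ht ?k (inv y) z"
    proof (cases "ht ?k (inv y) z = 0")
      case False
      then have "f z \<le> f y + e" using close[of z] by linarith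
      then have "ennreal (f z) \<le> ennreal (f y) + ennreal e"
        using CcpD(2)[OF f, of y] e by (simp add: ennreal_plus[symmetric] del: ennreal_plus)
      then show ?thesis by (rule mult_right_mono) simp
    qed simp
  qed
  then show "smooth ?k (\<lambda>z. ennreal (f z)) y \<le> ennreal (f y) + ennreal e" by (simp only: const)
qed

lemma ht_add_const: "F \<in> borel_measurable borel \<Longrightarrow> ht (\<lambda>z. F z + c) x y = ht F x y + c"
  unfolding ht_def by (subst nn_integral_add) (auto simp: kap_UNIV)

text \<open>Replacing \<open>f\<close> by its smoothing on one side and \<open>g\<close> on the other costs an error of at most \<open>d\<close> times
  the integral of the other function, and between the smoothed sides equality holds.\<close>

lemma adjoint_Ccp_le:
  assumes f: "f \<in> Ccp" and g: "g \<in> Ccp"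
  shows "(\<integral>\<^sup>+y. ht (\<lambda>z. ennreal (f z)) x y * ennreal (g y) \<partial>m) \<le> (\<integral>\<^sup>+y. ennreal (f y) * ht (\<lambda>z. ennreal (g z)) (inv x) y \<partial>m)"
proof (rule ennreal_le_epsilon)
  fix e :: real assume e: "0 < e"
  let ?f = "\<lambda>z. ennreal (f z)" and ?g = "\<lambda>z. ennreal (g z)"
  define c where "c = (LINT z|m. f z) + (LINT z|m. g z)"
  have n: "0 \<le> (LINT z|m. f z)" "0 \<le> (LINT z|m. g z)"
    by (auto intro!: integral_nonneg_AE simp: CcpD(2)[OF f] CcpD(2)[OF g])
  define d where "d = e / (c + 1)"
  have d: "0 < d" "d * c \<le> e"
  proof -
    have "0 \<le> c" using n by (simp add: c_def)
    then show "0 < d" "d * c \<le> e" using e by (auto simp: d_def field_simps)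
  qed
  have unif: "\<exists>V. open V \<and> unit_elt H \<in> V \<and> (\<forall>y z t. t \<in> V \<longrightarrow> t \<in> sp (inv y) z \<longrightarrow> \<bar>f z - f y\<bar> < d)" if f: "f \<in> Ccp" for f
  proof -
    obtain K where K: "compact K" "\<And>x. x \<notin> K \<Longrightarrow> complex_of_real (f x) = 0" using Ccp_Cc[OF f] unfolding Cc_def by blast
    show ?thesis
    proof (rule uniform_translates[OF Cc_cont[OF Ccp_Cc[OF f]] K open_UNIV subset_UNIV d(1)])
      fix V assume V: "open V" "unit_elt H \<in> V"
        "\<And>y z t. t \<in> V \<Longrightarrow> t \<in> sp (inv y) z \<Longrightarrow> cmod (complex_of_real (f z) - complex_of_real (f y)) < d"
      have "\<bar>f z - f y\<bar> < d" if "t \<in> V" "t \<in> sp (inv y) z" for y z t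
        using V(3)[OF that] by (simp flip: of_real_diff)
      then show ?thesis using V(1,2) by blast
    qed
  qed
  obtain V1 V2 where V: "open V1" "unit_elt H \<in> V1" "open V2" "unit_elt H \<in> V2"
    "\<And>y z t. t \<in> V1 \<Longrightarrow> t \<in> sp (inv y) z \<Longrightarrow> \<bar>f z - f y\<bar> < d" "\<And>y z t. t \<in> V2 \<Longrightarrow> t \<in> sp (inv y) z \<Longrightarrow> \<bar>g z - g y\<bar> < d"
    using unif[OF f] unif[OF g] by blast
  obtain k where k: "k \<in> Ccp" "\<And>z. k (inv z) = k z" "\<And>z. z \<notin> V1 \<inter> V2 \<Longrightarrow> k z = 0" "(\<integral>\<^sup>+z. ennreal (k z) \<partial>m) = 1"
    using approximate_unit[of "V1 \<inter> V2"] V(1-4) by blast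
  let ?k = "\<lambda>z. ennreal (k z)"
  note lk = Ccp_lsc[OF k(1)] and lf = Ccp_lsc[OF f] and lg = Ccp_lsc[OF g]
  have c1: "?f y \<le> smooth ?k ?f y + ennreal d" for y
  proof (rule smooth_close(1)[where V = "V1 \<inter> V2", OF f k(1,2) _ k(4) _ d(1)])
    show "k z = 0" if "z \<notin> V1 \<inter> V2" for z by (rule k(3)[OF that])
    show "\<bar>f z - f y\<bar> < d" if "t \<in> V1 \<inter> V2" "t \<in> sp (inv y) z" for y z t
      using that by (intro V(5)[of t]) auto
  qed
  have c2: "smooth ?k ?g y \<le> ?g y + ennreal d" for y
  proof (rule smooth_close(2)[where V = "V1 \<inter> V2", OF g k(1,2) _ k(4) _ d(1)])
    show "k z = 0" if "z \<notin> V1 \<inter> V2" for z by (rule k(3)[OF that])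
    show "\<bar>g z - g y\<bar> < d" if "t \<in> V1 \<inter> V2" "t \<in> sp (inv y) z" for y z t
      using that by (intro V(6)[of t]) auto
  qed
  have ms: "smooth ?k ?f \<in> borel_measurable borel" by (rule lsc_measurable[OF lsc_smooth[OF lk lf] refl])
  have mg: "?g \<in> borel_measurable m" "?f \<in> borel_measurable m" by (auto intro: lsc_measurable lg lf)
  have mg': "?g \<in> borel_measurable borel" by (rule lsc_measurable[OF lg refl])
  have mht: "(\<lambda>y. ht F x y) \<in> borel_measurable m" if "lsc F" for F x
    by (rule lsc_measurable[OF ht_lsc_compose[OF that]]) (auto intro!: continuous_intros)
  have "(\<integral>\<^sup>+y. ht ?f x y * ?g y \<partial>m) \<le> (\<integral>\<^sup>+y. ht (smooth ?k ?f) x y * ?g y + ennreal d * ?g y \<partial>m)"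
  proof (rule nn_integral_mono)
    fix y
    have "ht ?f x y \<le> ht (\<lambda>z. smooth ?k ?f z + ennreal d) x y" by (rule ht_mono) (rule le_funI, rule c1)
    then have "ht ?f x y \<le> ht (smooth ?k ?f) x y + ennreal d" by (simp add: ht_add_const[OF ms])
    from mult_right_mono[OF this, of "?g y"] show "ht ?f x y * ?g y \<le> ht (smooth ?k ?f) x y * ?g y + ennreal d * ?g y"
      by (simp add: distrib_right)
  qed
  also have "\<dots> = (\<integral>\<^sup>+y. ht (smooth ?k ?f) x y * ?g y \<partial>m) + ennreal d * (\<integral>\<^sup>+y. ?g y \<partial>m)"
    using mg mht[OF lsc_smooth[OF lk lf]] by (subst nn_integral_add) (auto simp: nn_integral_cmult)
  also have "(\<integral>\<^sup>+y. ht (smooth ?k ?f) x y * ?g y \<partial>m) = (\<integral>\<^sup>+z. ?f z * ht (smooth ?k ?g) (inv x) z \<partial>m)"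
    by (rule smooth_adjoint[OF lk _ lf lg]) (simp add: k(2))
  also have "\<dots> \<le> (\<integral>\<^sup>+z. ?f z * ht ?g (inv x) z + ennreal d * ?f z \<partial>m)"
  proof (rule nn_integral_mono)
    fix z
    have "ht (smooth ?k ?g) (inv x) z \<le> ht (\<lambda>z. ?g z + ennreal d) (inv x) z" by (rule ht_mono) (rule le_funI, rule c2)
    then have "ht (smooth ?k ?g) (inv x) z \<le> ht ?g (inv x) z + ennreal d" by (simp add: ht_add_const[OF mg'])
    from mult_left_mono[OF this, of "?f z"] show "?f z * ht (smooth ?k ?g) (inv x) z \<le> ?f z * ht ?g (inv x) z + ennreal d * ?f z"
      by (simp add: distrib_left mult.commute[of "ennreal d"])
  qed
  also have "\<dots> = (\<integral>\<^sup>+z. ?f z * ht ?g (inv x) z \<partial>m) + ennreal d * (\<integral>\<^sup>+z. ?f z \<partial>m)"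
    using mg mht[OF lg] by (subst nn_integral_add) (auto simp: nn_integral_cmult)
  finally have "(\<integral>\<^sup>+y. ht ?f x y * ?g y \<partial>m) \<le> (\<integral>\<^sup>+z. ?f z * ht ?g (inv x) z \<partial>m) +
     (ennreal d * (\<integral>\<^sup>+z. ?f z \<partial>m) + ennreal d * (\<integral>\<^sup>+y. ?g y \<partial>m))"
    by (simp add: add.assoc add_mono)
  also have "ennreal d * (\<integral>\<^sup>+z. ?f z \<partial>m) + ennreal d * (\<integral>\<^sup>+y. ?g y \<partial>m) = ennreal (d * c)"
    using n d(1) by (simp add: nn_integral_Ccp f g c_def distrib_left ennreal_mult ennreal_plus[symmetric] del: ennreal_plus flip: ennreal_mult)
  also have "ennreal (d * c) \<le> ennreal e" using d(2) by (rule ennreal_leI)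
  finally show "(\<integral>\<^sup>+y. ht ?f x y * ?g y \<partial>m) \<le> (\<integral>\<^sup>+y. ?f y * ht ?g (inv x) y \<partial>m) + ennreal e"
    by (simp add: add_left_mono)
qed

lemma adjoint_Ccp:
  assumes f: "f \<in> Ccp" and g: "g \<in> Ccp"
  shows "(\<integral>\<^sup>+y. ht (\<lambda>z. ennreal (f z)) x y * ennreal (g y) \<partial>m) = (\<integral>\<^sup>+y. ennreal (f y) * ht (\<lambda>z. ennreal (g z)) (inv x) y \<partial>m)"
  using adjoint_Ccp_le[OF f g, of x] adjoint_Ccp_le[OF g f, of "inv x"] by (simp add: mult.commute)

lemma adjoint_lsc:
  assumes f: "f \<in> Ccp" and G: "lsc G"
  shows "(\<integral>\<^sup>+y. ht (\<lambda>z. ennreal (f z)) x y * G y \<partial>m) = (\<integral>\<^sup>+y. ennreal (f y) * ht G (inv x) y \<partial>m)"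
proof -
  let ?f = "\<lambda>z. ennreal (f z)"
  have lf: "lsc (\<lambda>y. ht ?f x y)" by (intro ht_lsc_compose Ccp_lsc f continuous_intros)
  have "(\<integral>\<^sup>+y. ht ?f x y * G y \<partial>m) = (\<integral>\<^sup>+y. (SUP \<gamma>\<in>below G. ht ?f x y * ennreal (\<gamma> y)) \<partial>m)"
    by (intro nn_integral_cong) (simp add: SUP_below[OF lc G] flip: SUP_mult_left_ennreal)
  also have "\<dots> = (SUP \<gamma>\<in>below G. \<integral>\<^sup>+y. ht ?f x y * ennreal (\<gamma> y) \<partial>m)"
  proof (rule nn_integral_SUP_directed[OF m_radon])
    show "lsc (\<lambda>y. ht ?f x y * ennreal (\<gamma> y))" if "\<gamma> \<in> below G" for \<gamma>
      using that by (intro lsc_mult lf Ccp_lsc) (simp add: below_def)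
    show "directed_fam (below G) (\<lambda>\<gamma> y. ht ?f x y * ennreal (\<gamma> y))"
      by (rule directed_fam_mono[OF directed_below]) (rule le_funI, rule mult_left_mono, erule le_funD, simp)
  qed
  also have "\<dots> = (SUP \<gamma>\<in>below G. \<integral>\<^sup>+y. ht (\<lambda>z. ennreal (\<gamma> z)) (inv x) y * ?f y \<partial>m)"
  proof (rule SUP_cong)
    fix \<gamma> assume "\<gamma> \<in> below G"
    then have "\<gamma> \<in> Ccp" by (simp add: below_def)
    then show "(\<integral>\<^sup>+y. ht ?f x y * ennreal (\<gamma> y) \<partial>m) = (\<integral>\<^sup>+y. ht (\<lambda>z. ennreal (\<gamma> z)) (inv x) y * ?f y \<partial>m)"
      unfolding adjoint_Ccp[OF f \<open>\<gamma> \<in> Ccp\<close>] by (simp add: mult.commute)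
  qed simp
  also have "\<dots> = (\<integral>\<^sup>+y. ht G (inv x) y * ?f y \<partial>m)"
    by (rule ht_integral_SUP_below[OF m_radon G continuous_on_const continuous_on_id Ccp_lsc[OF f], symmetric])
  finally show ?thesis by (simp add: mult.commute)
qed

lemma htrans_Cb1: "u \<in> Cb \<Longrightarrow> htrans H u x \<in> Cb"
  using htrans_Cb_compose[of u "\<lambda>_. x" "\<lambda>y. y"] by (simp add: continuous_on_const continuous_on_id)

text \<open>If \<open>f\<close> is not integrable the left hand side is zero.\<close>

lemma htrans_le_ht: "ennreal (cmod (htrans H f x y)) \<le> ht (\<lambda>z. ennreal (cmod (f z))) x y"
proof (cases "integrable (kap x y) f")
  case True then show ?thesis unfolding htrans_kap ht_def by (rule integral_norm_bound_ennreal)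
next
  case False then show ?thesis by (simp add: htrans_kap not_integrable_integral_eq)
qed

lemma htrans_Cc_integrable:
  assumes h: "h \<in> Cc" shows "integrable m (htrans H h x)"
proof (rule integrableI_bounded)
  show "htrans H h x \<in> borel_measurable m" by (rule Cb_measurable[OF htrans_Cb1[OF Cc_Cb[OF h]]]) simp
  have n: "(\<lambda>z. cmod (h z)) \<in> Ccp" by (rule Cc_Ccp[OF h]) (auto intro!: continuous_intros)
  have "(\<integral>\<^sup>+y. ennreal (cmod (htrans H h x y)) \<partial>m) \<le> (\<integral>\<^sup>+y. ht (\<lambda>z. ennreal (cmod (h z))) x y \<partial>m)"
    by (intro nn_integral_mono htrans_le_ht)
  also have "\<dots> = ennreal (LINT z|m. cmod (h z))" using ht_integral[OF Ccp_lsc[OF n]] nn_integral_Ccp[OF n] by simp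
  finally show "(\<integral>\<^sup>+y. ennreal (cmod (htrans H h x y)) \<partial>m) < \<infinity>" by (rule le_less_trans) simp
qed

text \<open>The adjoint of a left translation is the translation by the involuted element.\<close>

lemma adjoint_Cb:
  assumes h: "h \<in> Cc" and u: "u \<in> Cb"
  shows "(LINT y|m. htrans H h x y * u y) = (LINT y|m. h y * htrans H u (inv x) y)"
proof -
  have i: "integrable m (\<lambda>y. htrans H h x y * u y)" "integrable m (\<lambda>y. h y * htrans H u (inv x) y)" if "h \<in> Cc" "u \<in> Cb" for h u
    by (rule integrable_mult_Cb[OF m_radon htrans_Cc_integrable[OF that(1)] that(2)],
        rule integrable_mult_Cb[OF m_radon Cc_integrable[OF m_radon that(1)] htrans_Cb1[OF that(2)]])
  define P where "P = (\<lambda>h u. h \<in> Cc \<and> u \<in> Cb \<and> (LINT y|m. htrans H h x y * u y) = (LINT y|m. h y * htrans H u (inv x) y))"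
  obtain B where B: "0 < B" "\<And>x. cmod (u x) \<le> B" using Cb_bound[OF u] by blast
  have base: "P (\<lambda>x. complex_of_real (\<phi> x)) (\<lambda>x. complex_of_real (v x))"
    if \<phi>: "\<phi> \<in> Ccp" and v: "continuous_on UNIV v" "\<And>x. 0 \<le> v x" "\<And>x. v x \<le> B" for \<phi> v
  proof -
    have vC: "(\<lambda>x. complex_of_real (v x)) \<in> Cb" by (rule CbI[where B = B]) (use v in \<open>auto intro!: continuous_intros\<close>)
    have iv: "integrable (kap a b) v" for a b using integrable_kap_Cb[OF vC, of a b] by (simp add: complex_of_real_integrable_eq)
    define p q where "p = (\<lambda>y. LINT z|kap x y. \<phi> z)" and "q = (\<lambda>y. LINT z|kap (inv x) y. v z)"
    have pq: "htrans H (\<lambda>z. complex_of_real (\<phi> z)) x y = complex_of_real (p y)"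
      "htrans H (\<lambda>z. complex_of_real (v z)) (inv x) y = complex_of_real (q y)" for y
      by (simp_all add: htrans_kap p_def q_def)
    have nn: "0 \<le> p y" "0 \<le> q y" for y by (auto simp: p_def q_def CcpD(2)[OF \<phi>] v intro!: integral_nonneg_AE)
    have hpq: "ht (\<lambda>z. ennreal (\<phi> z)) x y = ennreal (p y)" "ht (\<lambda>z. ennreal (v z)) (inv x) y = ennreal (q y)" for y
      by (simp_all add: ht_Ccp[OF \<phi>] p_def q_def) (simp add: ht_def nn_integral_real[OF iv v(2)])
    have ii: "integrable m (\<lambda>y. p y * v y)" "integrable m (\<lambda>y. \<phi> y * q y)"
      using i[OF Ccp_Cc[OF \<phi>] vC] unfolding pq by (simp_all add: complex_of_real_integrable_eq flip: of_real_mult)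
    have "(\<integral>\<^sup>+y. ennreal (p y * v y) \<partial>m) = (\<integral>\<^sup>+y. ennreal (\<phi> y * q y) \<partial>m)"
      using adjoint_lsc[OF \<phi>, of "\<lambda>z. ennreal (v z)" x] v(1) unfolding hpq
      by (simp add: ennreal_mult nn v CcpD(2)[OF \<phi>] lsc_continuous continuous_on_ennreal)
    then have "ennreal (LINT y|m. p y * v y) = ennreal (LINT y|m. \<phi> y * q y)"
      using nn_integral_real[OF ii(1)] nn_integral_real[OF ii(2)] nn v(2) CcpD(2)[OF \<phi>] by simp
    then have "(LINT y|m. p y * v y) = (LINT y|m. \<phi> y * q y)"
      by (subst (asm) ennreal_inj) (auto intro!: integral_nonneg_AE simp: nn v(2) CcpD(2)[OF \<phi>])
    then show ?thesis unfolding P_def pq using Ccp_Cc[OF \<phi>] vC by (simp flip: of_real_mult)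
  qed
  have "P h (\<lambda>x. complex_of_real (v x))" if v: "continuous_on UNIV v" "\<And>x. 0 \<le> v x" "\<And>x. v x \<le> B" for v
  proof (rule complex_parts_induct[of "\<lambda>h. P h (\<lambda>x. complex_of_real (v x))" h])
    fix r :: "complex \<Rightarrow> real" assume "continuous_on UNIV r" "\<And>z. 0 \<le> r z \<and> r z \<le> cmod z"
    then show "P (\<lambda>x. complex_of_real (r (h x))) (\<lambda>x. complex_of_real (v x))" by (intro base Cc_Ccp[OF h] v)
  next
    fix f g assume "P f (\<lambda>x. complex_of_real (v x))" "P g (\<lambda>x. complex_of_real (v x))"
    then show "P (\<lambda>x. f x + g x) (\<lambda>x. complex_of_real (v x))"
      unfolding P_def by (simp add: Cc_add htrans_add Cc_Cb distrib_right i)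
  next
    fix c f assume "P f (\<lambda>x. complex_of_real (v x))"
    then show "P (\<lambda>x. c * f x) (\<lambda>x. complex_of_real (v x))"
      unfolding P_def by (simp add: Cc_cmult htrans_cmult mult.assoc)
  qed
  note 1 = this
  have "P h u"
  proof (rule complex_parts_induct[of "P h" u])
    fix r :: "complex \<Rightarrow> real" assume r: "continuous_on UNIV r" "\<And>z. 0 \<le> r z \<and> r z \<le> cmod z"
    have "continuous_on UNIV (\<lambda>x. r (u x))" by (rule continuous_on_compose2[OF r(1) Cb_cont[OF u]]) simp
    moreover have "r (u x) \<le> B" for x using r(2)[of "u x"] B(2)[of x] by simp
    ultimately show "P h (\<lambda>x. complex_of_real (r (u x)))" using r(2) by (intro 1) auto
  next
    fix f g assume "P h f" "P h g"
    then show "P h (\<lambda>x. f x + g x)" unfolding P_def by (simp add: Cb_add htrans_add distrib_left i)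
  next
    fix c f assume "P h f"
    then show "P h (\<lambda>x. c * f x)" unfolding P_def by (simp add: Cb_cmult htrans_cmult mult.left_commute[of _ c])
  qed
  then show ?thesis by (simp add: P_def)
qed

end

section \<open>Convolution of integrable and square integrable functions\<close>

text \<open>The square root on the extended nonnegative reals, needed to factor an integrand that may be infinite
  for the Cauchy--Schwarz inequality.\<close>

definition esqrt :: "ennreal \<Rightarrow> ennreal" where
  "esqrt v = (if v = top then top else ennreal (sqrt (enn2real v)))"

lemma esqrt_measurable [measurable]: "esqrt \<in> borel_measurable borel"
  unfolding esqrt_def[abs_def] by measurable

lemma esqrt_power2: "(esqrt v)\<^sup>2 = v"
proof (cases v)
  case (real r) then show ?thesis by (simp add: esqrt_def ennreal_power)
next
  case top then show ?thesis by (simp add: esqrt_def power2_eq_square ennreal_top_mult)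
qed

lemma le_esqrt: "a\<^sup>2 \<le> v \<Longrightarrow> a \<le> esqrt v"
proof (cases v)
  case (real r)
  assume "a\<^sup>2 \<le> v"
  then have "a\<^sup>2 \<le> (ennreal (sqrt r))\<^sup>2" using real by (simp add: ennreal_power)
  then show ?thesis using real ennreal_power2_le[of a "sqrt r"] by (simp add: esqrt_def)
qed (simp add: esqrt_def)

lemma ennreal_approx_product:
  fixes a b c :: real
  assumes "a * a * b < c" "0 \<le> a" "0 \<le> b"
  obtains e where "0 < e" "(a + e) * (a + e) * (b + e) < c"
proof -
  have "((\<lambda>e. (a + e) * (a + e) * (b + e)) \<longlongrightarrow> (a + 0) * (a + 0) * (b + 0)) (at_right 0)"
    by (intro tendsto_intros)
  then have "eventually (\<lambda>e. (a + e) * (a + e) * (b + e) < c) (at_right 0)"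
    using assms(1) by (intro order_tendstoD(2)) auto
  moreover have "eventually (\<lambda>e::real. 0 < e) (at_right 0)" by (rule eventually_at_right_less)
  ultimately have "eventually (\<lambda>e. 0 < e \<and> (a + e) * (a + e) * (b + e) < c) (at_right 0)"
    by eventually_elim simp
  then show thesis using that by (metis (mono_tags, lifting) eventually_happens' trivial_limit_at_right_real)
qed

context haar begin

lemma ht_power2_le:
  assumes "p \<in> borel_measurable borel"
  shows "(ht p x y)\<^sup>2 \<le> ht (\<lambda>z. (p z)\<^sup>2) x y"
proof -
  have [measurable]: "p \<in> borel_measurable (kap x y)" using assms by simp
  show ?thesis
    using Cauchy_Schwarz_nn_integral[of p "kap x y" "\<lambda>_. 1"] unfolding ht_def by (simp add: kap_UNIV)
qed

text \<open>For nonnegative functions the norm of \<open>L\<^sup>1(H)\<close> is multiplicative under convolution, by Tonelli's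
  theorem and left invariance.\<close>

lemma integral_translates:
  assumes f: "lsc f" and p: "lsc p"
  shows "(\<integral>\<^sup>+x. \<integral>\<^sup>+y. f y * ht p (inv y) x \<partial>m \<partial>m) = (\<integral>\<^sup>+y. f y \<partial>m) * (\<integral>\<^sup>+y. p y \<partial>m)"
proof -
  have "lsc (\<lambda>q. f (snd q) * ht p (inv (snd q)) (fst q))"
    by (intro lsc_mult lsc_compose[OF f] ht_lsc_compose[OF p] continuous_on_compose2[OF inv_cont _ subset_UNIV] continuous_intros)
  from Tonelli_lsc[OF lc lc m_radon m_radon this]
  have "(\<integral>\<^sup>+x. \<integral>\<^sup>+y. f y * ht p (inv y) x \<partial>m \<partial>m) = (\<integral>\<^sup>+y. \<integral>\<^sup>+x. f y * ht p (inv y) x \<partial>m \<partial>m)" by simp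
  also have "\<dots> = (\<integral>\<^sup>+y. f y * (\<integral>\<^sup>+x. p x \<partial>m) \<partial>m)"
  proof (rule nn_integral_cong)
    fix y
    have "(\<lambda>x. ht p (inv y) x) \<in> borel_measurable m"
      by (rule lsc_measurable[OF ht_lsc_compose[OF p]]) (auto intro!: continuous_intros)
    then show "(\<integral>\<^sup>+x. f y * ht p (inv y) x \<partial>m) = f y * (\<integral>\<^sup>+x. p x \<partial>m)"
      by (simp add: nn_integral_cmult ht_integral[OF p])
  qed
  also have "\<dots> = (\<integral>\<^sup>+y. f y \<partial>m) * (\<integral>\<^sup>+y. p y \<partial>m)"
    by (rule nn_integral_multc) (rule lsc_measurable[OF f], simp)
  finally show ?thesis .
qed

text \<open>Cauchy--Schwarz, with \<open>f * p\<close> split as the square root of \<open>f\<close> times the square root of \<open>f\<close> times \<open>p\<close>,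
  bounds the square of the integral by the product of the integral of \<open>f\<close> and that of \<open>f\<close> times the
  translates of \<open>p\<^sup>2\<close>. With lower semicontinuous majorants of \<open>f\<close> and \<open>p\<^sup>2\<close> the bound is measurable in \<open>x\<close> and
  integrable by \<open>integral_translates\<close>, whatever the measurability of the left hand side.\<close>

lemma square_translates_dominated:
  assumes f: "f \<in> borel_measurable borel" and p: "p \<in> borel_measurable borel"
    and a: "(\<integral>\<^sup>+y. f y \<partial>m) = ennreal a" "0 \<le> a" and b: "(\<integral>\<^sup>+y. (p y)\<^sup>2 \<partial>m) = ennreal b" "0 \<le> b" and c: "a * a * b < c"
  obtains W where "lsc W" "\<And>x. (\<integral>\<^sup>+y. f y * ht p (inv y) x \<partial>m)\<^sup>2 \<le> W x" "(\<integral>\<^sup>+x. W x \<partial>m) \<le> ennreal c"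
proof -
  obtain e where e: "0 < e" "(a + e) * (a + e) * (b + e) < c" using ennreal_approx_product[OF c a(2) b(2)] .
  have [measurable]: "f \<in> borel_measurable m" "p \<in> borel_measurable m" using f p by simp_all
  have "lsc_dominable m f" "lsc_dominable m (\<lambda>y. (p y)\<^sup>2)" by (intro lsc_dominable_measurable[OF m_radon]; measurable)+
  then obtain F Q where F: "lsc F" "f \<le> F" "(\<integral>\<^sup>+y. F y \<partial>m) \<le> ennreal a + ennreal e"
    and Q: "lsc Q" "(\<lambda>y. (p y)\<^sup>2) \<le> Q" "(\<integral>\<^sup>+y. Q y \<partial>m) \<le> ennreal b + ennreal e"
    unfolding lsc_dominable_def a(1) b(1) using e(1) by meson
  have mF[measurable]: "F \<in> borel_measurable m" by (rule lsc_measurable[OF F(1)]) simp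
  have lh: "lsc (\<lambda>y. F y * ht Q (inv y) x)" for x
    by (intro lsc_mult F ht_lsc_compose[OF Q(1)] inv_cont continuous_intros)
  have mh[measurable]: "(\<lambda>y. ht Q (inv y) x) \<in> borel_measurable m" for x
    by (rule lsc_measurable[OF ht_lsc_compose[OF Q(1) inv_cont]]) (auto intro!: continuous_intros)
  define W where "W = (\<lambda>x. (\<integral>\<^sup>+y. F y \<partial>m) * (\<integral>\<^sup>+y. F y * ht Q (inv y) x \<partial>m))"
  have lW: "lsc (\<lambda>x. \<integral>\<^sup>+y. F y * ht Q (inv y) x \<partial>m)"
  proof -
    have "lsc (\<lambda>q. F (snd q) * ht Q (inv (snd q)) (fst q))"
      by (intro lsc_mult lsc_compose[OF F(1)] ht_lsc_compose[OF Q(1)] continuous_on_compose2[OF inv_cont _ subset_UNIV] continuous_intros)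
    from lsc_nn_integral[OF lc m_radon this] show ?thesis by simp
  qed
  show thesis
  proof (rule that[of W])
    show "lsc W" unfolding W_def by (intro lsc_mult lsc_const lW)
    show "(\<integral>\<^sup>+y. f y * ht p (inv y) x \<partial>m)\<^sup>2 \<le> W x" for x
    proof -
      have le: "ht p (inv y) x \<le> esqrt (ht Q (inv y) x)" for y
        by (rule le_esqrt, rule order_trans[OF ht_power2_le[OF p]], rule ht_mono, rule Q(2))
      have "(\<integral>\<^sup>+y. f y * ht p (inv y) x \<partial>m) \<le> (\<integral>\<^sup>+y. esqrt (F y) * (esqrt (F y) * esqrt (ht Q (inv y) x)) \<partial>m)"
      proof (rule nn_integral_mono)
        fix y
        have "f y * ht p (inv y) x \<le> F y * esqrt (ht Q (inv y) x)" by (intro mult_mono le le_funD[OF F(2)]) auto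
        also have "F y = esqrt (F y) * esqrt (F y)" using esqrt_power2[of "F y"] by (simp add: power2_eq_square)
        finally show "f y * ht p (inv y) x \<le> esqrt (F y) * (esqrt (F y) * esqrt (ht Q (inv y) x))" by (simp add: mult.assoc)
      qed
      then have "(\<integral>\<^sup>+y. f y * ht p (inv y) x \<partial>m)\<^sup>2 \<le> (\<integral>\<^sup>+y. esqrt (F y) * (esqrt (F y) * esqrt (ht Q (inv y) x)) \<partial>m)\<^sup>2"
        unfolding power2_eq_square by (intro mult_mono) auto
      also have "\<dots> \<le> (\<integral>\<^sup>+y. (esqrt (F y))\<^sup>2 \<partial>m) * (\<integral>\<^sup>+y. (esqrt (F y) * esqrt (ht Q (inv y) x))\<^sup>2 \<partial>m)"
        by (rule Cauchy_Schwarz_nn_integral) measurable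
      also have "\<dots> = W x" by (simp add: W_def power_mult_distrib esqrt_power2)
      finally show ?thesis .
    qed
    have "(\<integral>\<^sup>+x. W x \<partial>m) = (\<integral>\<^sup>+y. F y \<partial>m) * ((\<integral>\<^sup>+y. F y \<partial>m) * (\<integral>\<^sup>+y. Q y \<partial>m))"
      unfolding W_def integral_translates[OF F(1) Q(1), symmetric]
      by (rule nn_integral_cmult) (rule lsc_measurable[OF lW], simp)
    also have "\<dots> \<le> (ennreal a + ennreal e) * ((ennreal a + ennreal e) * (ennreal b + ennreal e))"
      by (intro mult_mono F Q) auto
    also have "\<dots> = ennreal ((a + e) * ((a + e) * (b + e)))"
      using a(2) b(2) e(1) by (simp add: ennreal_plus[symmetric] ennreal_mult[symmetric] del: ennreal_plus)
    also have "\<dots> \<le> ennreal c" using e(2) by (intro ennreal_leI) (simp add: mult.assoc)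
    finally show "(\<integral>\<^sup>+x. W x \<partial>m) \<le> ennreal c" .
  qed
qed

lemma L1D: "f \<in> L1 m \<Longrightarrow> integrable m f" by (simp add: L1_def)

lemma L1_norm_nonneg: "0 \<le> L1_norm m f" by (simp add: L1_norm_def)

lemma nn_integral_L1: "f \<in> L1 m \<Longrightarrow> (\<integral>\<^sup>+x. ennreal (cmod (f x)) \<partial>m) = ennreal (L1_norm m f)"
  unfolding L1_norm_def L1_def by (rule nn_integral_real) auto

lemma conv_le: "ennreal (cmod (conv H m f g x)) \<le> (\<integral>\<^sup>+y. ennreal (cmod (f y)) * ht (\<lambda>z. ennreal (cmod (g z))) (inv y) x \<partial>m)"
proof (cases "integrable m (\<lambda>y. f y * htrans H g (inv y) x)")
  case True
  have "ennreal (cmod (conv H m f g x)) \<le> (\<integral>\<^sup>+y. ennreal (cmod (f y * htrans H g (inv y) x)) \<partial>m)"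
    unfolding conv_def by (rule integral_norm_bound_ennreal[OF True])
  also have "\<dots> \<le> (\<integral>\<^sup>+y. ennreal (cmod (f y)) * ht (\<lambda>z. ennreal (cmod (g z))) (inv y) x \<partial>m)"
    by (intro nn_integral_mono) (auto simp: norm_mult ennreal_mult intro!: mult_left_mono htrans_le_ht)
  finally show ?thesis .
next
  case False then show ?thesis by (simp add: conv_def not_integrable_integral_eq)
qed

text \<open>Keeps the majorant \<open>W\<close> besides the norm inequality: it is a measurable bound for the convolution of an
  integrable and a square integrable function, whose own measurability is unknown.\<close>

lemma conv_square_dominated:
  assumes f: "f \<in> L1 m" and g: "g \<in> L2 m" and c: "L1_norm m f * L2_norm m g < c"
  obtains W where "lsc W" "\<And>x. (\<integral>\<^sup>+y. ennreal (cmod (f y)) * ht (\<lambda>z. ennreal (cmod (g z))) (inv y) x \<partial>m)\<^sup>2 \<le> W x"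
    "(\<integral>\<^sup>+x. W x \<partial>m) \<le> ennreal (c\<^sup>2)"
proof -
  have [measurable]: "f \<in> borel_measurable borel" "g \<in> borel_measurable borel"
    using L1D[OF f] L2D(1)[OF g] borel_measurable_integrable by auto
  have n: "0 \<le> L1_norm m f * L2_norm m g" by (simp add: L1_norm_nonneg L2_norm_nonneg)
  have "(L1_norm m f * L2_norm m g)\<^sup>2 < c\<^sup>2" using c n by (intro power_strict_mono) auto
  then have lt: "L1_norm m f * L1_norm m f * (L2_norm m g)\<^sup>2 < c\<^sup>2" by (simp add: power_mult_distrib power2_eq_square[of "L1_norm m f"])
  have b: "(\<integral>\<^sup>+y. (ennreal (cmod (g y)))\<^sup>2 \<partial>m) = ennreal ((L2_norm m g)\<^sup>2)"
    using nn_integral_L2[OF g] by (simp add: ennreal_power)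
  show thesis
    by (rule square_translates_dominated[OF _ _ nn_integral_L1[OF f] L1_norm_nonneg b _ lt]) (simp_all add: that)
qed

lemma conv_L2_nn:
  assumes f: "f \<in> L1 m" and g: "g \<in> L2 m" and c: "L1_norm m f * L2_norm m g < c"
  shows "(\<integral>\<^sup>+x. ennreal ((cmod (conv H m f g x))\<^sup>2) \<partial>m) \<le> ennreal (c\<^sup>2)"
proof (rule conv_square_dominated[OF assms])
  fix W assume W: "lsc W" "\<And>x. (\<integral>\<^sup>+y. ennreal (cmod (f y)) * ht (\<lambda>z. ennreal (cmod (g z))) (inv y) x \<partial>m)\<^sup>2 \<le> W x"
    "(\<integral>\<^sup>+x. W x \<partial>m) \<le> ennreal (c\<^sup>2)"
  have "(\<integral>\<^sup>+x. ennreal ((cmod (conv H m f g x))\<^sup>2) \<partial>m) \<le> (\<integral>\<^sup>+x. W x \<partial>m)"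
  proof (rule nn_integral_mono)
    fix x
    have "ennreal ((cmod (conv H m f g x))\<^sup>2) = ennreal (cmod (conv H m f g x)) * ennreal (cmod (conv H m f g x))"
      by (simp add: ennreal_mult[symmetric] power2_eq_square)
    also have "\<dots> \<le> (\<integral>\<^sup>+y. ennreal (cmod (f y)) * ht (\<lambda>z. ennreal (cmod (g z))) (inv y) x \<partial>m)\<^sup>2"
      unfolding power2_eq_square by (intro mult_mono conv_le) auto
    also have "\<dots> \<le> W x" by (rule W(2))
    finally show "ennreal ((cmod (conv H m f g x))\<^sup>2) \<le> W x" .
  qed
  also have "\<dots> \<le> ennreal (c\<^sup>2)" by (rule W(3))
  finally show ?thesis .
qed

text \<open>The operator \<open>\<lambda>(f)\<close> is bounded, which makes the supremum that defines its norm a supremum of a bounded set.\<close>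

lemma conv_L2_norm:
  assumes f: "f \<in> L1 m" and g: "g \<in> L2 m"
  shows "L2_norm m (conv H m f g) \<le> L1_norm m f * L2_norm m g"
proof (rule dense_ge)
  fix c assume c: "L1_norm m f * L2_norm m g < c"
  have "0 \<le> L1_norm m f * L2_norm m g" by (simp add: L1_norm_nonneg L2_norm_nonneg)
  then show "L2_norm m (conv H m f g) \<le> c" using c conv_L2_nn[OF f g c] by (intro L2_norm_le) auto
qed

lemma conv_Cb:
  assumes f: "f \<in> L1 m" and u: "u \<in> Cb"
  shows "conv H m f u \<in> Cb"
proof -
  have "(\<lambda>p. htrans H u (inv (snd p)) (fst p)) \<in> Cb"
    by (rule htrans_Cb_compose[OF u]) (auto intro!: continuous_intros continuous_on_compose2[OF inv_cont])
  from Cb_integral[OF lc m_radon L1D[OF f] this] show ?thesis by (simp add: conv_def[abs_def])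
qed

lemma conv_integrand:
  assumes f: "f \<in> L1 m" and u: "u \<in> Cb"
  shows "integrable m (\<lambda>y. f y * htrans H u (inv y) x)"
  by (rule integrable_mult_Cb[OF m_radon L1D[OF f] htrans_Cb_compose[OF u inv_cont continuous_on_const]])

lemma conv_L2:
  assumes f: "f \<in> L1 m" and u: "u \<in> Cb" "u \<in> L2 m"
  shows "conv H m f u \<in> L2 m"
proof (rule L2I(1))
  show "conv H m f u \<in> borel_measurable m" by (rule Cb_measurable[OF conv_Cb[OF f u(1)]]) simp
  show "(\<integral>\<^sup>+x. ennreal ((cmod (conv H m f u x))\<^sup>2) \<partial>m) \<le> ennreal ((L1_norm m f * L2_norm m u + 1)\<^sup>2)"
    by (rule conv_L2_nn[OF f u(2)]) simp
qed (simp add: L1_norm_nonneg L2_norm_nonneg add_nonneg_nonneg)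

lemma conv_L1:
  assumes f: "f \<in> L1 m" and u: "u \<in> Cb" "u \<in> L1 m"
  shows "conv H m f u \<in> L1 m"
proof -
  have [measurable]: "f \<in> borel_measurable m" "u \<in> borel_measurable m" using L1D[OF f] L1D[OF u(2)] by auto
  have "lsc_dominable m (\<lambda>y. ennreal (cmod (f y)))" "lsc_dominable m (\<lambda>y. ennreal (cmod (u y)))"
    by (intro lsc_dominable_measurable[OF m_radon]; measurable)+
  then obtain F Q where F: "lsc F" "(\<lambda>y. ennreal (cmod (f y))) \<le> F" "(\<integral>\<^sup>+y. F y \<partial>m) \<le> ennreal (L1_norm m f) + ennreal 1"
    and Q: "lsc Q" "(\<lambda>y. ennreal (cmod (u y))) \<le> Q" "(\<integral>\<^sup>+y. Q y \<partial>m) \<le> ennreal (L1_norm m u) + ennreal 1"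
    unfolding lsc_dominable_def nn_integral_L1[OF f] nn_integral_L1[OF u(2)] using zero_less_one by meson
  have "(\<integral>\<^sup>+x. ennreal (cmod (conv H m f u x)) \<partial>m) \<le> (\<integral>\<^sup>+x. \<integral>\<^sup>+y. F y * ht Q (inv y) x \<partial>m \<partial>m)"
  proof (rule nn_integral_mono, rule order_trans[OF conv_le], rule nn_integral_mono)
    fix x y show "ennreal (cmod (f y)) * ht (\<lambda>z. ennreal (cmod (u z))) (inv y) x \<le> F y * ht Q (inv y) x"
      by (intro mult_mono ht_mono Q le_funD[OF F(2)]) auto
  qed
  also have "\<dots> \<le> (ennreal (L1_norm m f) + ennreal 1) * (ennreal (L1_norm m u) + ennreal 1)"
    unfolding integral_translates[OF F(1) Q(1)] by (intro mult_mono F Q) auto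
  also have "\<dots> < \<infinity>" by (simp add: ennreal_mult_less_top)
  finally have "integrable m (conv H m f u)"
    using Cb_measurable[OF conv_Cb[OF f u(1)], of m] by (intro integrableI_bounded) auto
  then show ?thesis by (simp add: L1_def)
qed

text \<open>If the convolution integral of \<open>g\<close> at \<open>x\<close> does not exist, its value there is zero.\<close>

lemma conv_perturb:
  assumes f: "f \<in> L1 m" and g: "g \<in> L2 m" and g': "g' \<in> Cb"
  shows "ennreal (cmod (conv H m f g x)) \<le> ennreal (cmod (conv H m f g' x)) +
     (\<integral>\<^sup>+y. ennreal (cmod (f y)) * ht (\<lambda>z. ennreal (cmod (g z - g' z))) (inv y) x \<partial>m)"
proof (cases "integrable m (\<lambda>y. f y * htrans H g (inv y) x)")
  case False then show ?thesis by (simp add: conv_def not_integrable_integral_eq)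
next
  case True
  note i' = conv_integrand[OF f g', of x]
  have [measurable]: "g \<in> borel_measurable borel" "g' \<in> borel_measurable borel"
    using L2D(1)[OF g] Cb_measurable[OF g', of borel] by auto
  have step: "ennreal (cmod (htrans H g a b - htrans H g' a b)) \<le> ht (\<lambda>z. ennreal (cmod (g z - g' z))) a b" for a b
  proof (cases "integrable (kap a b) (\<lambda>z. g z - g' z)")
    case True
    have "integrable (kap a b) (\<lambda>z. (g z - g' z) + g' z)"
      by (rule Bochner_Integration.integrable_add[OF True integrable_kap_Cb[OF g']])
    then have ig: "integrable (kap a b) g" by simp
    have "htrans H g a b - htrans H g' a b = htrans H (\<lambda>z. g z - g' z) a b"
      unfolding htrans_kap by (rule Bochner_Integration.integral_diff[OF ig integrable_kap_Cb[OF g'], symmetric])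
    then show ?thesis using htrans_le_ht[of "\<lambda>z. g z - g' z" a b] by simp
  next
    case False
    then have "ht (\<lambda>z. ennreal (cmod (g z - g' z))) a b = \<infinity>"
      unfolding ht_def by (subst (asm) integrable_iff_bounded) (auto simp: not_less top_unique)
    then show ?thesis by simp
  qed
  have "conv H m f g x - conv H m f g' x = (LINT y|m. f y * htrans H g (inv y) x - f y * htrans H g' (inv y) x)"
    unfolding conv_def by (rule Bochner_Integration.integral_diff[OF True i', symmetric])
  then have "ennreal (cmod (conv H m f g x - conv H m f g' x)) \<le> (\<integral>\<^sup>+y. ennreal (cmod (f y * htrans H g (inv y) x - f y * htrans H g' (inv y) x)) \<partial>m)"
    using integral_norm_bound_ennreal[OF Bochner_Integration.integrable_diff[OF True i']] by simp
  also have "\<dots> \<le> (\<integral>\<^sup>+y. ennreal (cmod (f y)) * ht (\<lambda>z. ennreal (cmod (g z - g' z))) (inv y) x \<partial>m)"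
  proof (rule nn_integral_mono)
    fix y
    have "ennreal (cmod (f y * htrans H g (inv y) x - f y * htrans H g' (inv y) x)) = ennreal (cmod (f y)) * ennreal (cmod (htrans H g (inv y) x - htrans H g' (inv y) x))"
      by (simp add: ennreal_mult[symmetric] right_diff_distrib[symmetric] norm_mult)
    then show "ennreal (cmod (f y * htrans H g (inv y) x - f y * htrans H g' (inv y) x)) \<le> ennreal (cmod (f y)) * ht (\<lambda>z. ennreal (cmod (g z - g' z))) (inv y) x"
      using mult_left_mono[OF step] by simp
  qed
  finally have d: "ennreal (cmod (conv H m f g x - conv H m f g' x)) \<le> (\<integral>\<^sup>+y. ennreal (cmod (f y)) * ht (\<lambda>z. ennreal (cmod (g z - g' z))) (inv y) x \<partial>m)" .
  have "cmod (conv H m f g x) \<le> cmod (conv H m f g' x) + cmod (conv H m f g x - conv H m f g' x)"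
    using norm_triangle_ineq[of "conv H m f g' x" "conv H m f g x - conv H m f g' x"] by simp
  then have "ennreal (cmod (conv H m f g x)) \<le> ennreal (cmod (conv H m f g' x)) + ennreal (cmod (conv H m f g x - conv H m f g' x))"
    by (simp add: ennreal_plus[symmetric] del: ennreal_plus)
  then show ?thesis using add_left_mono[OF d] order_trans by blast
qed

text \<open>A bound for the convolution operator need only be checked on test functions. As convolutions of
  square integrable functions need not be known to be measurable, the distance of \<open>f * g\<close> to the
  convolution with an approximating test function is controlled pointwise by the square root \<open>b\<close> of a
  lower semicontinuous majorant, which is square integrable with small norm.\<close>

lemma conv_bound_Cc:
  assumes f: "f \<in> L1 m" and C: "0 \<le> C" "\<And>g. g \<in> Cc \<Longrightarrow> L2_norm m (conv H m f g) \<le> C * L2_norm m g" and g: "g \<in> L2 m"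
  shows "L2_norm m (conv H m f g) \<le> C * L2_norm m g"
proof -
  define K where "K = L1_norm m f"
  have K: "0 \<le> K" by (simp add: K_def L1_norm_nonneg)
  have "L2_norm m (conv H m f g) \<le> C * L2_norm m g + e" if e: "0 < e" for e
  proof (cases "integrable m (\<lambda>x. (cmod (conv H m f g x))\<^sup>2)")
    case False
    then have "L2_norm m (conv H m f g) = 0" by (simp add: L2_norm_def not_integrable_integral_eq)
    then show ?thesis using e C(1) L2_norm_nonneg[of m g] by simp
  next
    case True
    define d where "d = e / (C + K + 2)"
    have d: "0 < d" "(C + (K + 1)) * d \<le> e"
    proof -
      have "0 < C + K + 2" using C(1) K by linarith
      then show d0: "0 < d" using e by (simp add: d_def)
      have "(C + K + 2) * d = e" using \<open>0 < C + K + 2\<close> by (simp add: d_def)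
      then show "(C + (K + 1)) * d \<le> e" using d0 by (simp add: algebra_simps)
    qed
    obtain g' where g': "g' \<in> Cc" "L2_norm m (\<lambda>x. g x - g' x) < d" using Cc_dense_L2[OF lc m_radon g d(1)] .
    note gL2 = Cc_L2[OF m_radon g'(1)]
    have dl: "(\<lambda>x. g x - g' x) \<in> L2 m" by (rule L2_diff[OF g gL2])
    have "L1_norm m f * L2_norm m (\<lambda>x. g x - g' x) \<le> K * d"
      unfolding K_def[symmetric] using g'(2) K by (intro mult_left_mono) auto
    also have "\<dots> < (K + 1) * d" using d(1) by simp
    finally have lt: "L1_norm m f * L2_norm m (\<lambda>x. g x - g' x) < (K + 1) * d" .
    show ?thesis
    proof (rule conv_square_dominated[OF f dl lt])
      fix W assume W: "lsc W" "\<And>x. (\<integral>\<^sup>+y. ennreal (cmod (f y)) * ht (\<lambda>z. ennreal (cmod (g z - g' z))) (inv y) x \<partial>m)\<^sup>2 \<le> W x"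
        "(\<integral>\<^sup>+x. W x \<partial>m) \<le> ennreal (((K + 1) * d)\<^sup>2)"
      have [measurable]: "W \<in> borel_measurable m" by (rule lsc_measurable[OF W(1)]) simp
      define b where "b = (\<lambda>x. complex_of_real (sqrt (enn2real (W x))))"
      have fin: "(\<integral>\<^sup>+x. W x \<partial>m) \<noteq> \<infinity>" using W(3) by (auto simp: top_unique)
      have AEfin: "AE x in m. W x \<noteq> \<infinity>" by (rule nn_integral_noteq_infinite[OF _ fin]) simp
      have "(\<integral>\<^sup>+x. ennreal ((cmod (b x))\<^sup>2) \<partial>m) = (\<integral>\<^sup>+x. W x \<partial>m)"
      proof (rule nn_integral_cong_AE)
        show "AE x in m. ennreal ((cmod (b x))\<^sup>2) = W x" using AEfin
          by eventually_elim (simp add: b_def less_top)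
      qed
      then have "(\<integral>\<^sup>+x. ennreal ((cmod (b x))\<^sup>2) \<partial>m) \<le> ennreal (((K + 1) * d)\<^sup>2)" using W(3) by simp
      moreover have "b \<in> borel_measurable m" unfolding b_def by measurable
      ultimately have bL2: "b \<in> L2 m" "L2_norm m b \<le> (K + 1) * d"
        using L2I[of b m "(K + 1) * d"] d(1) K by auto
      define v where "v = (\<lambda>x. complex_of_real (cmod (conv H m f g' x)))"
      have cL2: "conv H m f g' \<in> L2 m" by (rule conv_L2[OF f Cc_Cb[OF g'(1)] gL2])
      have vL2: "v \<in> L2 m" using L2D[OF cL2] by (auto simp: L2_def v_def)
      have vn: "L2_norm m v = L2_norm m (conv H m f g')" by (simp add: L2_norm_def v_def)
      note s = L2_add[OF vL2 bL2(1)]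
      have "(L2_norm m (conv H m f g))\<^sup>2 \<le> (L2_norm m (\<lambda>x. v x + b x))\<^sup>2"
        unfolding L2_norm_power2
      proof (rule integral_mono_AE[OF True L2D(2)[OF s(1)]])
        show "AE x in m. (cmod (conv H m f g x))\<^sup>2 \<le> (cmod (v x + b x))\<^sup>2"
          using AEfin
        proof eventually_elim
          case (elim x)
          define D where "D = (\<integral>\<^sup>+y. ennreal (cmod (f y)) * ht (\<lambda>z. ennreal (cmod (g z - g' z))) (inv y) x \<partial>m)"
          obtain w where w: "W x = ennreal w" "0 \<le> w" using elim by (cases "W x") auto
          have "D\<^sup>2 \<le> (ennreal (sqrt w))\<^sup>2" using W(2)[of x] w by (simp add: D_def ennreal_power)
          then have "D \<le> ennreal (sqrt w)" by (rule ennreal_power2_le) (use w in simp)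
          then have "ennreal (cmod (conv H m f g x)) \<le> ennreal (cmod (conv H m f g' x)) + ennreal (sqrt w)"
            using conv_perturb[OF f g Cc_Cb[OF g'(1)], of x] add_left_mono order_trans unfolding D_def by blast
          then have "cmod (conv H m f g x) \<le> cmod (conv H m f g' x) + sqrt w"
            using w(2) by (simp add: ennreal_plus[symmetric] del: ennreal_plus)
          also have "\<dots> = cmod (v x + b x)"
          proof -
            have "v x + b x = complex_of_real (cmod (conv H m f g' x) + sqrt w)" by (simp add: v_def b_def w)
            then show ?thesis using w(2) by (simp only: norm_of_real) simp
          qed
          finally show ?case by (rule power_mono) simp
        qed
      qed
      then have "L2_norm m (conv H m f g) \<le> L2_norm m (\<lambda>x. v x + b x)"
        by (rule power2_le_imp_le) (rule L2_norm_nonneg)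
      also have "\<dots> \<le> L2_norm m (conv H m f g') + (K + 1) * d" using s(2) bL2(2) vn by simp
      also have "L2_norm m (conv H m f g') \<le> C * L2_norm m g'" by (rule C(2)[OF g'(1)])
      also have "C * L2_norm m g' \<le> C * (L2_norm m g + d)"
      proof (rule mult_left_mono[OF _ C(1)])
        have "L2_norm m g' = L2_norm m (\<lambda>x. g x + -1 * (g x - g' x))" by simp
        also have "\<dots> \<le> L2_norm m g + L2_norm m (\<lambda>x. -1 * (g x - g' x))" by (rule L2_add(2)[OF g L2_cmult[OF dl]])
        also have "L2_norm m (\<lambda>x. -1 * (g x - g' x)) = L2_norm m (\<lambda>x. g x - g' x)" unfolding L2_norm_cmult by simp
        finally show "L2_norm m g' \<le> L2_norm m g + d" using g'(2) by simp
      qed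
      finally show ?thesis using d(2) by (simp add: algebra_simps)
    qed
  qed
  then show ?thesis by (rule field_le_epsilon)
qed

end

section \<open>The norm of the reduced algebra and its dual\<close>

context haar begin

lemma conv_add_right:
  assumes "f \<in> L1 m" "u \<in> Cb" "v \<in> Cb"
  shows "conv H m f (\<lambda>x. u x + v x) = (\<lambda>x. conv H m f u x + conv H m f v x)"
  unfolding conv_def htrans_add[OF assms(2,3)] distrib_left
  by (rule ext, rule Bochner_Integration.integral_add; rule conv_integrand; fact)

lemma conv_cmult_right: "conv H m f (\<lambda>x. c * u x) = (\<lambda>x. c * conv H m f u x)"
  unfolding conv_def htrans_cmult by (simp add: mult.left_commute[of _ c])

lemma conv_add_left:
  assumes "f \<in> L1 m" "g \<in> L1 m" "u \<in> Cb"
  shows "conv H m (\<lambda>x. f x + g x) u = (\<lambda>x. conv H m f u x + conv H m g u x)"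
  unfolding conv_def distrib_right
  by (rule ext, rule Bochner_Integration.integral_add; rule conv_integrand; fact)

lemma conv_cmult_left: "conv H m (\<lambda>x. c * f x) u = (\<lambda>x. c * conv H m f u x)"
  unfolding conv_def by (simp add: mult.assoc)

lemma conv_diff_right:
  assumes "f \<in> L1 m" "u \<in> Cb" "v \<in> Cb"
  shows "conv H m f (\<lambda>x. u x - v x) = (\<lambda>x. conv H m f u x - conv H m f v x)"
  using conv_add_right[OF assms(1,2) Cb_cmult[OF assms(3)], of "-1"] conv_cmult_right[of f "-1" v] by simp

lemma left_regular_L1_conv: "left_regular_L1 H m f g = conv H m f g"
  by (simp add: left_regular_L1_def left_regular_def conv_def fun_eq_iff)

abbreviation N :: "('a \<Rightarrow> complex) \<Rightarrow> real" where "N f \<equiv> Cstar_norm H m f"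

lemma zero_L2: "(\<lambda>x. 0) \<in> L2 m" "L2_norm m (\<lambda>x. 0) = 0"
  by (simp_all add: L2_def L2_norm_def)

lemma N_upper1:
  assumes f: "f \<in> L1 m" and g: "g \<in> L2 m" "L2_norm m g \<le> 1"
  shows "L2_norm m (conv H m f g) \<le> N f"
  unfolding Cstar_norm_def left_regular_L1_conv
proof (rule cSup_upper)
  show "bdd_above {L2_norm m (conv H m f g) |g. g \<in> L2 m \<and> L2_norm m g \<le> 1}"
  proof (rule bdd_aboveI, safe)
    fix g assume "g \<in> L2 m" "L2_norm m g \<le> 1"
    then show "L2_norm m (conv H m f g) \<le> L1_norm m f"
      using conv_L2_norm[OF f, of g] mult_left_mono[of "L2_norm m g" 1 "L1_norm m f"] L1_norm_nonneg[of f] by simp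
  qed
qed (use g in blast)

lemma N_nonneg: "f \<in> L1 m \<Longrightarrow> 0 \<le> N f"
  using order_trans[OF L2_norm_nonneg N_upper1[OF _ zero_L2(1)]] zero_L2(2) by simp

lemma N_upper:
  assumes f: "f \<in> L1 m" and g: "g \<in> L2 m"
  shows "L2_norm m (conv H m f g) \<le> N f * L2_norm m g"
proof (cases "L2_norm m g = 0")
  case True
  then show ?thesis using conv_L2_norm[OF f g] by simp
next
  case False
  define s where "s = L2_norm m g"
  have s: "0 < s" using False L2_norm_nonneg[of m g] by (simp add: s_def)
  have "L2_norm m (\<lambda>x. complex_of_real (1/s) * g x) = 1"
    unfolding L2_norm_cmult using s by (simp add: s_def[symmetric] norm_divide)
  then have "L2_norm m (conv H m f (\<lambda>x. complex_of_real (1/s) * g x)) \<le> N f"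
    by (intro N_upper1[OF f L2_cmult[OF g]]) simp
  then have "(1/s) * L2_norm m (conv H m f g) \<le> N f"
    unfolding conv_cmult_right L2_norm_cmult using s by (simp add: norm_divide)
  then show ?thesis using s by (simp add: s_def[symmetric] field_simps)
qed

text \<open>Together with \<open>N_upper\<close>, this identifies the norm as the operator norm on test functions.\<close>

lemma N_least:
  assumes f: "f \<in> L1 m" and C: "0 \<le> C" "\<And>g. g \<in> Cc \<Longrightarrow> L2_norm m (conv H m f g) \<le> C * L2_norm m g"
  shows "N f \<le> C"
  unfolding Cstar_norm_def left_regular_L1_conv
proof (rule cSup_least)
  show "{L2_norm m (conv H m f g) |g. g \<in> L2 m \<and> L2_norm m g \<le> 1} \<noteq> {}" using zero_L2 by force
  fix t assume "t \<in> {L2_norm m (conv H m f g) |g. g \<in> L2 m \<and> L2_norm m g \<le> 1}"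
  then obtain g where g: "t = L2_norm m (conv H m f g)" "g \<in> L2 m" "L2_norm m g \<le> 1" by blast
  have "t \<le> C * L2_norm m g" unfolding g(1) by (rule conv_bound_Cc[OF f C g(2)])
  also have "\<dots> \<le> C" using g(3) C(1) mult_left_mono[of "L2_norm m g" 1 C] by simp
  finally show "t \<le> C" .
qed

lemma N_le_L1: "f \<in> L1 m \<Longrightarrow> N f \<le> L1_norm m f"
  by (rule N_least) (auto intro: L1_norm_nonneg conv_L2_norm Cc_L2[OF m_radon])

lemma L1_add: "f \<in> L1 m \<Longrightarrow> g \<in> L1 m \<Longrightarrow> (\<lambda>x. f x + g x) \<in> L1 m"
  and L1_cmult: "f \<in> L1 m \<Longrightarrow> (\<lambda>x. c * f x) \<in> L1 m"
  and L1_diff: "f \<in> L1 m \<Longrightarrow> g \<in> L1 m \<Longrightarrow> (\<lambda>x. f x - g x) \<in> L1 m"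
  and Cc_L1: "f \<in> Cc \<Longrightarrow> f \<in> L1 m"
  by (auto simp: L1_def intro: Cc_integrable[OF m_radon])

lemma L1_Cb_L2': "f \<in> L1 m \<Longrightarrow> f \<in> Cb \<Longrightarrow> f \<in> L2 m"
  by (rule L1_Cb_L2[OF m_radon L1D])

lemma N_add:
  assumes f: "f \<in> L1 m" and g: "g \<in> L1 m"
  shows "N (\<lambda>x. f x + g x) \<le> N f + N g"
proof (rule N_least[OF L1_add[OF f g]])
  fix u :: "'a \<Rightarrow> complex" assume u: "u \<in> Cc"
  note uL = Cc_L2[OF m_radon u]
  have "L2_norm m (conv H m (\<lambda>x. f x + g x) u) \<le> L2_norm m (conv H m f u) + L2_norm m (conv H m g u)"
    unfolding conv_add_left[OF f g Cc_Cb[OF u]]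
    by (rule L2_add(2)[OF conv_L2[OF f Cc_Cb[OF u] uL] conv_L2[OF g Cc_Cb[OF u] uL]])
  also have "\<dots> \<le> N f * L2_norm m u + N g * L2_norm m u" by (intro add_mono N_upper f g uL)
  finally show "L2_norm m (conv H m (\<lambda>x. f x + g x) u) \<le> (N f + N g) * L2_norm m u" by (simp add: distrib_right)
qed (simp add: N_nonneg f g)

lemma N_cmult_le:
  assumes f: "f \<in> L1 m" shows "N (\<lambda>x. c * f x) \<le> cmod c * N f"
proof (rule N_least[OF L1_cmult[OF f]])
  fix u :: "'a \<Rightarrow> complex" assume u: "u \<in> Cc"
  have "L2_norm m (conv H m (\<lambda>x. c * f x) u) = cmod c * L2_norm m (conv H m f u)"
    unfolding conv_cmult_left L2_norm_cmult ..
  also have "\<dots> \<le> cmod c * (N f * L2_norm m u)" by (intro mult_left_mono N_upper f Cc_L2[OF m_radon u]) simp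
  finally show "L2_norm m (conv H m (\<lambda>x. c * f x) u) \<le> cmod c * N f * L2_norm m u" by (simp add: mult.assoc)
qed (simp add: N_nonneg f)

lemma N_perturb:
  assumes f: "f \<in> L1 m" and g: "g \<in> L1 m"
  shows "N g \<le> N f + L1_norm m (\<lambda>x. f x - g x)"
proof -
  have "N g = N (\<lambda>x. f x + -1 * (f x - g x))" by simp
  also have "\<dots> \<le> N f + N (\<lambda>x. -1 * (f x - g x))" by (intro N_add f L1_cmult L1_diff g)
  also have "N (\<lambda>x. -1 * (f x - g x)) \<le> cmod (-1) * N (\<lambda>x. f x - g x)" by (rule N_cmult_le[OF L1_diff[OF f g]])
  also have "N (\<lambda>x. f x - g x) \<le> L1_norm m (\<lambda>x. f x - g x)" by (rule N_le_L1[OF L1_diff[OF f g]])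
  finally show ?thesis by simp
qed

text \<open>By Jensen's inequality for the probability measures \<open>\<delta>\<^sub>x * \<delta>\<^sub>y\<close> and left invariance.\<close>

lemma htrans_L2_norm:
  assumes u: "u \<in> Cb" "u \<in> L2 m"
  shows "L2_norm m (htrans H u x) \<le> L2_norm m u"
proof (rule L2_norm_le[OF _ L2_norm_nonneg])
  have l: "lsc (\<lambda>z. ennreal ((cmod (u z))\<^sup>2))"
    by (intro lsc_continuous continuous_on_ennreal continuous_intros Cb_cont u)
  have um: "u \<in> borel_measurable borel" by (rule Cb_measurable[OF u(1)]) simp
  have "(\<integral>\<^sup>+y. ennreal ((cmod (htrans H u x y))\<^sup>2) \<partial>m) \<le> (\<integral>\<^sup>+y. ht (\<lambda>z. ennreal ((cmod (u z))\<^sup>2)) x y \<partial>m)"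
  proof (rule nn_integral_mono)
    fix y
    have "ennreal ((cmod (htrans H u x y))\<^sup>2) = (ennreal (cmod (htrans H u x y)))\<^sup>2" by (simp add: ennreal_power)
    also have "\<dots> \<le> (ht (\<lambda>z. ennreal (cmod (u z))) x y)\<^sup>2"
      unfolding power2_eq_square by (intro mult_mono htrans_le_ht) auto
    also have "\<dots> \<le> ht (\<lambda>z. (ennreal (cmod (u z)))\<^sup>2) x y"
      using um by (intro ht_power2_le) measurable
    finally show "ennreal ((cmod (htrans H u x y))\<^sup>2) \<le> ht (\<lambda>z. ennreal ((cmod (u z))\<^sup>2)) x y"
      by (simp add: ennreal_power)
  qed
  also have "\<dots> = ennreal ((L2_norm m u)\<^sup>2)" by (simp add: ht_integral[OF l] nn_integral_L2[OF u(2)])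
  finally show "(\<integral>\<^sup>+y. ennreal ((cmod (htrans H u x y))\<^sup>2) \<partial>m) \<le> ennreal ((L2_norm m u)\<^sup>2)" .
qed

text \<open>Left translations commute with convolution from the right: the translation is moved to \<open>g\<close> by the
  adjoint relation, and then outside by associativity.\<close>

lemma conv_htrans:
  assumes h: "h \<in> Cc" and g: "g \<in> Cc"
  shows "conv H m (htrans H h y) g x = htrans H (conv H m h g) y x"
proof -
  have gm: "g \<in> borel_measurable borel" by (rule Cb_measurable[OF Cc_Cb[OF g]]) simp
  have K: "(\<lambda>w. htrans H g w x) \<in> Cb" "(\<lambda>z. htrans H g (inv z) x) \<in> Cb"
    by (intro htrans_Cb_compose[OF Cc_Cb[OF g]] inv_cont continuous_intros)+
  have inner: "htrans H (\<lambda>z. htrans H g (inv z) x) (inv y) z = (LINT w|kap y x. htrans H g (inv z) w)" for z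
  proof -
    have "htrans H (\<lambda>z. htrans H g (inv z) x) (inv y) z = htrans H (\<lambda>w. htrans H g w x) (inv z) y"
      using htrans_inv[of "\<lambda>w. htrans H g w x" z "inv y"] Cb_measurable[OF K(1), of borel] by simp
    also have "\<dots> = (LINT w|kap y x. htrans H g (inv z) w)"
      unfolding htrans_kap[of "\<lambda>w. htrans H g w x"] by (rule htrans_assoc[OF g, symmetric])
    finally show ?thesis .
  qed
  have "conv H m (htrans H h y) g x = (LINT z|m. h z * htrans H (\<lambda>z. htrans H g (inv z) x) (inv y) z)"
    unfolding conv_def by (rule adjoint_Cb[OF h K(2)])
  also have "\<dots> = (LINT z|m. h z * (LINT w|kap y x. 1 * htrans H g (inv z) w))" by (simp add: inner)
  also have "\<dots> = (LINT w|kap y x. 1 * (LINT z|m. h z * htrans H g (inv z) w))"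
  proof -
    have "(\<lambda>p. htrans H g (inv (fst p)) (snd p)) \<in> Cb"
      by (intro htrans_Cb_compose[OF Cc_Cb[OF g]] continuous_on_compose2[OF inv_cont _ subset_UNIV] continuous_intros)
    from Fubini_Cb[OF lc lc m_radon kap_radon Cc_integrable[OF m_radon h] integrable_kap_const[of y x 1] this]
    show ?thesis by simp
  qed
  also have "\<dots> = htrans H (conv H m h g) y x" by (simp add: htrans_kap conv_def)
  finally show ?thesis .
qed

text \<open>Translation by a point acts on \<open>\<lambda>(h)\<close> as multiplication by a contraction.\<close>

lemma N_htrans:
  assumes h: "h \<in> Cc" shows "N (htrans H h y) \<le> N h"
proof (rule N_least)
  show "htrans H h y \<in> L1 m" using htrans_Cc_integrable[OF h] by (simp add: L1_def)
  show "0 \<le> N h" by (rule N_nonneg[OF Cc_L1[OF h]])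
  fix g :: "'a \<Rightarrow> complex" assume g: "g \<in> Cc"
  note gL = Cc_L2[OF m_radon g] and hL = Cc_L1[OF h]
  have "L2_norm m (conv H m (htrans H h y) g) = L2_norm m (htrans H (conv H m h g) y)"
    by (simp add: conv_htrans[OF h g, abs_def] L2_norm_def)
  also have "\<dots> \<le> L2_norm m (conv H m h g)"
    by (rule htrans_L2_norm[OF conv_Cb[OF hL Cc_Cb[OF g]] conv_L2[OF hL Cc_Cb[OF g] gL]])
  also have "\<dots> \<le> N h * L2_norm m g" by (rule N_upper[OF hL gL])
  finally show "L2_norm m (conv H m (htrans H h y) g) \<le> N h * L2_norm m g" .
qed

text \<open>\<open>u\<close> defines a functional on the completion of \<open>L\<^sup>1(H)\<close> of norm at most \<open>C\<close>. Bounds are easier to handle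
  than the dual norm itself, which is a supremum over a set that has to be shown to be bounded.\<close>

definition dual_bound :: "real \<Rightarrow> ('a \<Rightarrow> complex) \<Rightarrow> bool" where
  "dual_bound C u \<longleftrightarrow> (\<forall>f\<in>L1 m. cmod (pairing m u f) \<le> C * N f)"

lemma dual_boundD: "dual_bound C u \<Longrightarrow> f \<in> L1 m \<Longrightarrow> cmod (pairing m u f) \<le> C * N f"
  by (simp add: dual_bound_def)

lemma dual_bound_mono: "dual_bound C u \<Longrightarrow> C \<le> D \<Longrightarrow> dual_bound D u"
  unfolding dual_bound_def by (meson N_nonneg mult_right_mono order_trans)

lemma pairing_commute: "pairing m u f = (LINT x|m. f x * u x)"
  by (simp add: pairing_def mult.commute)

lemma pairing_integrable: "u \<in> Cb \<Longrightarrow> f \<in> L1 m \<Longrightarrow> integrable m (\<lambda>x. f x * u x)"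
  by (rule integrable_mult_Cb[OF m_radon L1D])

lemma dual_bound_add:
  assumes "u \<in> Cb" "v \<in> Cb" "dual_bound C u" "dual_bound D v"
  shows "dual_bound (C + D) (\<lambda>x. u x + v x)"
  unfolding dual_bound_def
proof
  fix f assume f: "f \<in> L1 m"
  have "pairing m (\<lambda>x. u x + v x) f = pairing m u f + pairing m v f"
    unfolding pairing_commute distrib_left
    by (intro Bochner_Integration.integral_add pairing_integrable assms f)
  also have "cmod \<dots> \<le> C * N f + D * N f"
    using norm_triangle_ineq dual_boundD[OF assms(3) f] dual_boundD[OF assms(4) f] by (meson add_mono order_trans)
  finally show "cmod (pairing m (\<lambda>x. u x + v x) f) \<le> (C + D) * N f" by (simp add: distrib_right)
qed

lemma dual_bound_cmult: "dual_bound C u \<Longrightarrow> dual_bound (cmod c * C) (\<lambda>x. c * u x)"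
  unfolding dual_bound_def pairing_def by (simp add: mult.assoc norm_mult mult_left_mono)

lemma dual_bound_zero: "dual_bound 0 (\<lambda>x. 0)"
  by (simp add: dual_bound_def pairing_def)

lemma tilde_Cc: "\<phi> \<in> Cc \<Longrightarrow> tilde H \<phi> \<in> Cc"
  unfolding tilde_def[abs_def] by (intro Cc_cnj Cc_inv)

lemma htrans_tilde:
  assumes "\<phi> \<in> Cc"
  shows "htrans H (tilde H \<phi>) (inv y) x = cnj (htrans H \<phi> (inv x) y)"
proof -
  have "htrans H (\<lambda>z. cnj (\<phi> z)) (inv x) (inv (inv y)) = htrans H (\<lambda>z. cnj (\<phi> (inv z))) (inv y) x"
    by (rule htrans_inv) (rule Cb_measurable[OF Cc_Cb[OF Cc_cnj[OF assms]]], simp)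
  then show ?thesis by (simp add: tilde_def[abs_def] htrans_kap)
qed

text \<open>Coefficient functions of the left regular representation are bounded functionals: interchanging
  the integrals turns the pairing with \<open>f\<close> into the pairing of \<open>\<psi>\<close> with \<open>f\<close> convolved with the conjugate of \<open>\<phi>\<close>.\<close>

lemma dual_bound_conv_tilde:
  assumes \<psi>: "\<psi> \<in> L1 m" "\<psi> \<in> Cb" and \<phi>: "\<phi> \<in> Cc"
  shows "dual_bound (L2_norm m \<psi> * L2_norm m \<phi>) (conv H m \<psi> (tilde H \<phi>))"
  unfolding dual_bound_def
proof
  fix f assume f: "f \<in> L1 m"
  let ?K = "\<lambda>p. htrans H (\<lambda>z. cnj (\<phi> z)) (inv (fst p)) (snd p)"
  have cn: "cnj (htrans H \<phi> a b) = htrans H (\<lambda>z. cnj (\<phi> z)) a b" for a b by (simp add: htrans_kap)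
  note \<phi>c = Cc_cnj[OF \<phi>]
  have K: "?K \<in> Cb"
    by (intro htrans_Cb_compose[OF Cc_Cb[OF \<phi>c]] continuous_on_compose2[OF inv_cont _ subset_UNIV] continuous_intros)
  have "pairing m (conv H m \<psi> (tilde H \<phi>)) f = (LINT x|m. f x * (LINT y|m. \<psi> y * ?K (x, y)))"
    unfolding pairing_commute conv_def htrans_tilde[OF \<phi>] cn by simp
  also have "\<dots> = (LINT y|m. \<psi> y * (LINT x|m. f x * ?K (x, y)))"
    by (rule Fubini_Cb[OF lc lc m_radon m_radon L1D[OF f] L1D[OF \<psi>(1)] K])
  also have "\<dots> = (LINT y|m. \<psi> y * conv H m f (\<lambda>z. cnj (\<phi> z)) y)" by (simp add: conv_def)
  finally have "cmod (pairing m (conv H m \<psi> (tilde H \<phi>)) f) \<le> L2_norm m \<psi> * L2_norm m (conv H m f (\<lambda>z. cnj (\<phi> z)))"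
    using L2_Cauchy_Schwarz[OF L1_Cb_L2'[OF \<psi>] conv_L2[OF f Cc_Cb[OF \<phi>c] Cc_L2[OF m_radon \<phi>c]]] by simp
  also have "\<dots> \<le> L2_norm m \<psi> * (N f * L2_norm m (\<lambda>z. cnj (\<phi> z)))"
    by (intro mult_left_mono N_upper f Cc_L2[OF m_radon \<phi>c] L2_norm_nonneg)
  finally show "cmod (pairing m (conv H m \<psi> (tilde H \<phi>)) f) \<le> L2_norm m \<psi> * L2_norm m \<phi> * N f"
    by (simp add: L2_norm_cnj mult_ac)
qed

text \<open>For a test function \<open>h\<close>, the adjoint relation moves the translation to \<open>h\<close>, where it does not increase
  the norm. A general \<open>h\<close> is approximated by test functions in \<open>L\<^sup>1(H)\<close>.\<close>

lemma dual_bound_htrans: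
  assumes u: "u \<in> Cb" "dual_bound C u" and C: "0 \<le> C" and h: "h \<in> L1 m"
  shows "cmod (LINT x|m. h x * htrans H u y x) \<le> C * N h"
proof (rule field_le_epsilon)
  fix e :: real assume e: "0 < e"
  obtain B where B: "0 < B" "\<And>x. cmod (u x) \<le> B" using Cb_bound[OF u(1)] by blast
  define d where "d = e / (B + C)"
  have d: "0 < d" "(B + C) * d = e" using e B(1) C by (auto simp: d_def)
  obtain g where g: "g \<in> Cc" "(LINT x|m. cmod (h x - g x)) < d" using Cc_dense_L1[OF lc m_radon L1D[OF h] d(1)] .
  note gL = Cc_L1[OF g(1)]
  have nd: "L1_norm m (\<lambda>x. h x - g x) < d" using g(2) by (simp add: L1_norm_def)
  have "cmod (LINT x|m. g x * htrans H u y x) \<le> C * N g"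
  proof -
    have "(LINT x|m. g x * htrans H u y x) = pairing m u (htrans H g (inv y))"
      using adjoint_Cb[OF g(1) u(1), of "inv y"] by (simp add: pairing_commute)
    also have "cmod \<dots> \<le> C * N (htrans H g (inv y))"
      by (rule dual_boundD[OF u(2)]) (simp add: L1_def htrans_Cc_integrable[OF g(1)])
    also have "\<dots> \<le> C * N g" by (rule mult_left_mono[OF N_htrans[OF g(1)] C])
    finally show ?thesis .
  qed
  moreover have "C * N g \<le> C * (N h + d)"
    using N_perturb[OF h gL] nd C by (intro mult_left_mono) auto
  moreover have "cmod (LINT x|m. (h x - g x) * htrans H u y x) \<le> B * d"
  proof -
    have "cmod (LINT x|m. (h x - g x) * htrans H u y x) \<le> B * (LINT x|m. cmod (h x - g x))"
      by (rule integral_mult_bound[OF m_radon L1D[OF L1_diff[OF h gL]] htrans_bound[OF B(2)]])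
    also have "\<dots> \<le> B * d" using g(2) B(1) by (intro mult_left_mono) auto
    finally show ?thesis .
  qed
  moreover have "(LINT x|m. h x * htrans H u y x) = (LINT x|m. (h x - g x) * htrans H u y x) + (LINT x|m. g x * htrans H u y x)"
  proof -
    have "(LINT x|m. h x * htrans H u y x) = (LINT x|m. (h x - g x) * htrans H u y x + g x * htrans H u y x)"
      by (simp add: left_diff_distrib)
    also have "\<dots> = (LINT x|m. (h x - g x) * htrans H u y x) + (LINT x|m. g x * htrans H u y x)"
      by (intro Bochner_Integration.integral_add pairing_integrable htrans_Cb1 u L1_diff h gL)
    finally show ?thesis .
  qed
  ultimately have "cmod (LINT x|m. h x * htrans H u y x) \<le> B * d + C * (N h + d)"
    using norm_triangle_ineq[of "LINT x|m. (h x - g x) * htrans H u y x" "LINT x|m. g x * htrans H u y x"] by simp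
  then show "cmod (LINT x|m. h x * htrans H u y x) \<le> C * N h + e" using d(2) by (simp add: algebra_simps)
qed

text \<open>The estimate for translates, integrated against \<open>f\<close>.\<close>

lemma dual_bound_conv:
  assumes f: "f \<in> L1 m" and u: "u \<in> Cb" "dual_bound C u" and C: "0 \<le> C"
  shows "dual_bound (C * L1_norm m f) (conv H m f u)"
  unfolding dual_bound_def
proof
  fix h assume h: "h \<in> L1 m"
  have K: "(\<lambda>p. htrans H u (inv (snd p)) (fst p)) \<in> Cb"
    by (intro htrans_Cb_compose[OF u(1)] continuous_on_compose2[OF inv_cont _ subset_UNIV] continuous_intros)
  have "pairing m (conv H m f u) h = (LINT x|m. h x * (LINT y|m. f y * htrans H u (inv y) x))"
    by (simp add: pairing_commute conv_def)
  also have "\<dots> = (LINT y|m. f y * (LINT x|m. h x * htrans H u (inv y) x))"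
    using Fubini_Cb[OF lc lc m_radon m_radon L1D[OF h] L1D[OF f] K] by simp
  also have "cmod \<dots> \<le> (C * N h) * (LINT y|m. cmod (f y))"
    by (rule integral_mult_bound[OF m_radon L1D[OF f] dual_bound_htrans[OF u C h]])
  finally show "cmod (pairing m (conv H m f u) h) \<le> C * L1_norm m f * N h"
    by (simp add: L1_norm_def mult_ac)
qed

text \<open>The dual norm is the least bound of the functional: this lemma and \<open>dual_bound_B_norm\<close>.\<close>

lemma B_norm_le:
  assumes "dual_bound C w" "0 \<le> C"
  shows "B_norm H m w \<le> C"
  unfolding B_norm_def
proof (rule cSup_least)
  have z: "(\<lambda>x. 0) \<in> L1 m" by (simp add: L1_def)
  have "N (\<lambda>x. 0) \<le> 1" using N_le_L1[OF z] by (simp add: L1_norm_def)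
  with z show "{cmod (pairing m w f) |f. f \<in> L1 m \<and> N f \<le> 1} \<noteq> {}" by blast
  fix t assume "t \<in> {cmod (pairing m w f) |f. f \<in> L1 m \<and> N f \<le> 1}"
  then obtain f where f: "t = cmod (pairing m w f)" "f \<in> L1 m" "N f \<le> 1" by blast
  have "t \<le> C * N f" unfolding f(1) by (rule dual_boundD[OF assms(1) f(2)])
  also have "\<dots> \<le> C" using f(3) assms(2) mult_left_mono[of "N f" 1 C] by simp
  finally show "t \<le> C" .
qed

lemma dual_bound_B_norm:
  assumes "dual_bound C w"
  shows "dual_bound (B_norm H m w) w"
  unfolding dual_bound_def
proof
  fix f assume f: "f \<in> L1 m"
  have up: "cmod (pairing m w g) \<le> B_norm H m w" if g: "g \<in> L1 m" "N g \<le> 1" for g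
    unfolding B_norm_def
  proof (rule cSup_upper)
    show "bdd_above {cmod (pairing m w f) |f. f \<in> L1 m \<and> N f \<le> 1}"
    proof (rule bdd_aboveI, safe)
      fix f assume f: "f \<in> L1 m" "N f \<le> 1"
      have "cmod (pairing m w f) \<le> \<bar>C\<bar> * N f" by (rule dual_boundD[OF dual_bound_mono[OF assms] f(1)]) simp
      also have "\<dots> \<le> \<bar>C\<bar>" using f(2) mult_left_mono[of "N f" 1 "\<bar>C\<bar>"] by simp
      finally show "cmod (pairing m w f) \<le> \<bar>C\<bar>" .
    qed
  qed (use g in blast)
  show "cmod (pairing m w f) \<le> B_norm H m w * N f"
  proof (cases "N f = 0")
    case True then show ?thesis using dual_boundD[OF assms f] by simp
  next
    case False
    define s where "s = N f"
    have s: "0 < s" using False N_nonneg[OF f] by (simp add: s_def)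
    have "N (\<lambda>x. complex_of_real (1/s) * f x) \<le> 1"
      using N_cmult_le[OF f, of "complex_of_real (1/s)"] s by (simp add: s_def[symmetric] norm_divide)
    then have "cmod (pairing m w (\<lambda>x. complex_of_real (1/s) * f x)) \<le> B_norm H m w"
      by (intro up L1_cmult f)
    moreover have "pairing m w (\<lambda>x. complex_of_real (1/s) * f x) = complex_of_real (1/s) * pairing m w f"
      unfolding pairing_commute by (simp add: mult.assoc)
    ultimately have "(1/s) * cmod (pairing m w f) \<le> B_norm H m w" using s by (simp add: norm_mult norm_divide)
    then show ?thesis using s by (simp add: s_def[symmetric] field_simps)
  qed
qed

end

section \<open>The Fourier space and the ideal\<close>

context haar begin

lemma conv_tilde_Cb: "\<psi> \<in> L1 m \<Longrightarrow> \<phi> \<in> Cc \<Longrightarrow> conv H m \<psi> (tilde H \<phi>) \<in> Cb"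
  by (intro conv_Cb Cc_Cb tilde_Cc)

lemma span_sum:
  fixes n :: nat
  assumes "\<And>i. i < n \<Longrightarrow> \<theta> i \<in> Cc"
  shows "(\<lambda>x. \<Sum>i<n. d i * conv H m (\<theta> i) (tilde H (\<theta> i)) x) \<in> fourier_span H m"
  unfolding fourier_span_def mem_Collect_eq
  by (rule exI[of _ n], rule exI[of _ d], rule exI[of _ \<theta>]) (simp add: assms)

lemma span_zero: "(\<lambda>x. 0) \<in> fourier_span H m"
  unfolding fourier_span_def by (simp, intro exI[of _ 0]) simp

lemma span_snoc:
  assumes "v \<in> fourier_span H m" "\<phi> \<in> Cc"
  shows "(\<lambda>x. v x + c * conv H m \<phi> (tilde H \<phi>) x) \<in> fourier_span H m"
  using assms(1) unfolding fourier_span_def[of H m]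
proof (elim CollectE exE conjE, fold fourier_span_def)
  fix n :: nat and d :: "nat \<Rightarrow> complex" and \<theta> :: "nat \<Rightarrow> 'a \<Rightarrow> complex"
  assume v: "v = (\<lambda>x. \<Sum>i<n. d i * conv H m (\<theta> i) (tilde H (\<theta> i)) x)" "\<forall>i<n. \<theta> i \<in> Cc"
  have "(\<lambda>x. v x + c * conv H m \<phi> (tilde H \<phi>) x) =
    (\<lambda>x. \<Sum>i<Suc n. (d(n := c)) i * conv H m ((\<theta>(n := \<phi>)) i) (tilde H ((\<theta>(n := \<phi>)) i)) x)"
    by (simp add: v(1))
  also have "\<dots> \<in> fourier_span H m" by (rule span_sum) (use v(2) assms(2) in \<open>auto simp: less_Suc_eq\<close>)
  finally show "(\<lambda>x. v x + c * conv H m \<phi> (tilde H \<phi>) x) \<in> fourier_span H m" .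
qed

text \<open>Gives inductions over the span without mentioning coefficients and generators as families.\<close>

lemma span_induct [consumes 1, case_names zero snoc]:
  assumes v: "v \<in> fourier_span H m" and zero: "P (\<lambda>x. 0)"
    and snoc: "\<And>v c \<phi>. v \<in> fourier_span H m \<Longrightarrow> P v \<Longrightarrow> \<phi> \<in> Cc \<Longrightarrow> P (\<lambda>x. v x + c * conv H m \<phi> (tilde H \<phi>) x)"
  shows "P v"
  using v unfolding fourier_span_def mem_Collect_eq
proof (elim exE conjE)
  fix n :: nat and d :: "nat \<Rightarrow> complex" and \<theta> :: "nat \<Rightarrow> 'a \<Rightarrow> complex"
  assume n: "v = (\<lambda>x. \<Sum>i<n. d i * conv H m (\<theta> i) (tilde H (\<theta> i)) x)" "\<forall>i<n. \<theta> i \<in> Cc"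
  have "P (\<lambda>x. \<Sum>i<n. d i * conv H m (\<theta> i) (tilde H (\<theta> i)) x)" using n(2)
  proof (induction n)
    case (Suc n)
    let ?w = "\<lambda>x. \<Sum>i<n. d i * conv H m (\<theta> i) (tilde H (\<theta> i)) x"
    have "\<forall>i<n. \<theta> i \<in> Cc" "\<theta> n \<in> Cc" using Suc.prems by simp_all
    moreover from this(1) have "?w \<in> fourier_span H m" by (intro span_sum) simp
    ultimately show ?case using snoc[of ?w "\<theta> n" "d n"] Suc.IH by simp
  qed (simp add: zero)
  then show "P v" by (simp add: n(1))
qed

lemma span_add:
  assumes u: "u \<in> fourier_span H m" and v: "v \<in> fourier_span H m"
  shows "(\<lambda>x. u x + v x) \<in> fourier_span H m"
  using v
proof (induction rule: span_induct)
  case (snoc v c \<phi>)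
  then show ?case using span_snoc[of "\<lambda>x. u x + v x" \<phi> c] by (simp add: add.assoc)
qed (simp add: u)

lemma span_cmult:
  assumes "v \<in> fourier_span H m" shows "(\<lambda>x. d * v x) \<in> fourier_span H m"
  using assms
proof (induction rule: span_induct)
  case (snoc v c \<phi>)
  then show ?case using span_snoc[of "\<lambda>x. d * v x" \<phi> "d * c"] by (simp add: distrib_left mult.assoc)
qed (simp add: span_zero)

lemma span_Cb_dual_bound: "v \<in> fourier_span H m \<Longrightarrow> v \<in> Cb \<and> (\<exists>C. dual_bound C v)"
proof (induction rule: span_induct)
  case zero then show ?case using dual_bound_zero Cb_const by blast
next
  case (snoc v c \<phi>)
  from snoc.IH obtain C where C: "v \<in> Cb" "dual_bound C v" by blast
  note L = Cc_L1[OF snoc.hyps(2)]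
  have cb: "(\<lambda>x. c * conv H m \<phi> (tilde H \<phi>) x) \<in> Cb" by (rule Cb_cmult[OF conv_tilde_Cb[OF L snoc.hyps(2)]])
  have b: "dual_bound (cmod c * (L2_norm m \<phi> * L2_norm m \<phi>)) (\<lambda>x. c * conv H m \<phi> (tilde H \<phi>) x)"
    by (rule dual_bound_cmult[OF dual_bound_conv_tilde[OF L Cc_Cb[OF snoc.hyps(2)] snoc.hyps(2)]])
  show ?case using Cb_add[OF C(1) cb] dual_bound_add[OF C(1) cb C(2) b] by (intro conjI exI)
qed

text \<open>Polarization: \<open>\<psi> * \<phi>~\<close> is the combination with coefficients \<open>1/4, \<i>/4, -1/4, -\<i>/4\<close> of the functions
  \<open>\<theta> * \<theta>~\<close> for \<open>\<theta> = \<psi> + a \<phi>\<close> with \<open>a = 1, \<i>, -1, -\<i>\<close>.\<close>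

lemma conv_tilde_span:
  assumes \<psi>: "\<psi> \<in> Cc" and \<phi>: "\<phi> \<in> Cc"
  shows "conv H m \<psi> (tilde H \<phi>) \<in> fourier_span H m"
proof -
  define \<theta> where "\<theta> = (\<lambda>a x. \<psi> x + a * \<phi> x)"
  have \<theta>: "\<theta> a \<in> Cc" for a unfolding \<theta>_def by (intro Cc_add Cc_cmult \<psi> \<phi>)
  note t = Cc_Cb[OF tilde_Cc[OF \<psi>]] Cc_Cb[OF tilde_Cc[OF \<phi>]] and l = Cc_L1[OF \<psi>] Cc_L1[OF \<phi>]
  have ex: "conv H m (\<theta> a) (tilde H (\<theta> a)) x = conv H m \<psi> (tilde H \<psi>) x + cnj a * conv H m \<psi> (tilde H \<phi>) x
     + a * conv H m \<phi> (tilde H \<psi>) x + a * cnj a * conv H m \<phi> (tilde H \<phi>) x" for a x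
  proof -
    have tl: "tilde H (\<theta> a) = (\<lambda>x. tilde H \<psi> x + cnj a * tilde H \<phi> x)" by (simp add: \<theta>_def tilde_def fun_eq_iff)
    have "conv H m (\<theta> a) (tilde H (\<theta> a)) x = conv H m \<psi> (tilde H (\<theta> a)) x + a * conv H m \<phi> (tilde H (\<theta> a)) x"
      unfolding \<theta>_def conv_add_left[OF l(1) L1_cmult[OF l(2)] Cc_Cb[OF tilde_Cc[OF \<theta>[unfolded \<theta>_def]]]] conv_cmult_left ..
    also have "\<dots> = (conv H m \<psi> (tilde H \<psi>) x + cnj a * conv H m \<psi> (tilde H \<phi>) x) + a * (conv H m \<phi> (tilde H \<psi>) x + cnj a * conv H m \<phi> (tilde H \<phi>) x)"
      unfolding tl conv_add_right[OF l(1) t(1) Cb_cmult[OF t(2)]] conv_add_right[OF l(2) t(1) Cb_cmult[OF t(2)]] conv_cmult_right ..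
    finally show ?thesis by (simp add: algebra_simps)
  qed
  have "(\<lambda>x. (((0 + 1/4 * conv H m (\<theta> 1) (tilde H (\<theta> 1)) x) + \<i>/4 * conv H m (\<theta> \<i>) (tilde H (\<theta> \<i>)) x)
      + (-1/4) * conv H m (\<theta> (-1)) (tilde H (\<theta> (-1))) x) + (-\<i>/4) * conv H m (\<theta> (-\<i>)) (tilde H (\<theta> (-\<i>))) x) \<in> fourier_span H m"
    by (intro span_snoc span_zero \<theta>)
  also have "(\<lambda>x. (((0 + 1/4 * conv H m (\<theta> 1) (tilde H (\<theta> 1)) x) + \<i>/4 * conv H m (\<theta> \<i>) (tilde H (\<theta> \<i>)) x)
      + (-1/4) * conv H m (\<theta> (-1)) (tilde H (\<theta> (-1))) x) + (-\<i>/4) * conv H m (\<theta> (-\<i>)) (tilde H (\<theta> (-\<i>))) x) = conv H m \<psi> (tilde H \<phi>)"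
  proof
    fix x
    show "(((0 + 1/4 * conv H m (\<theta> 1) (tilde H (\<theta> 1)) x) + \<i>/4 * conv H m (\<theta> \<i>) (tilde H (\<theta> \<i>)) x)
      + (-1/4) * conv H m (\<theta> (-1)) (tilde H (\<theta> (-1))) x) + (-\<i>/4) * conv H m (\<theta> (-\<i>)) (tilde H (\<theta> (-\<i>))) x = conv H m \<psi> (tilde H \<phi>) x"
      unfolding ex by (rule complex_eqI) (simp_all add: field_simps)
  qed
  finally show ?thesis .
qed

text \<open>Membership in the Fourier space in terms of bounds on functionals; the equivalence is \<open>fourier_space_iff\<close>.\<close>

definition approximable :: "('a \<Rightarrow> complex) \<Rightarrow> bool" where
  "approximable u \<longleftrightarrow> u \<in> Cb \<and> (\<forall>e>0. \<exists>v\<in>fourier_span H m. dual_bound e (\<lambda>x. u x - v x))"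

lemma approximable_dual_bound:
  assumes "approximable u" obtains C where "0 \<le> C" "dual_bound C u"
proof -
  obtain v where v: "v \<in> fourier_span H m" "dual_bound 1 (\<lambda>x. u x - v x)" using assms zero_less_one unfolding approximable_def by blast
  obtain C where C: "v \<in> Cb" "dual_bound C v" using span_Cb_dual_bound[OF v(1)] by blast
  have u: "u \<in> Cb" using assms by (simp add: approximable_def)
  have "dual_bound (1 + C) u" using dual_bound_add[OF Cb_diff[OF u C(1)] C(1) v(2) C(2)] by simp
  then have "dual_bound \<bar>1 + C\<bar> u" by (rule dual_bound_mono) simp
  then show thesis by (rule that[rotated]) simp
qed

lemma fourier_space_iff: "u \<in> fourier_space H m \<longleftrightarrow> approximable u"
proof
  assume u: "u \<in> fourier_space H m"
  then have uB: "u \<in> Cb" by (auto simp: fourier_space_def B_lambda_def Cb_def)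
  obtain C where C: "dual_bound C u" using u by (auto simp: fourier_space_def B_lambda_def dual_bound_def)
  have "\<exists>v\<in>fourier_span H m. dual_bound e (\<lambda>x. u x - v x)" if "0 < e" for e
  proof -
    obtain v where v: "v \<in> fourier_span H m" "B_norm H m (\<lambda>x. u x - v x) < e"
    proof -
      have "\<forall>\<epsilon>>0. \<exists>v\<in>fourier_span H m. B_norm H m (\<lambda>x. u x - v x) < \<epsilon>"
        using u by (simp add: fourier_space_def)
      then obtain v where "v \<in> fourier_span H m" "B_norm H m (\<lambda>x. u x - v x) < e" using \<open>0 < e\<close> by auto
      then show thesis by (rule that)
    qed
    obtain D where D: "v \<in> Cb" "dual_bound D v" using span_Cb_dual_bound[OF v(1)] by blast
    have "dual_bound (C + cmod (-1) * D) (\<lambda>x. u x + -1 * v x)"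
      by (rule dual_bound_add[OF uB Cb_cmult[OF D(1)] C dual_bound_cmult[OF D(2)]])
    then have "dual_bound (B_norm H m (\<lambda>x. u x - v x)) (\<lambda>x. u x - v x)" using dual_bound_B_norm by simp
    then have "dual_bound e (\<lambda>x. u x - v x)" by (rule dual_bound_mono) (use v(2) in simp)
    then show ?thesis using v(1) by blast
  qed
  then show "approximable u" using uB by (simp add: approximable_def)
next
  assume a: "approximable u"
  then have uB: "u \<in> Cb" by (simp add: approximable_def)
  obtain C where C: "dual_bound C u" using approximable_dual_bound[OF a] by blast
  have "\<exists>v\<in>fourier_span H m. B_norm H m (\<lambda>x. u x - v x) < e" if "0 < e" for e
  proof -
    have "0 < e/2" using that by simp
    then obtain v where v: "v \<in> fourier_span H m" "dual_bound (e/2) (\<lambda>x. u x - v x)" using a unfolding approximable_def by blast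
    have "B_norm H m (\<lambda>x. u x - v x) \<le> e/2" by (rule B_norm_le[OF v(2)]) (use that in simp)
    then show ?thesis using v(1) that by (intro bexI[of _ v]) auto
  qed
  then show "u \<in> fourier_space H m"
    using uB C Cb_measurable[OF uB, of m] by (auto simp: fourier_space_def B_lambda_def dual_bound_def Cb_def)
qed

lemma approximable_span: "v \<in> fourier_span H m \<Longrightarrow> approximable v"
  unfolding approximable_def using span_Cb_dual_bound[of v] dual_bound_mono[OF dual_bound_zero] by (auto intro!: bexI[of _ v])

lemma approximable_limit:
  assumes u: "u \<in> Cb" and lim: "\<And>e. 0 < e \<Longrightarrow> \<exists>v. approximable v \<and> dual_bound e (\<lambda>x. u x - v x)"
  shows "approximable u"
  unfolding approximable_def
proof (intro conjI u allI impI)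
  fix e :: real assume "0 < e"
  then have e2: "0 < e/2" by simp
  obtain v where v: "approximable v" "dual_bound (e/2) (\<lambda>x. u x - v x)" using lim[OF e2] by blast
  then obtain w where w: "w \<in> fourier_span H m" "dual_bound (e/2) (\<lambda>x. v x - w x)" using e2 unfolding approximable_def by blast
  have vC: "v \<in> Cb" using v(1) by (simp add: approximable_def)
  have wC: "w \<in> Cb" using span_Cb_dual_bound[OF w(1)] by blast
  have "dual_bound e (\<lambda>x. u x - w x)"
    using dual_bound_add[OF Cb_diff[OF u vC] Cb_diff[OF vC wC] v(2) w(2)] by simp
  then show "\<exists>v\<in>fourier_span H m. dual_bound e (\<lambda>x. u x - v x)" using w(1) by blast
qed

lemma approximable_add:
  assumes u: "approximable u" and v: "approximable v" shows "approximable (\<lambda>x. u x + v x)"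
proof (rule approximable_limit)
  have C: "u \<in> Cb" "v \<in> Cb" using u v by (auto simp: approximable_def)
  show "(\<lambda>x. u x + v x) \<in> Cb" by (intro Cb_add C)
  fix e :: real assume "0 < e"
  then have e2: "0 < e/2" by simp
  then obtain p q where p: "p \<in> fourier_span H m" "dual_bound (e/2) (\<lambda>x. u x - p x)" and q: "q \<in> fourier_span H m" "dual_bound (e/2) (\<lambda>x. v x - q x)"
    using u v unfolding approximable_def by meson
  have pq: "p \<in> Cb" "q \<in> Cb" using span_Cb_dual_bound p(1) q(1) by blast+
  have "dual_bound (e/2 + e/2) (\<lambda>x. (u x - p x) + (v x - q x))"
    by (intro dual_bound_add Cb_diff C pq p(2) q(2))
  then have "dual_bound e (\<lambda>x. u x + v x - (p x + q x))" by (simp add: algebra_simps)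
  then show "\<exists>w. approximable w \<and> dual_bound e (\<lambda>x. u x + v x - w x)" using approximable_span[OF span_add[OF p(1) q(1)]] by blast
qed

lemma approximable_cmult:
  assumes u: "approximable u" shows "approximable (\<lambda>x. c * u x)"
proof (rule approximable_limit)
  have C: "u \<in> Cb" using u by (auto simp: approximable_def)
  show "(\<lambda>x. c * u x) \<in> Cb" by (intro Cb_cmult C)
  fix e :: real assume e: "0 < e"
  have pos: "0 < cmod c + 1" by (simp add: add_nonneg_pos)
  then have "0 < e / (cmod c + 1)" using e by simp
  then obtain p where p: "p \<in> fourier_span H m" "dual_bound (e / (cmod c + 1)) (\<lambda>x. u x - p x)" using u unfolding approximable_def by blast
  have "dual_bound (cmod c * (e / (cmod c + 1))) (\<lambda>x. c * (u x - p x))" by (rule dual_bound_cmult[OF p(2)])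
  moreover have "cmod c * (e / (cmod c + 1)) \<le> e" using pos e by (simp add: field_simps)
  ultimately have "dual_bound e (\<lambda>x. c * u x - c * p x)" by (simp add: right_diff_distrib dual_bound_mono)
  then show "\<exists>w. approximable w \<and> dual_bound e (\<lambda>x. c * u x - w x)" using approximable_span[OF span_cmult[OF p(1), of c]] by blast
qed

text \<open>\<open>\<psi>\<close> is a limit of test functions in \<open>L\<^sup>2(H)\<close>, and the dual norm of \<open>\<psi> * \<phi>~\<close> is controlled by that norm of \<open>\<psi>\<close>.\<close>

lemma approximable_conv_tilde:
  assumes \<psi>: "\<psi> \<in> L1 m" "\<psi> \<in> Cb" and \<phi>: "\<phi> \<in> Cc"
  shows "approximable (conv H m \<psi> (tilde H \<phi>))"
proof (rule approximable_limit)
  show "conv H m \<psi> (tilde H \<phi>) \<in> Cb" by (rule conv_tilde_Cb[OF \<psi>(1) \<phi>])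
  fix e :: real assume e: "0 < e"
  define d where "d = e / (L2_norm m \<phi> + 1)"
  have pos: "0 < L2_norm m \<phi> + 1" using L2_norm_nonneg[of m \<phi>] by linarith
  have d: "0 < d" "d * L2_norm m \<phi> \<le> e" using e pos by (auto simp: d_def field_simps)
  obtain g where g: "g \<in> Cc" "L2_norm m (\<lambda>x. \<psi> x - g x) < d"
    using Cc_dense_L2[OF lc m_radon L1_Cb_L2'[OF \<psi>] d(1)] .
  note t = Cc_Cb[OF tilde_Cc[OF \<phi>]] and gL = Cc_L1[OF g(1)]
  have "dual_bound (L2_norm m (\<lambda>x. \<psi> x - g x) * L2_norm m \<phi>) (conv H m (\<lambda>x. \<psi> x - g x) (tilde H \<phi>))"
    by (rule dual_bound_conv_tilde[OF L1_diff[OF \<psi>(1) gL] Cb_diff[OF \<psi>(2) Cc_Cb[OF g(1)]] \<phi>])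
  moreover have "L2_norm m (\<lambda>x. \<psi> x - g x) * L2_norm m \<phi> \<le> e"
    using order_trans[OF mult_right_mono[OF less_imp_le[OF g(2)] L2_norm_nonneg] d(2)] .
  moreover have "conv H m (\<lambda>x. \<psi> x - g x) (tilde H \<phi>) = (\<lambda>x. conv H m \<psi> (tilde H \<phi>) x - conv H m g (tilde H \<phi>) x)"
    using conv_add_left[OF \<psi>(1) L1_cmult[OF gL, of "-1"] t] conv_cmult_left[of "-1" g "tilde H \<phi>"] by simp
  ultimately have "dual_bound e (\<lambda>x. conv H m \<psi> (tilde H \<phi>) x - conv H m g (tilde H \<phi>) x)" using dual_bound_mono by simp
  then show "\<exists>w. approximable w \<and> dual_bound e (\<lambda>x. conv H m \<psi> (tilde H \<phi>) x - w x)"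
    using approximable_span[OF conv_tilde_span[OF g(1) \<phi>]] by blast
qed

text \<open>Fubini's theorem together with the fact that left translations commute with convolution from the right.\<close>

lemma conv_assoc:
  assumes f: "f \<in> L1 m" and \<phi>: "\<phi> \<in> Cc" and g: "g \<in> Cc"
  shows "conv H m f (conv H m \<phi> g) = conv H m (conv H m f \<phi>) g"
proof
  fix x
  have gm: "g \<in> borel_measurable borel" by (rule Cb_measurable[OF Cc_Cb[OF g]]) simp
  have "htrans H g (inv z) x = htrans H (\<lambda>z. g (inv z)) (inv x) z" for z
    using htrans_inv[OF gm, of z "inv x"] by simp
  then have b: "integrable m (\<lambda>z. htrans H g (inv z) x)"
    using htrans_Cc_integrable[OF Cc_inv[OF g], of "inv x"] by simp
  have K: "(\<lambda>p. htrans H \<phi> (inv (fst p)) (snd p)) \<in> Cb"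
    by (intro htrans_Cb_compose[OF Cc_Cb[OF \<phi>]] continuous_on_compose2[OF inv_cont _ subset_UNIV] continuous_intros)
  have "conv H m f (conv H m \<phi> g) x = (LINT y|m. f y * conv H m (htrans H \<phi> (inv y)) g x)"
    unfolding conv_htrans[OF \<phi> g] by (simp add: conv_def)
  also have "\<dots> = (LINT y|m. f y * (LINT z|m. htrans H g (inv z) x * htrans H \<phi> (inv y) z))"
    unfolding conv_def[of H m "htrans H \<phi> (inv _)"] by (simp add: mult.commute)
  also have "\<dots> = (LINT z|m. htrans H g (inv z) x * (LINT y|m. f y * htrans H \<phi> (inv y) z))"
    using Fubini_Cb[OF lc lc m_radon m_radon L1D[OF f] b K] by simp
  also have "\<dots> = conv H m (conv H m f \<phi>) g x" by (simp add: conv_def mult.commute)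
  finally show "conv H m f (conv H m \<phi> g) x = conv H m (conv H m f \<phi>) g x" .
qed

text \<open>On generators, associativity turns \<open>f * (\<phi> * \<phi>~)\<close> into \<open>(f * \<phi>) * \<phi>~\<close>; convolution by \<open>f\<close> is bounded in the
  dual norm, which gives the limits.\<close>

lemma approximable_conv:
  assumes f: "f \<in> L1 m" and u: "approximable u"
  shows "approximable (conv H m f u)"
proof (rule approximable_limit)
  have uC: "u \<in> Cb" using u by (simp add: approximable_def)
  show "conv H m f u \<in> Cb" by (rule conv_Cb[OF f uC])
  have span: "approximable (conv H m f v)" if "v \<in> fourier_span H m" for v
    using that
  proof (induction rule: span_induct)
    case zero
    have "conv H m f (\<lambda>x. 0) = (\<lambda>x. 0)" by (simp add: fun_eq_iff conv_def htrans_def)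
    then show ?case using approximable_span[OF span_zero] by simp
  next
    case (snoc v c \<phi>)
    note \<phi> = snoc.hyps(2)
    have "conv H m f (\<lambda>x. v x + c * conv H m \<phi> (tilde H \<phi>) x) = (\<lambda>x. conv H m f v x + c * conv H m (conv H m f \<phi>) (tilde H \<phi>) x)"
    proof
      fix x
      have vC: "v \<in> Cb" using span_Cb_dual_bound[OF snoc.hyps(1)] by (rule conjunct1)
      have C: "conv H m \<phi> (tilde H \<phi>) \<in> Cb" by (rule conv_tilde_Cb[OF Cc_L1[OF \<phi>] \<phi>])
      show "conv H m f (\<lambda>x. v x + c * conv H m \<phi> (tilde H \<phi>) x) x = conv H m f v x + c * conv H m (conv H m f \<phi>) (tilde H \<phi>) x"
        unfolding conv_add_right[OF f vC Cb_cmult[OF C]] conv_cmult_right conv_assoc[OF f \<phi> tilde_Cc[OF \<phi>]] ..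
    qed
    moreover have "approximable (conv H m (conv H m f \<phi>) (tilde H \<phi>))"
      by (rule approximable_conv_tilde[OF conv_L1[OF f Cc_Cb[OF \<phi>] Cc_L1[OF \<phi>]] conv_Cb[OF f Cc_Cb[OF \<phi>]] \<phi>])
    ultimately show ?case using approximable_add[OF snoc.IH approximable_cmult] by simp
  qed
  fix e :: real assume e: "0 < e"
  define d where "d = e / (L1_norm m f + 1)"
  have pos: "0 < L1_norm m f + 1" using L1_norm_nonneg[of f] by linarith
  have d: "0 < d" "d * L1_norm m f \<le> e" using e pos by (auto simp: d_def field_simps)
  obtain v where v: "v \<in> fourier_span H m" "dual_bound d (\<lambda>x. u x - v x)" using u d(1) unfolding approximable_def by blast
  have vC: "v \<in> Cb" using span_Cb_dual_bound[OF v(1)] by blast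
  have "dual_bound (d * L1_norm m f) (conv H m f (\<lambda>x. u x - v x))"
    by (rule dual_bound_conv[OF f Cb_diff[OF uC vC] v(2)]) (use d(1) in simp)
  then have "dual_bound e (\<lambda>x. conv H m f u x - conv H m f v x)"
    unfolding conv_diff_right[OF f uC vC] using d(2) by (rule dual_bound_mono)
  then show "\<exists>w. approximable w \<and> dual_bound e (\<lambda>x. conv H m f u x - w x)" using span[OF v(1)] by blast
qed

lemma LA_iff: "u \<in> LA H m \<longleftrightarrow> u \<in> L1 m \<and> approximable u"
  by (simp add: LA_def fourier_space_iff)

lemma LA_left_ideal: "left_ideal_L1 H m (LA H m)"
  unfolding left_ideal_L1_def LA_iff
proof (intro conjI ballI allI)
  show "LA H m \<subseteq> L1 m" by (auto simp: LA_def)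
  show "(\<lambda>_. 0) \<in> L1 m" by (simp add: L1_def)
  show "approximable (\<lambda>_. 0)" by (rule approximable_span[OF span_zero])
next
  fix f g assume "f \<in> LA H m" "g \<in> LA H m"
  then show "(\<lambda>x. f x + g x) \<in> L1 m" "approximable (\<lambda>x. f x + g x)" by (auto simp: LA_iff intro: L1_add approximable_add)
next
  fix c f assume "f \<in> LA H m"
  then show "(\<lambda>x. c * f x) \<in> L1 m" "approximable (\<lambda>x. c * f x)" by (auto simp: LA_iff intro: L1_cmult approximable_cmult)
next
  fix f g assume f: "f \<in> L1 m" and "g \<in> LA H m"
  then have g: "g \<in> L1 m" "approximable g" by (auto simp: LA_iff)
  then have "g \<in> Cb" by (simp add: approximable_def)
  then show "conv H m f g \<in> L1 m" using conv_L1[OF f _ g(1)] by blast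
  show "approximable (conv H m f g)" by (rule approximable_conv[OF f g(2)])
qed

text \<open>\<open>h * k\<close> for a symmetric test function \<open>k\<close> of integral one near the unit. It is uniformly close to \<open>h\<close>,
  and for small supports of \<open>k\<close> both functions vanish outside a fixed compact set \<open>L\<close>.\<close>

lemma conv_approximate_unit:
  assumes h: "h \<in> Cc" and e: "0 < e"
  obtains w where "w \<in> LA H m" "L1_norm m (\<lambda>x. h x - w x) < e"
proof -
  obtain S where S: "compact S" "\<And>x. x \<notin> S \<Longrightarrow> h x = 0" using h by (auto simp: Cc_def)
  obtain Q L where Q: "open Q" "compact L" "S \<subseteq> Q" "Q \<subseteq> L" using lch_compact_nbhd[OF lc S(1)] .
  have Lfin: "emeasure m L < \<infinity>" by (rule radon_compact[OF m_radon Q(2)])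
  have Ls: "L \<in> sets m" using borel_compact[OF Q(2)] by simp
  define d where "d = e / (measure m L + 1)"
  have pos: "0 < measure m L + 1" by (simp add: add_nonneg_pos)
  have d: "0 < d" "d * measure m L < e" using e pos by (auto simp: d_def field_simps)
  show thesis
  proof (rule uniform_translates[OF Cc_cont[OF h] S Q(1,3) d(1)])
    fix V assume V: "open V" "unit_elt H \<in> V"
      "\<And>y z t. t \<in> V \<Longrightarrow> t \<in> sp (inv y) z \<Longrightarrow> cmod (h z - h y) < d"
      "\<And>y z t. t \<in> V \<Longrightarrow> t \<in> sp (inv y) z \<Longrightarrow> z \<in> S \<Longrightarrow> y \<in> Q"
    obtain k where k: "k \<in> Ccp" "\<And>z. k (inv z) = k z" "\<And>z. z \<notin> V \<Longrightarrow> k z = 0" "(\<integral>\<^sup>+z. ennreal (k z) \<partial>m) = 1"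
      using approximate_unit[OF V(1,2)] by blast
    let ?k = "\<lambda>z. complex_of_real (k z)"
    have kC: "?k \<in> Cc" by (rule Ccp_Cc[OF k(1)])
    have kt: "tilde H ?k = ?k" by (simp add: tilde_def k(2) fun_eq_iff)
    define w where "w = conv H m h ?k"
    have wspan: "w \<in> fourier_span H m" using conv_tilde_span[OF h kC] by (simp add: kt w_def)
    have wL1: "w \<in> L1 m" unfolding w_def by (rule conv_L1[OF Cc_L1[OF h] Cc_Cb[OF kC] Cc_L1[OF kC]])
    have close: "cmod (h y - w y) \<le> d * indicator L y" for y
    proof -
      \<comment> \<open>The weights of the average \<open>w y\<close> of \<open>h\<close>; they are concentrated where \<open>h z\<close> is close to \<open>h y\<close>.\<close>
      define r where "r = (\<lambda>z. LINT t|kap (inv z) y. k t)"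
      have r0: "0 \<le> r z" for z unfolding r_def by (rule integral_nonneg_AE) (simp add: CcpD(2)[OF k(1)])
      have hr: "ht (\<lambda>z. ennreal (k z)) (inv y) z = ennreal (r z)" for z
        using ht_symmetric[OF Ccp_lsc[OF k(1)], of y "inv z"] by (simp add: k(2) r_def ht_Ccp[OF k(1)])
      have supp: "\<exists>t\<in>V. t \<in> sp (inv y) z" if "r z \<noteq> 0" for z
      proof -
        have "ht (\<lambda>z. ennreal (k z)) (inv y) z \<noteq> 0" using that r0[of z] by (simp add: hr)
        then obtain t where "t \<in> sp (inv y) z" "ennreal (k t) \<noteq> 0" by (rule ht_posD)
        then have "t \<in> sp (inv y) z" "k t \<noteq> 0" by auto
        then show ?thesis using k(3)[of t] by blast
      qed
      have wr: "w y = (LINT z|m. h z * complex_of_real (r z))"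
        by (simp add: w_def conv_def htrans_kap r_def)
      have ir': "integrable m (\<lambda>z. complex_of_real (r z))"
      proof -
        have "complex_of_real (r z) = htrans H ?k (inv y) z" for z
          using htrans_inv[of ?k z "inv y"] Cb_measurable[OF Cc_Cb[OF kC], of borel] by (simp add: r_def htrans_kap k(2))
        then show ?thesis using htrans_Cc_integrable[OF kC, of "inv y"] by simp
      qed
      then have ir: "integrable m r" by (simp add: complex_of_real_integrable_eq)
      have "(\<integral>\<^sup>+z. ennreal (r z) \<partial>m) = 1"
        unfolding hr[symmetric] ht_integral[OF Ccp_lsc[OF k(1)]] by (rule k(4))
      then have one: "(LINT z|m. r z) = 1" using nn_integral_real[OF ir r0] by simp
      have bound: "cmod (h y - w y) \<le> d"
      proof -
        have le: "cmod (if r z = 0 then 0 else h y - h z) \<le> d" for z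
        proof (cases "r z = 0")
          case False
          obtain t where "t \<in> V" "t \<in> sp (inv y) z" using supp[OF False] by blast
          then show ?thesis using V(3)[of t y z] False by (simp add: norm_minus_commute)
        qed (use d(1) in simp)
        have i2: "integrable m (\<lambda>z. complex_of_real (r z) * h z)" by (rule integrable_mult_Cb[OF m_radon ir' Cc_Cb[OF h]])
        have "h y - w y = (LINT z|m. complex_of_real (r z) * h y) - (LINT z|m. complex_of_real (r z) * h z)"
          unfolding wr using one by (simp add: mult.commute)
        also have "\<dots> = (LINT z|m. complex_of_real (r z) * (h y - h z))"
          unfolding right_diff_distrib
          by (rule Bochner_Integration.integral_diff[symmetric]) (use ir' i2 in auto)
        also have "\<dots> = (LINT z|m. complex_of_real (r z) * (if r z = 0 then 0 else h y - h z))"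
          by (rule Bochner_Integration.integral_cong) auto
        finally have "cmod (h y - w y) \<le> d * (LINT z|m. cmod (complex_of_real (r z)))"
          using integral_mult_bound[OF m_radon ir', of "\<lambda>z. if r z = 0 then 0 else h y - h z" d, OF le] by simp
        then show ?thesis using one r0 by simp
      qed
      show ?thesis
      proof (cases "y \<in> L")
        case True then show ?thesis using bound by simp
      next
        case False
        then have y: "y \<notin> Q" "y \<notin> S" using Q by auto
        have z0: "h z * complex_of_real (r z) = 0" for z
          using supp[of z] V(4)[of _ y z] y(1) S(2)[of z] by fastforce
        have "w y = 0" unfolding wr z0 by simp
        then show ?thesis using False S(2)[OF y(2)] by simp
      qed
    qed
    have iL: "integrable m (\<lambda>y. d * indicator L y)" using Ls Lfin by (simp add: integrable_indicator_iff)
    have "L1_norm m (\<lambda>x. h x - w x) \<le> (LINT y|m. d * indicator L y)"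
      unfolding L1_norm_def
      by (rule integral_mono[OF _ iL close]) (use L1D[OF L1_diff[OF Cc_L1[OF h] wL1]] in simp)
    also have "\<dots> = d * measure m L" using Ls by simp
    also have "\<dots> < e" by (rule d(2))
    finally have "L1_norm m (\<lambda>x. h x - w x) < e" .
    moreover have "w \<in> LA H m" unfolding LA_iff using wL1 approximable_span[OF wspan] by simp
    ultimately show thesis by (rule that[rotated])
  qed
qed

lemma LA_dense: "dense_L1 m (LA H m)"
  unfolding dense_L1_def
proof (intro ballI allI impI)
  fix f :: "'a \<Rightarrow> complex" and e :: real assume f: "f \<in> L1 m" and "0 < e"
  then have e2: "0 < e/2" by simp
  obtain h where h: "h \<in> Cc" "(LINT x|m. cmod (f x - h x)) < e/2" using Cc_dense_L1[OF lc m_radon L1D[OF f] e2] .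
  obtain w where w: "w \<in> LA H m" "L1_norm m (\<lambda>x. h x - w x) < e/2" using conv_approximate_unit[OF h(1) e2] .
  have wL: "w \<in> L1 m" using w(1) by (simp add: LA_def)
  note i = L1D[OF L1_diff[OF f Cc_L1[OF h(1)]]] L1D[OF L1_diff[OF Cc_L1[OF h(1)] wL]] L1D[OF L1_diff[OF f wL]]
  have "L1_norm m (\<lambda>x. f x - w x) \<le> (LINT x|m. cmod (f x - h x) + cmod (h x - w x))"
    unfolding L1_norm_def
  proof (rule integral_mono)
    show "cmod (f x - w x) \<le> cmod (f x - h x) + cmod (h x - w x)" for x
      using norm_triangle_ineq[of "f x - h x" "h x - w x"] by simp
  qed (use i in auto)
  also have "\<dots> = (LINT x|m. cmod (f x - h x)) + L1_norm m (\<lambda>x. h x - w x)"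
    unfolding L1_norm_def using i by (intro Bochner_Integration.integral_add) auto
  also have "\<dots> < e" using h(2) w(2) by simp
  finally show "\<exists>g\<in>LA H m. L1_norm m (\<lambda>x. f x - g x) < e" using w(1) by blast
qed

end

theorem lemma2p1:
  fixes H :: "('a::t2_space) hypergroup_struct" and m :: "'a measure"
  assumes "hypergroup H" and "left_haar_measure H m"
  shows "left_ideal_L1 H m (LA H m) \<and> dense_L1 m (LA H m)"
proof -
  interpret haar H m by unfold_locales (fact assms)+
  show ?thesis using LA_left_ideal LA_dense by blast
qed

end
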